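(* Let $X$ and $Y$ be cubical complexes and $R$ a field. Then $$HM_*[X\otimes Y]=HM_*[X]\boxtimes HM_*[Y],$$ i.e. for every $n\ge1$ there is an isomorphism of $R[X\otimes Y]$-bimodules $HM_n[X\otimes Y]\cong (HM_*[X]\boxtimes HM_*[Y])_n$, where the action on $HM_*[X]\boxtimes HM_*[Y]$ of a shuffle of a path $p$ of $X$ with a path $q$ of $Y$ is the action of $p$ on the first component and the action of $q$ on the second component.
   Context: A precubical set $X$ is a graded set $(X_n)_{n\in\mathbb N}$ with maps $d^0_i,d^1_i:X_n\to X_{n-1}$ ($0\le i\le n-1$) such that $d^k_i d^l_j=d^l_{j-1}d^k_i$ for $i<j$, $k,l\in\{0,1\}$. For $I=\{i_1<\dots<i_k\}$ put $d^\epsilon_I=d^\epsilon_{i_1}\circ\dots\circ d^\epsilon_{i_k}$; for an $n$-cube $c$ put $d^\epsilon(c)=d^\epsilon_{\{0,\dots,n-1\}}(c)\in X_0$. Cubical complex: a ($d$-dimensional) cubical complex is a finite set of cubes $(D,\vec x)$, $D\subseteq\{1,\dots,d\}$, $\vec x\in\mathbb Z^d$, closed under faces. The cube $(D,\vec x)$ has dimension $n=|D|$. If $D[i]$ is the $i$th element of $D$ ($1\le i\le n$), its $i$th past face is $(D\setminus\{D[i]\},\vec x)$ and its $i$th future face is $(D\setminus\{D[i]\},\vec x+\vec 1_{D[i]})$, where $\vec 1_k$ is the $k$th unit vector. With these faces (indices shifted by one) it is a finite precubical set. Tensor product: $(X\otimes Y)_n=\coprod_{i+j=n}X_i\times Y_j$,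 and for $(c,d)\in X_i\times Y_j$, $d^\epsilon_k(c,d)=(d^\epsilon_k(c),d)$ if $0\le k\le i-1$, and $(c,d^\epsilon_{k-i}(d))$ if $i\le k\le i+j-1$. Homology modules: a cube chain from $v$ to $w$ (vertices of a precubical set $X$) is a sequence $c=(c_1,\dots,c_l)$, $l\ge0$, $c_k\in X_{n_k}$, $n_k>0$, with either $l=0$ and $v=w$, or $d^0(c_1)=v$, $d^1(c_l)=w$ and $d^1(c_k)=d^0(c_{k+1})$. Its dimension is $n_1+\dots+n_l-l$. The path algebra $R[X]$ has as $R$-basis the $0$-dimensional cube chains (directed paths, including constant paths $e_v$), with product the concatenation if defined and $0$ otherwise. For $i\ge1$, $R_i[X]$ is the $R$-vector space with basis the cube chains of dimension $i-1$, an $R[X]$-bimodule via concatenation: $p\bullet r\bullet q$ is the concatenation if endpoints match, $0$ otherwise. The boundary $\partial:R_{i+1}[X]\to R_i[X]$ ($i\ge1$) is $$\partial c=\sum_{k=1}^l\sum_{r=1}^{n_k-1}\sum_{I\subseteq\{0,\dots,n_k-1\},|I|=r}(-1)^{n_1+\dots+n_{k-1}+k+r+1}\mathrm{sgn}(I)\,d_{k,I}(c),$$ with $d_{k,I}(c)=(c_1,\dots,c_{k-1},d^0_{\overline I}(c_k),d^1_I(c_k),c_{k+1},\dots,c_l)$, $\overline I=\{0,\dots,n_k-1\}\setminus I$, and $\mathrm{sgn}(I)=1$ if $\sum_{j\in I}(j+1)\equiv\sum_{j=1}^r j \bmod 2$, $-1$ otherwise; $\partial=0$ on $R_1[X]$.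 For $i\ge1$, $HM_i[X]=\mathrm{Ker}\,\partial_{|R_i[X]}/\mathrm{Im}\,\partial_{|R_{i+1}[X]}$, an $R[X]$-bimodule. Shifted tensor product: for $n\ge1$, $(HM_*[X]\boxtimes HM_*[Y])_n=\bigoplus_{i,j\ge1,\ i+j=n+1}HM_i[X]\otimes_R HM_j[Y]$. Shuffles: every directed path $r$ of $X\otimes Y$ from $(x,y)$ to $(x',y')$ is a sequence of edges of the form $(a,b)$ with either $a\in X_1,b\in Y_0$ or $a\in X_0,b\in Y_1$; reading off the edges of $X$ (resp. of $Y$) gives a path $p$ of $X$ from $x$ to $x'$ (resp. $q$ of $Y$ from $y$ to $y'$), and $r$ is called a shuffle of $p$ and $q$. The $R[X\otimes Y]$-bimodule structure is $r\bullet(a\otimes b)=(p\bullet a)\otimes(q\bullet b)$ and $(a\otimes b)\bullet r=(a\bullet p)\otimes(b\bullet q)$. *)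

theory Defs
  imports "HOL-Algebra.Algebraic_Closure_Type" "HOL-Library.Poly_Mapping"
begin

(* frees the name X, which Polynomials uses for an indeterminate *)
no_notation Polynomials.var (\<open>X\<index>\<close>)

section \<open>Precubical sets\<close>

text \<open>
  The graded set \<open>X\<^sub>n\<close> is given by one set \<open>cubes X\<close> with a dimension function. The superscript of
  a face map is a Boolean: \<open>False\<close> stands for 0 (past faces) and \<open>True\<close> for 1 (future faces).
\<close>

record 'a precubical =
  cubes :: "'a set"
  cdim :: "'a \<Rightarrow> nat"
  face :: "bool \<Rightarrow> nat \<Rightarrow> 'a \<Rightarrow> 'a"

locale precubical_set =
  fixes X :: "'a precubical"
  assumes face_in_cubes: "c \<in> cubes X \<Longrightarrow> i < cdim X c \<Longrightarrow> face X e i c \<in> cubes X"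
    and cdim_face: "c \<in> cubes X \<Longrightarrow> i < cdim X c \<Longrightarrow> cdim X (face X e i c) = cdim X c - 1"
    and face_face: "c \<in> cubes X \<Longrightarrow> i < j \<Longrightarrow> j < cdim X c \<Longrightarrow>
      face X k i (face X l j c) = face X l (j - 1) (face X k i c)"

definition vertices :: "'a precubical \<Rightarrow> 'a set" where
  "vertices X = {c \<in> cubes X. cdim X c = 0}"

text \<open>The face of largest index is applied first.\<close>

definition iter_face :: "'a precubical \<Rightarrow> bool \<Rightarrow> nat set \<Rightarrow> 'a \<Rightarrow> 'a" where
  "iter_face X e I c = foldr (face X e) (sorted_list_of_set I) c"

definition corner :: "'a precubical \<Rightarrow> bool \<Rightarrow> 'a \<Rightarrow> 'a" where
  "corner X e c = iter_face X e {..<cdim X c} c"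

definition tensor_precubical :: "'a precubical \<Rightarrow> 'b precubical \<Rightarrow> ('a \<times> 'b) precubical" where
  "tensor_precubical X Y =
    \<lparr>cubes = cubes X \<times> cubes Y,
     cdim = (\<lambda>(c, d). cdim X c + cdim Y d),
     face = (\<lambda>e k (c, d). if k < cdim X c then (face X e k c, d) else (c, face Y e (k - cdim X c) d))\<rparr>"

lemma precubical_set_tensor:
  assumes "precubical_set X" "precubical_set Y"
  shows "precubical_set (tensor_precubical X Y)"
proof -
  interpret X: precubical_set X by fact
  interpret Y: precubical_set Y by fact
  let ?T = "tensor_precubical X Y"
  have cdim: "cdim ?T (a, b) = cdim X a + cdim Y b" for a b
    by (simp add: tensor_precubical_def)
  have left: "face ?T e i (a, b) = (face X e i a, b)" if "i < cdim X a" for e i a b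
    using that by (simp add: tensor_precubical_def)
  have right: "face ?T e i (a, b) = (a, face Y e (i - cdim X a) b)" if "cdim X a \<le> i" for e i a b
    using that by (simp add: tensor_precubical_def)
  have mem: "(a, b) \<in> cubes ?T \<longleftrightarrow> a \<in> cubes X \<and> b \<in> cubes Y" for a b
    by (simp add: tensor_precubical_def)
  show ?thesis
  proof (unfold_locales, goal_cases)
    case (1 c i e)
    obtain a b where c: "c = (a, b)" by fastforce
    show ?case
    proof (cases "i < cdim X a")
      case True
      then show ?thesis using 1 X.face_in_cubes[of a i e] by (simp add: c mem left)
    next
      case False
      then show ?thesis using 1 Y.face_in_cubes[of b "i - cdim X a" e]
        by (simp add: c mem right cdim)
    qed
  next
    case (2 c i e)
    obtain a b where c: "c = (a, b)" by fastforce
    show ?case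
    proof (cases "i < cdim X a")
      case True
      then show ?thesis using 2 X.cdim_face[of a i e] by (simp add: c mem left cdim)
    next
      case False
      then have "cdim Y (face Y e (i - cdim X a) b) = cdim Y b - 1" "0 < cdim Y b"
        using 2 Y.cdim_face[of b "i - cdim X a" e] by (simp_all add: c mem cdim)
      then show ?thesis using False by (simp add: c right cdim)
    qed
  next
    case (3 c i j k l)
    obtain a b where c: "c = (a, b)" by fastforce
    have ab: "a \<in> cubes X" "b \<in> cubes Y" "j < cdim X a + cdim Y b"
      using 3 by (simp_all add: c mem cdim)
    consider "j < cdim X a" | "i < cdim X a" "cdim X a \<le> j" | "cdim X a \<le> i" by linarith
    then show ?case
    proof cases
      case 1
      have "cdim X (face X l j a) = cdim X a - 1" "cdim X (face X k i a) = cdim X a - 1"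
        using X.cdim_face ab 1 3(2) by simp_all
      then show ?thesis using 1 3(2) X.face_face[of a i j k l] ab by (simp add: c left)
    next
      case 2
      have "cdim X (face X k i a) = cdim X a - 1" using X.cdim_face ab 2 by simp
      moreover have "j - 1 - (cdim X a - 1) = j - cdim X a" "cdim X a - 1 \<le> j - 1"
        using 2 by simp_all
      ultimately show ?thesis using 2 by (simp add: c left right)
    next
      case 3
      have "j - 1 - cdim X a = j - cdim X a - 1" by simp
      then show ?thesis using 3 \<open>i < j\<close> Y.face_face[of b "i - cdim X a" "j - cdim X a" k l] ab
        by (simp add: c right)
    qed
  qed
qed


section \<open>Cubical complexes\<close>

text \<open>
  The vector component of a cube is a function of type \<open>nat \<Rightarrow> int\<close> which vanishes outside
  \<open>{1..d}\<close>. List indices start at 0, so \<open>sorted_list_of_set D ! i\<close> is the direction of the face of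
  index \<open>i\<close> after the shift by one.
\<close>

type_synonym euclidean_cube = "nat set \<times> (nat \<Rightarrow> int)"

definition cube_face :: "bool \<Rightarrow> nat \<Rightarrow> euclidean_cube \<Rightarrow> euclidean_cube" where
  "cube_face e i = (\<lambda>(D, x). let k = sorted_list_of_set D ! i in
     (D - {k}, if e then x(k := x k + 1) else x))"

definition cubical_complex :: "nat \<Rightarrow> euclidean_cube set \<Rightarrow> bool" where
  "cubical_complex d K \<longleftrightarrow> finite K \<and>
     (\<forall>(D, x)\<in>K. D \<subseteq> {1..d} \<and> (\<forall>k. k \<notin> {1..d} \<longrightarrow> x k = 0)) \<and>
     (\<forall>c\<in>K. \<forall>i<card (fst c). \<forall>e. cube_face e i c \<in> K)"

definition cubical_precubical :: "euclidean_cube set \<Rightarrow> euclidean_cube precubical" where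
  "cubical_precubical K = \<lparr>cubes = K, cdim = (\<lambda>c. card (fst c)), face = cube_face\<rparr>"

lemma cubical_complex_finite_directions:
  assumes "cubical_complex d K" "c \<in> K"
  shows "finite (fst c)"
proof -
  have "fst c \<subseteq> {1..d}" using assms by (force simp: cubical_complex_def)
  then show ?thesis using finite_subset by blast
qed

lemma nth_sorted_list_of_set_remove:
  assumes "finite D" "m < card D" "i < card D - 1"
  shows "sorted_list_of_set (D - {sorted_list_of_set D ! m}) ! i =
    sorted_list_of_set D ! (if i < m then i else Suc i)"
proof -
  let ?xs = "sorted_list_of_set D"
  have len: "length ?xs = card D" by simp
  have dec: "?xs = take m ?xs @ ?xs ! m # drop (Suc m) ?xs"
    by (rule id_take_nth_drop) (use assms(2) in simp)
  have "distinct (take m ?xs @ ?xs ! m # drop (Suc m) ?xs)"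
    by (subst dec[symmetric]) simp
  then have "remove1 (?xs ! m) (take m ?xs @ ?xs ! m # drop (Suc m) ?xs) =
      take m ?xs @ drop (Suc m) ?xs"
    by (simp add: remove1_append)
  then have "remove1 (?xs ! m) ?xs = take m ?xs @ drop (Suc m) ?xs"
    by (metis dec)
  then have "sorted_list_of_set (D - {?xs ! m}) = take m ?xs @ drop (Suc m) ?xs"
    using assms(1) by (simp add: sorted_list_of_set_remove)
  then show ?thesis using assms len by (auto simp: nth_append)
qed

lemma precubical_set_cubical:
  assumes "cubical_complex d K"
  shows "precubical_set (cubical_precubical K)"
proof (unfold_locales, goal_cases)
  case (1 c i e)
  then show ?case using assms by (simp add: cubical_complex_def cubical_precubical_def)
next
  case (2 c i e)
  then have fin: "finite (fst c)" and i: "i < card (fst c)"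
    using cubical_complex_finite_directions[OF assms] by (simp_all add: cubical_precubical_def)
  have "sorted_list_of_set (fst c) ! i \<in> fst c"
    using nth_mem[of i "sorted_list_of_set (fst c)"] fin i by simp
  then show ?case using fin
    by (simp add: cubical_precubical_def cube_face_def Let_def case_prod_beta)
next
  case (3 c i j k l)
  then have fin: "finite (fst c)" and j: "j < card (fst c)"
    using cubical_complex_finite_directions[OF assms] by (simp_all add: cubical_precubical_def)
  obtain D x where c: "c = (D, x)" by fastforce
  let ?p = "sorted_list_of_set D ! i" and ?q = "sorted_list_of_set D ! j"
  have 1: "sorted_list_of_set (D - {?q}) ! i = ?p"
    using nth_sorted_list_of_set_remove[of D j i] fin j 3(2) c by simp
  have 2: "sorted_list_of_set (D - {?p}) ! (j - 1) = ?q"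
  proof -
    have "\<not> j - 1 < i" "Suc (j - 1) = j" "i < card D" "j - 1 < card D - 1" using j 3(2) c by auto
    then show ?thesis using nth_sorted_list_of_set_remove[of D i "j - 1"] fin c by simp
  qed
  have neq: "?p \<noteq> ?q" using j 3(2) c by (simp add: nth_eq_iff_index_eq)
  have lhs: "cube_face k i (cube_face l j c) = (D - {?q} - {?p},
      let y = (if l then x(?q := x ?q + 1) else x) in if k then y(?p := y ?p + 1) else y)"
    unfolding c cube_face_def Let_def prod.case 1 ..
  have rhs: "cube_face l (j - 1) (cube_face k i c) = (D - {?p} - {?q},
      let y = (if k then x(?p := x ?p + 1) else x) in if l then y(?q := y ?q + 1) else y)"
    unfolding c cube_face_def Let_def prod.case 2 ..
  have "cube_face k i (cube_face l j c) = cube_face l (j - 1) (cube_face k i c)"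
    unfolding lhs rhs using neq by (auto simp: Let_def fun_upd_twist)
  then show ?case by (simp add: cubical_precubical_def)
qed


section \<open>Free vector spaces, quotients, tensor products and direct sums\<close>

text \<open>
  The ground field is a type of class \<open>field\<close>. In records of type \<open>module\<close> the components \<open>mult\<close>
  and \<open>one\<close> carry no meaning unless the record is a ring, and are then left undefined.
\<close>

definition pm_scale :: "'r::field \<Rightarrow> ('s \<Rightarrow>\<^sub>0 'r) \<Rightarrow> ('s \<Rightarrow>\<^sub>0 'r)" where
  "pm_scale c f = Poly_Mapping.map ((*) c) f"

lemma lookup_pm_scale: "Poly_Mapping.lookup (pm_scale c f) x = c * Poly_Mapping.lookup f x"
  by (simp add: pm_scale_def Poly_Mapping.map.rep_eq when_def)

interpretation pm: vector_space "pm_scale :: 'r::field \<Rightarrow> ('s \<Rightarrow>\<^sub>0 'r) \<Rightarrow> ('s \<Rightarrow>\<^sub>0 'r)"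
proof unfold_locales
  show "pm_scale a (x + y) = pm_scale a x + pm_scale a y" for a :: 'r and x y :: "'s \<Rightarrow>\<^sub>0 'r"
    by (rule poly_mapping_eqI) (simp add: lookup_pm_scale lookup_add ring_class.ring_distribs)
  show "pm_scale (a + b) x = pm_scale a x + pm_scale b x" for a b :: 'r and x :: "'s \<Rightarrow>\<^sub>0 'r"
    by (rule poly_mapping_eqI) (simp add: lookup_pm_scale lookup_add ring_class.ring_distribs)
  show "pm_scale a (pm_scale b x) = pm_scale (a * b) x" for a b :: 'r and x :: "'s \<Rightarrow>\<^sub>0 'r"
    by (rule poly_mapping_eqI) (simp add: lookup_pm_scale)
  show "pm_scale 1 x = x" for x :: "'s \<Rightarrow>\<^sub>0 'r"
    by (rule poly_mapping_eqI) (simp add: lookup_pm_scale)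
qed

abbreviation basis_vec :: "'s \<Rightarrow> ('s \<Rightarrow>\<^sub>0 'r::field)" where
  "basis_vec x \<equiv> Poly_Mapping.single x 1"

text \<open>Linear extension of a map defined on basis elements.\<close>

definition lin_ext :: "('s \<Rightarrow> ('t \<Rightarrow>\<^sub>0 'r)) \<Rightarrow> ('s \<Rightarrow>\<^sub>0 'r) \<Rightarrow> ('t \<Rightarrow>\<^sub>0 'r::field)" where
  "lin_ext g f = (\<Sum>x\<in>Poly_Mapping.keys f. pm_scale (Poly_Mapping.lookup f x) (g x))"

definition free_module :: "'s set \<Rightarrow> ('r::field, 's \<Rightarrow>\<^sub>0 'r) module" where
  "free_module S = \<lparr>carrier = {f. Poly_Mapping.keys f \<subseteq> S}, monoid.mult = undefined, one = undefined,
     ring.zero = 0, add = (+), module.smult = pm_scale\<rparr>"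

definition quot_module ::
  "('r::field, 'm, 'z) module_scheme \<Rightarrow> 'm set \<Rightarrow> ('r, 'm set) module" where
  "quot_module M N = \<lparr>carrier = a_rcosets\<^bsub>M\<^esub> N, monoid.mult = undefined, one = undefined,
     ring.zero = N, add = set_add M, module.smult = (\<lambda>c C. N <+>\<^bsub>M\<^esub> ((\<lambda>x. c \<odot>\<^bsub>M\<^esub> x) ` C))\<rparr>"

text \<open>
  \<open>tensor_module M N\<close> is the tensor product over the ground field: the free vector space on
  \<open>carrier M \<times> carrier N\<close> modulo the bilinearity relations.
\<close>

definition tensor_relations ::
  "('r::field, 'm, 'z) module_scheme \<Rightarrow> ('r, 'n, 'y) module_scheme \<Rightarrow> ('m \<times> 'n \<Rightarrow>\<^sub>0 'r) set" where
  "tensor_relations M N = pm.span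
     ({basis_vec (a \<oplus>\<^bsub>M\<^esub> a', b) - basis_vec (a, b) - basis_vec (a', b) | a a' b.
         a \<in> carrier M \<and> a' \<in> carrier M \<and> b \<in> carrier N} \<union>
      {basis_vec (a, b \<oplus>\<^bsub>N\<^esub> b') - basis_vec (a, b) - basis_vec (a, b') | a b b'.
         a \<in> carrier M \<and> b \<in> carrier N \<and> b' \<in> carrier N} \<union>
      {basis_vec (c \<odot>\<^bsub>M\<^esub> a, b) - pm_scale c (basis_vec (a, b)) | c a b.
         a \<in> carrier M \<and> b \<in> carrier N} \<union>
      {basis_vec (a, c \<odot>\<^bsub>N\<^esub> b) - pm_scale c (basis_vec (a, b)) | c a b.
         a \<in> carrier M \<and> b \<in> carrier N})"

definition tensor_module ::
  "('r::field, 'm, 'z) module_scheme \<Rightarrow> ('r, 'n, 'y) module_scheme \<Rightarrow>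
   ('r, ('m \<times> 'n \<Rightarrow>\<^sub>0 'r) set) module" where
  "tensor_module M N =
     quot_module (free_module (carrier M \<times> carrier N)) (tensor_relations M N)"

text \<open>
  \<open>tensor_map M N f g\<close> is the endomorphism \<open>f \<otimes> g\<close> of \<open>tensor_module M N\<close>, for linear endomorphisms
  \<open>f\<close> of \<open>M\<close> and \<open>g\<close> of \<open>N\<close>; it maps the class of \<open>(a, b)\<close> to the class of \<open>(f a, g b)\<close>.
\<close>

definition tensor_map ::
  "('r::field, 'm, 'z) module_scheme \<Rightarrow> ('r, 'n, 'y) module_scheme \<Rightarrow>
   ('m \<Rightarrow> 'm) \<Rightarrow> ('n \<Rightarrow> 'n) \<Rightarrow> ('m \<times> 'n \<Rightarrow>\<^sub>0 'r) set \<Rightarrow> ('m \<times> 'n \<Rightarrow>\<^sub>0 'r) set" where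
  "tensor_map M N f g T =
     tensor_relations M N <+>\<^bsub>free_module (carrier M \<times> carrier N)\<^esub>
       (lin_ext (\<lambda>(a, b). basis_vec (f a, g b)) ` T)"

definition direct_sum ::
  "'i set \<Rightarrow> ('i \<Rightarrow> ('r::field, 'm, 'z) module_scheme) \<Rightarrow> ('r, 'i \<Rightarrow> 'm) module" where
  "direct_sum I M = \<lparr>carrier = {f \<in> \<Pi>\<^sub>E i\<in>I. carrier (M i). finite {i \<in> I. f i \<noteq> \<zero>\<^bsub>M i\<^esub>}},
     monoid.mult = undefined, one = undefined,
     ring.zero = (\<lambda>i\<in>I. \<zero>\<^bsub>M i\<^esub>), add = (\<lambda>f g. \<lambda>i\<in>I. f i \<oplus>\<^bsub>M i\<^esub> g i),
     module.smult = (\<lambda>c f. \<lambda>i\<in>I. c \<odot>\<^bsub>M i\<^esub> f i)\<rparr>"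


section \<open>Bimodules over an algebra\<close>

record ('r, 'a, 'm) bimodule = "('r, 'm) module" +
  lact :: "'a \<Rightarrow> 'm \<Rightarrow> 'm"
  ract :: "'m \<Rightarrow> 'a \<Rightarrow> 'm"

definition with_actions ::
  "('r, 'm) module \<Rightarrow> ('a \<Rightarrow> 'm \<Rightarrow> 'm) \<Rightarrow> ('m \<Rightarrow> 'a \<Rightarrow> 'm) \<Rightarrow> ('r, 'a, 'm) bimodule" where
  "with_actions M l r = module.extend M (bimodule.fields l r)"

locale bimodule =
  A: ring A + A: Module.module "ring_of_type_algebra :: 'r ring" A +
  M: Module.module "ring_of_type_algebra :: 'r ring" M
  for A :: "('r::field, 'a, 'z) module_scheme" and M :: "('r, 'a, 'm, 'y) bimodule_scheme" +
  assumes lact_closed: "\<lbrakk>a \<in> carrier A; x \<in> carrier M\<rbrakk> \<Longrightarrow> lact M a x \<in> carrier M"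
    and lact_add: "\<lbrakk>a \<in> carrier A; x \<in> carrier M; y \<in> carrier M\<rbrakk> \<Longrightarrow>
      lact M a (x \<oplus>\<^bsub>M\<^esub> y) = lact M a x \<oplus>\<^bsub>M\<^esub> lact M a y"
    and add_lact: "\<lbrakk>a \<in> carrier A; b \<in> carrier A; x \<in> carrier M\<rbrakk> \<Longrightarrow>
      lact M (a \<oplus>\<^bsub>A\<^esub> b) x = lact M a x \<oplus>\<^bsub>M\<^esub> lact M b x"
    and lact_assoc: "\<lbrakk>a \<in> carrier A; b \<in> carrier A; x \<in> carrier M\<rbrakk> \<Longrightarrow>
      lact M (a \<otimes>\<^bsub>A\<^esub> b) x = lact M a (lact M b x)"
    and lact_one: "x \<in> carrier M \<Longrightarrow> lact M \<one>\<^bsub>A\<^esub> x = x"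
    and ract_closed: "\<lbrakk>a \<in> carrier A; x \<in> carrier M\<rbrakk> \<Longrightarrow> ract M x a \<in> carrier M"
    and ract_add: "\<lbrakk>a \<in> carrier A; x \<in> carrier M; y \<in> carrier M\<rbrakk> \<Longrightarrow>
      ract M (x \<oplus>\<^bsub>M\<^esub> y) a = ract M x a \<oplus>\<^bsub>M\<^esub> ract M y a"
    and add_ract: "\<lbrakk>a \<in> carrier A; b \<in> carrier A; x \<in> carrier M\<rbrakk> \<Longrightarrow>
      ract M x (a \<oplus>\<^bsub>A\<^esub> b) = ract M x a \<oplus>\<^bsub>M\<^esub> ract M x b"
    and ract_assoc: "\<lbrakk>a \<in> carrier A; b \<in> carrier A; x \<in> carrier M\<rbrakk> \<Longrightarrow>
      ract M x (a \<otimes>\<^bsub>A\<^esub> b) = ract M (ract M x a) b"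
    and ract_one: "x \<in> carrier M \<Longrightarrow> ract M x \<one>\<^bsub>A\<^esub> = x"
    and lact_ract: "\<lbrakk>a \<in> carrier A; b \<in> carrier A; x \<in> carrier M\<rbrakk> \<Longrightarrow>
      ract M (lact M a x) b = lact M a (ract M x b)"
    and smult_lact: "\<lbrakk>a \<in> carrier A; x \<in> carrier M\<rbrakk> \<Longrightarrow>
      lact M (c \<odot>\<^bsub>A\<^esub> a) x = c \<odot>\<^bsub>M\<^esub> lact M a x"
    and smult_ract: "\<lbrakk>a \<in> carrier A; x \<in> carrier M\<rbrakk> \<Longrightarrow>
      ract M x (c \<odot>\<^bsub>A\<^esub> a) = c \<odot>\<^bsub>M\<^esub> ract M x a"

locale bimodule_iso =
  M: bimodule A M + N: bimodule A N
  for A :: "('r::field, 'a, 'z) module_scheme"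
    and M :: "('r, 'a, 'm, 'y) bimodule_scheme"
    and N :: "('r, 'a, 'n, 'x) bimodule_scheme" +
  fixes h :: "'m \<Rightarrow> 'n"
  assumes bij: "bij_betw h (carrier M) (carrier N)"
    and add: "\<lbrakk>x \<in> carrier M; y \<in> carrier M\<rbrakk> \<Longrightarrow> h (x \<oplus>\<^bsub>M\<^esub> y) = h x \<oplus>\<^bsub>N\<^esub> h y"
    and smult: "x \<in> carrier M \<Longrightarrow> h (c \<odot>\<^bsub>M\<^esub> x) = c \<odot>\<^bsub>N\<^esub> h x"
    and lact: "\<lbrakk>a \<in> carrier A; x \<in> carrier M\<rbrakk> \<Longrightarrow> h (lact M a x) = lact N a (h x)"
    and ract: "\<lbrakk>a \<in> carrier A; x \<in> carrier M\<rbrakk> \<Longrightarrow> h (ract M x a) = ract N (h x) a"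


section \<open>Cube chains, the path algebra and the homology modules\<close>

text \<open>
  A cube chain is stored together with its endpoints, so that the constant path \<open>e\<^sub>v\<close> is
  \<open>(v, [], v)\<close>.
\<close>

type_synonym 'a cube_chain = "'a \<times> 'a list \<times> 'a"

definition is_cube_chain :: "'a precubical \<Rightarrow> 'a cube_chain \<Rightarrow> bool" where
  "is_cube_chain X = (\<lambda>(v, cs, w). v \<in> vertices X \<and> w \<in> vertices X \<and>
     (\<forall>c\<in>set cs. c \<in> cubes X \<and> cdim X c > 0) \<and>
     (if cs = [] then v = w
      else corner X False (hd cs) = v \<and> corner X True (last cs) = w \<and>
        (\<forall>k. Suc k < length cs \<longrightarrow> corner X True (cs ! k) = corner X False (cs ! Suc k))))"

definition chain_dim :: "'a precubical \<Rightarrow> 'a cube_chain \<Rightarrow> nat" where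
  "chain_dim X = (\<lambda>(v, cs, w). (\<Sum>c\<leftarrow>cs. cdim X c) - length cs)"

definition cube_chains :: "'a precubical \<Rightarrow> nat \<Rightarrow> 'a cube_chain set" where
  "cube_chains X m = {p. is_cube_chain X p \<and> chain_dim X p = m}"

text \<open>Bilinear extension of concatenation: product of the path algebra and both of its actions.\<close>

definition chain_concat :: "'a cube_chain \<Rightarrow> 'a cube_chain \<Rightarrow> ('a cube_chain \<Rightarrow>\<^sub>0 'r::field)" where
  "chain_concat = (\<lambda>(v, cs, w) (v', ds, w').
     if w = v' then basis_vec (v, cs @ ds, w') else 0)"

definition chain_mult ::
  "('a cube_chain \<Rightarrow>\<^sub>0 'r) \<Rightarrow> ('a cube_chain \<Rightarrow>\<^sub>0 'r) \<Rightarrow> ('a cube_chain \<Rightarrow>\<^sub>0 'r::field)" where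
  "chain_mult f g = lin_ext (\<lambda>p. lin_ext (\<lambda>q. chain_concat p q) g) f"

text \<open>The unit is the sum of the constant paths; this requires finitely many vertices.\<close>

definition path_algebra :: "'a precubical \<Rightarrow> ('r::field, 'a cube_chain \<Rightarrow>\<^sub>0 'r) module" where
  "path_algebra X = \<lparr>carrier = {f. Poly_Mapping.keys f \<subseteq> cube_chains X 0},
     monoid.mult = chain_mult, one = (\<Sum>v\<in>vertices X. basis_vec (v, [], v)),
     ring.zero = 0, add = (+), module.smult = pm_scale\<rparr>"

definition chain_space :: "'a precubical \<Rightarrow> nat \<Rightarrow> ('a cube_chain \<Rightarrow>\<^sub>0 'r::field) set" where
  "chain_space X i = {f. Poly_Mapping.keys f \<subseteq> cube_chains X (i - 1)}"

definition sgn_set :: "nat set \<Rightarrow> 'r::field" where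
  "sgn_set I = (if (\<Sum>j\<in>I. j + 1) mod 2 = (\<Sum>j=1..card I. j) mod 2 then 1 else - 1)"

text \<open>\<open>k\<close> ranges over \<open>1, \<dots>, length cs\<close>, and \<open>cs ! (k - 1)\<close> is the \<open>k\<close>-th cube.\<close>

definition split_chain :: "'a precubical \<Rightarrow> nat \<Rightarrow> nat set \<Rightarrow> 'a cube_chain \<Rightarrow> 'a cube_chain" where
  "split_chain X k I = (\<lambda>(v, cs, w). let c = cs ! (k - 1) in
     (v, take (k - 1) cs
         @ [iter_face X False ({..<cdim X c} - I) c, iter_face X True I c] @ drop k cs, w))"

definition chain_boundary :: "'a precubical \<Rightarrow> 'a cube_chain \<Rightarrow> ('a cube_chain \<Rightarrow>\<^sub>0 'r::field)" where
  "chain_boundary X = (\<lambda>(v, cs, w).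
     \<Sum>k=1..length cs. \<Sum>r=1..cdim X (cs ! (k - 1)) - 1.
       \<Sum>I\<in>{I. I \<subseteq> {..<cdim X (cs ! (k - 1))} \<and> card I = r}.
         pm_scale ((- 1) ^ ((\<Sum>c\<leftarrow>take (k - 1) cs. cdim X c) + k + r + 1) * sgn_set I)
           (basis_vec (split_chain X k I (v, cs, w))))"

text \<open>On chains of dimension 0 all cubes are edges, so the sum over \<open>r\<close> is empty and \<open>boundary\<close>
  vanishes on \<open>chain_space X 1\<close>.\<close>

definition boundary ::
  "'a precubical \<Rightarrow> ('a cube_chain \<Rightarrow>\<^sub>0 'r) \<Rightarrow> ('a cube_chain \<Rightarrow>\<^sub>0 'r::field)" where
  "boundary X = lin_ext (chain_boundary X)"

definition cycles :: "'a precubical \<Rightarrow> nat \<Rightarrow> ('a cube_chain \<Rightarrow>\<^sub>0 'r::field) set" where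
  "cycles X i = {f \<in> chain_space X i. boundary X f = 0}"

definition boundaries :: "'a precubical \<Rightarrow> nat \<Rightarrow> ('a cube_chain \<Rightarrow>\<^sub>0 'r::field) set" where
  "boundaries X i = boundary X ` chain_space X (i + 1)"

definition cycle_module :: "'a precubical \<Rightarrow> nat \<Rightarrow> ('r::field, 'a cube_chain \<Rightarrow>\<^sub>0 'r) module" where
  "cycle_module X i = \<lparr>carrier = cycles X i, monoid.mult = undefined, one = undefined,
     ring.zero = 0, add = (+), module.smult = pm_scale\<rparr>"

text \<open>\<open>HM X i\<close> is meant for \<open>i \<ge> 1\<close>. The action of \<open>u\<close> sends the class of a cycle \<open>z\<close> to the class
  of the concatenation of \<open>u\<close> and \<open>z\<close>.\<close>

definition HM :: "'a precubical \<Rightarrow> nat \<Rightarrow>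
    ('r::field, 'a cube_chain \<Rightarrow>\<^sub>0 'r, ('a cube_chain \<Rightarrow>\<^sub>0 'r) set) bimodule" where
  "HM X i = with_actions (quot_module (cycle_module X i) (boundaries X i))
     (\<lambda>u C. boundaries X i <+>\<^bsub>cycle_module X i\<^esub> (\<lambda>z. chain_mult u z) ` C)
     (\<lambda>C u. boundaries X i <+>\<^bsub>cycle_module X i\<^esub> (\<lambda>z. chain_mult z u) ` C)"


section \<open>Shifted tensor product\<close>

text \<open>For a directed path \<open>r\<close> of the tensor product, \<open>left_path X r\<close> and \<open>right_path Y r\<close> are the
  paths \<open>p\<close> and \<open>q\<close> of which \<open>r\<close> is a shuffle.\<close>

definition left_path :: "'a precubical \<Rightarrow> ('a \<times> 'b) cube_chain \<Rightarrow> 'a cube_chain" where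
  "left_path X = (\<lambda>(v, cs, w). (fst v, [a. (a, b) \<leftarrow> cs, cdim X a = 1], fst w))"

definition right_path :: "'b precubical \<Rightarrow> ('a \<times> 'b) cube_chain \<Rightarrow> 'b cube_chain" where
  "right_path Y = (\<lambda>(v, cs, w). (snd v, [b. (a, b) \<leftarrow> cs, cdim Y b = 1], snd w))"

definition box_index :: "nat \<Rightarrow> (nat \<times> nat) set" where
  "box_index n = {(i, j). i \<ge> 1 \<and> j \<ge> 1 \<and> i + j = n + 1}"

text \<open>The actions of basis paths \<open>r\<close> are extended linearly to the path algebra of the tensor
  product.\<close>

definition box_module :: "'a precubical \<Rightarrow> 'b precubical \<Rightarrow> nat \<Rightarrow>
    ('r::field, nat \<times> nat \<Rightarrow>
      (('a cube_chain \<Rightarrow>\<^sub>0 'r) set \<times> ('b cube_chain \<Rightarrow>\<^sub>0 'r) set \<Rightarrow>\<^sub>0 'r) set) module" where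
  "box_module X Y n = direct_sum (box_index n) (\<lambda>(i, j). tensor_module (HM X i) (HM Y j))"

definition box_path_lact where
  "box_path_lact X Y n r t = (\<lambda>(i, j)\<in>box_index n.
     tensor_map (HM X i) (HM Y j)
       (\<lambda>a. lact (HM X i) (basis_vec (left_path X r)) a)
       (\<lambda>b. lact (HM Y j) (basis_vec (right_path Y r)) b) (t (i, j)))"

definition box_path_ract where
  "box_path_ract X Y n t r = (\<lambda>(i, j)\<in>box_index n.
     tensor_map (HM X i) (HM Y j)
       (\<lambda>a. ract (HM X i) a (basis_vec (left_path X r)))
       (\<lambda>b. ract (HM Y j) b (basis_vec (right_path Y r))) (t (i, j)))"

definition HM_box :: "'a precubical \<Rightarrow> 'b precubical \<Rightarrow> nat \<Rightarrow>
    ('r::field, ('a \<times> 'b) cube_chain \<Rightarrow>\<^sub>0 'r, nat \<times> nat \<Rightarrow>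
      (('a cube_chain \<Rightarrow>\<^sub>0 'r) set \<times> ('b cube_chain \<Rightarrow>\<^sub>0 'r) set \<Rightarrow>\<^sub>0 'r) set) bimodule" where
  "HM_box X Y n = with_actions (box_module X Y n)
     (\<lambda>u t. \<Oplus>\<^bsub>box_module X Y n\<^esub>r\<in>Poly_Mapping.keys u.
        Poly_Mapping.lookup u r \<odot>\<^bsub>box_module X Y n\<^esub> box_path_lact X Y n r t)
     (\<lambda>t u. \<Oplus>\<^bsub>box_module X Y n\<^esub>r\<in>Poly_Mapping.keys u.
        Poly_Mapping.lookup u r \<odot>\<^bsub>box_module X Y n\<^esub> box_path_ract X Y n t r)"

end

theory Submission
  imports Defs
begin

text \<open>
  The chain complexes in question compute the homology of spaces of directed paths: an \<open>n\<close>-cube in a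
  chain stands for the \<open>(n - 1)\<close>-dimensional permutohedron of ways to pass it, and the boundary splits
  a cube into two consecutive ones. A directed path of a product is a pair of directed paths, so a
  Kuenneth theorem is to be expected. The proof below is purely combinatorial and algebraic.

  A cube of \<open>X \<otimes> Y\<close> is a pair of cubes; call it mixed if both have positive dimension. The map
  \<open>unshuffle\<close> sends a chain of \<open>X \<otimes> Y\<close> without mixed cubes to its part in \<open>X\<close> tensor its part in
  \<open>Y\<close>, with the Koszul sign, and a chain with a mixed cube to zero. It is a chain map
  (\<open>unshuffle_chain_map\<close>): the two ways to split a mixed cube completely into its two factors have
  opposite signs. It visibly commutes with the action of shuffles of paths. A right inverse is the
  cross product, which first passes the chain of \<open>X\<close> and then that of \<open>Y\<close>.

  The cross product is also an inverse up to boundaries (\<open>cycle_homologous_cross_unshuffle_chain\<close>).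
  The chains in its image, first cubes of \<open>X\<close> and then cubes of \<open>Y\<close>, are called sorted. The
  chains that are not sorted cancel in pairs: where the order is first violated there is either a
  mixed cube, or a cube of \<open>Y\<close> followed by one of \<open>X\<close>, and splitting or merging at this place exchanges
  the two cases. The number of pairs of directions in the wrong order shows that this matching is acyclic
  in the sense of discrete Morse theory (\<open>acyclic_matching\<close>), so every cycle is homologous to a
  combination of sorted chains.

  It remains to compute the homology of a tensor product of two complexes over a field. Each
  complex has a linear map \<open>k\<close> of degree 1 with \<open>\<partial>k\<partial> = \<partial>\<close>, and then \<open>p = 1 - \<partial>k - k\<partial>\<close> is zero on
  boundaries, has values in the cycles and is homotopic to the identity, hence \<open>p \<otimes> p\<close> is homotopic to
  the identity of the tensor product. So the cross product of homology classes is bijective, with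
  inverse \<open>c \<otimes> d \<mapsto> [p c] \<otimes> [p d]\<close> after unshuffling (\<open>quotient_iso_homology\<close>).

  Neither \<open>p\<close> nor the cross product respects the actions on chains. But two cycles of \<open>X \<otimes> Y\<close> with
  the same image under \<open>unshuffle\<close> are homologous, and \<open>unshuffle\<close> is equivariant, therefore the
  cross product is equivariant in homology (\<open>mult_cross_prod_homologous\<close>). The bimodule axioms of
  the shifted tensor product are transported along the isomorphism.

  The directions of the cubes carry labels (\<open>split_cubes\<close>), so that faces commute without index
  shifts; for a cubical complex the labels are the coordinate directions.
\<close>

section \<open>Linear extension\<close>

lemma keys_pm_scale: "Poly_Mapping.keys (pm_scale c f) \<subseteq> Poly_Mapping.keys f"
  by (auto simp: in_keys_iff lookup_pm_scale)

lemma lin_ext_superset: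
  assumes "finite S" "Poly_Mapping.keys f \<subseteq> S"
  shows "lin_ext g f = (\<Sum>x\<in>S. pm_scale (Poly_Mapping.lookup f x) (g x))"
  unfolding lin_ext_def
  by (rule sum.mono_neutral_left) (use assms in \<open>auto simp: in_keys_iff\<close>)

lemma lin_ext_zero [simp]: "lin_ext g 0 = 0"
  by (simp add: lin_ext_def)

lemma lin_ext_add: "lin_ext g (f + f') = lin_ext g f + lin_ext g f'"
proof -
  let ?S = "Poly_Mapping.keys f \<union> Poly_Mapping.keys f'"
  have "finite ?S" "Poly_Mapping.keys (f + f') \<subseteq> ?S"
    using Poly_Mapping.keys_add[of f f'] by auto
  then show ?thesis
    by (simp add: lin_ext_superset[of ?S] lookup_add pm.scale_left_distrib sum.distrib)
qed

lemma lin_ext_scale: "lin_ext g (pm_scale c f) = pm_scale c (lin_ext g f)"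
  by (simp add: lin_ext_superset[OF finite_keys keys_pm_scale] lookup_pm_scale
      lin_ext_def[of g f] pm.scale_sum_right)

lemma linear_lin_ext: "Vector_Spaces.linear pm_scale pm_scale (lin_ext g)"
  by unfold_locales (simp_all add: lin_ext_add lin_ext_scale)

lemma lin_ext_minus: "lin_ext g (- f) = - lin_ext g f"
  using lin_ext_scale[of g "- 1" f] by simp

lemma lin_ext_diff: "lin_ext g (f - f') = lin_ext g f - lin_ext g f'"
  using lin_ext_add[of g f "- f'"] by (simp add: lin_ext_minus)

lemma lin_ext_sum: "lin_ext g (\<Sum>i\<in>I. F i) = (\<Sum>i\<in>I. lin_ext g (F i))"
  by (induction I rule: infinite_finite_induct) (simp_all add: lin_ext_add)

lemma lin_ext_basis [simp]: "lin_ext g (basis_vec x) = g x"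
  by (simp add: lin_ext_def)

lemma lin_ext_basis_vec [simp]: "lin_ext basis_vec f = f"
proof (rule poly_mapping_eqI)
  fix y
  have "Poly_Mapping.lookup (lin_ext basis_vec f) y =
      (\<Sum>x\<in>Poly_Mapping.keys f. if x = y then Poly_Mapping.lookup f y else 0)"
    unfolding lin_ext_def lookup_sum
    by (rule sum.cong) (auto simp: lookup_pm_scale lookup_single when_def)
  then show "Poly_Mapping.lookup (lin_ext basis_vec f) y = Poly_Mapping.lookup f y"
    by (simp add: in_keys_iff)
qed

lemma lin_ext_cong:
  "f = f' \<Longrightarrow> (\<And>x. x \<in> Poly_Mapping.keys f \<Longrightarrow> g x = g' x) \<Longrightarrow> lin_ext g f = lin_ext g' f'"
  by (simp add: lin_ext_def)

lemma linear_of_lin_ext: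
  assumes "Vector_Spaces.linear pm_scale pm_scale F"
  shows "F (lin_ext g f) = lin_ext (\<lambda>x. F (g x)) f"
proof -
  interpret F: Vector_Spaces.linear pm_scale pm_scale F by fact
  show ?thesis by (simp add: lin_ext_def F.sum F.scale)
qed

lemma lin_ext_lin_ext: "lin_ext g (lin_ext h f) = lin_ext (\<lambda>x. lin_ext g (h x)) f"
  by (rule linear_of_lin_ext[OF linear_lin_ext])

lemma linear_eq_lin_ext:
  assumes "Vector_Spaces.linear pm_scale pm_scale F"
  shows "F f = lin_ext (\<lambda>x. F (basis_vec x)) f"
  using linear_of_lin_ext[OF assms, of basis_vec f] by simp

lemma lin_ext_fun_add: "lin_ext (\<lambda>x. g x + h x) f = lin_ext g f + lin_ext h f"
  by (simp add: lin_ext_def pm.scale_right_distrib sum.distrib)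

lemma lin_ext_fun_diff: "lin_ext (\<lambda>x. g x - h x) f = lin_ext g f - lin_ext h f"
  by (simp add: lin_ext_def pm.scale_right_diff_distrib sum_subtractf)

lemma lin_ext_fun_scale: "lin_ext (\<lambda>x. pm_scale c (g x)) f = pm_scale c (lin_ext g f)"
  unfolding lin_ext_def pm.scale_sum_right by (simp add: mult.commute)

lemma lin_ext_fun_zero [simp]: "lin_ext (\<lambda>x. 0) f = 0"
  by (simp add: lin_ext_def)

lemma lin_ext_fun_sum: "lin_ext (\<lambda>x. \<Sum>i\<in>I. g i x) f = (\<Sum>i\<in>I. lin_ext (g i) f)"
  by (induction I rule: infinite_finite_induct) (simp_all add: lin_ext_fun_add)

lemma lin_ext_swap:
  "lin_ext (\<lambda>x. lin_ext (B x) g) f = lin_ext (\<lambda>y. lin_ext (\<lambda>x. B x y) f) g"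
  unfolding lin_ext_def pm.scale_sum_right
  by (subst sum.swap) (simp add: mult.commute)

lemma lin_ext_in_subspace:
  assumes "pm.subspace V" "\<And>x. x \<in> Poly_Mapping.keys f \<Longrightarrow> g x \<in> V"
  shows "lin_ext g f \<in> V"
  unfolding lin_ext_def using assms by (intro pm.subspace_sum pm.subspace_scale)

lemma keys_lin_ext: "Poly_Mapping.keys (lin_ext g f) \<subseteq> (\<Union>x\<in>Poly_Mapping.keys f. Poly_Mapping.keys (g x))"
  unfolding lin_ext_def
  by (rule subset_trans[OF Poly_Mapping.keys_sum]) (intro UN_mono keys_pm_scale order_refl)

lemma keys_lin_extE:
  assumes "y \<in> Poly_Mapping.keys (lin_ext g f)"
  obtains x where "x \<in> Poly_Mapping.keys f" "y \<in> Poly_Mapping.keys (g x)"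
  using assms keys_lin_ext by fastforce

lemma subspace_keys: "pm.subspace {f :: 's \<Rightarrow>\<^sub>0 'r::field. Poly_Mapping.keys f \<subseteq> S}"
  unfolding pm.subspace_def
  by (auto dest!: subsetD[OF Poly_Mapping.keys_add] subsetD[OF keys_pm_scale])

lemma subspace_linear_image:
  assumes "pm.subspace V"
  shows "pm.subspace (lin_ext g ` V)"
  unfolding pm.subspace_def
proof (intro conjI ballI allI)
  show "0 \<in> lin_ext g ` V" using pm.subspace_0[OF assms] by (auto intro!: image_eqI[of _ _ 0])
next
  fix x y assume "x \<in> lin_ext g ` V" "y \<in> lin_ext g ` V"
  then obtain u v where "u \<in> V" "v \<in> V" "x = lin_ext g u" "y = lin_ext g v" by blast
  then show "x + y \<in> lin_ext g ` V"
    using pm.subspace_add[OF assms] by (auto simp: lin_ext_add[symmetric])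
next
  fix c x assume "x \<in> lin_ext g ` V"
  then show "pm_scale c x \<in> lin_ext g ` V"
    using pm.subspace_scale[OF assms] by (auto simp: lin_ext_scale[symmetric])
qed

definition pm_map :: "('s \<Rightarrow> 't) \<Rightarrow> ('s \<Rightarrow>\<^sub>0 'r::field) \<Rightarrow> ('t \<Rightarrow>\<^sub>0 'r)" where
  "pm_map h = lin_ext (\<lambda>x. basis_vec (h x))"

lemma pm_map_basis [simp]: "pm_map h (basis_vec x) = basis_vec (h x)"
  by (simp add: pm_map_def)

lemma pm_map_ident [simp]: "pm_map (\<lambda>x. x) f = f"
  by (simp add: pm_map_def)

lemma pm_map_id [simp]: "pm_map id f = f"
  by (simp add: pm_map_def)

lemma pm_map_zero [simp]: "pm_map h 0 = 0"
  by (simp add: pm_map_def)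

lemma pm_map_add: "pm_map h (f + g) = pm_map h f + pm_map h g"
  by (simp add: pm_map_def lin_ext_add)

lemma pm_map_diff: "pm_map h (f - g) = pm_map h f - pm_map h g"
  by (simp add: pm_map_def lin_ext_diff)

lemma pm_map_minus: "pm_map h (- f) = - pm_map h f"
  by (simp add: pm_map_def lin_ext_minus)

lemma pm_map_scale: "pm_map h (pm_scale c f) = pm_scale c (pm_map h f)"
  by (simp add: pm_map_def lin_ext_scale)

lemma pm_map_sum: "pm_map h (\<Sum>i\<in>I. F i) = (\<Sum>i\<in>I. pm_map h (F i))"
  by (simp add: pm_map_def lin_ext_sum)

lemma pm_map_pm_map: "pm_map h (pm_map g f) = pm_map (\<lambda>x. h (g x)) f"
  by (simp add: pm_map_def lin_ext_lin_ext)

lemma pm_map_lin_ext: "pm_map h (lin_ext g f) = lin_ext (\<lambda>x. pm_map h (g x)) f"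
  by (simp add: pm_map_def lin_ext_lin_ext)

lemma lin_ext_pm_map: "lin_ext g (pm_map h f) = lin_ext (\<lambda>x. g (h x)) f"
  by (simp add: pm_map_def lin_ext_lin_ext)

lemma keys_pm_map: "Poly_Mapping.keys (pm_map h f) \<subseteq> h ` Poly_Mapping.keys f"
  using keys_lin_ext[of "\<lambda>x. basis_vec (h x)" f] by (auto simp: pm_map_def)

text \<open>This identifies the free vector space on pairs with the tensor product of two free vector
  spaces, so chains of a tensor product of complexes need no quotient.\<close>

definition pm_tensor :: "('s \<Rightarrow>\<^sub>0 'r::field) \<Rightarrow> ('t \<Rightarrow>\<^sub>0 'r) \<Rightarrow> ('s \<times> 't \<Rightarrow>\<^sub>0 'r)" where
  "pm_tensor f g = lin_ext (\<lambda>a. lin_ext (\<lambda>b. basis_vec (a, b)) g) f"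

lemma pm_tensor_basis [simp]: "pm_tensor (basis_vec a) (basis_vec b) = basis_vec (a, b)"
  by (simp add: pm_tensor_def)

lemma pm_tensor_zero [simp]: "pm_tensor 0 g = 0" "pm_tensor f 0 = 0"
  by (simp_all add: pm_tensor_def)

lemma pm_tensor_add_left: "pm_tensor (f + f') g = pm_tensor f g + pm_tensor f' g"
  by (simp add: pm_tensor_def lin_ext_add)

lemma pm_tensor_add_right: "pm_tensor f (g + g') = pm_tensor f g + pm_tensor f g'"
  by (simp add: pm_tensor_def lin_ext_add lin_ext_fun_add)

lemma pm_tensor_diff_left: "pm_tensor (f - f') g = pm_tensor f g - pm_tensor f' g"
  by (simp add: pm_tensor_def lin_ext_diff)

lemma pm_tensor_diff_right: "pm_tensor f (g - g') = pm_tensor f g - pm_tensor f g'"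
  by (simp add: pm_tensor_def lin_ext_diff lin_ext_fun_diff)

lemma pm_tensor_scale_left: "pm_tensor (pm_scale c f) g = pm_scale c (pm_tensor f g)"
  by (simp add: pm_tensor_def lin_ext_scale)

lemma pm_tensor_scale_right: "pm_tensor f (pm_scale c g) = pm_scale c (pm_tensor f g)"
  by (simp add: pm_tensor_def lin_ext_scale lin_ext_fun_scale)

lemmas pm_tensor_simps = pm_tensor_add_left pm_tensor_add_right pm_tensor_diff_left
  pm_tensor_diff_right pm_tensor_scale_left pm_tensor_scale_right

lemma keys_pm_tensor:
  "Poly_Mapping.keys (pm_tensor f g) \<subseteq> Poly_Mapping.keys f \<times> Poly_Mapping.keys g"
  unfolding pm_tensor_def by (auto elim!: keys_lin_extE)

lemma lin_ext_pm_tensor: "lin_ext h (pm_tensor f g) = lin_ext (\<lambda>a. lin_ext (\<lambda>b. h (a, b)) g) f"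
  by (simp add: pm_tensor_def lin_ext_lin_ext)

lemma pm_tensor_basis_left: "pm_tensor (basis_vec a) g = pm_map (Pair a) g"
  by (simp add: pm_tensor_def pm_map_def)

lemma pm_tensor_basis_right: "pm_tensor f (basis_vec b) = pm_map (\<lambda>a. (a, b)) f"
  by (simp add: pm_tensor_def pm_map_def)

lemma lin_ext_pm_tensor_left: "lin_ext (\<lambda>x. pm_tensor (F x) g) f = pm_tensor (lin_ext F f) g"
  by (simp add: pm_tensor_def lin_ext_lin_ext)

lemma lin_ext_pm_tensor_right: "lin_ext (\<lambda>x. pm_tensor f (F x)) g = pm_tensor f (lin_ext F g)"
  unfolding pm_tensor_def by (subst lin_ext_swap) (simp add: lin_ext_lin_ext)

section \<open>Quotients of subspaces\<close>

definition sub_module :: "('s \<Rightarrow>\<^sub>0 'r) set \<Rightarrow> ('r::field, 's \<Rightarrow>\<^sub>0 'r) module" where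
  "sub_module V = \<lparr>carrier = V, monoid.mult = undefined, one = undefined,
     ring.zero = 0, add = (+), module.smult = pm_scale\<rparr>"

lemma cycle_module_eq: "cycle_module X i = sub_module (cycles X i)"
  by (simp add: cycle_module_def sub_module_def)

lemma free_module_eq: "free_module S = sub_module {f. Poly_Mapping.keys f \<subseteq> S}"
  by (simp add: free_module_def sub_module_def)

lemma sub_module_simps [simp]:
  "carrier (sub_module V) = V" "x \<oplus>\<^bsub>sub_module V\<^esub> y = x + y" "\<zero>\<^bsub>sub_module V\<^esub> = 0"
  "c \<odot>\<^bsub>sub_module V\<^esub> x = pm_scale c x"
  by (simp_all add: sub_module_def)

definition cls :: "'m::ab_group_add set \<Rightarrow> 'm \<Rightarrow> 'm set" where
  "cls N x = (+) x ` N"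

lemma in_cls_iff: "y \<in> cls N x \<longleftrightarrow> y - x \<in> N"
proof
  assume "y - x \<in> N"
  then show "y \<in> cls N x" unfolding cls_def by (intro image_eqI[of _ _ "y - x"]) simp_all
qed (auto simp: cls_def)

lemma set_add_sub_module: "set_add (sub_module V) A B = {a + b | a b. a \<in> A \<and> b \<in> B}"
  by (auto simp: set_add_def')

locale pm_quotient =
  fixes V N :: "('s \<Rightarrow>\<^sub>0 'r::field) set"
  assumes subspace_V: "pm.subspace V" and subspace_N: "pm.subspace N" and sub: "N \<subseteq> V"
begin

lemma cls_eq_iff: "cls N x = cls N y \<longleftrightarrow> x - y \<in> N"
proof
  assume "cls N x = cls N y"
  moreover have "x \<in> cls N x" by (simp add: in_cls_iff pm.subspace_0[OF subspace_N])
  ultimately show "x - y \<in> N" by (simp add: in_cls_iff)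
next
  assume *: "x - y \<in> N"
  have "z - x \<in> N \<longleftrightarrow> z - y \<in> N" for z
    using pm.subspace_add[OF subspace_N _ *, of "z - x"] pm.subspace_diff[OF subspace_N _ *, of "z - y"]
    by auto
  then show "cls N x = cls N y" by (auto simp: in_cls_iff)
qed

lemma cls_self: "x \<in> cls N x"
  by (simp add: in_cls_iff pm.subspace_0[OF subspace_N])

lemma cls_zero: "cls N 0 = N"
  by (simp add: cls_def)

lemma set_add_cls: "set_add (sub_module V) (cls N x) (cls N y) = cls N (x + y)"
proof (intro Set.set_eqI iffI)
  fix z assume "z \<in> set_add (sub_module V) (cls N x) (cls N y)"
  then obtain a b where "z = a + b" "a - x \<in> N" "b - y \<in> N"
    by (auto simp: set_add_sub_module in_cls_iff)
  then show "z \<in> cls N (x + y)" using pm.subspace_add[OF subspace_N, of "a - x" "b - y"]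
    by (simp add: in_cls_iff algebra_simps)
next
  fix z assume "z \<in> cls N (x + y)"
  then have "z = x + (z - x)" "z - x \<in> cls N y" by (simp_all add: in_cls_iff algebra_simps)
  then show "z \<in> set_add (sub_module V) (cls N x) (cls N y)"
    unfolding set_add_sub_module using cls_self by blast
qed

text \<open>A linear map that preserves \<open>N\<close> acts on the quotient by the formula which the homology
  modules and the tensor products use.\<close>

lemma set_add_image_cls:
  assumes "Vector_Spaces.linear pm_scale pm_scale F" "\<And>y. y \<in> N \<Longrightarrow> F y \<in> N"
  shows "set_add (sub_module V) N (F ` cls N x) = cls N (F x)"
proof (intro Set.set_eqI iffI)
  interpret F: Vector_Spaces.linear pm_scale pm_scale F by fact
  fix z assume "z \<in> set_add (sub_module V) N (F ` cls N x)"
  then obtain a y where "z = a + F y" "a \<in> N" "y - x \<in> N"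
    by (auto simp: set_add_sub_module in_cls_iff)
  then show "z \<in> cls N (F x)"
    using pm.subspace_add[OF subspace_N, of a "F (y - x)"] assms(2)[of "y - x"]
    by (simp add: in_cls_iff F.diff algebra_simps)
next
  fix z assume "z \<in> cls N (F x)"
  then have "z = (z - F x) + F x" "z - F x \<in> N" by (simp_all add: in_cls_iff)
  then show "z \<in> set_add (sub_module V) N (F ` cls N x)"
    unfolding set_add_sub_module using cls_self by blast
qed

abbreviation "Q \<equiv> quot_module (sub_module V) N"

lemma carrier_Q: "carrier Q = cls N ` V"
proof -
  have "N #>\<^bsub>add_monoid (sub_module V)\<^esub> x = cls N x" for x
    by (auto simp: r_coset_def cls_def sub_module_def add.commute)
  then show ?thesis
    by (auto simp: quot_module_def A_RCOSETS_defs a_r_coset_def sub_module_def RCOSETS_def)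
qed

lemma linear_scale_pm: "Vector_Spaces.linear pm_scale pm_scale (pm_scale c)"
  by unfold_locales (simp_all add: pm.scale_right_distrib mult.commute)

lemma Q_zero: "\<zero>\<^bsub>Q\<^esub> = cls N 0"
  by (simp add: quot_module_def cls_zero)

lemma Q_add: "cls N x \<oplus>\<^bsub>Q\<^esub> cls N y = cls N (x + y)"
  using set_add_cls by (simp add: quot_module_def)

lemma Q_smult: "c \<odot>\<^bsub>Q\<^esub> cls N x = cls N (pm_scale c x)"
  using set_add_image_cls[OF linear_scale_pm pm.subspace_scale[OF subspace_N]]
  by (simp add: quot_module_def)

lemma module_Q: "Module.module (ring_of_type_algebra :: 'r ring) Q"
proof (rule moduleI)
  show "cring (ring_of_type_algebra :: 'r ring)" by (rule cring_from_type_algebra)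
  show "abelian_group Q"
  proof (rule abelian_groupI)
    show "\<exists>y\<in>carrier Q. y \<oplus>\<^bsub>Q\<^esub> x = \<zero>\<^bsub>Q\<^esub>" if x: "x \<in> carrier Q" for x
    proof -
      obtain a where a: "a \<in> V" "x = cls N a" using x by (auto simp: carrier_Q)
      have "cls N (- a) \<in> carrier Q"
        using a pm.subspace_neg[OF subspace_V] by (auto simp: carrier_Q)
      then show ?thesis using a by (intro bexI[of _ "cls N (- a)"]) (simp_all add: Q_add Q_zero)
    qed
  qed (auto simp: carrier_Q Q_add Q_zero algebra_simps intro!: imageI
      pm.subspace_add[OF subspace_V] pm.subspace_0[OF subspace_V])
qed (auto simp: carrier_Q Q_add Q_smult ring_of_type_algebra_def
      pm.scale_left_distrib pm.scale_right_distrib intro!: imageI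
      pm.subspace_add[OF subspace_V] pm.subspace_scale[OF subspace_V])

end

section \<open>Labelled cubes\<close>

text \<open>The sign of the shuffle that lists the block \<open>I\<close> before the block \<open>J\<close> is \<open>-1\<close> to this number.\<close>

definition inv_count :: "nat set \<Rightarrow> nat set \<Rightarrow> nat" where
  "inv_count I J = card {(i, j). i \<in> I \<and> j \<in> J \<and> j < i}"

lemma finite_inversions: "finite I \<Longrightarrow> finite J \<Longrightarrow> finite {(i, j). i \<in> I \<and> j \<in> J \<and> j < (i :: nat)}"
  by (rule finite_subset[of _ "I \<times> J"]) auto

lemma inv_count_Un_left:
  assumes "finite A" "finite B" "finite J" "A \<inter> B = {}"
  shows "inv_count (A \<union> B) J = inv_count A J + inv_count B J"
proof -
  have "{(i, j). i \<in> A \<union> B \<and> j \<in> J \<and> j < i} =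
      {(i, j). i \<in> A \<and> j \<in> J \<and> j < i} \<union> {(i, j). i \<in> B \<and> j \<in> J \<and> j < i}" by auto
  then show ?thesis unfolding inv_count_def
    by (simp only:) (rule card_Un_disjoint, use assms finite_inversions in auto)
qed

lemma inv_count_Un_right:
  assumes "finite A" "finite B" "finite J" "A \<inter> B = {}"
  shows "inv_count J (A \<union> B) = inv_count J A + inv_count J B"
proof -
  have "{(i, j). i \<in> J \<and> j \<in> A \<union> B \<and> j < i} =
      {(i, j). i \<in> J \<and> j \<in> A \<and> j < i} \<union> {(i, j). i \<in> J \<and> j \<in> B \<and> j < i}" by auto
  then show ?thesis unfolding inv_count_def
    by (simp only:) (rule card_Un_disjoint, use assms finite_inversions in auto)
qed

text \<open>A split of a cube passes the directions of a set \<open>I\<close> first and the other directions afterwards.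
  The cube \<open>lo I c\<close> is the past face of \<open>c\<close> which keeps the directions \<open>I\<close>, and \<open>hi I c\<close> is the future
  face in which the directions \<open>I\<close> have been used up. Directions are named by labels that a face
  inherits from the cube, instead of by their positions: the identities between iterated faces then
  involve no shift of indices.\<close>

locale split_cubes =
  fixes Q :: "'a set" and dirs :: "'a \<Rightarrow> nat set" and lo hi :: "nat set \<Rightarrow> 'a \<Rightarrow> 'a"
  assumes finite_dirs: "c \<in> Q \<Longrightarrow> finite (dirs c)"
    and lo_in: "c \<in> Q \<Longrightarrow> I \<subseteq> dirs c \<Longrightarrow> lo I c \<in> Q"
    and dirs_lo: "c \<in> Q \<Longrightarrow> I \<subseteq> dirs c \<Longrightarrow> dirs (lo I c) = I"
    and hi_in: "c \<in> Q \<Longrightarrow> I \<subseteq> dirs c \<Longrightarrow> hi I c \<in> Q"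
    and dirs_hi: "c \<in> Q \<Longrightarrow> I \<subseteq> dirs c \<Longrightarrow> dirs (hi I c) = dirs c - I"
    and lo_lo: "c \<in> Q \<Longrightarrow> A \<subseteq> I \<Longrightarrow> I \<subseteq> dirs c \<Longrightarrow> lo A (lo I c) = lo A c"
    and hi_hi: "c \<in> Q \<Longrightarrow> A \<inter> B = {} \<Longrightarrow> A \<union> B \<subseteq> dirs c \<Longrightarrow> hi B (hi A c) = hi (A \<union> B) c"
    and lo_hi: "c \<in> Q \<Longrightarrow> A \<inter> B = {} \<Longrightarrow> A \<union> B \<subseteq> dirs c \<Longrightarrow> lo B (hi A c) = hi A (lo (A \<union> B) c)"
    and lo_dirs: "c \<in> Q \<Longrightarrow> lo (dirs c) c = c"
    and hi_empty: "c \<in> Q \<Longrightarrow> hi {} c = c"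
begin

definition splits :: "'a \<Rightarrow> nat set set" where
  "splits c = {I. I \<subset> dirs c \<and> I \<noteq> {}}"

definition split_sign :: "'a \<Rightarrow> nat set \<Rightarrow> 'r::field" where
  "split_sign c I = (- 1) ^ (card I + inv_count I (dirs c - I))"

definition bd1 :: "'a \<Rightarrow> ('a list \<Rightarrow>\<^sub>0 'r::field)" where
  "bd1 c = (\<Sum>I\<in>splits c. pm_scale (split_sign c I) (basis_vec [lo I c, hi I c]))"

definition cube_deg :: "'a \<Rightarrow> nat" where
  "cube_deg c = card (dirs c) - 1"

definition deg :: "'a list \<Rightarrow> nat" where
  "deg cs = (\<Sum>c\<leftarrow>cs. cube_deg c)"

text \<open>The extension of \<open>bd1\<close> to a signed derivation, where a cube has degree one less than its
  dimension. Chains are lists here: splitting a cube does not change the end points of a chain.\<close>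

fun bd :: "'a list \<Rightarrow> ('a list \<Rightarrow>\<^sub>0 'r::field)" where
  "bd [] = 0"
| "bd (c # cs) = pm_map (\<lambda>l. l @ cs) (bd1 c) + pm_scale ((- 1) ^ cube_deg c) (pm_map ((#) c) (bd cs))"

lemma deg_simps [simp]: "deg [] = 0" "deg (c # cs) = cube_deg c + deg cs"
  "deg (cs @ ds) = deg cs + deg ds"
  by (simp_all add: deg_def)

lemma finite_splits: "c \<in> Q \<Longrightarrow> finite (splits c)"
  by (rule finite_subset[of _ "Pow (dirs c)"]) (auto simp: splits_def finite_dirs)

lemma keys_bd1:
  assumes "c \<in> Q" "l \<in> Poly_Mapping.keys (bd1 c :: 'a list \<Rightarrow>\<^sub>0 'r::field)"
  obtains I where "I \<in> splits c" "l = [lo I c, hi I c]"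
  using assms(2) unfolding bd1_def
  by (auto dest!: subsetD[OF Poly_Mapping.keys_sum] subsetD[OF keys_pm_scale] intro: that)

lemma keys_bd1_deg:
  assumes "c \<in> Q" "l \<in> Poly_Mapping.keys (bd1 c :: 'a list \<Rightarrow>\<^sub>0 'r::field)"
  shows "Suc (deg l) = cube_deg c" "set l \<subseteq> {x \<in> Q. dirs x \<noteq> {}}"
proof -
  obtain I where I: "I \<in> splits c" "l = [lo I c, hi I c]" using keys_bd1 assms by blast
  then have sub: "I \<subseteq> dirs c" "I \<subset> dirs c" "I \<noteq> {}" by (auto simp: splits_def)
  have fin: "finite (dirs c)" "finite I" using finite_dirs assms sub(1) finite_subset by auto
  have "card (dirs c) = card I + card (dirs c - I)"
    using fin sub by (metis card_Un_disjoint Diff_disjoint Un_Diff_cancel finite_Diff sup.absorb2)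
  moreover have "card I > 0" "card (dirs c - I) > 0"
    using fin sub by (auto simp: card_gt_0_iff)
  ultimately show "Suc (deg l) = cube_deg c"
    using sub by (simp add: I(2) cube_deg_def dirs_lo dirs_hi assms(1))
  show "set l \<subseteq> {x \<in> Q. dirs x \<noteq> {}}"
    using sub assms(1) by (auto simp: I(2) dirs_lo dirs_hi lo_in hi_in)
qed

lemma bd_append:
  "(bd (xs @ ys) :: 'a list \<Rightarrow>\<^sub>0 'r::field) =
     pm_map (\<lambda>l. l @ ys) (bd xs) + pm_scale ((- 1) ^ deg xs) (pm_map ((@) xs) (bd ys))"
proof (induction xs)
  case Nil
  show ?case using lin_ext_basis_vec by (simp add: pm_map_def)
next
  case (Cons c cs)
  then show ?case
    by (simp add: pm_map_add pm_map_scale pm_map_pm_map pm.scale_right_distrib power_add add.assoc)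
qed

lemma bd_singleton: "bd [c] = bd1 c"
  using lin_ext_basis_vec by (simp add: pm_map_def)

lemma keys_bd_deg:
  assumes "set cs \<subseteq> {x \<in> Q. dirs x \<noteq> {}}" "l \<in> Poly_Mapping.keys (bd cs :: 'a list \<Rightarrow>\<^sub>0 'r::field)"
  shows "Suc (deg l) = deg cs \<and> set l \<subseteq> {x \<in> Q. dirs x \<noteq> {}}"
  using assms
proof (induction cs arbitrary: l)
  case (Cons c cs)
  from Cons.prems(2) consider
    l1 where "l1 \<in> Poly_Mapping.keys (bd1 c :: 'a list \<Rightarrow>\<^sub>0 'r)" "l = l1 @ cs"
  | l2 where "l2 \<in> Poly_Mapping.keys (bd cs :: 'a list \<Rightarrow>\<^sub>0 'r)" "l = c # l2"
    by (auto dest!: subsetD[OF Poly_Mapping.keys_add] subsetD[OF keys_pm_scale] subsetD[OF keys_pm_map])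
  then show ?case
  proof cases
    case 1
    then show ?thesis using keys_bd1_deg[of c l1] Cons.prems(1) by auto
  next
    case 2
    then show ?thesis using Cons.IH[of l2] Cons.prems(1) by auto
  qed
qed simp

text \<open>Splitting a cube twice refines its directions to an ordered partition into three blocks. Each
  partition arises in two ways, by splitting the first or the second of two blocks, with opposite
  signs.\<close>

lemma bd_bd1:
  assumes c: "c \<in> Q"
  shows "lin_ext bd (bd1 c) = (0 :: 'a list \<Rightarrow>\<^sub>0 'r::field)"
proof -
  let ?D = "dirs c"
  have finD: "finite ?D" using finite_dirs c by simp
  let ?P = "{(I, A). I \<in> splits c \<and> A \<subset> I \<and> A \<noteq> {}}"
  let ?t = "\<lambda>A I. basis_vec [lo A c, hi A (lo I c), hi I c] :: 'a list \<Rightarrow>\<^sub>0 'r"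
  let ?s1 = "\<lambda>I A. split_sign c I * split_sign (lo I c) A :: 'r"
  let ?s2 = "\<lambda>I B. split_sign c I * (- 1) ^ cube_deg (lo I c) * split_sign (hi I c) B :: 'r"
  have first: "pm_map (\<lambda>l. l @ [hi I c]) (bd1 (lo I c)) =
      (\<Sum>A\<in>{A. A \<subset> I \<and> A \<noteq> {}}. pm_scale (split_sign (lo I c) A) (?t A I))" if "I \<in> splits c" for I
  proof -
    have I: "I \<subseteq> ?D" using that by (auto simp: splits_def)
    have "splits (lo I c) = {A. A \<subset> I \<and> A \<noteq> {}}" using I c by (simp add: splits_def dirs_lo)
    moreover have "lo A (lo I c) = lo A c" if "A \<subset> I" for A using that I c lo_lo by auto
    ultimately show ?thesis unfolding bd1_def pm_map_sum pm_map_scale by (auto intro!: sum.cong)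
  qed
  have second: "pm_map ((#) (lo I c)) (bd1 (hi I c)) =
      (\<Sum>B\<in>splits (hi I c). pm_scale (split_sign (hi I c) B) (?t I (I \<union> B)))" if "I \<in> splits c" for I
  proof -
    have I: "I \<subseteq> ?D" using that by (auto simp: splits_def)
    have "lo B (hi I c) = hi I (lo (I \<union> B) c)" "hi B (hi I c) = hi (I \<union> B) c"
      if "B \<in> splits (hi I c)" for B
      using that I c lo_hi[of c I B] hi_hi[of c I B] by (auto simp: splits_def dirs_hi)
    then show ?thesis unfolding bd1_def pm_map_sum pm_map_scale by (auto intro!: sum.cong)
  qed
  have fs: "finite {A. A \<subset> I \<and> A \<noteq> {}}" if "I \<in> splits c" for I
    using that finD finite_subset[of I] by (auto simp: splits_def intro: finite_subset[of _ "Pow I"])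
  have fh: "finite (splits (hi I c))" if "I \<in> splits c" for I
    using that c by (intro finite_splits hi_in) (auto simp: splits_def)
  have "lin_ext bd (bd1 c) = (\<Sum>I\<in>splits c. pm_scale (split_sign c I) (bd [lo I c, hi I c]))"
    unfolding bd1_def lin_ext_sum lin_ext_scale by simp
  also have "\<dots> = (\<Sum>I\<in>splits c. \<Sum>A\<in>{A. A \<subset> I \<and> A \<noteq> {}}. pm_scale (?s1 I A) (?t A I)) +
      (\<Sum>I\<in>splits c. \<Sum>B\<in>splits (hi I c). pm_scale (?s2 I B) (?t I (I \<union> B)))"
    unfolding sum.distrib[symmetric]
  proof (rule sum.cong[OF refl])
    fix I assume I: "I \<in> splits c"
    have "bd [lo I c, hi I c] = pm_map (\<lambda>l. l @ [hi I c]) (bd1 (lo I c)) +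
        pm_scale ((- 1) ^ cube_deg (lo I c)) (pm_map ((#) (lo I c)) (bd1 (hi I c)))"
      by (simp only: bd.simps(2)[of "lo I c"] bd_singleton)
    then show "pm_scale (split_sign c I) (bd [lo I c, hi I c]) =
        (\<Sum>A\<in>{A. A \<subset> I \<and> A \<noteq> {}}. pm_scale (?s1 I A) (?t A I)) +
        (\<Sum>B\<in>splits (hi I c). pm_scale (?s2 I B) (?t I (I \<union> B)))"
      by (simp add: first[OF I] second[OF I] pm.scale_right_distrib pm.scale_sum_right mult.assoc)
  qed
  also have "(\<Sum>I\<in>splits c. \<Sum>A\<in>{A. A \<subset> I \<and> A \<noteq> {}}. pm_scale (?s1 I A) (?t A I)) =
      (\<Sum>(I, A)\<in>?P. pm_scale (?s1 I A) (?t A I))"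
    using finite_splits[OF c] fs by (subst sum.Sigma) (auto intro!: sum.cong)
  \<comment> \<open>The second sum is written as a sum over the same pairs: its blocks \<open>I\<close> and \<open>B\<close> become the
    nested sets \<open>I \<union> B\<close> and \<open>I\<close>.\<close>
  also have "(\<Sum>I\<in>splits c. \<Sum>B\<in>splits (hi I c). pm_scale (?s2 I B) (?t I (I \<union> B))) =
      (\<Sum>(I, A)\<in>?P. pm_scale (?s2 A (I - A)) (?t A I))"
    using finite_splits[OF c] fh
  proof (subst sum.Sigma)
    show "(\<Sum>(I, B)\<in>(SIGMA I:splits c. splits (hi I c)). pm_scale (?s2 I B) (?t I (I \<union> B))) =
        (\<Sum>(I, A)\<in>?P. pm_scale (?s2 A (I - A)) (?t A I))"
    proof (rule sum.reindex_bij_witness[of _ "\<lambda>(I, A). (A, I - A)" "\<lambda>(I, B). (I \<union> B, I)"], goal_cases)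
      case (1 p)
      obtain I B where p: "p = (I, B)" by fastforce
      then have "I \<in> splits c" "B \<in> splits (hi I c)" using 1 by auto
      then have "B \<subseteq> ?D - I" using dirs_hi[OF c, of I] by (auto simp: splits_def)
      then show ?case by (auto simp: p)
    next
      case (2 p)
      obtain I B where p: "p = (I, B)" by fastforce
      then have "I \<in> splits c" "B \<in> splits (hi I c)" using 2 by auto
      then have "I \<subset> ?D" "I \<noteq> {}" "B \<subset> ?D - I" "B \<noteq> {}"
        using dirs_hi[OF c, of I] by (auto simp: splits_def)
      then show ?case by (auto simp: p splits_def)
    next
      case (3 p)
      then show ?case by auto
    next
      case (4 p)
      obtain I A where p: "p = (I, A)" by fastforce
      then have *: "I \<subset> ?D" "A \<subset> I" "A \<noteq> {}" using 4 by (auto simp: splits_def)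
      then have "dirs (hi A c) = ?D - A" using dirs_hi[OF c, of A] by auto
      then show ?case using * by (auto simp: p splits_def)
    next
      case (5 p)
      obtain I B where p: "p = (I, B)" by fastforce
      then have "I \<in> splits c" "B \<in> splits (hi I c)" using 5 by auto
      then have "B \<subseteq> ?D - I" using dirs_hi[OF c, of I] by (auto simp: splits_def)
      then have "I \<union> B - I = B" by auto
      then show ?case by (simp add: p)
    qed
  qed auto
  also have "(\<Sum>(I, A)\<in>?P. pm_scale (?s1 I A) (?t A I)) + (\<Sum>(I, A)\<in>?P. pm_scale (?s2 A (I - A)) (?t A I)) =
      (\<Sum>(I, A)\<in>?P. pm_scale (?s1 I A + ?s2 A (I - A)) (?t A I))"
    unfolding sum.distrib[symmetric] by (auto intro!: sum.cong simp: pm.scale_left_distrib)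
  also have "\<dots> = 0"
  proof (rule sum.neutral, rule ballI)
    fix p assume "p \<in> ?P"
    then obtain I A where p: "p = (I, A)" and I: "I \<in> splits c" and A: "A \<subset> I" "A \<noteq> {}" by blast
    let ?B = "I - A" and ?K = "?D - I"
    have ID: "I \<subseteq> ?D" "A \<subseteq> ?D" using I A by (auto simp: splits_def)
    have fin: "finite I" "finite A" "finite ?B" "finite ?K" using finite_subset[OF ID(1) finD] finite_subset[OF ID(2) finD] finD by auto
    have d: "dirs (lo I c) = I" "dirs (lo A c) = A" "dirs (hi A c) = ?D - A"
      using ID c dirs_lo dirs_hi by auto
    have "?D - A = ?B \<union> ?K" "I = A \<union> ?B" "?D - A - ?B = ?K" using ID A by auto
    then have inv: "inv_count A (?D - A) = inv_count A ?B + inv_count A ?K"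
      "inv_count I ?K = inv_count A ?K + inv_count ?B ?K" "?D - A - ?B = ?K"
      using inv_count_Un_right[of ?B ?K A] inv_count_Un_left[of A ?B ?K] fin by auto
    have cd: "card I = card A + card ?B" "card A > 0"
      using fin A card_Un_disjoint[of A ?B] by (auto simp: card_gt_0_iff Un_absorb1)
    \<comment> \<open>The exponents of the two signs of the ordered partition into \<open>A\<close>, \<open>?B\<close> and \<open>?K\<close>.\<close>
    define m where "m = card I + inv_count I ?K + (card A + inv_count A ?B)"
    define n where "n = card A + inv_count A (?D - A) + (card A - 1) + (card ?B + inv_count ?B ?K)"
    have "n + m = 2 * (card I + inv_count I ?K + inv_count A ?B + card A - 1) + 1"
      unfolding m_def n_def inv using cd by simp
    then have "odd (n + m)" by presburger
    then have "(- 1 :: 'r) ^ m + (- 1) ^ n = 0" by (auto simp: minus_one_power_iff)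
    moreover have "?s1 I A = (- 1 :: 'r) ^ m" "?s2 A ?B = (- 1 :: 'r) ^ n"
      by (simp_all add: split_sign_def cube_deg_def d inv m_def n_def power_add)
    ultimately show "(case p of (I, A) \<Rightarrow> pm_scale (?s1 I A + ?s2 A (I - A)) (?t A I)) = 0"
      by (simp add: p)
  qed
  finally show ?thesis .
qed

lemma bd_bd:
  assumes "set cs \<subseteq> {x \<in> Q. dirs x \<noteq> {}}"
  shows "lin_ext bd (bd cs) = (0 :: 'a list \<Rightarrow>\<^sub>0 'r::field)"
  using assms
proof (induction cs)
  case (Cons c cs)
  let ?s = "(- 1) ^ cube_deg c :: 'r"
  have c: "c \<in> Q" using Cons by simp
  have 1: "lin_ext bd (pm_map (\<lambda>l. l @ cs) (bd1 c)) =
      - pm_scale ?s (lin_ext (\<lambda>l. pm_map ((@) l) (bd cs)) (bd1 c :: 'a list \<Rightarrow>\<^sub>0 'r))"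
  proof -
    have "lin_ext bd (pm_map (\<lambda>l. l @ cs) (bd1 c)) = lin_ext (\<lambda>l. bd (l @ cs)) (bd1 c :: 'a list \<Rightarrow>\<^sub>0 'r)"
      by (simp add: lin_ext_pm_map)
    also have "\<dots> = lin_ext (\<lambda>l. pm_map (\<lambda>m. m @ cs) (bd l) + pm_scale (- ?s) (pm_map ((@) l) (bd cs))) (bd1 c)"
    proof (rule lin_ext_cong[OF refl])
      fix l assume "l \<in> Poly_Mapping.keys (bd1 c :: 'a list \<Rightarrow>\<^sub>0 'r)"
      from keys_bd1_deg(1)[OF c this] have "- ?s = (- 1) ^ deg l" by (metis add.inverse_inverse mult_minus1 power_Suc)
      then show "bd (l @ cs) = pm_map (\<lambda>m. m @ cs) (bd l) + pm_scale (- ?s) (pm_map ((@) l) (bd cs))"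
        by (simp add: bd_append)
    qed
    finally show ?thesis unfolding lin_ext_fun_add lin_ext_fun_scale
      by (simp add: pm_map_lin_ext[symmetric] bd_bd1[OF c])
  qed
  have 2: "lin_ext bd (pm_map ((#) c) (bd cs)) = lin_ext (\<lambda>l. pm_map ((@) l) (bd cs)) (bd1 c :: 'a list \<Rightarrow>\<^sub>0 'r)"
  proof -
    have "lin_ext bd (pm_map ((#) c) (bd cs)) =
        lin_ext (\<lambda>l. pm_map (\<lambda>m. m @ l) (bd1 c)) (bd cs) +
        pm_scale ?s (pm_map ((#) c) (lin_ext bd (bd cs :: 'a list \<Rightarrow>\<^sub>0 'r)))"
      by (simp add: lin_ext_pm_map lin_ext_fun_add lin_ext_fun_scale pm_map_lin_ext)
    also have "lin_ext bd (bd cs :: 'a list \<Rightarrow>\<^sub>0 'r) = 0" using Cons by simp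
    finally show ?thesis unfolding pm_map_def by (simp add: lin_ext_swap[of _ _ "bd cs"])
  qed
  show ?case by (simp only: bd.simps lin_ext_add lin_ext_scale 1 2) simp
qed simp

subsection \<open>Chains\<close>

fun lchain :: "'a \<Rightarrow> 'a list \<Rightarrow> 'a \<Rightarrow> bool" where
  "lchain v [] w \<longleftrightarrow> v = w \<and> v \<in> Q \<and> dirs v = {}"
| "lchain v (c # cs) w \<longleftrightarrow> c \<in> Q \<and> dirs c \<noteq> {} \<and> lo {} c = v \<and> lchain (hi (dirs c) c) cs w"

lemma lchain_vertices: "lchain v cs w \<Longrightarrow> v \<in> Q \<and> dirs v = {} \<and> w \<in> Q \<and> dirs w = {}"
  by (induction cs arbitrary: v) (auto simp: lo_in dirs_lo)

lemma lchain_append: "lchain v (xs @ ys) w \<longleftrightarrow> (\<exists>u. lchain v xs u \<and> lchain u ys w)"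
  by (induction xs arbitrary: v) (auto dest: lchain_vertices)

lemma lchain_set: "lchain v cs w \<Longrightarrow> set cs \<subseteq> {x \<in> Q. dirs x \<noteq> {}}"
  by (induction cs arbitrary: v) auto

text \<open>The two parts of a split cube meet in the vertex at which exactly the directions \<open>I\<close> have been
  passed, and the end points are those of the cube.\<close>

lemma lchain_split:
  assumes "c \<in> Q" "I \<in> splits c"
  shows "lchain (lo {} c) [lo I c, hi I c] (hi (dirs c) c)"
proof -
  have I: "I \<subseteq> dirs c" "I \<noteq> {}" "dirs c - I \<noteq> {}" using assms by (auto simp: splits_def)
  have "hi (dirs c - I) (hi I c) = hi (dirs c) c"
    using hi_hi[OF assms(1), of I "dirs c - I"] I by (simp add: Un_absorb1)
  moreover have "lo {} (hi I c) = hi I (lo I c)" using lo_hi[OF assms(1), of I "{}"] I by simp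
  moreover have "lo {} (lo I c) = lo {} c" using lo_lo[OF assms(1), of "{}" I] I by simp
  ultimately show ?thesis
    using I assms(1) by (simp add: dirs_lo dirs_hi lo_in hi_in)
qed

lemma lchain_bd:
  assumes "lchain v cs w" "l \<in> Poly_Mapping.keys (bd cs :: 'a list \<Rightarrow>\<^sub>0 'r::field)"
  shows "lchain v l w"
  using assms
proof (induction cs arbitrary: v l)
  case (Cons c cs)
  from Cons.prems(2) consider
    l1 where "l1 \<in> Poly_Mapping.keys (bd1 c :: 'a list \<Rightarrow>\<^sub>0 'r)" "l = l1 @ cs"
  | l2 where "l2 \<in> Poly_Mapping.keys (bd cs :: 'a list \<Rightarrow>\<^sub>0 'r)" "l = c # l2"
    by (auto dest!: subsetD[OF Poly_Mapping.keys_add] subsetD[OF keys_pm_scale] subsetD[OF keys_pm_map])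
  then show ?case
  proof cases
    case 1
    have c: "c \<in> Q" using Cons.prems by simp
    obtain I where "I \<in> splits c" "l1 = [lo I c, hi I c]" using keys_bd1[OF c 1(1)] by blast
    then have "lchain v l1 (hi (dirs c) c)" using lchain_split[OF c, of I] Cons.prems(1) by (simp del: lchain.simps(2) add: lchain.simps(2)[of v c])
    then show ?thesis using Cons.prems(1) 1(2)
      by (simp add: lchain_append) blast
  next
    case 2
    then show ?thesis using Cons by auto
  qed
qed simp

lemma bd_vertices_free:
  assumes "deg cs = 0" "set cs \<subseteq> {x \<in> Q. dirs x \<noteq> {}}"
  shows "(bd cs :: 'a list \<Rightarrow>\<^sub>0 'r::field) = 0"
proof -
  have "l \<notin> Poly_Mapping.keys (bd cs :: 'a list \<Rightarrow>\<^sub>0 'r)" for l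
    using keys_bd_deg[OF assms(2), of l] assms(1) by auto
  then have "Poly_Mapping.keys (bd cs :: 'a list \<Rightarrow>\<^sub>0 'r) = {}" by blast
  then show ?thesis by simp
qed

end

section \<open>Acyclic matchings\<close>

text \<open>Discrete Morse theory in a single degree. A pair \<open>matched m u\<close> consists of an upper cell \<open>m\<close> and
  a face \<open>u\<close> of it with nonzero incidence, the lower cell; the cells of \<open>C\<close> without partner are
  critical. The weight makes the matching acyclic: every face of \<open>m\<close> other than \<open>u\<close> is an upper cell
  itself or weighs less than \<open>u\<close>.\<close>

locale acyclic_matching =
  fixes C C' crit :: "'s set" and d :: "'s \<Rightarrow> ('s \<Rightarrow>\<^sub>0 'r::field)"
    and matched :: "'s \<Rightarrow> 's \<Rightarrow> bool" and weight :: "'s \<Rightarrow> nat"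
  assumes exhaust: "c \<in> C \<Longrightarrow> c \<in> crit \<or> (\<exists>u. matched c u) \<or> (\<exists>m\<in>C'. matched m c)"
    and incidence: "m \<in> C \<union> C' \<Longrightarrow> matched m u \<Longrightarrow>
      \<exists>e. e \<noteq> 0 \<and> (\<forall>l\<in>Poly_Mapping.keys (d m - pm_scale e (basis_vec u)). (\<exists>u'. matched l u') \<or> weight l < weight u)"
    and d_C': "m \<in> C' \<Longrightarrow> Poly_Mapping.keys (d m) \<subseteq> C"
    and d_crit: "c \<in> C \<Longrightarrow> c \<in> crit \<Longrightarrow> Poly_Mapping.keys (d c) \<subseteq> crit"
    and matched_fun: "matched m u \<Longrightarrow> matched m u' \<Longrightarrow> u = u'"
    and matched_inj: "matched m u \<Longrightarrow> matched m' u \<Longrightarrow> m = m'"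
    and matched_disjoint: "matched m u \<Longrightarrow> \<not> matched u u'"
    and matched_crit: "matched m u \<Longrightarrow> u \<notin> crit"
begin

text \<open>Subtracting a multiple of the boundary of \<open>m\<close> removes \<open>u\<close> from a chain, and adds only upper
  cells and lower cells of smaller weight. So the lower cells can be removed by decreasing weight.\<close>

lemma eliminate_lower_cells:
  assumes "Poly_Mapping.keys z \<subseteq> C" "\<And>m u. u \<in> Poly_Mapping.keys z \<Longrightarrow> matched m u \<Longrightarrow> weight u < N"
  shows "\<exists>y. Poly_Mapping.keys y \<subseteq> C' \<and> (\<forall>u\<in>Poly_Mapping.keys (z - lin_ext d y). \<forall>m. \<not> matched m u)"
  using assms
proof (induction N arbitrary: z)
  case 0
  then show ?case by (intro exI[of _ 0]) auto
next
  case (Suc N)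
  define U where "U = {u \<in> Poly_Mapping.keys z. weight u = N \<and> (\<exists>m. matched m u)}"
  have finU: "finite U" unfolding U_def by simp
  have "\<forall>u\<in>U. \<exists>m\<in>C'. matched m u"
    using exhaust Suc.prems(1) matched_crit matched_disjoint unfolding U_def by blast
  then obtain m where m: "\<And>u. u \<in> U \<Longrightarrow> m u \<in> C' \<and> matched (m u) u" by metis
  then have "\<forall>u\<in>U. \<exists>e. e \<noteq> 0 \<and>
      (\<forall>l\<in>Poly_Mapping.keys (d (m u) - pm_scale e (basis_vec u)). (\<exists>u'. matched l u') \<or> weight l < weight u)"
    using incidence by blast
  then obtain e where e: "\<And>u. u \<in> U \<Longrightarrow> e u \<noteq> 0" and
    inc: "\<And>u l. u \<in> U \<Longrightarrow> l \<in> Poly_Mapping.keys (d (m u) - pm_scale (e u) (basis_vec u)) \<Longrightarrow>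
      (\<exists>u'. matched l u') \<or> weight l < weight u" by metis
  define y where "y = (\<Sum>u\<in>U. pm_scale (Poly_Mapping.lookup z u / e u) (basis_vec (m u)))"
  have y: "Poly_Mapping.keys y \<subseteq> C'"
    unfolding y_def using m
    by (auto dest!: subsetD[OF Poly_Mapping.keys_sum] subsetD[OF keys_pm_scale])
  let ?z = "z - lin_ext d y"
  have zC: "Poly_Mapping.keys ?z \<subseteq> C"
  proof
    fix c assume "c \<in> Poly_Mapping.keys ?z"
    then consider "c \<in> Poly_Mapping.keys z" | "c \<in> Poly_Mapping.keys (lin_ext d y)"
      using Poly_Mapping.keys_diff[of z "lin_ext d y"] by blast
    then show "c \<in> C" using Suc.prems(1) y d_C' by cases (auto elim!: keys_lin_extE)
  qed
  have lower: "weight l < N" if l: "l \<in> Poly_Mapping.keys ?z" "matched k l" for k l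
  proof (rule ccontr)
    assume N: "\<not> weight l < N"
    have "Poly_Mapping.lookup (d (m u)) l = (if u = l then e u else 0)" if u: "u \<in> U" for u
    proof -
      have "l \<notin> Poly_Mapping.keys (d (m u) - pm_scale (e u) (basis_vec u))"
        using inc[OF u, of l] matched_disjoint[OF l(2)] N u by (auto simp: U_def)
      then show ?thesis
        by (auto simp: in_keys_iff lookup_minus lookup_pm_scale lookup_single when_def)
    qed
    then have "Poly_Mapping.lookup (lin_ext d y) l = (\<Sum>u\<in>U. Poly_Mapping.lookup z u / e u * (if u = l then e u else 0))"
      unfolding y_def lin_ext_sum lookup_sum by (simp add: lin_ext_scale lookup_pm_scale)
    also have "\<dots> = (\<Sum>u\<in>U. if l = u then Poly_Mapping.lookup z l else 0)"
      by (rule sum.cong) (use e in auto)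
    also have "\<dots> = (if l \<in> U then Poly_Mapping.lookup z l else 0)" using finU by simp
    also have "\<dots> = Poly_Mapping.lookup z l"
    proof (cases "l \<in> Poly_Mapping.keys z")
      case True
      then have "weight l = N" using Suc.prems(2)[OF True l(2)] N by simp
      then show ?thesis using True l(2) by (auto simp: U_def)
    qed (simp add: in_keys_iff)
    finally show False using l(1) by (simp add: in_keys_iff lookup_minus)
  qed
  have "\<exists>y'. Poly_Mapping.keys y' \<subseteq> C' \<and>
      (\<forall>u\<in>Poly_Mapping.keys (?z - lin_ext d y'). \<forall>m. \<not> matched m u)"
    by (rule Suc.IH[OF zC]) (rule lower)
  then obtain y' where y': "Poly_Mapping.keys y' \<subseteq> C'"
    "\<forall>u\<in>Poly_Mapping.keys (?z - lin_ext d y'). \<forall>m. \<not> matched m u" by blast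
  have "Poly_Mapping.keys (y + y') \<subseteq> C'" using y y'(1) Poly_Mapping.keys_add[of y y'] by blast
  moreover have "\<forall>u\<in>Poly_Mapping.keys (z - lin_ext d (y + y')). \<forall>m. \<not> matched m u"
    using y'(2) by (simp only: lin_ext_add diff_diff_add)
  ultimately show ?case by blast
qed

text \<open>Among the upper cells of the chain, take one whose partner \<open>u\<close> has the largest weight. No
  other cell of the chain has \<open>u\<close> as a face, so the boundary of the chain is not zero at \<open>u\<close>.\<close>

lemma cycle_without_lower_cells:
  assumes "Poly_Mapping.keys z \<subseteq> C" "lin_ext d z = 0" "\<And>m u. u \<in> Poly_Mapping.keys z \<Longrightarrow> \<not> matched m u"
  shows "Poly_Mapping.keys z \<subseteq> crit"
proof (rule ccontr)
  assume "\<not> Poly_Mapping.keys z \<subseteq> crit"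
  define P where "P = {(m, u). m \<in> Poly_Mapping.keys z \<and> matched m u}"
  have "P \<noteq> {}" unfolding P_def using exhaust assms(1,3) \<open>\<not> Poly_Mapping.keys z \<subseteq> crit\<close> by blast
  have "P \<subseteq> (\<lambda>m. (m, SOME u. matched m u)) ` Poly_Mapping.keys z"
  proof
    fix p assume "p \<in> P"
    then obtain m u where p: "p = (m, u)" "m \<in> Poly_Mapping.keys z" "matched m u" unfolding P_def by blast
    then have "(SOME u. matched m u) = u" by (metis matched_fun someI)
    then show "p \<in> (\<lambda>m. (m, SOME u. matched m u)) ` Poly_Mapping.keys z" using p by blast
  qed
  then have finP: "finite P" by (rule finite_subset) simp
  obtain m u where mu: "(m, u) \<in> P" and max: "\<And>m' u'. (m', u') \<in> P \<Longrightarrow> weight u' \<le> weight u"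
  proof -
    let ?W = "(\<lambda>p. weight (snd p)) ` P"
    have "Max ?W \<in> ?W" using finP \<open>P \<noteq> {}\<close> by (intro Max_in) auto
    then obtain m u where "(m, u) \<in> P" "weight u = Max ?W" by force
    moreover have "weight u' \<le> Max ?W" if "(m', u') \<in> P" for m' u'
      using that finP by (intro Max_ge) force+
    ultimately show thesis using that by metis
  qed
  have m: "m \<in> Poly_Mapping.keys z" "matched m u" using mu by (auto simp: P_def)
  have other: "Poly_Mapping.lookup (d c) u = 0" if c: "c \<in> Poly_Mapping.keys z" "c \<noteq> m" for c
  proof (cases "c \<in> crit")
    case True
    then show ?thesis using d_crit[of c] matched_crit[OF m(2)] subsetD[OF assms(1) c(1)] by (auto simp: in_keys_iff)
  next
    case False
    then obtain u' where u': "matched c u'" using exhaust[of c] assms(1,3) c(1) by blast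
    then have "weight u' \<le> weight u" using max[of c u'] c(1) by (simp add: P_def)
    obtain e where "\<forall>l\<in>Poly_Mapping.keys (d c - pm_scale e (basis_vec u')). (\<exists>u'. matched l u') \<or> weight l < weight u'"
      using incidence[OF _ u'] c(1) assms(1) by blast
    then have "u \<notin> Poly_Mapping.keys (d c - pm_scale e (basis_vec u'))"
      using matched_disjoint[OF m(2)] \<open>weight u' \<le> weight u\<close> by force
    moreover have "u' \<noteq> u" using matched_inj m(2) u' c(2) by blast
    ultimately show ?thesis
      by (simp add: in_keys_iff lookup_minus lookup_pm_scale lookup_single)
  qed
  obtain e where e: "e \<noteq> 0"
    "\<forall>l\<in>Poly_Mapping.keys (d m - pm_scale e (basis_vec u)). (\<exists>u'. matched l u') \<or> weight l < weight u"
    using incidence[OF _ m(2)] m(1) assms(1) by blast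
  then have "u \<notin> Poly_Mapping.keys (d m - pm_scale e (basis_vec u))" using matched_disjoint[OF m(2)] by force
  then have "Poly_Mapping.lookup (d m) u = e"
    by (simp add: in_keys_iff lookup_minus lookup_pm_scale)
  moreover have "Poly_Mapping.lookup (lin_ext d z) u =
      (\<Sum>c\<in>Poly_Mapping.keys z. if c = m then Poly_Mapping.lookup z m * Poly_Mapping.lookup (d m) u else 0)"
    unfolding lin_ext_def lookup_sum lookup_pm_scale by (rule sum.cong) (use other in auto)
  ultimately have "Poly_Mapping.lookup z m * e = 0" using m(1) assms(2) by simp
  then show False using m(1) e(1) by (simp add: in_keys_iff)
qed

theorem cycle_homologous_to_critical:
  assumes dd: "\<And>c. c \<in> C' \<Longrightarrow> lin_ext d (d c) = 0"
    and z: "Poly_Mapping.keys z \<subseteq> C" "lin_ext d z = 0"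
  shows "\<exists>y. Poly_Mapping.keys y \<subseteq> C' \<and> Poly_Mapping.keys (z - lin_ext d y) \<subseteq> crit"
proof -
  have "\<And>m u. u \<in> Poly_Mapping.keys z \<Longrightarrow> matched m u \<Longrightarrow> weight u < Suc (Max (weight ` Poly_Mapping.keys z))"
    by (simp add: less_Suc_eq_le)
  then obtain y where y: "Poly_Mapping.keys y \<subseteq> C'"
    "\<forall>u\<in>Poly_Mapping.keys (z - lin_ext d y). \<forall>m. \<not> matched m u"
    using eliminate_lower_cells[OF z(1), of "Suc (Max (weight ` Poly_Mapping.keys z))"] by blast
  have ddy: "lin_ext d (lin_ext d y) = 0"
  proof -
    have "lin_ext d (lin_ext d y) = lin_ext (\<lambda>_. 0) y"
      unfolding lin_ext_lin_ext by (rule lin_ext_cong[OF refl]) (use dd y(1) in auto)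
    then show ?thesis by simp
  qed
  have "Poly_Mapping.keys (lin_ext d y) \<subseteq> C" using y(1) d_C' by (auto elim!: keys_lin_extE)
  then have "Poly_Mapping.keys (z - lin_ext d y) \<subseteq> C"
    using z(1) Poly_Mapping.keys_diff[of z "lin_ext d y"] by blast
  with cycle_without_lower_cells[of "z - lin_ext d y"] have "Poly_Mapping.keys (z - lin_ext d y) \<subseteq> crit"
    using y(2) z(2) ddy by (simp add: lin_ext_diff)
  then show ?thesis using y(1) by blast
qed

end

section \<open>Products of labelled cubes\<close>

text \<open>Since the labels of \<open>X\<close> precede those of \<open>Y\<close>, the directions of a product cube are the union of
  the directions of its factors, in the order which the tensor product of precubical sets uses.\<close>

locale tensor_cubes =
  X: split_cubes Q1 dirs1 lo1 hi1 + Y: split_cubes Q2 dirs2 lo2 hi2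
  for Q1 :: "'a set" and dirs1 lo1 hi1 and Q2 :: "'b set" and dirs2 lo2 hi2 +
  assumes dirs_less: "\<And>a b i j. a \<in> Q1 \<Longrightarrow> b \<in> Q2 \<Longrightarrow> i \<in> dirs1 a \<Longrightarrow> j \<in> dirs2 b \<Longrightarrow> i < j"
begin

definition tdirs :: "'a \<times> 'b \<Rightarrow> nat set" where
  "tdirs = (\<lambda>(a, b). dirs1 a \<union> dirs2 b)"

definition tlo :: "nat set \<Rightarrow> 'a \<times> 'b \<Rightarrow> 'a \<times> 'b" where
  "tlo I = (\<lambda>(a, b). (lo1 (I \<inter> dirs1 a) a, lo2 (I \<inter> dirs2 b) b))"

definition thi :: "nat set \<Rightarrow> 'a \<times> 'b \<Rightarrow> 'a \<times> 'b" where
  "thi I = (\<lambda>(a, b). (hi1 (I \<inter> dirs1 a) a, hi2 (I \<inter> dirs2 b) b))"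

lemma tdirs_pair: "tdirs (a, b) = dirs1 a \<union> dirs2 b"
  and tlo_pair: "tlo I (a, b) = (lo1 (I \<inter> dirs1 a) a, lo2 (I \<inter> dirs2 b) b)"
  and thi_pair: "thi I (a, b) = (hi1 (I \<inter> dirs1 a) a, hi2 (I \<inter> dirs2 b) b)"
  by (simp_all add: tdirs_def tlo_def thi_def)

lemma dirs_disjoint: "a \<in> Q1 \<Longrightarrow> b \<in> Q2 \<Longrightarrow> dirs1 a \<inter> dirs2 b = {}"
  using dirs_less by fastforce

sublocale T: split_cubes "Q1 \<times> Q2" tdirs tlo thi
proof (unfold_locales, goal_cases)
  case (1 c)
  then show ?case by (auto simp: tdirs_pair X.finite_dirs Y.finite_dirs)
next
  case (2 c I)
  then show ?case by (auto simp: tlo_pair X.lo_in Y.lo_in)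
next
  case (3 c I)
  then show ?case by (auto simp: tlo_pair tdirs_pair X.dirs_lo Y.dirs_lo)
next
  case (4 c I)
  then show ?case by (auto simp: thi_pair X.hi_in Y.hi_in)
next
  case (5 c I)
  then show ?case using dirs_disjoint by (fastforce simp: thi_pair tdirs_pair X.dirs_hi Y.dirs_hi)
next
  case (6 c A I)
  obtain a b where c: "c = (a, b)" by fastforce
  have "A \<inter> (I \<inter> dirs1 a) = A \<inter> dirs1 a" "A \<inter> (I \<inter> dirs2 b) = A \<inter> dirs2 b" using 6 by auto
  moreover have "A \<inter> dirs1 a \<subseteq> I \<inter> dirs1 a" "A \<inter> dirs2 b \<subseteq> I \<inter> dirs2 b" using 6 by auto
  ultimately show ?case using 6 by (simp add: c tlo_pair X.dirs_lo Y.dirs_lo X.lo_lo Y.lo_lo)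
next
  case (7 c A B)
  obtain a b where c: "c = (a, b)" by fastforce
  have "B \<inter> (dirs1 a - A \<inter> dirs1 a) = B \<inter> dirs1 a" "B \<inter> (dirs2 b - A \<inter> dirs2 b) = B \<inter> dirs2 b"
    using 7 by auto
  moreover have "(A \<inter> dirs1 a) \<inter> (B \<inter> dirs1 a) = {}" "(A \<inter> dirs2 b) \<inter> (B \<inter> dirs2 b) = {}" using 7 by auto
  ultimately show ?case using 7
    by (simp add: c thi_pair X.dirs_hi Y.dirs_hi X.hi_hi Y.hi_hi Int_Un_distrib2)
next
  case (8 c A B)
  obtain a b where c: "c = (a, b)" by fastforce
  have "B \<inter> (dirs1 a - A \<inter> dirs1 a) = B \<inter> dirs1 a" "B \<inter> (dirs2 b - A \<inter> dirs2 b) = B \<inter> dirs2 b"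
    using 8 by auto
  moreover have "(A \<inter> dirs1 a) \<inter> (B \<inter> dirs1 a) = {}" "(A \<inter> dirs2 b) \<inter> (B \<inter> dirs2 b) = {}" using 8 by auto
  moreover have "A \<inter> ((A \<union> B) \<inter> dirs1 a) = A \<inter> dirs1 a" "A \<inter> ((A \<union> B) \<inter> dirs2 b) = A \<inter> dirs2 b" by auto
  ultimately show ?case using 8
    by (simp add: c thi_pair tlo_pair X.dirs_hi Y.dirs_hi X.dirs_lo Y.dirs_lo X.lo_hi Y.lo_hi Int_Un_distrib2[symmetric])
next
  case (9 c)
  then show ?case using X.lo_dirs Y.lo_dirs
    by (auto simp: tlo_pair tdirs_pair Int_absorb1)
next
  case (10 c)
  then show ?case by (auto simp: thi_pair X.hi_empty Y.hi_empty)
qed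

lemma cube_deg_pure:
  "dirs2 b = {} \<Longrightarrow> T.cube_deg (a, b) = X.cube_deg a"
  "dirs1 a = {} \<Longrightarrow> T.cube_deg (a, b) = Y.cube_deg b"
  by (simp_all add: T.cube_deg_def X.cube_deg_def Y.cube_deg_def tdirs_pair)

lemma bd1_pure_left:
  assumes "a \<in> Q1" "b \<in> Q2" "dirs2 b = {}"
  shows "T.bd1 (a, b) = pm_map (map (\<lambda>x. (x, b))) (X.bd1 a)"
proof -
  have "lo2 {} b = b" "hi2 {} b = b" using Y.lo_dirs[of b] Y.hi_empty[of b] assms by auto
  then have *: "T.splits (a, b) = X.splits a" "T.split_sign (a, b) = X.split_sign a"
    "I \<in> X.splits a \<Longrightarrow> tlo I (a, b) = (lo1 I a, b)" "I \<in> X.splits a \<Longrightarrow> thi I (a, b) = (hi1 I a, b)" for I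
    using assms by (auto simp: T.splits_def X.splits_def T.split_sign_def X.split_sign_def tdirs_pair
        tlo_pair thi_pair fun_eq_iff Int_absorb2)
  show ?thesis unfolding T.bd1_def X.bd1_def pm_map_sum pm_map_scale
    by (auto intro!: sum.cong simp: *)
qed

lemma bd1_pure_right:
  assumes "a \<in> Q1" "b \<in> Q2" "dirs1 a = {}"
  shows "T.bd1 (a, b) = pm_map (map (Pair a)) (Y.bd1 b)"
proof -
  have "lo1 {} a = a" "hi1 {} a = a" using X.lo_dirs[of a] X.hi_empty[of a] assms by auto
  then have *: "T.splits (a, b) = Y.splits b" "T.split_sign (a, b) = Y.split_sign b"
    "I \<in> Y.splits b \<Longrightarrow> tlo I (a, b) = (a, lo2 I b)" "I \<in> Y.splits b \<Longrightarrow> thi I (a, b) = (a, hi2 I b)" for I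
    using assms by (auto simp: T.splits_def Y.splits_def T.split_sign_def Y.split_sign_def tdirs_pair
        tlo_pair thi_pair fun_eq_iff Int_absorb2)
  show ?thesis unfolding T.bd1_def Y.bd1_def pm_map_sum pm_map_scale
    by (auto intro!: sum.cong simp: *)
qed

lemma bd_pure_left:
  assumes "set l \<subseteq> Q1" "b \<in> Q2" "dirs2 b = {}"
  shows "T.bd (map (\<lambda>x. (x, b)) l) = pm_map (map (\<lambda>x. (x, b))) (X.bd l)"
  using assms by (induction l) (simp_all add: bd1_pure_left cube_deg_pure pm_map_add pm_map_scale pm_map_pm_map)

lemma bd_pure_right:
  assumes "set l \<subseteq> Q2" "a \<in> Q1" "dirs1 a = {}"
  shows "T.bd (map (Pair a) l) = pm_map (map (Pair a)) (Y.bd l)"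
  using assms by (induction l) (simp_all add: bd1_pure_right cube_deg_pure pm_map_add pm_map_scale pm_map_pm_map)

lemma deg_pure_left: "dirs2 b = {} \<Longrightarrow> T.deg (map (\<lambda>x. (x, b)) l) = X.deg l"
  by (induction l) (simp_all add: cube_deg_pure)

lemma deg_pure_right: "dirs1 a = {} \<Longrightarrow> T.deg (map (Pair a) l) = Y.deg l"
  by (induction l) (simp_all add: cube_deg_pure)

subsection \<open>The projection to the tensor product of the chain complexes\<close>

text \<open>The sign is that of moving the cube \<open>b\<close> past the chain \<open>A\<close> in the tensor product of complexes.\<close>

definition addY :: "'b \<Rightarrow> 'a list \<times> 'b list \<Rightarrow> ('a list \<times> 'b list \<Rightarrow>\<^sub>0 'r::field)" where
  "addY b = (\<lambda>(A, B). pm_scale ((- 1) ^ (Y.cube_deg b * X.deg A)) (basis_vec (A, b # B)))"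

text \<open>The chain of \<open>X\<close> and the chain of \<open>Y\<close> of which the given chain is a shuffle. A mixed cube has
  degree one more than the sum of the degrees of its factors, so chains with a mixed cube have no
  image of the right degree of this form, and are sent to zero.\<close>

fun unshuffle :: "('a \<times> 'b) list \<Rightarrow> ('a list \<times> 'b list \<Rightarrow>\<^sub>0 'r::field)" where
  "unshuffle [] = basis_vec ([], [])"
| "unshuffle (c # cs) = (if dirs2 (snd c) = {} then pm_map (\<lambda>(A, B). (fst c # A, B)) (unshuffle cs)
     else if dirs1 (fst c) = {} then lin_ext (addY (snd c)) (unshuffle cs) else 0)"

definition tensor_bd :: "'a list \<times> 'b list \<Rightarrow> ('a list \<times> 'b list \<Rightarrow>\<^sub>0 'r::field)" where
  "tensor_bd = (\<lambda>(A, B). pm_map (\<lambda>l. (l, B)) (X.bd A) + pm_scale ((- 1) ^ X.deg A) (pm_map (Pair A) (Y.bd B)))"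

abbreviation "T_good \<equiv> {c \<in> Q1 \<times> Q2. tdirs c \<noteq> {}}"

lemma keys_unshuffle:
  assumes "set cs \<subseteq> T_good" "(A, B) \<in> Poly_Mapping.keys (unshuffle cs :: _ \<Rightarrow>\<^sub>0 'r::field)"
  shows "set A \<subseteq> {a \<in> Q1. dirs1 a \<noteq> {}} \<and> set B \<subseteq> {b \<in> Q2. dirs2 b \<noteq> {}} \<and>
    X.deg A + Y.deg B = T.deg cs"
  using assms
proof (induction cs arbitrary: A B)
  case (Cons c cs)
  obtain a b where c: "c = (a, b)" by fastforce
  consider "dirs2 b = {}" | "dirs2 b \<noteq> {}" "dirs1 a = {}" | "dirs2 b \<noteq> {}" "dirs1 a \<noteq> {}" by blast
  then show ?case
  proof cases
    case 1
    then obtain A' where "(A', B) \<in> Poly_Mapping.keys (unshuffle cs :: _ \<Rightarrow>\<^sub>0 'r)" "A = a # A'"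
      using Cons.prems(2) by (auto simp: c dest!: subsetD[OF keys_pm_map])
    then show ?thesis using Cons.IH[of A' B] Cons.prems(1) 1
      by (auto simp: c cube_deg_pure tdirs_pair)
  next
    case 2
    then have "\<exists>B'. (A, B') \<in> Poly_Mapping.keys (unshuffle cs :: _ \<Rightarrow>\<^sub>0 'r) \<and> B = b # B'"
      using Cons.prems(2)
      by (auto simp: c addY_def elim!: keys_lin_extE dest!: subsetD[OF keys_pm_scale])
    then obtain B' where "(A, B') \<in> Poly_Mapping.keys (unshuffle cs :: _ \<Rightarrow>\<^sub>0 'r)" "B = b # B'" by blast
    then show ?thesis using Cons.IH[of A B'] Cons.prems(1) 2
      by (auto simp: c cube_deg_pure tdirs_pair)
  next
    case 3
    then show ?thesis using Cons.prems(2) by (simp add: c)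
  qed
qed simp

lemma keys_unshuffle_lchain:
  assumes "T.lchain v cs w" "(A, B) \<in> Poly_Mapping.keys (unshuffle cs :: _ \<Rightarrow>\<^sub>0 'r::field)"
  shows "X.lchain (fst v) A (fst w) \<and> Y.lchain (snd v) B (snd w)"
  using assms
proof (induction cs arbitrary: v A B)
  case Nil
  then show ?case by (auto simp: tdirs_pair)
next
  case (Cons c cs)
  obtain a b where c: "c = (a, b)" by fastforce
  have ab: "a \<in> Q1" "b \<in> Q2" using Cons.prems(1) by (auto simp: c)
  have v: "v = (lo1 {} a, lo2 {} b)" "T.lchain (thi (tdirs c) c) cs w"
    using Cons.prems(1) by (auto simp: c tlo_pair)
  have thi: "thi (tdirs c) c = (hi1 (dirs1 a) a, hi2 (dirs2 b) b)"
    by (simp add: c thi_pair tdirs_pair Int_absorb1)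
  consider "dirs2 b = {}" | "dirs2 b \<noteq> {}" "dirs1 a = {}" | "dirs2 b \<noteq> {}" "dirs1 a \<noteq> {}" by blast
  then show ?case
  proof cases
    case 1
    then obtain A' where "(A', B) \<in> Poly_Mapping.keys (unshuffle cs :: _ \<Rightarrow>\<^sub>0 'r)" "A = a # A'"
      using Cons.prems(2) by (auto simp: c dest!: subsetD[OF keys_pm_map])
    moreover have "dirs1 a \<noteq> {}" using Cons.prems(1) 1 by (auto simp: c tdirs_pair)
    moreover have "hi2 {} b = b" "lo2 {} b = b" using 1 Y.lo_dirs[of b] Y.hi_empty[of b] ab by auto
    ultimately show ?thesis using Cons.IH[OF v(2), of A' B] ab 1 by (simp add: thi v(1))
  next
    case 2
    then have "\<exists>B'. (A, B') \<in> Poly_Mapping.keys (unshuffle cs :: _ \<Rightarrow>\<^sub>0 'r) \<and> B = b # B'"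
      using Cons.prems(2)
      by (auto simp: c addY_def elim!: keys_lin_extE dest!: subsetD[OF keys_pm_scale])
    then obtain B' where "(A, B') \<in> Poly_Mapping.keys (unshuffle cs :: _ \<Rightarrow>\<^sub>0 'r)" "B = b # B'" by blast
    moreover have "hi1 {} a = a" "lo1 {} a = a" using 2 X.lo_dirs[of a] X.hi_empty[of a] ab by auto
    ultimately show ?thesis using Cons.IH[OF v(2), of A B'] ab 2 by (simp add: thi v(1))
  next
    case 3
    then show ?thesis using Cons.prems(2) by (simp add: c)
  qed
qed

lemma unshuffle_append_left:
  assumes "dirs2 b = {}"
  shows "unshuffle (map (\<lambda>x. (x, b)) l @ cs) = pm_map (\<lambda>(A, B). (l @ A, B)) (unshuffle cs)"
  using assms by (induction l) (simp_all add: pm_map_pm_map case_prod_unfold)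

lemma lin_ext_addY_pm_map:
  "lin_ext (addY b) (pm_map (\<lambda>(A, B). (l @ A, B)) w) =
    pm_scale ((- 1) ^ (Y.cube_deg b * X.deg l)) (pm_map (\<lambda>(A, B). (l @ A, B)) (lin_ext (addY b) w))"
proof -
  have "lin_ext (addY b) (pm_map (\<lambda>(A, B). (l @ A, B)) w) = lin_ext (\<lambda>p. pm_scale ((- 1) ^ (Y.cube_deg b * X.deg l))
      (pm_map (\<lambda>(A, B). (l @ A, B)) (addY b p))) w"
    unfolding lin_ext_pm_map
    by (rule lin_ext_cong) (auto simp: addY_def pm_map_scale power_add distrib_left)
  then show ?thesis by (simp add: lin_ext_fun_scale pm_map_lin_ext)
qed

text \<open>The two splits of a mixed cube into pure cubes have the same image up to sign, and the signs
  are opposite; every other split still contains a mixed cube. This makes the projection a chain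
  map although it is zero on mixed cubes.\<close>

lemma unshuffle_splits_mixed:
  assumes ab: "a \<in> Q1" "b \<in> Q2" "dirs1 a \<noteq> {}" "dirs2 b \<noteq> {}"
  shows "lin_ext (\<lambda>l. unshuffle (l @ cs)) (T.bd1 (a, b)) = (0 :: _ \<Rightarrow>\<^sub>0 'r::field)"
proof -
  let ?c = "(a, b)" and ?D = "dirs1 a" and ?E = "dirs2 b"
  let ?f = "\<lambda>I. pm_scale (T.split_sign ?c I) (unshuffle ([tlo I ?c, thi I ?c] @ cs)) :: _ \<Rightarrow>\<^sub>0 'r"
  have disj: "?D \<inter> ?E = {}" using dirs_disjoint ab by blast
  then have disj': "?E \<inter> ?D = {}" by (simp add: Int_commute)
  have less: "i < j" if "i \<in> ?D" "j \<in> ?E" for i j using dirs_less[OF ab(1,2) that] .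
  have fin: "finite ?D" "finite ?E" using X.finite_dirs Y.finite_dirs ab by auto
  have lo0: "lo1 ?D a = a" "lo2 ?E b = b" "hi1 {} a = a" "hi2 {} b = b"
    using ab X.lo_dirs Y.lo_dirs X.hi_empty Y.hi_empty by auto
  have c: "?c \<in> Q1 \<times> Q2" using ab by simp
  have "lin_ext (\<lambda>l. unshuffle (l @ cs)) (T.bd1 ?c) = (\<Sum>I\<in>T.splits ?c. ?f I)"
    unfolding T.bd1_def lin_ext_sum lin_ext_scale lin_ext_basis ..
  also have "\<dots> = (\<Sum>I\<in>{?D, ?E}. ?f I)"
  proof (rule sum.mono_neutral_right)
    show "finite (T.splits ?c)" using T.finite_splits[OF c] .
    show "{?D, ?E} \<subseteq> T.splits ?c" using ab disj by (auto simp: T.splits_def tdirs_pair)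
    show "\<forall>I\<in>T.splits ?c - {?D, ?E}. ?f I = 0"
    proof
      fix I assume I: "I \<in> T.splits ?c - {?D, ?E}"
      have d: "dirs1 (fst (tlo I ?c)) = I \<inter> ?D" "dirs2 (snd (tlo I ?c)) = I \<inter> ?E"
        "dirs1 (fst (thi I ?c)) = ?D - I" "dirs2 (snd (thi I ?c)) = ?E - I"
        using X.dirs_lo[OF ab(1), of "I \<inter> ?D"] X.dirs_hi[OF ab(1), of "I \<inter> ?D"]
          Y.dirs_lo[OF ab(2), of "I \<inter> ?E"] Y.dirs_hi[OF ab(2), of "I \<inter> ?E"]
        by (simp_all add: tlo_pair thi_pair Diff_Int)
      have "(I \<inter> ?D \<noteq> {} \<and> I \<inter> ?E \<noteq> {}) \<or> (?D - I \<noteq> {} \<and> ?E - I \<noteq> {})"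
      proof (rule ccontr)
        assume "\<not> ?thesis"
        then have *: "I \<inter> ?D = {} \<or> I \<inter> ?E = {}" "?D - I = {} \<or> ?E - I = {}" by simp_all
        have I': "I \<subseteq> ?D \<union> ?E" "I \<noteq> ?D" "I \<noteq> ?E"
          using I unfolding T.splits_def tdirs_pair by (simp_all add: psubset_eq)
        from *(1) show False
        proof
          assume 1: "I \<inter> ?D = {}"
          have "?D - I = ?D" using 1 by blast
          then have "\<not> ?D - I = {}" using ab(3) by simp
          then have "?E \<subseteq> I" using *(2) by simp
          moreover have "I \<subseteq> ?E" using 1 I'(1) by blast
          ultimately show False using I'(3) by simp
        next
          assume 1: "I \<inter> ?E = {}"
          have "?E - I = ?E" using 1 by blast
          then have "\<not> ?E - I = {}" using ab(4) by simp
          then have "?D \<subseteq> I" using *(2) by simp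
          moreover have "I \<subseteq> ?D" using 1 I'(1) by blast
          ultimately show False using I'(2) by simp
        qed
      qed
      then have "unshuffle ([tlo I ?c, thi I ?c] @ cs) = (0 :: _ \<Rightarrow>\<^sub>0 'r)"
        using d by (elim disjE) simp_all
      then show "?f I = 0" by simp
    qed
  qed
  also have "\<dots> = ?f ?D + ?f ?E"
  proof -
    have "?D \<noteq> ?E" using disj ab(3) by auto
    then show ?thesis by simp
  qed
  also have "\<dots> = 0"
  proof -
    let ?w = "pm_map (\<lambda>(A, B). (a # A, B)) (lin_ext (addY b) (unshuffle cs)) :: _ \<Rightarrow>\<^sub>0 'r"
    have 1: "tlo ?D ?c = (a, lo2 {} b)" "thi ?D ?c = (hi1 ?D a, b)"
      "tlo ?E ?c = (lo1 {} a, b)" "thi ?E ?c = (a, hi2 ?E b)"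
      using disj disj' lo0 by (simp_all add: tlo_pair thi_pair)
    have 2: "dirs2 (lo2 {} b) = {}" "dirs1 (hi1 ?D a) = {}" "dirs1 (lo1 {} a) = {}" "dirs2 (hi2 ?E b) = {}"
      using ab(1,2) by (simp_all add: X.dirs_lo Y.dirs_lo X.dirs_hi Y.dirs_hi)
    have "unshuffle ([tlo ?D ?c, thi ?D ?c] @ cs) = ?w" using ab by (simp add: 1 2)
    moreover have "unshuffle ([tlo ?E ?c, thi ?E ?c] @ cs) = pm_scale ((- 1) ^ (Y.cube_deg b * X.cube_deg a)) ?w"
      using ab lin_ext_addY_pm_map[of b "[a]" "unshuffle cs"] by (simp add: 1 2)
    moreover have "T.split_sign ?c ?D = (- 1 :: 'r) ^ card ?D"
    proof -
      have "{(i, j). i \<in> ?D \<and> j \<in> ?D \<union> ?E - ?D \<and> j < i} = {}" using less by (auto dest: less_asym)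
      then have "inv_count ?D (?D \<union> ?E - ?D) = 0" unfolding inv_count_def by (simp only: card.empty)
      then show ?thesis unfolding T.split_sign_def tdirs_pair by (simp only: add_0_right)
    qed
    moreover have "T.split_sign ?c ?E = (- 1 :: 'r) ^ (card ?E + card ?E * card ?D)"
    proof -
      have "{(i, j). i \<in> ?E \<and> j \<in> ?D \<union> ?E - ?E \<and> j < i} = ?E \<times> ?D"
        using less disj' by blast
      then have "inv_count ?E (?D \<union> ?E - ?E) = card ?E * card ?D"
        unfolding inv_count_def by (simp only: card_cartesian_product)
      then show ?thesis unfolding T.split_sign_def tdirs_pair by (simp only:)
    qed
    moreover have "(- 1 :: 'r) ^ (card ?E + card ?E * card ?D) * (- 1) ^ (Y.cube_deg b * X.cube_deg a) =
        - ((- 1) ^ card ?D)"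
    proof -
      obtain m n where mn: "card ?D = Suc m" "card ?E = Suc n"
        using fin ab by (metis card_gt_0_iff gr0_implies_Suc)
      have "Suc n + Suc n * Suc m + n * m = 2 * (n * m + n + 1) + m" by simp
      then show ?thesis unfolding X.cube_deg_def Y.cube_deg_def mn power_add[symmetric]
        by (simp add: minus_one_power_iff)
    qed
    ultimately show ?thesis by simp
  qed
  finally show ?thesis .
qed

text \<open>Induction on the chain. If the first cube belongs to \<open>X\<close> or to \<open>Y\<close>, the Leibniz rules on both
  sides correspond term by term; if it is mixed, both sides are zero.\<close>

theorem unshuffle_chain_map:
  assumes "set cs \<subseteq> T_good"
  shows "lin_ext unshuffle (T.bd cs) = (lin_ext tensor_bd (unshuffle cs) :: _ \<Rightarrow>\<^sub>0 'r::field)"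
  using assms
proof (induction cs)
  case Nil
  then show ?case by (simp add: tensor_bd_def)
next
  case (Cons c cs)
  obtain a b where c: "c = (a, b)" by fastforce
  have ab: "a \<in> Q1" "b \<in> Q2" "dirs1 a \<noteq> {} \<or> dirs2 b \<noteq> {}" using Cons.prems by (auto simp: c tdirs_pair)
  have IH: "lin_ext unshuffle (T.bd cs) = (lin_ext tensor_bd (unshuffle cs) :: _ \<Rightarrow>\<^sub>0 'r)" using Cons by simp
  have good: "set cs \<subseteq> T_good" using Cons.prems by simp
  let ?w = "unshuffle cs :: _ \<Rightarrow>\<^sub>0 'r"
  have lhs: "lin_ext unshuffle (T.bd (c # cs)) = lin_ext (\<lambda>l. unshuffle (l @ cs)) (T.bd1 c) +
      pm_scale ((- 1) ^ T.cube_deg c) (lin_ext (\<lambda>l. unshuffle (c # l)) (T.bd cs) :: _ \<Rightarrow>\<^sub>0 'r)"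
    by (simp add: lin_ext_add lin_ext_scale lin_ext_pm_map)
  consider "dirs2 b = {}" | "dirs2 b \<noteq> {}" "dirs1 a = {}" | "dirs2 b \<noteq> {}" "dirs1 a \<noteq> {}" by blast
  then show ?case
  proof cases
    case 1
    have "lin_ext (\<lambda>l. unshuffle (l @ cs)) (T.bd1 c) =
        (lin_ext (\<lambda>l. pm_map (\<lambda>(A, B). (l @ A, B)) ?w) (X.bd1 a) :: _ \<Rightarrow>\<^sub>0 'r)"
      unfolding c bd1_pure_left[OF ab(1,2) 1] lin_ext_pm_map unshuffle_append_left[OF 1] ..
    also have "\<dots> = lin_ext (\<lambda>p. pm_map (\<lambda>l. (l @ fst p, snd p)) (X.bd1 a)) ?w"
      unfolding pm_map_def by (subst lin_ext_swap) (simp add: case_prod_beta)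
    finally have s1: "lin_ext (\<lambda>l. unshuffle (l @ cs)) (T.bd1 c) =
        (lin_ext (\<lambda>p. pm_map (\<lambda>l. (l @ fst p, snd p)) (X.bd1 a)) ?w :: _ \<Rightarrow>\<^sub>0 'r)" .
    have s2: "lin_ext (\<lambda>l. unshuffle (c # l)) (T.bd cs) =
        (lin_ext (\<lambda>p. pm_map (\<lambda>(A, B). (a # A, B)) (tensor_bd p)) ?w :: _ \<Rightarrow>\<^sub>0 'r)"
      using 1 by (simp add: c pm_map_lin_ext[symmetric] IH)
    have "lin_ext tensor_bd (unshuffle (c # cs)) = (lin_ext (\<lambda>p. tensor_bd (a # fst p, snd p)) ?w :: _ \<Rightarrow>\<^sub>0 'r)"
      using 1 by (simp add: c lin_ext_pm_map case_prod_beta)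
    also have "\<dots> = lin_ext (\<lambda>p. pm_map (\<lambda>l. (l @ fst p, snd p)) (X.bd1 a) +
        pm_scale ((- 1) ^ T.cube_deg c) (pm_map (\<lambda>(A, B). (a # A, B)) (tensor_bd p))) ?w"
      by (rule lin_ext_cong[OF refl])
        (auto simp: tensor_bd_def c cube_deg_pure(1)[OF 1] pm_map_add pm_map_scale pm_map_pm_map
          pm.scale_right_distrib power_add)
    finally show ?thesis unfolding lhs s1 s2 lin_ext_fun_add lin_ext_fun_scale ..
  next
    case 2
    note e = cube_deg_pure(2)[OF 2(2)]
    have s1: "lin_ext (\<lambda>l. unshuffle (l @ cs)) (T.bd1 c) =
        (lin_ext (\<lambda>p. pm_scale ((- 1) ^ ((Y.cube_deg b - 1) * X.deg (fst p)))
          (pm_map (\<lambda>l. (fst p, l @ snd p)) (Y.bd1 b))) ?w :: _ \<Rightarrow>\<^sub>0 'r)"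
    proof -
      have "lin_ext (\<lambda>l. unshuffle (l @ cs)) (T.bd1 c) = (lin_ext (\<lambda>l. unshuffle (map (Pair a) l @ cs)) (Y.bd1 b) :: _ \<Rightarrow>\<^sub>0 'r)"
        unfolding c bd1_pure_right[OF ab(1,2) 2(2)] lin_ext_pm_map ..
      also have "\<dots> = lin_ext (\<lambda>l. lin_ext (\<lambda>p. pm_scale ((- 1) ^ ((Y.cube_deg b - 1) * X.deg (fst p)))
          (basis_vec (fst p, l @ snd p))) ?w) (Y.bd1 b)"
      proof (rule lin_ext_cong[OF refl])
        fix l assume l: "l \<in> Poly_Mapping.keys (Y.bd1 b :: _ \<Rightarrow>\<^sub>0 'r)"
        obtain I where I: "I \<in> Y.splits b" "l = [lo2 I b, hi2 I b]" using Y.keys_bd1[OF ab(2) l] by blast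
        then have ne: "dirs2 (lo2 I b) \<noteq> {}" "dirs2 (hi2 I b) \<noteq> {}"
          using ab(2) by (auto simp: Y.splits_def Y.dirs_lo Y.dirs_hi)
        have "Y.cube_deg (lo2 I b) + Y.cube_deg (hi2 I b) = Y.cube_deg b - 1"
          using Y.keys_bd1_deg(1)[OF ab(2) l] by (simp add: I(2))
        then have "lin_ext (addY (lo2 I b)) (addY (hi2 I b) p) = pm_scale ((- 1) ^ ((Y.cube_deg b - 1) * X.deg (fst p)))
            (basis_vec (fst p, l @ snd p) :: _ \<Rightarrow>\<^sub>0 'r)" for p
          by (simp add: addY_def case_prod_beta lin_ext_scale I(2) power_add[symmetric]
              distrib_right[symmetric] add.commute)
        then show "unshuffle (map (Pair a) l @ cs) = lin_ext (\<lambda>p. pm_scale ((- 1) ^ ((Y.cube_deg b - 1) * X.deg (fst p)))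
          (basis_vec (fst p, l @ snd p))) ?w"
          using 2 ne by (simp add: I(2) lin_ext_lin_ext)
      qed
      finally show ?thesis unfolding pm_map_def
        by (subst (asm) lin_ext_swap) (simp add: lin_ext_fun_scale)
    qed
    have s2: "lin_ext (\<lambda>l. unshuffle (c # l)) (T.bd cs) = (lin_ext (\<lambda>p. lin_ext (addY b) (tensor_bd p)) ?w :: _ \<Rightarrow>\<^sub>0 'r)"
      using 2 by (simp add: c lin_ext_lin_ext[symmetric] IH)
    have "lin_ext tensor_bd (unshuffle (c # cs)) = (lin_ext (\<lambda>p. lin_ext tensor_bd (addY b p)) ?w :: _ \<Rightarrow>\<^sub>0 'r)"
      using 2 by (simp add: c lin_ext_lin_ext)
    also have "\<dots> = lin_ext (\<lambda>p. pm_scale ((- 1) ^ ((Y.cube_deg b - 1) * X.deg (fst p)))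
          (pm_map (\<lambda>l. (fst p, l @ snd p)) (Y.bd1 b)) +
        pm_scale ((- 1) ^ T.cube_deg c) (lin_ext (addY b) (tensor_bd p))) ?w"
    proof (rule lin_ext_cong[OF refl])
      fix p assume p: "p \<in> Poly_Mapping.keys ?w"
      obtain A B where AB: "p = (A, B)" by fastforce
      let ?e = "Y.cube_deg b" and ?m = "X.deg A"
      have A: "set A \<subseteq> {a \<in> Q1. dirs1 a \<noteq> {}}" using keys_unshuffle[OF good] p AB by blast
      have L: "lin_ext tensor_bd (addY b p) = pm_scale ((- 1) ^ (?e * ?m)) (pm_map (\<lambda>l. (l, b # B)) (X.bd A)) +
          (pm_scale ((- 1) ^ (?e * ?m + ?m)) (pm_map (\<lambda>l. (A, l @ B)) (Y.bd1 b)) +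
           pm_scale ((- 1) ^ (?e * ?m + ?m + ?e)) (pm_map (\<lambda>l. (A, b # l)) (Y.bd B) :: _ \<Rightarrow>\<^sub>0 'r))"
        by (simp add: AB addY_def tensor_bd_def lin_ext_scale pm_map_add pm_map_scale pm_map_pm_map
            pm.scale_right_distrib power_add)
      have "lin_ext (\<lambda>l. addY b (l, B)) (X.bd A) =
          lin_ext (\<lambda>l. pm_scale ((- 1) ^ (?e * (?m - 1))) (basis_vec (l, b # B))) (X.bd A :: _ \<Rightarrow>\<^sub>0 'r)"
      proof (rule lin_ext_cong[OF refl])
        fix l assume "l \<in> Poly_Mapping.keys (X.bd A :: _ \<Rightarrow>\<^sub>0 'r)"
        from X.keys_bd_deg[OF A this] have "X.deg l = ?m - 1" by arith
        then show "addY b (l, B) = pm_scale ((- 1) ^ (?e * (?m - 1))) (basis_vec (l, b # B))"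
          by (simp add: addY_def)
      qed
      then have R: "lin_ext (addY b) (tensor_bd p) =
          pm_scale ((- 1) ^ (?e * (?m - 1))) (pm_map (\<lambda>l. (l, b # B)) (X.bd A)) +
          pm_scale ((- 1) ^ (?m + ?e * ?m)) (pm_map (\<lambda>l. (A, b # l)) (Y.bd B) :: _ \<Rightarrow>\<^sub>0 'r)"
        unfolding AB tensor_bd_def prod.case lin_ext_add lin_ext_scale lin_ext_pm_map
        by (simp add: addY_def lin_ext_fun_scale pm_map_def power_add)
      \<comment> \<open>The exponents below contain \<open>?m - 1\<close> and \<open>?e - 1\<close>. They are wrong if \<open>?m\<close> or \<open>?e\<close> is zero, but
        then the term vanishes.\<close>
      have z1: "X.bd A = (0 :: _ \<Rightarrow>\<^sub>0 'r)" if "?m = 0" using X.bd_vertices_free[OF that A] .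
      have z2: "Y.bd1 b = (0 :: _ \<Rightarrow>\<^sub>0 'r)" if "?e = 0"
      proof -
        have "set [b] \<subseteq> {b \<in> Q2. dirs2 b \<noteq> {}}" using ab 2 by simp
        then show ?thesis unfolding Y.bd_singleton[of b, symmetric]
          by (intro Y.bd_vertices_free) (use that in simp_all)
      qed
      have p1: "pm_scale ((- 1) ^ ?e) (pm_scale ((- 1) ^ (?e * (?m - 1))) (pm_map (\<lambda>l. (l, b # B)) (X.bd A))) =
          pm_scale ((- 1) ^ (?e * ?m)) (pm_map (\<lambda>l. (l, b # B)) (X.bd A) :: _ \<Rightarrow>\<^sub>0 'r)"
        using z1 by (cases ?m) (simp_all add: power_add)
      have p2: "pm_scale ((- 1) ^ ((?e - 1) * ?m)) (pm_map (\<lambda>l. (A, l @ B)) (Y.bd1 b)) =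
          pm_scale ((- 1) ^ (?e * ?m + ?m)) (pm_map (\<lambda>l. (A, l @ B)) (Y.bd1 b) :: _ \<Rightarrow>\<^sub>0 'r)"
        using z2 by (cases ?e) (simp_all add: minus_one_power_iff)
      show "lin_ext tensor_bd (addY b p) = pm_scale ((- 1) ^ ((Y.cube_deg b - 1) * X.deg (fst p)))
          (pm_map (\<lambda>l. (fst p, l @ snd p)) (Y.bd1 b)) +
        (pm_scale ((- 1) ^ T.cube_deg c) (lin_ext (addY b) (tensor_bd p)) :: _ \<Rightarrow>\<^sub>0 'r)"
        unfolding L R c e pm.scale_right_distrib p1 unfolding AB fst_conv snd_conv p2
        by (simp add: power_add ac_simps)
    qed
    finally show ?thesis unfolding lhs s1 s2 lin_ext_fun_add lin_ext_fun_scale ..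
  next
    case 3
    then show ?thesis unfolding lhs using unshuffle_splits_mixed[of a b cs, where 'r = 'r] ab by (simp add: c)
  qed
qed

subsection \<open>The cross product\<close>

text \<open>A right inverse of \<open>unshuffle\<close>: \<open>y\<close> is the vertex of \<open>Y\<close> at which the factor in \<open>X\<close> is
  traversed, and \<open>x\<close> is the vertex of \<open>X\<close> at which the factor in \<open>Y\<close> is traversed. No sign occurs,
  because nothing is moved past anything.\<close>

definition sorted_chain :: "'b \<Rightarrow> 'a \<Rightarrow> 'a list \<times> 'b list \<Rightarrow> ('a \<times> 'b) list" where
  "sorted_chain y x = (\<lambda>(A, B). map (\<lambda>a. (a, y)) A @ map (Pair x) B)"

lemma bd_sorted_chain:
  assumes "set A \<subseteq> Q1" "set B \<subseteq> Q2" "y \<in> Q2" "dirs2 y = {}" "x \<in> Q1" "dirs1 x = {}"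
  shows "T.bd (sorted_chain y x (A, B)) = pm_map (sorted_chain y x) (tensor_bd (A, B))"
  using assms
  by (simp add: sorted_chain_def T.bd_append bd_pure_left bd_pure_right deg_pure_left tensor_bd_def
      pm_map_add pm_map_scale pm_map_pm_map)

lemma unshuffle_sorted_chain:
  assumes "dirs2 y = {}" "dirs1 x = {}" "\<forall>b\<in>set B. dirs2 b \<noteq> {}"
  shows "unshuffle (sorted_chain y x (A, B)) = (basis_vec (A, B) :: _ \<Rightarrow>\<^sub>0 'r::field)"
proof -
  have "unshuffle (map (Pair x) B) = (basis_vec ([], B) :: _ \<Rightarrow>\<^sub>0 'r)"
    using assms(2,3) by (induction B) (simp_all add: addY_def)
  then show ?thesis using assms(1) by (simp add: sorted_chain_def unshuffle_append_left)
qed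

lemma lchain_sorted_chain:
  assumes "X.lchain x A x'" "Y.lchain y B y'"
  shows "T.lchain (x, y) (sorted_chain y x' (A, B)) (x', y')"
proof -
  have x': "x' \<in> Q1" "dirs1 x' = {}" and y: "y \<in> Q2" "dirs2 y = {}"
    using X.lchain_vertices[OF assms(1)] Y.lchain_vertices[OF assms(2)] by auto
  have "T.lchain (x, y) (map (\<lambda>a. (a, y)) A) (x', y)"
    using assms(1)
  proof (induction A arbitrary: x)
    case (Cons a A)
    have "lo2 {} y = y" "hi2 {} y = y" using Y.lo_dirs[of y] Y.hi_empty[of y] y by auto
    then show ?case using Cons y by (auto simp: tdirs_pair tlo_pair thi_pair)
  qed (use y in \<open>auto simp: tdirs_pair\<close>)
  moreover have "T.lchain (x', y) (map (Pair x') B) (x', y')"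
    using assms(2)
  proof (induction B arbitrary: y)
    case (Cons b B)
    have "lo1 {} x' = x'" "hi1 {} x' = x'" using X.lo_dirs[of x'] X.hi_empty[of x'] x' by auto
    then show ?case using Cons x' by (auto simp: tdirs_pair tlo_pair thi_pair)
  qed (use x' in \<open>auto simp: tdirs_pair\<close>)
  ultimately show ?thesis by (auto simp: sorted_chain_def T.lchain_append)
qed

lemma deg_sorted_chain:
  "dirs2 y = {} \<Longrightarrow> dirs1 x = {} \<Longrightarrow> T.deg (sorted_chain y x (A, B)) = X.deg A + Y.deg B"
  by (simp add: sorted_chain_def deg_pure_left deg_pure_right)

end

context split_cubes
begin

definition chains :: "nat \<Rightarrow> 'a cube_chain set" where
  "chains n = {(v, l, w). lchain v l w \<and> deg l = n}"

definition chain_bd :: "'a cube_chain \<Rightarrow> ('a cube_chain \<Rightarrow>\<^sub>0 'r::field)" where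
  "chain_bd = (\<lambda>(v, l, w). pm_map (\<lambda>l. (v, l, w)) (bd l))"

lemma keys_chain_bd:
  assumes "c \<in> chains n"
  shows "Poly_Mapping.keys (chain_bd c :: _ \<Rightarrow>\<^sub>0 'r::field) \<subseteq> {q \<in> chains (n - 1). n > 0}"
proof
  fix q assume q: "q \<in> Poly_Mapping.keys (chain_bd c :: _ \<Rightarrow>\<^sub>0 'r)"
  obtain v l w where c: "c = (v, l, w)" by (cases c)
  then have l: "lchain v l w" "deg l = n" using assms by (auto simp: chains_def)
  obtain l' where l': "l' \<in> Poly_Mapping.keys (bd l :: _ \<Rightarrow>\<^sub>0 'r)" "q = (v, l', w)"
    using q by (auto simp: chain_bd_def c dest!: subsetD[OF keys_pm_map])
  have "Suc (deg l') = n" using keys_bd_deg[OF lchain_set[OF l(1)] l'(1)] l(2) by simp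
  then show "q \<in> {q \<in> chains (n - 1). n > 0}"
    using lchain_bd[OF l(1) l'(1)] by (auto simp: chains_def l'(2))
qed

lemma chain_bd_chain_bd: "c \<in> chains n \<Longrightarrow> lin_ext chain_bd (chain_bd c) = (0 :: _ \<Rightarrow>\<^sub>0 'r::field)"
  using bd_bd[OF lchain_set, where 'r = 'r]
  by (auto simp: chains_def chain_bd_def lin_ext_pm_map pm_map_lin_ext[symmetric])

end

context tensor_cubes
begin

subsection \<open>Sorting chains\<close>

definition pureX :: "'a \<times> 'b \<Rightarrow> bool" where
  "pureX c \<longleftrightarrow> dirs1 (fst c) \<noteq> {} \<and> dirs2 (snd c) = {}"

definition pureY :: "'a \<times> 'b \<Rightarrow> bool" where
  "pureY c \<longleftrightarrow> dirs1 (fst c) = {} \<and> dirs2 (snd c) \<noteq> {}"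

definition mixed :: "'a \<times> 'b \<Rightarrow> bool" where
  "mixed c \<longleftrightarrow> dirs1 (fst c) \<noteq> {} \<and> dirs2 (snd c) \<noteq> {}"

definition sorted_chains :: "('a \<times> 'b) list set" where
  "sorted_chains = {xs @ ys | xs ys. Ball (set xs) pureX \<and> Ball (set ys) pureY}"

text \<open>The pairs of the matching: both chains have the same sorted beginning; after it, \<open>m\<close> has a mixed
  cube and \<open>u\<close> has the same cube split with the \<open>Y\<close>-part first. This is the wrong order, so \<open>u\<close> is
  not sorted either, and its merge is determined by the first cube of \<open>X\<close> behind a cube of \<open>Y\<close>.\<close>

definition merges :: "('a \<times> 'b) list \<Rightarrow> ('a \<times> 'b) list \<Rightarrow> bool" where
  "merges m u \<longleftrightarrow> (\<exists>xs ys a b zs. Ball (set xs) pureX \<and> Ball (set ys) pureY \<and>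
     (a, b) \<in> Q1 \<times> Q2 \<and> mixed (a, b) \<and> m = xs @ ys @ (a, b) # zs \<and>
     u = xs @ ys @ (lo1 {} a, b) # (a, hi2 (dirs2 b) b) # zs)"

text \<open>The longest sorted beginning and the rest. The partner of a chain can be read off from it, so
  the matching is one-to-one; the first cube of the rest tells upper cells from lower cells.\<close>

definition first_unsorted :: "('a \<times> 'b) list \<Rightarrow> ('a \<times> 'b) list \<times> ('a \<times> 'b) list \<times> ('a \<times> 'b) list" where
  "first_unsorted cs = (takeWhile pureX cs, takeWhile pureY (dropWhile pureX cs),
     dropWhile pureY (dropWhile pureX cs))"

lemma first_unsorted:
  assumes "Ball (set xs) pureX" "Ball (set ys) pureY" "zs = [] \<or> \<not> pureY (hd zs)" "ys = [] \<Longrightarrow> zs = [] \<or> \<not> pureX (hd zs)"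
  shows "first_unsorted (xs @ ys @ zs) = (xs, ys, zs)"
proof -
  have "ys @ zs = [] \<or> \<not> pureX (hd (ys @ zs))"
    using assms(2,4) by (cases ys) (auto simp: pureX_def pureY_def)
  then have "takeWhile pureX (xs @ ys @ zs) = xs" "dropWhile pureX (xs @ ys @ zs) = ys @ zs"
    using assms(1) by (cases "ys @ zs"; auto simp: takeWhile_append2 dropWhile_append2)+
  moreover have "takeWhile pureY (ys @ zs) = ys" "dropWhile pureY (ys @ zs) = zs"
    using assms(2,3) by (cases zs; auto simp: takeWhile_append2 dropWhile_append2)+
  ultimately show ?thesis by (simp add: first_unsorted_def)
qed

lemma first_unsorted_merges:
  assumes "merges m u"
  obtains xs ys a b zs where "first_unsorted m = (xs, ys, (a, b) # zs)"
    "first_unsorted u = (xs, ys @ [(lo1 {} a, b)], (a, hi2 (dirs2 b) b) # zs)"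
    "m = xs @ ys @ (a, b) # zs" "u = xs @ ys @ (lo1 {} a, b) # (a, hi2 (dirs2 b) b) # zs"
    "Ball (set xs) pureX" "Ball (set ys) pureY" "a \<in> Q1" "b \<in> Q2" "mixed (a, b)"
proof -
  obtain xs ys a b zs where *: "Ball (set xs) pureX" "Ball (set ys) pureY" "a \<in> Q1" "b \<in> Q2"
    "mixed (a, b)" "m = xs @ ys @ (a, b) # zs"
    "u = xs @ ys @ (lo1 {} a, b) # (a, hi2 (dirs2 b) b) # zs"
    using assms by (auto simp: merges_def)
  have "first_unsorted m = (xs, ys, (a, b) # zs)"
    unfolding *(6) by (rule first_unsorted) (use *(1,2,5) in \<open>auto simp: mixed_def pureX_def pureY_def\<close>)
  moreover have "first_unsorted u = (xs, ys @ [(lo1 {} a, b)], (a, hi2 (dirs2 b) b) # zs)"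
  proof -
    have u: "u = xs @ (ys @ [(lo1 {} a, b)]) @ (a, hi2 (dirs2 b) b) # zs" by (simp add: *(7))
    have p: "pureY (lo1 {} a, b)" "\<not> pureY (a, hi2 (dirs2 b) b)"
      using *(3-5) by (simp_all add: pureY_def mixed_def X.dirs_lo)
    show ?thesis unfolding u by (rule first_unsorted) (use *(1,2) p in auto)
  qed
  ultimately show thesis using that * by blast
qed

lemma first_unsorted_sorted: "cs \<in> sorted_chains \<Longrightarrow> snd (snd (first_unsorted cs)) = []"
  using first_unsorted[of _ _ "[]"] by (auto simp: sorted_chains_def)

lemma merges_fun:
  assumes "merges m u" "merges m u'"
  shows "u = u'"
proof -
  obtain xs ys a b zs where 1: "first_unsorted m = (xs, ys, (a, b) # zs)"
    "u = xs @ ys @ (lo1 {} a, b) # (a, hi2 (dirs2 b) b) # zs"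
    using assms(1) by (rule first_unsorted_merges)
  obtain xs' ys' a' b' zs' where 2: "first_unsorted m = (xs', ys', (a', b') # zs')"
    "u' = xs' @ ys' @ (lo1 {} a', b') # (a', hi2 (dirs2 b') b') # zs'"
    using assms(2) by (rule first_unsorted_merges)
  show ?thesis using 1(1)[unfolded 2(1)] unfolding 1(2) 2(2) by simp
qed

lemma merges_inj:
  assumes "merges m u" "merges m' u"
  shows "m = m'"
proof -
  obtain xs ys a b zs where 1: "m = xs @ ys @ (a, b) # zs"
    "first_unsorted u = (xs, ys @ [(lo1 {} a, b)], (a, hi2 (dirs2 b) b) # zs)"
    using assms(1) by (rule first_unsorted_merges)
  obtain xs' ys' a' b' zs' where 2: "m' = xs' @ ys' @ (a', b') # zs'"
    "first_unsorted u = (xs', ys' @ [(lo1 {} a', b')], (a', hi2 (dirs2 b') b') # zs')"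
    using assms(2) by (rule first_unsorted_merges)
  show ?thesis using 1(2)[unfolded 2(2)] unfolding 1(1) 2(1) by simp
qed

lemma merges_disjoint:
  assumes "merges m u"
  shows "\<not> merges u u'"
proof
  assume u: "merges u u'"
  obtain xs ys a b zs where 1: "b \<in> Q2"
    "first_unsorted u = (xs, ys @ [(lo1 {} a, b)], (a, hi2 (dirs2 b) b) # zs)"
    using assms(1) by (rule first_unsorted_merges)
  obtain xs' ys' a' b' zs' where 2: "first_unsorted u = (xs', ys', (a', b') # zs')" "mixed (a', b')"
    using u by (rule first_unsorted_merges)
  show False using 2(2) 1(2)[unfolded 2(1)] 1(1) by (simp add: mixed_def Y.dirs_hi)
qed

lemma merges_not_sorted:
  assumes "merges m u"
  shows "u \<notin> sorted_chains"
proof -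
  obtain xs ys a b zs where "first_unsorted u = (xs, ys @ [(lo1 {} a, b)], (a, hi2 (dirs2 b) b) # zs)"
    using assms(1) by (rule first_unsorted_merges)
  then show ?thesis using first_unsorted_sorted[of u] by auto
qed

definition sumX :: "('a \<times> 'b) list \<Rightarrow> nat" where
  "sumX cs = (\<Sum>c\<leftarrow>cs. card (dirs1 (fst c)))"

definition sumY :: "('a \<times> 'b) list \<Rightarrow> nat" where
  "sumY cs = (\<Sum>c\<leftarrow>cs. card (dirs2 (snd c)))"

text \<open>The number of pairs of a direction of \<open>Y\<close> and a direction of \<open>X\<close> such that the direction of
  \<open>Y\<close> is passed in an earlier cube. It is the weight that makes the matching acyclic.\<close>

fun disorder :: "('a \<times> 'b) list \<Rightarrow> nat" where
  "disorder [] = 0"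
| "disorder (c # cs) = card (dirs2 (snd c)) * sumX cs + disorder cs"

lemma sumX_append [simp]: "sumX (cs @ ds) = sumX cs + sumX ds"
  and sumY_append [simp]: "sumY (cs @ ds) = sumY cs + sumY ds"
  by (simp_all add: sumX_def sumY_def)

lemma disorder_append: "disorder (cs @ ds) = disorder cs + disorder ds + sumY cs * sumX ds"
  by (induction cs) (simp_all add: sumX_def sumY_def algebra_simps)

text \<open>Splitting a mixed cube creates at most one disorder for each pair of its directions, and all
  of them only if the \<open>Y\<close>-part is passed entirely before the \<open>X\<close>-part.\<close>

lemma disorder_split_mixed:
  assumes ab: "a \<in> Q1" "b \<in> Q2" "mixed (a, b)" and I: "I \<in> T.splits (a, b)" "I \<noteq> dirs2 b"
  shows "disorder (xs @ [tlo I (a, b), thi I (a, b)] @ zs) <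
    disorder (xs @ [(lo1 {} a, b), (a, hi2 (dirs2 b) b)] @ zs)"
proof -
  let ?D = "dirs1 a" and ?E = "dirs2 b"
  have fin: "finite ?D" "finite ?E" using X.finite_dirs Y.finite_dirs ab by auto
  have ne: "?D \<noteq> {}" "?E \<noteq> {}" using ab(3) by (auto simp: mixed_def)
  have d: "dirs1 (fst (tlo I (a, b))) = I \<inter> ?D" "dirs2 (snd (tlo I (a, b))) = I \<inter> ?E"
    "dirs1 (fst (thi I (a, b))) = ?D - I" "dirs2 (snd (thi I (a, b))) = ?E - I"
    using X.dirs_lo[OF ab(1), of "I \<inter> ?D"] X.dirs_hi[OF ab(1), of "I \<inter> ?D"]
      Y.dirs_lo[OF ab(2), of "I \<inter> ?E"] Y.dirs_hi[OF ab(2), of "I \<inter> ?E"]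
    by (simp_all add: tlo_pair thi_pair Diff_Int)
  have d': "dirs1 (lo1 {} a) = {}" "dirs2 (hi2 ?E b) = {}" using ab by (simp_all add: X.dirs_lo Y.dirs_hi)
  have "I \<subseteq> ?D \<union> ?E" using I(1) by (auto simp: T.splits_def tdirs_pair)
  have "card (I \<inter> ?D) + card (?D - I) = card ?D" "card (I \<inter> ?E) + card (?E - I) = card ?E"
    using card_Int_Diff[OF fin(1), of I] card_Int_Diff[OF fin(2), of I] by (simp_all add: Int_commute)
  then have sums: "sumX [tlo I (a, b), thi I (a, b)] = card ?D" "sumY [tlo I (a, b), thi I (a, b)] = card ?E"
    "sumX [(lo1 {} a, b), (a, hi2 ?E b)] = card ?D" "sumY [(lo1 {} a, b), (a, hi2 ?E b)] = card ?E"
    by (simp_all add: sumX_def sumY_def d d')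
  have "disorder [tlo I (a, b), thi I (a, b)] = card (I \<inter> ?E) * card (?D - I)" by (simp add: sumX_def d)
  also have "\<dots> < card ?E * card ?D"
  proof (cases "?E \<subseteq> I")
    case True
    then have "?D - I \<noteq> ?D" using \<open>I \<subseteq> ?D \<union> ?E\<close> I(2) by blast
    then have "card (?D - I) < card ?D" using fin(1) by (intro psubset_card_mono) auto
    moreover have "card (I \<inter> ?E) = card ?E" using True by (simp add: Int_absorb1)
    ultimately show ?thesis using ne fin by (simp add: card_gt_0_iff)
  next
    case False
    then have "card (I \<inter> ?E) < card ?E" using fin(2) by (intro psubset_card_mono) auto
    moreover have "card (?D - I) \<le> card ?D" "card ?D > 0" using fin ne by (auto intro: card_mono simp: card_gt_0_iff)
    ultimately show ?thesis by (meson le_less_trans mult_le_mono2 mult_less_mono1)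
  qed
  also have "\<dots> = disorder [(lo1 {} a, b), (a, hi2 ?E b)]" by (simp add: sumX_def d')
  finally show ?thesis unfolding disorder_append sums sumX_append by simp
qed

lemma keys_bd_pureX:
  assumes "Ball (set cs) pureX" "set cs \<subseteq> Q1 \<times> Q2" "l \<in> Poly_Mapping.keys (T.bd cs :: _ \<Rightarrow>\<^sub>0 'r::field)"
  shows "Ball (set l) pureX"
  using assms
proof (induction cs arbitrary: l)
  case (Cons c cs)
  obtain a b where c': "c = (a, b)" by fastforce
  then have c: "c = (a, b)" "a \<in> Q1" "b \<in> Q2" "dirs2 b = {}"
    using Cons.prems(1,2) by (simp_all add: pureX_def)
  from Cons.prems(3) consider
    l1 where "l1 \<in> Poly_Mapping.keys (T.bd1 c :: _ \<Rightarrow>\<^sub>0 'r)" "l = l1 @ cs"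
  | l2 where "l2 \<in> Poly_Mapping.keys (T.bd cs :: _ \<Rightarrow>\<^sub>0 'r)" "l = c # l2"
    by (auto dest!: subsetD[OF Poly_Mapping.keys_add] subsetD[OF keys_pm_scale] subsetD[OF keys_pm_map])
  then show ?case
  proof cases
    case 1
    from 1(1)[unfolded c(1) bd1_pure_left[OF c(2-4)]] obtain m where
      m: "m \<in> Poly_Mapping.keys (X.bd1 a :: _ \<Rightarrow>\<^sub>0 'r)" "l1 = map (\<lambda>x. (x, b)) m"
      by (auto dest!: subsetD[OF keys_pm_map])
    show ?thesis using X.keys_bd1_deg(2)[OF c(2) m(1)] Cons.prems(1) c(4)
      by (auto simp: 1(2) m(2) pureX_def)
  next
    case 2
    then show ?thesis using Cons.IH[of l2] Cons.prems(1,2) by simp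
  qed
qed simp

lemma keys_bd_pureY:
  assumes "Ball (set cs) pureY" "set cs \<subseteq> Q1 \<times> Q2" "l \<in> Poly_Mapping.keys (T.bd cs :: _ \<Rightarrow>\<^sub>0 'r::field)"
  shows "Ball (set l) pureY"
  using assms
proof (induction cs arbitrary: l)
  case (Cons c cs)
  obtain a b where c': "c = (a, b)" by fastforce
  then have c: "c = (a, b)" "a \<in> Q1" "b \<in> Q2" "dirs1 a = {}"
    using Cons.prems(1,2) by (simp_all add: pureY_def)
  from Cons.prems(3) consider
    l1 where "l1 \<in> Poly_Mapping.keys (T.bd1 c :: _ \<Rightarrow>\<^sub>0 'r)" "l = l1 @ cs"
  | l2 where "l2 \<in> Poly_Mapping.keys (T.bd cs :: _ \<Rightarrow>\<^sub>0 'r)" "l = c # l2"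
    by (auto dest!: subsetD[OF Poly_Mapping.keys_add] subsetD[OF keys_pm_scale] subsetD[OF keys_pm_map])
  then show ?case
  proof cases
    case 1
    from 1(1)[unfolded c(1) bd1_pure_right[OF c(2-4)]] obtain m where
      m: "m \<in> Poly_Mapping.keys (Y.bd1 b :: _ \<Rightarrow>\<^sub>0 'r)" "l1 = map (Pair a) m"
      by (auto dest!: subsetD[OF keys_pm_map])
    show ?thesis using Y.keys_bd1_deg(2)[OF c(3) m(1)] Cons.prems(1) c(4)
      by (auto simp: 1(2) m(2) pureY_def)
  next
    case 2
    then show ?thesis using Cons.IH[of l2] Cons.prems(1,2) by simp
  qed
qed simp

lemma keys_bd_sorted:
  assumes "cs \<in> sorted_chains" "set cs \<subseteq> Q1 \<times> Q2" "l \<in> Poly_Mapping.keys (T.bd cs :: _ \<Rightarrow>\<^sub>0 'r::field)"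
  shows "l \<in> sorted_chains"
proof -
  obtain xs ys where cs: "cs = xs @ ys" "Ball (set xs) pureX" "Ball (set ys) pureY"
    using assms(1) by (auto simp: sorted_chains_def)
  consider l1 where "l1 \<in> Poly_Mapping.keys (T.bd xs :: _ \<Rightarrow>\<^sub>0 'r)" "l = l1 @ ys"
  | l2 where "l2 \<in> Poly_Mapping.keys (T.bd ys :: _ \<Rightarrow>\<^sub>0 'r)" "l = xs @ l2"
    using assms(3) unfolding cs T.bd_append
    by (auto dest!: subsetD[OF Poly_Mapping.keys_add] subsetD[OF keys_pm_scale] subsetD[OF keys_pm_map])
  then show ?thesis
  proof cases
    case 1
    then have "Ball (set l1) pureX" using keys_bd_pureX[OF cs(2) _ 1(1)] assms(2) cs(1) by simp
    then show ?thesis using 1(2) cs(3) unfolding sorted_chains_def by blast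
  next
    case 2
    then have "Ball (set l2) pureY" using keys_bd_pureY[OF cs(3) _ 2(1)] assms(2) cs(1) by simp
    then show ?thesis using 2(2) cs(2) unfolding sorted_chains_def by blast
  qed
qed

text \<open>If another cube of \<open>m\<close> is split, the mixed cube remains the first unsorted one and the face is an
  upper cell again. Among the splits of the mixed cube, \<open>u\<close> has the largest disorder.\<close>

lemma bd_merge:
  assumes "merges m u" "set m \<subseteq> Q1 \<times> Q2"
  shows "\<exists>e. e \<noteq> 0 \<and> (\<forall>l\<in>Poly_Mapping.keys (T.bd m - pm_scale e (basis_vec u) :: _ \<Rightarrow>\<^sub>0 'r::field).
    (\<exists>u'. merges l u') \<or> disorder l < disorder u)"
proof -
  obtain xs ys a b zs where *: "m = xs @ ys @ (a, b) # zs"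
    "u = xs @ ys @ (lo1 {} a, b) # (a, hi2 (dirs2 b) b) # zs"
    "Ball (set xs) pureX" "Ball (set ys) pureY" "a \<in> Q1" "b \<in> Q2" "mixed (a, b)"
    using assms(1) by (elim first_unsorted_merges)
  let ?c = "(a, b)"
  have disj: "dirs1 a \<inter> dirs2 b = {}" using dirs_disjoint *(5,6) by blast
  have ne: "dirs1 a \<noteq> {}" "dirs2 b \<noteq> {}" using *(7) by (simp_all add: mixed_def)
  let ?E = "dirs2 b"
  have E: "?E \<in> T.splits ?c" using ne disj by (auto simp: T.splits_def tdirs_pair)
  have "?E \<inter> dirs1 a = {}" using disj by (simp add: Int_commute)
  then have tE: "[tlo ?E ?c, thi ?E ?c] = [(lo1 {} a, b), (a, hi2 ?E b)]"
    using X.hi_empty[OF *(5)] Y.lo_dirs[OF *(6)] by (simp add: tlo_pair thi_pair)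
  let ?s = "T.split_sign ?c ?E :: 'r"
  \<comment> \<open>The splits of the mixed cube that do not lead to \<open>u\<close>.\<close>
  define R where "R = (\<Sum>I\<in>T.splits ?c - {?E}. pm_scale (T.split_sign ?c I) (basis_vec [tlo I ?c, thi I ?c]) :: _ \<Rightarrow>\<^sub>0 'r)"
  have bd1: "T.bd1 ?c = pm_scale ?s (basis_vec [(lo1 {} a, b), (a, hi2 ?E b)]) + R"
    unfolding T.bd1_def R_def using sum.remove[OF T.finite_splits E, where g = "\<lambda>I. pm_scale (T.split_sign ?c I) (basis_vec [tlo I ?c, thi I ?c]) :: _ \<Rightarrow>\<^sub>0 'r"] *(5,6)
    by (simp add: tE)
  have R: "\<exists>I\<in>T.splits ?c. I \<noteq> ?E \<and> l = [tlo I ?c, thi I ?c]" if "l \<in> Poly_Mapping.keys R" for l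
    using that unfolding R_def
    by (auto dest!: subsetD[OF Poly_Mapping.keys_sum] subsetD[OF keys_pm_scale])
  let ?sx = "(- 1) ^ T.deg xs :: 'r" and ?sy = "(- 1) ^ T.deg ys :: 'r" and ?sc = "(- 1) ^ T.cube_deg ?c :: 'r"
  let ?e = "?sx * ?sy * ?s"
  have matched: "\<exists>u'. merges (xs' @ ys' @ ?c # zs') u'"
    if "Ball (set xs') pureX" "Ball (set ys') pureY" for xs' ys' zs'
    unfolding merges_def using that *(5-7) by blast
  have good: "set xs \<subseteq> Q1 \<times> Q2" "set ys \<subseteq> Q1 \<times> Q2" using assms(2) *(1) by auto
  have "T.bd m - pm_scale ?e (basis_vec u) =
      pm_map (\<lambda>l. l @ ys @ ?c # zs) (T.bd xs) +
      pm_scale ?sx (pm_map (\<lambda>l. xs @ l @ ?c # zs) (T.bd ys)) +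
      pm_scale (?sx * ?sy) (pm_map (\<lambda>l. xs @ ys @ l @ zs) R) +
      pm_scale (?sx * ?sy * ?sc) (pm_map (\<lambda>l. xs @ ys @ ?c # l) (T.bd zs))"
    unfolding *(1,2) T.bd_append T.bd.simps bd1
    by (simp add: pm_map_add pm_map_scale pm_map_pm_map pm.scale_right_distrib mult.assoc)
  moreover have "(\<exists>u'. merges l u') \<or> disorder l < disorder u"
    if "l \<in> Poly_Mapping.keys (pm_map (\<lambda>l. l @ ys @ ?c # zs) (T.bd xs) +
      pm_scale ?sx (pm_map (\<lambda>l. xs @ l @ ?c # zs) (T.bd ys)) +
      pm_scale (?sx * ?sy) (pm_map (\<lambda>l. xs @ ys @ l @ zs) R) +
      pm_scale (?sx * ?sy * ?sc) (pm_map (\<lambda>l. xs @ ys @ ?c # l) (T.bd zs)))" for l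
  proof -
    from that consider
      k where "k \<in> Poly_Mapping.keys (T.bd xs :: _ \<Rightarrow>\<^sub>0 'r)" "l = k @ ys @ ?c # zs"
    | k where "k \<in> Poly_Mapping.keys (T.bd ys :: _ \<Rightarrow>\<^sub>0 'r)" "l = xs @ k @ ?c # zs"
    | k where "k \<in> Poly_Mapping.keys R" "l = xs @ ys @ k @ zs"
    | k where "l = xs @ ys @ ?c # k"
      by (auto dest!: subsetD[OF Poly_Mapping.keys_add] subsetD[OF keys_pm_scale] subsetD[OF keys_pm_map])
    then show ?thesis
    proof cases
      case 1
      then show ?thesis using matched[of k ys zs] keys_bd_pureX[OF *(3) good(1) 1(1)] *(4) by simp
    next
      case 2
      then show ?thesis using matched[of xs k zs] keys_bd_pureY[OF *(4) good(2) 2(1)] *(3) by simp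
    next
      case 3
      obtain I where I: "I \<in> T.splits ?c" "I \<noteq> ?E" "k = [tlo I ?c, thi I ?c]" using R[OF 3(1)] by blast
      show ?thesis using disorder_split_mixed[OF *(5-7) I(1,2), of "xs @ ys" zs]
        by (simp add: 3(2) I(3) *(2))
    next
      case 4
      then show ?thesis using matched[of xs ys k] *(3,4) by simp
    qed
  qed
  moreover have "?e \<noteq> 0" by (simp add: T.split_sign_def)
  ultimately show ?thesis by metis
qed

text \<open>In a chain that is not sorted, the first cube that violates the order is either mixed or
  belongs to \<open>X\<close>; in the latter case the cube before it belongs to \<open>Y\<close> and the two can be merged.\<close>

lemma sorted_or_merges:
  assumes "T.lchain v cs w"
  shows "cs \<in> sorted_chains \<or> (\<exists>u. merges cs u) \<or> (\<exists>m. merges m cs \<and> T.lchain v m w \<and> T.deg m = Suc (T.deg cs))"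
proof -
  define xs where "xs = takeWhile pureX cs"
  define ys where "ys = takeWhile pureY (dropWhile pureX cs)"
  define zs where "zs = dropWhile pureY (dropWhile pureX cs)"
  have cs: "cs = xs @ ys @ zs" by (simp add: xs_def ys_def zs_def)
  have xs: "Ball (set xs) pureX" and ys: "Ball (set ys) pureY"
    by (auto simp: xs_def ys_def dest: set_takeWhileD)
  have good: "set cs \<subseteq> T_good" using T.lchain_set[OF assms] .
  show ?thesis
  proof (cases zs)
    case Nil
    then show ?thesis using cs xs ys unfolding sorted_chains_def by auto
  next
    case (Cons c zs')
    obtain a b' where c: "c = (a, b')" by fastforce
    have cQ: "a \<in> Q1" "b' \<in> Q2" "dirs1 a \<noteq> {} \<or> dirs2 b' \<noteq> {}"
      using good by (auto simp: cs Cons c tdirs_pair)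
    have "\<not> pureY c" using Cons hd_dropWhile[of pureY "dropWhile pureX cs"] by (simp add: zs_def)
    then have a: "dirs1 a \<noteq> {}" using cQ by (auto simp: pureY_def c)
    show ?thesis
    proof (cases "dirs2 b' = {}")
      case False
      then have "mixed c" using a by (simp add: mixed_def c)
      then have "\<exists>u. merges cs u" unfolding merges_def cs Cons c using xs ys cQ by blast
      then show ?thesis by blast
    next
      case True
      then have pX: "pureX c" using a by (simp add: pureX_def c)
      have "ys \<noteq> []"
      proof
        assume "ys = []"
        then have "dropWhile pureX cs = c # zs'" using Cons takeWhile_dropWhile_id[of pureY "dropWhile pureX cs"]
          by (simp add: zs_def ys_def)
        then show False using hd_dropWhile[of pureX cs] pX by simp
      qed
      then obtain ys' p where ys': "ys = ys' @ [p]" by (metis rev_exhaust)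
      obtain x b where p: "p = (x, b)" by fastforce
      have pQ: "x \<in> Q1" "b \<in> Q2" "dirs1 x = {}" "dirs2 b \<noteq> {}"
        using good ys by (auto simp: cs ys' p pureY_def)
      obtain t where t: "T.lchain v (xs @ ys') t" "T.lchain t (p # c # zs') w"
      proof -
        have "T.lchain v ((xs @ ys') @ p # c # zs') w" using assms by (simp add: cs ys' Cons)
        then show thesis using that unfolding T.lchain_append[of v "xs @ ys'"] by blast
      qed
      have x0: "lo1 {} x = x" "hi1 {} x = x" using X.lo_dirs[OF pQ(1)] X.hi_empty[OF pQ(1)] pQ(3) by auto
      have y0: "lo2 {} b' = b'" "hi2 {} b' = b'" using Y.lo_dirs[OF cQ(2)] Y.hi_empty[OF cQ(2)] True by auto
      have t1: "t = (x, lo2 {} b)" "(x, hi2 (dirs2 b) b) = (lo1 {} a, b')" "T.lchain (hi1 (dirs1 a) a, b') zs' w"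
        using t(2) pQ(3) True x0 y0
        by (auto simp: p c tlo_pair thi_pair tdirs_pair)
      have "T.lchain t ((a, b) # zs') w"
        using t1 cQ pQ a by (simp add: tlo_pair thi_pair tdirs_pair Int_absorb1)
      then have "T.lchain v ((xs @ ys') @ (a, b) # zs') w"
        unfolding T.lchain_append[of v "xs @ ys'"] using t(1) by blast
      then have "T.lchain v (xs @ ys' @ (a, b) # zs') w" by simp
      moreover have "merges (xs @ ys' @ (a, b) # zs') cs"
        unfolding merges_def
        by (rule exI[of _ xs], rule exI[of _ ys'], rule exI[of _ a], rule exI[of _ b], rule exI[of _ zs'])
          (use xs ys cQ pQ a t1(2) in \<open>auto simp: ys' cs Cons p c mixed_def\<close>)
      moreover have "T.deg (xs @ ys' @ (a, b) # zs') = Suc (T.deg cs)"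
      proof -
        have "card (dirs1 a) > 0" "card (dirs2 b) > 0"
          using a pQ(4) X.finite_dirs[OF cQ(1)] Y.finite_dirs[OF pQ(2)] by (auto simp: card_gt_0_iff)
        moreover have "card (dirs1 a \<union> dirs2 b) = card (dirs1 a) + card (dirs2 b)"
          using X.finite_dirs[OF cQ(1)] Y.finite_dirs[OF pQ(2)] dirs_disjoint[OF cQ(1) pQ(2)]
          by (simp add: card_Un_disjoint)
        ultimately show ?thesis
          by (simp add: cs ys' Cons p c T.cube_deg_def tdirs_pair True pQ(3))
      qed
      ultimately show ?thesis by blast
    qed
  qed
qed

subsection \<open>The projection is a quasi-isomorphism\<close>

definition unshuffle_chain :: "('a \<times> 'b) cube_chain \<Rightarrow> ('a cube_chain \<times> 'b cube_chain \<Rightarrow>\<^sub>0 'r::field)" where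
  "unshuffle_chain = (\<lambda>(v, l, w). pm_map (\<lambda>(A, B). ((fst v, A, fst w), (snd v, B, snd w))) (unshuffle l))"

definition cross_chain :: "'a cube_chain \<times> 'b cube_chain \<Rightarrow> ('a \<times> 'b) cube_chain" where
  "cross_chain = (\<lambda>((x, A, x'), (y, B, y')). ((x, y), sorted_chain y x' (A, B), (x', y')))"

definition len_deg :: "'a cube_chain \<Rightarrow> nat" where
  "len_deg = (\<lambda>(v, l, w). X.deg l)"

definition tensor_chain_bd :: "'a cube_chain \<times> 'b cube_chain \<Rightarrow> ('a cube_chain \<times> 'b cube_chain \<Rightarrow>\<^sub>0 'r::field)" where
  "tensor_chain_bd = (\<lambda>(c, d). pm_map (\<lambda>c'. (c', d)) (X.chain_bd c) + pm_scale ((- 1) ^ len_deg c) (pm_map (Pair c) (Y.chain_bd d)))"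

lemma keys_unshuffle_chain:
  assumes "p \<in> T.chains n" "(c, d) \<in> Poly_Mapping.keys (unshuffle_chain p :: _ \<Rightarrow>\<^sub>0 'r::field)"
  shows "\<exists>i j. c \<in> X.chains i \<and> d \<in> Y.chains j \<and> i + j = n"
proof -
  obtain v l w where p: "p = (v, l, w)" by (cases p)
  then have l: "T.lchain v l w" "T.deg l = n" using assms(1) by (auto simp: T.chains_def)
  obtain A B where AB: "(A, B) \<in> Poly_Mapping.keys (unshuffle l :: _ \<Rightarrow>\<^sub>0 'r)" "c = (fst v, A, fst w)" "d = (snd v, B, snd w)"
    using assms(2) by (auto simp: unshuffle_chain_def p dest!: subsetD[OF keys_pm_map])
  show ?thesis using keys_unshuffle[OF T.lchain_set[OF l(1)] AB(1)] keys_unshuffle_lchain[OF l(1) AB(1)] l(2)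
    by (simp add: AB X.chains_def Y.chains_def)
qed

lemma unshuffle_chain_chain_bd:
  assumes "p \<in> T.chains n"
  shows "lin_ext unshuffle_chain (T.chain_bd p) = (lin_ext tensor_chain_bd (unshuffle_chain p) :: _ \<Rightarrow>\<^sub>0 'r::field)"
proof -
  obtain v l w where p: "p = (v, l, w)" by (cases p)
  then have l: "T.lchain v l w" using assms(1) by (auto simp: T.chains_def)
  have *: "tensor_chain_bd ((fst v, A, fst w), (snd v, B, snd w)) =
      (pm_map (\<lambda>(A, B). ((fst v, A, fst w), (snd v, B, snd w))) (tensor_bd (A, B)) :: _ \<Rightarrow>\<^sub>0 'r)" for A B
    by (simp add: tensor_chain_bd_def tensor_bd_def X.chain_bd_def Y.chain_bd_def len_deg_def pm_map_add pm_map_scale pm_map_pm_map)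
  show ?thesis unfolding p T.chain_bd_def unshuffle_chain_def
    by (simp add: lin_ext_pm_map pm_map_lin_ext[symmetric] unshuffle_chain_map[OF T.lchain_set[OF l]])
      (simp add: pm_map_lin_ext * case_prod_unfold)
qed

lemma cross_chain_in: "c \<in> X.chains i \<Longrightarrow> d \<in> Y.chains j \<Longrightarrow> cross_chain (c, d) \<in> T.chains (i + j)"
  using lchain_sorted_chain deg_sorted_chain X.lchain_vertices Y.lchain_vertices
  by (fastforce simp: X.chains_def Y.chains_def T.chains_def cross_chain_def)

lemma chain_bd_cross_chain:
  assumes "c \<in> X.chains i" "d \<in> Y.chains j"
  shows "T.chain_bd (cross_chain (c, d)) = (pm_map cross_chain (tensor_chain_bd (c, d)) :: _ \<Rightarrow>\<^sub>0 'r::field)"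
proof -
  obtain x A x' where c: "c = (x, A, x')" by (cases c)
  obtain y B y' where d: "d = (y, B, y')" by (cases d)
  have "X.lchain x A x'" "Y.lchain y B y'" using assms by (auto simp: c d X.chains_def Y.chains_def)
  note * = X.lchain_vertices[OF this(1)] Y.lchain_vertices[OF this(2)] X.lchain_set[OF this(1)] Y.lchain_set[OF this(2)]
  have "T.bd (sorted_chain y x' (A, B)) = (pm_map (sorted_chain y x') (tensor_bd (A, B)) :: _ \<Rightarrow>\<^sub>0 'r)"
    by (rule bd_sorted_chain) (use * in auto)
  then show ?thesis
    by (simp add: c d cross_chain_def T.chain_bd_def tensor_chain_bd_def tensor_bd_def X.chain_bd_def Y.chain_bd_def len_deg_def
        pm_map_add pm_map_scale pm_map_pm_map)
qed

lemma unshuffle_chain_cross_chain: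
  assumes "c \<in> X.chains i" "d \<in> Y.chains j"
  shows "unshuffle_chain (cross_chain (c, d)) = (basis_vec (c, d) :: _ \<Rightarrow>\<^sub>0 'r::field)"
proof -
  obtain x A x' where c: "c = (x, A, x')" by (cases c)
  obtain y B y' where d: "d = (y, B, y')" by (cases d)
  have "X.lchain x A x'" "Y.lchain y B y'" using assms by (auto simp: c d X.chains_def Y.chains_def)
  note * = X.lchain_vertices[OF this(1)] Y.lchain_vertices[OF this(2)] Y.lchain_set[OF this(2)]
  have "unshuffle (sorted_chain y x' (A, B)) = (basis_vec (A, B) :: _ \<Rightarrow>\<^sub>0 'r)"
    by (rule unshuffle_sorted_chain) (use * in auto)
  then show ?thesis by (simp add: c d cross_chain_def unshuffle_chain_def)
qed

text \<open>Along cubes of \<open>X\<close> the component in \<open>Y\<close> stays at one vertex; hence a sorted chain is the cross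
  product of its unshuffled factors.\<close>

lemma lchain_pureX:
  "T.lchain v xs u \<Longrightarrow> Ball (set xs) pureX \<Longrightarrow> snd u = snd v \<and> xs = map (\<lambda>a. (a, snd v)) (map fst xs)"
proof (induction xs arbitrary: v)
  case (Cons c xs)
  obtain a b where c: "c = (a, b)" by fastforce
  have ab: "b \<in> Q2" "dirs2 b = {}" using Cons.prems by (auto simp: c pureX_def)
  then have "lo2 {} b = b" "hi2 {} b = b" using Y.lo_dirs[of b] Y.hi_empty[of b] by auto
  then show ?case using Cons.IH[of "thi (tdirs c) c"] Cons.prems ab by (auto simp: c tlo_pair thi_pair)
qed simp

lemma lchain_pureY:
  "T.lchain v ys u \<Longrightarrow> Ball (set ys) pureY \<Longrightarrow> fst u = fst v \<and> ys = map (Pair (fst v)) (map snd ys)"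
proof (induction ys arbitrary: v)
  case (Cons c ys)
  obtain a b where c: "c = (a, b)" by fastforce
  have ab: "a \<in> Q1" "dirs1 a = {}" using Cons.prems by (auto simp: c pureY_def)
  then have "lo1 {} a = a" "hi1 {} a = a" using X.lo_dirs[of a] X.hi_empty[of a] by auto
  then show ?case using Cons.IH[of "thi (tdirs c) c"] Cons.prems ab by (auto simp: c tlo_pair thi_pair)
qed simp

lemma cross_unshuffle_chain_sorted:
  assumes "(v, l, w) \<in> T.chains n" "l \<in> sorted_chains"
  shows "pm_map cross_chain (unshuffle_chain (v, l, w)) = (basis_vec (v, l, w) :: _ \<Rightarrow>\<^sub>0 'r::field)"
proof -
  obtain xs ys where l: "l = xs @ ys" "Ball (set xs) pureX" "Ball (set ys) pureY"
    using assms(2) by (auto simp: sorted_chains_def)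
  obtain u where u: "T.lchain v xs u" "T.lchain u ys w"
    using assms(1) by (auto simp: T.chains_def l(1) T.lchain_append)
  have xs: "snd u = snd v" "xs = map (\<lambda>a. (a, snd v)) (map fst xs)" using lchain_pureX[OF u(1) l(2)] by auto
  have ys: "fst w = fst u" "ys = map (Pair (fst u)) (map snd ys)" using lchain_pureY[OF u(2) l(3)] by auto
  have l': "l = sorted_chain (snd v) (fst w) (map fst xs, map snd ys)"
    unfolding sorted_chain_def prod.case l(1) ys(1) using xs(2) ys(2) by simp
  have "unshuffle l = (basis_vec (map fst xs, map snd ys) :: _ \<Rightarrow>\<^sub>0 'r)"
    unfolding l'
    by (rule unshuffle_sorted_chain)
      (use T.lchain_vertices[OF u(1)] T.lchain_vertices[OF u(2)] l(3) in \<open>auto simp: tdirs_def pureY_def case_prod_beta\<close>)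
  then show ?thesis by (simp add: unshuffle_chain_def cross_chain_def l'[symmetric])
qed

text \<open>By the matching, \<open>z\<close> is homologous to a combination of sorted chains. On those, unshuffling
  followed by sorting is the identity, and in general it commutes with the boundary.\<close>

theorem cycle_homologous_cross_unshuffle_chain:
  fixes z :: "('a \<times> 'b) cube_chain \<Rightarrow>\<^sub>0 'r::field"
  assumes z: "Poly_Mapping.keys z \<subseteq> T.chains n" "lin_ext T.chain_bd z = 0"
  shows "\<exists>y. Poly_Mapping.keys y \<subseteq> T.chains (Suc n) \<and>
    z - pm_map cross_chain (lin_ext unshuffle_chain z) = lin_ext T.chain_bd y"
proof -
  interpret M: acyclic_matching "T.chains n" "T.chains (Suc n)" "{(v, l, w). l \<in> sorted_chains}"
    "T.chain_bd :: _ \<Rightarrow> _ \<Rightarrow>\<^sub>0 'r" "\<lambda>(v, m, w) (v', u, w'). v = v' \<and> w = w' \<and> merges m u" "\<lambda>(v, l, w). disorder l"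
  proof (unfold_locales, goal_cases)
    case (1 c)
    then show ?case using sorted_or_merges by (fastforce simp: T.chains_def)
  next
    case (2 m u)
    obtain v l w where m: "m = (v, l, w)" by (cases m)
    obtain k where u: "u = (v, k, w)" "merges l k" using 2(2) by (cases u) (auto simp: m)
    have "set l \<subseteq> Q1 \<times> Q2" using 2(1) T.lchain_set by (fastforce simp: m T.chains_def)
    from bd_merge[OF u(2) this, where 'r = 'r] obtain e where e: "e \<noteq> 0"
      "\<forall>l\<in>Poly_Mapping.keys (T.bd l - pm_scale e (basis_vec k) :: _ \<Rightarrow>\<^sub>0 'r).
         (\<exists>u'. merges l u') \<or> disorder l < disorder k" by blast
    have "T.chain_bd m - pm_scale e (basis_vec u) =
        pm_map (\<lambda>l. (v, l, w)) (T.bd l - pm_scale e (basis_vec k) :: _ \<Rightarrow>\<^sub>0 'r)"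
      by (simp add: m u(1) T.chain_bd_def pm_map_diff pm_map_scale)
    then show ?case using e by (intro exI[of _ e]) (fastforce simp: u(1) dest!: subsetD[OF keys_pm_map])
  next
    case (3 m)
    then show ?case using T.keys_chain_bd[OF 3, where 'r = 'r] by auto
  next
    case (4 c)
    obtain v l w where c: "c = (v, l, w)" by (cases c)
    have "set l \<subseteq> Q1 \<times> Q2" using 4(1) T.lchain_set by (fastforce simp: c T.chains_def)
    then show ?case using keys_bd_sorted[of l, where 'r = 'r] 4(2)
      by (auto simp: c T.chain_bd_def dest!: subsetD[OF keys_pm_map])
  qed (auto dest: merges_fun merges_inj merges_disjoint merges_not_sorted)
  have "\<exists>y. Poly_Mapping.keys y \<subseteq> T.chains (Suc n) \<and>
      Poly_Mapping.keys (z - lin_ext T.chain_bd y) \<subseteq> {(v, l, w). l \<in> sorted_chains}"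
    by (rule M.cycle_homologous_to_critical) (use T.chain_bd_chain_bd z in auto)
  then obtain y where y: "Poly_Mapping.keys y \<subseteq> T.chains (Suc n)"
    "Poly_Mapping.keys (z - lin_ext T.chain_bd y) \<subseteq> {(v, l, w). l \<in> sorted_chains}" by blast
  let ?sP = "\<lambda>f. pm_map cross_chain (lin_ext unshuffle_chain f) :: _ \<Rightarrow>\<^sub>0 'r"
  have dy: "Poly_Mapping.keys (lin_ext T.chain_bd y) \<subseteq> T.chains n"
    using y(1) T.keys_chain_bd[where 'r = 'r] by (fastforce elim!: keys_lin_extE)
  have fixed: "?sP (z - lin_ext T.chain_bd y) = z - lin_ext T.chain_bd y"
  proof -
    have "?sP (z - lin_ext T.chain_bd y) = lin_ext (\<lambda>c. pm_map cross_chain (unshuffle_chain c)) (z - lin_ext T.chain_bd y)"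
      by (simp add: pm_map_lin_ext)
    also have "\<dots> = lin_ext basis_vec (z - lin_ext T.chain_bd y)"
    proof (rule lin_ext_cong[OF refl])
      fix c assume c: "c \<in> Poly_Mapping.keys (z - lin_ext T.chain_bd y)"
      then have "c \<in> T.chains n" using z(1) dy Poly_Mapping.keys_diff[of z "lin_ext T.chain_bd y"] by blast
      moreover obtain v l w where "c = (v, l, w)" by (cases c)
      ultimately show "pm_map cross_chain (unshuffle_chain c) = (basis_vec c :: _ \<Rightarrow>\<^sub>0 'r)"
        using c y(2) cross_unshuffle_chain_sorted by blast
    qed
    finally show ?thesis by simp
  qed
  have natural: "?sP (lin_ext T.chain_bd y) = lin_ext T.chain_bd (?sP y)"
  proof -
    have "lin_ext unshuffle_chain (lin_ext T.chain_bd y) = (lin_ext (\<lambda>c. lin_ext tensor_chain_bd (unshuffle_chain c)) y :: _ \<Rightarrow>\<^sub>0 'r)"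
      unfolding lin_ext_lin_ext by (rule lin_ext_cong[OF refl], rule unshuffle_chain_chain_bd) (use y(1) in auto)
    then have "?sP (lin_ext T.chain_bd y) = lin_ext (\<lambda>q. pm_map cross_chain (tensor_chain_bd q)) (lin_ext unshuffle_chain y)"
      by (simp add: pm_map_lin_ext lin_ext_lin_ext)
    also have "\<dots> = lin_ext (\<lambda>q. T.chain_bd (cross_chain q)) (lin_ext unshuffle_chain y)"
    proof (rule lin_ext_cong[OF refl])
      fix q assume "q \<in> Poly_Mapping.keys (lin_ext unshuffle_chain y :: _ \<Rightarrow>\<^sub>0 'r)"
      then obtain c where c: "c \<in> Poly_Mapping.keys y" "q \<in> Poly_Mapping.keys (unshuffle_chain c :: _ \<Rightarrow>\<^sub>0 'r)"
        by (auto elim!: keys_lin_extE)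
      obtain a b where q: "q = (a, b)" by (cases q)
      obtain i j where "a \<in> X.chains i" "b \<in> Y.chains j" using keys_unshuffle_chain[of c "Suc n" a b] c y(1) q by blast
      then show "pm_map cross_chain (tensor_chain_bd q) = (T.chain_bd (cross_chain q) :: _ \<Rightarrow>\<^sub>0 'r)"
        unfolding q by (simp add: chain_bd_cross_chain)
    qed
    finally show ?thesis by (simp add: lin_ext_pm_map)
  qed
  have key: "z - ?sP z = lin_ext T.chain_bd (y - ?sP y)"
  proof -
    have "?sP z - ?sP (lin_ext T.chain_bd y) = z - lin_ext T.chain_bd y"
      using fixed by (simp add: lin_ext_diff pm_map_diff)
    then show ?thesis unfolding lin_ext_diff natural by (simp add: algebra_simps)
  qed
  have "Poly_Mapping.keys (?sP y) \<subseteq> T.chains (Suc n)"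
  proof
    fix q assume "q \<in> Poly_Mapping.keys (?sP y)"
    then obtain a b where ab: "(a, b) \<in> Poly_Mapping.keys (lin_ext unshuffle_chain y :: _ \<Rightarrow>\<^sub>0 'r)" "q = cross_chain (a, b)"
      by (auto dest!: subsetD[OF keys_pm_map])
    then obtain c where c: "c \<in> Poly_Mapping.keys y" "(a, b) \<in> Poly_Mapping.keys (unshuffle_chain c :: _ \<Rightarrow>\<^sub>0 'r)"
      by (auto elim!: keys_lin_extE)
    obtain i j where "a \<in> X.chains i" "b \<in> Y.chains j" "i + j = Suc n" using keys_unshuffle_chain[of c "Suc n" a b] c y(1) by blast
    then show "q \<in> T.chains (Suc n)" using cross_chain_in ab(2) by metis
  qed
  then have "Poly_Mapping.keys (y - ?sP y) \<subseteq> T.chains (Suc n)"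
    using y(1) Poly_Mapping.keys_diff[of y "?sP y"] by blast
  then show ?thesis using key by blast
qed

end

section \<open>Labels for precubical sets\<close>

lemma inv_count_image:
  fixes f :: "nat \<Rightarrow> nat"
  assumes "strict_mono_on S f" "I \<subseteq> S" "J \<subseteq> S"
  shows "inv_count (f ` I) (f ` J) = inv_count I J"
proof -
  have inj: "inj_on f S" using assms(1) by (rule strict_mono_on_imp_inj_on)
  have "{(i, j). i \<in> f ` I \<and> j \<in> f ` J \<and> j < i} = map_prod f f ` {(i, j). i \<in> I \<and> j \<in> J \<and> j < i}"
  proof -
    have "f j < f i \<longleftrightarrow> j < i" if "i \<in> I" "j \<in> J" for i j
      using strict_mono_on_less[OF assms(1), of j i] that assms(2,3) by auto
    then show ?thesis by force
  qed
  moreover have "inj_on (map_prod f f) {(i, j). i \<in> I \<and> j \<in> J \<and> j < i}"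
    using inj assms(2,3) by (auto simp: inj_on_def subset_iff)
  ultimately show ?thesis unfolding inv_count_def by (simp add: card_image)
qed

text \<open>For \<open>j\<close> in \<open>I\<close>, the number \<open>j + 1\<close> counts the elements of \<open>I\<close> up to \<open>j\<close> and the smaller elements
  outside \<open>I\<close>. The former add up to \<open>1 + \<dots> + card I\<close>, the latter are the inversions.\<close>

lemma sgn_set_eq:
  assumes "I \<subseteq> {..<n}"
  shows "sgn_set I = (- 1 :: 'r::field) ^ inv_count I ({..<n} - I)"
proof -
  have fin: "finite I" using assms finite_subset by auto
  have "{(i, j). i \<in> I \<and> j \<in> {..<n} - I \<and> j < i} = (SIGMA i:I. {j. j < i \<and> j \<notin> I})"
    using assms by auto
  then have inv: "inv_count I ({..<n} - I) = (\<Sum>i\<in>I. card {j. j < i \<and> j \<notin> I})"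
    unfolding inv_count_def using fin by simp
  have "(\<Sum>i\<in>I. i + 1) = (\<Sum>i\<in>I. card {j. j < i \<and> j \<notin> I}) + (\<Sum>j=1..card I. j)"
    using fin
  proof (induction rule: finite_linorder_max_induct)
    case (insert m I)
    have m: "m \<notin> I" using insert by auto
    have "card {j. j < m \<and> j \<notin> insert m I} = m - card I"
    proof -
      have "{j. j < m \<and> j \<notin> insert m I} = {..<m} - I" by auto
      moreover have "I \<subseteq> {..<m}" using insert by auto
      ultimately show ?thesis using insert(1) by (simp add: card_Diff_subset)
    qed
    moreover have "card I \<le> m" using card_mono[of "{..<m}" I] insert by auto
    moreover have "(\<Sum>i\<in>I. card {j. j < i \<and> j \<notin> insert m I}) = (\<Sum>i\<in>I. card {j. j < i \<and> j \<notin> I})"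
    proof (rule sum.cong[OF refl])
      fix i assume "i \<in> I"
      then have "i < m" using insert by blast
      then have "{j. j < i \<and> j \<notin> insert m I} = {j. j < i \<and> j \<notin> I}" by auto
      then show "card {j. j < i \<and> j \<notin> insert m I} = card {j. j < i \<and> j \<notin> I}" by simp
    qed
    ultimately show ?case using insert m by simp
  qed simp
  then have "(\<Sum>j\<in>I. j + 1) = inv_count I ({..<n} - I) + (\<Sum>j=1..card I. j)" by (simp only: inv)
  moreover have "(p + q) mod 2 = q mod 2 \<longleftrightarrow> even p" for p q :: nat by presburger
  ultimately have "(\<Sum>j\<in>I. j + 1) mod 2 = (\<Sum>j=1..card I. j) mod 2 \<longleftrightarrow> even (inv_count I ({..<n} - I))"
    by (simp only:)
  then show ?thesis unfolding sgn_set_def by (simp add: minus_one_power_iff)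
qed

text \<open>The function \<open>lab c\<close> translates the face indices of the cube \<open>c\<close> into labels.\<close>

locale labelled_precubical = split_cubes Q dirs lo hi + precubical_set P
  for Q :: "'a set" and dirs lo hi and P :: "'a precubical" and lab :: "'a \<Rightarrow> nat \<Rightarrow> nat" +
  assumes cubes_eq: "cubes P = Q"
    and lab_mono: "c \<in> Q \<Longrightarrow> strict_mono_on {..<cdim P c} (lab c)"
    and lab_image: "c \<in> Q \<Longrightarrow> lab c ` {..<cdim P c} = dirs c"
    and iter_lo: "c \<in> Q \<Longrightarrow> I \<subseteq> {..<cdim P c} \<Longrightarrow> iter_face P False ({..<cdim P c} - I) c = lo (lab c ` I) c"
    and iter_hi: "c \<in> Q \<Longrightarrow> I \<subseteq> {..<cdim P c} \<Longrightarrow> iter_face P True I c = hi (lab c ` I) c"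
begin

lemma lab_inj: "c \<in> Q \<Longrightarrow> inj_on (lab c) {..<cdim P c}"
  using lab_mono strict_mono_on_imp_inj_on by blast

lemma cdim_eq: "c \<in> Q \<Longrightarrow> cdim P c = card (dirs c)"
  using card_image[OF lab_inj] lab_image by fastforce

lemma dirs_empty_iff: "c \<in> Q \<Longrightarrow> dirs c = {} \<longleftrightarrow> cdim P c = 0"
  using cdim_eq finite_dirs by simp

lemma vertices_eq: "vertices P = {c \<in> Q. dirs c = {}}"
  using dirs_empty_iff by (auto simp: vertices_def cubes_eq)

lemma corner_eq:
  assumes "c \<in> Q"
  shows "corner P False c = lo {} c" "corner P True c = hi (dirs c) c"
  using iter_lo[OF assms, of "{}"] iter_hi[OF assms, of "{..<cdim P c}"] lab_image[OF assms]
  by (simp_all add: corner_def)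

lemma is_cube_chain_eq: "is_cube_chain P (v, cs, w) \<longleftrightarrow> lchain v cs w"
proof (induction cs arbitrary: v)
  case Nil
  then show ?case by (auto simp: is_cube_chain_def vertices_eq)
next
  case (Cons c cs)
  show ?case
  proof (cases "c \<in> Q \<and> dirs c \<noteq> {}")
    case False
    then have "\<not> (c \<in> cubes P \<and> cdim P c > 0)" using dirs_empty_iff[of c] by (auto simp: cubes_eq)
    then have "\<not> is_cube_chain P (v, c # cs, w)" by (simp add: is_cube_chain_def)
    then show ?thesis using False by simp
  next
    case True
    then have c: "c \<in> Q" "dirs c \<noteq> {}" "cdim P c > 0" using dirs_empty_iff[of c] by simp_all
    have v: "lo {} c \<in> vertices P" "hi (dirs c) c \<in> vertices P"
      using c by (simp_all add: vertices_eq lo_in hi_in dirs_lo dirs_hi)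
    have all_Suc: "(\<forall>k. R k) \<longleftrightarrow> R 0 \<and> (\<forall>k. R (Suc k))" for R :: "nat \<Rightarrow> bool"
      by (metis not0_implies_Suc)
    have "is_cube_chain P (v, c # cs, w) \<longleftrightarrow> lo {} c = v \<and> is_cube_chain P (hi (dirs c) c, cs, w)"
    proof (cases cs)
      case Nil
      then show ?thesis using c v by (auto simp: is_cube_chain_def cubes_eq corner_eq)
    next
      case (Cons c' cs')
      have *: "(\<forall>k. Suc k < length (c # cs) \<longrightarrow> corner P True ((c # cs) ! k) = corner P False ((c # cs) ! Suc k)) \<longleftrightarrow>
          corner P True c = corner P False (hd cs) \<and>
          (\<forall>k. Suc k < length cs \<longrightarrow> corner P True (cs ! k) = corner P False (cs ! Suc k))"
        by (subst all_Suc) (simp add: Cons)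
      show ?thesis unfolding is_cube_chain_def prod.case *
        using c v by (auto simp: Cons cubes_eq corner_eq)
    qed
    then show ?thesis using c Cons.IH by simp
  qed
qed

lemma chain_dim_eq:
  assumes "set cs \<subseteq> {c \<in> Q. dirs c \<noteq> {}}"
  shows "chain_dim P (v, cs, w) = deg cs"
proof -
  have "(\<Sum>c\<leftarrow>cs. cdim P c) = deg cs + length cs"
    using assms
  proof (induction cs)
    case (Cons c cs)
    then have "cdim P c > 0" using dirs_empty_iff by auto
    then show ?case using Cons by (auto simp: cube_deg_def cdim_eq)
  qed simp
  then show ?thesis by (simp add: chain_dim_def)
qed

lemma cube_chains_eq: "cube_chains P n = chains n"
proof (intro subset_antisym subsetI)
  fix p assume p: "p \<in> cube_chains P n"
  obtain v cs w where "p = (v, cs, w)" by (cases p)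
  then show "p \<in> chains n" using p chain_dim_eq[OF lchain_set, of v cs w]
    by (simp add: cube_chains_def chains_def is_cube_chain_eq)
next
  fix p assume p: "p \<in> chains n"
  obtain v cs w where "p = (v, cs, w)" by (cases p)
  then show "p \<in> cube_chains P n" using p chain_dim_eq[OF lchain_set, of v cs w]
    by (simp add: cube_chains_def chains_def is_cube_chain_eq)
qed

definition index_bd1 :: "'a \<Rightarrow> ('a list \<Rightarrow>\<^sub>0 'r::field)" where
  "index_bd1 c = (\<Sum>r=1..cdim P c - 1. \<Sum>I\<in>{I. I \<subseteq> {..<cdim P c} \<and> card I = r}.
     pm_scale ((- 1) ^ r * sgn_set I)
       (basis_vec [iter_face P False ({..<cdim P c} - I) c, iter_face P True I c]))"

lemma index_bd1_eq:
  assumes c: "c \<in> Q"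
  shows "(index_bd1 c :: _ \<Rightarrow>\<^sub>0 'r::field) = bd1 c"
proof -
  let ?n = "cdim P c" and ?l = "lab c"
  let ?S = "{I. I \<subset> {..<?n} \<and> I \<noteq> {}}"
  let ?t = "\<lambda>I. pm_scale ((- 1) ^ card I * sgn_set I)
       (basis_vec [iter_face P False ({..<?n} - I) c, iter_face P True I c]) :: _ \<Rightarrow>\<^sub>0 'r"
  have finS: "finite ?S" by (rule finite_subset[of _ "Pow {..<?n}"]) auto
  have cardS: "card ` ?S \<subseteq> {1..?n - 1}"
  proof
    fix r assume "r \<in> card ` ?S"
    then obtain I where I: "I \<subset> {..<?n}" "I \<noteq> {}" "r = card I" by blast
    have "finite I" using I(1) finite_subset[of I "{..<?n}"] by auto
    then have "card I > 0" using I(2) by (simp add: card_gt_0_iff)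
    moreover have "card I < ?n" using psubset_card_mono[OF _ I(1)] by simp
    ultimately show "r \<in> {1..?n - 1}" using I(3) by simp
  qed
  have "index_bd1 c = (\<Sum>r\<in>{1..?n - 1}. \<Sum>I\<in>{I \<in> ?S. card I = r}. ?t I)"
    unfolding index_bd1_def
  proof (intro sum.cong refl)
    fix r assume r: "r \<in> {1..?n - 1}"
    show "{I. I \<subseteq> {..<?n} \<and> card I = r} = {I \<in> ?S. card I = r}"
    proof (intro Set.set_eqI iffI)
      fix I assume I: "I \<in> {I. I \<subseteq> {..<?n} \<and> card I = r}"
      then have "I \<noteq> {}" "I \<noteq> {..<?n}" using r by auto
      then show "I \<in> {I \<in> ?S. card I = r}" using I by blast
    qed auto
  qed auto
  also have "\<dots> = (\<Sum>I\<in>?S. ?t I)" by (rule sum.group[OF finS _ cardS]) simp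
  also have "\<dots> = (\<Sum>J\<in>splits c. pm_scale (split_sign c J) (basis_vec [lo J c, hi J c]))"
  proof (rule sum.reindex_bij_witness[of _ "\<lambda>J. {i \<in> {..<?n}. ?l i \<in> J}" "\<lambda>I. ?l ` I"], goal_cases)
    case (1 I)
    then have "I \<subseteq> {..<?n}" by auto
    then show ?case using lab_inj[OF c] by (auto simp: inj_on_def)
  next
    case (2 I)
    then have "I \<subset> {..<?n}" by simp
    then have "?l ` I \<subset> ?l ` {..<?n}" by (rule image_strict_mono[OF lab_inj[OF c]])
    then show ?case using 2 lab_image[OF c] by (simp add: splits_def)
  next
    case (3 J)
    then have "J \<subseteq> ?l ` {..<?n}" by (auto simp: splits_def lab_image[OF c])
    then show ?case by auto
  next
    case (4 J)
    then have J: "J \<subset> ?l ` {..<?n}" "J \<noteq> {}" by (auto simp: splits_def lab_image[OF c])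
    have "\<exists>i\<in>{..<?n}. ?l i \<in> J" using J by auto
    moreover have "\<exists>i\<in>{..<?n}. ?l i \<notin> J" using J by auto
    ultimately show ?case by blast
  next
    case (5 I)
    then have I: "I \<subseteq> {..<?n}" by auto
    have "card (?l ` I) = card I" using lab_inj[OF c] I by (meson card_image inj_on_subset)
    moreover have "dirs c - ?l ` I = ?l ` ({..<?n} - I)"
      using inj_on_image_set_diff[OF lab_inj[OF c], of "{..<?n}" I] I lab_image[OF c] by simp
    ultimately have "split_sign c (?l ` I) = ((- 1) ^ card I * sgn_set I :: 'r)"
      unfolding split_sign_def sgn_set_eq[OF I]
      by (simp add: inv_count_image[OF lab_mono[OF c] I] power_add)
    then show ?case using iter_lo[OF c I] iter_hi[OF c I] by simp
  qed
  finally show ?thesis by (simp add: bd1_def)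
qed

lemma chain_boundary_list:
  assumes "set cs \<subseteq> {c \<in> Q. dirs c \<noteq> {}}"
  shows "(\<Sum>k=1..length cs. pm_scale ((- 1) ^ ((\<Sum>c\<leftarrow>take (k - 1) cs. cdim P c) + k + 1))
    (pm_map (\<lambda>l. take (k - 1) cs @ l @ drop k cs) (index_bd1 (cs ! (k - 1))))) = (bd cs :: _ \<Rightarrow>\<^sub>0 'r::field)"
  (is "(\<Sum>k=1..length cs. ?g cs k) = _")
  using assms
proof (induction cs)
  case (Cons c cs)
  have c: "c \<in> Q" "cdim P c > 0" using Cons.prems dirs_empty_iff[of c] by simp_all
  have first_term: "(\<Sum>k=1..Suc n. f k) = f 1 + (\<Sum>k=1..n. f (Suc k))" for f :: "nat \<Rightarrow> 'a list \<Rightarrow>\<^sub>0 'r" and n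
    by (simp only: sum.atLeast1_atMost_eq sum.lessThan_Suc_shift One_nat_def)
  have "(\<Sum>k=1..length (c # cs). ?g (c # cs) k) = ?g (c # cs) 1 + (\<Sum>k=1..length cs. ?g (c # cs) (Suc k))"
    by (simp only: length_Cons first_term)
  also have "?g (c # cs) 1 = pm_map (\<lambda>l. l @ cs) (bd1 c)" using c by (simp add: index_bd1_eq)
  also have "(\<Sum>k=1..length cs. ?g (c # cs) (Suc k)) =
      (\<Sum>k=1..length cs. pm_scale ((- 1) ^ cube_deg c) (pm_map ((#) c) (?g cs k)))"
  proof (rule sum.cong[OF refl])
    fix k assume "k \<in> {1..length cs}"
    then obtain j where k: "k = Suc j" by (cases k) auto
    \<comment> \<open>With \<open>c\<close> put in front, the index of the split cube grows by one, and the exponent by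
      \<open>cdim P c + 1\<close>, which has the parity of \<open>cube_deg c\<close>.\<close>
    have "(- 1 :: 'r) ^ (cdim P c + (\<Sum>c\<leftarrow>take j cs. cdim P c) + Suc k + 1) =
        (- 1) ^ cube_deg c * (- 1) ^ ((\<Sum>c\<leftarrow>take j cs. cdim P c) + k + 1)"
      using c by (cases "cdim P c") (simp_all add: cube_deg_def cdim_eq[symmetric] power_add)
    then show "?g (c # cs) (Suc k) = pm_scale ((- 1) ^ cube_deg c) (pm_map ((#) c) (?g cs k))"
      by (simp add: k pm_map_scale pm_map_pm_map)
  qed
  also have "\<dots> = pm_scale ((- 1) ^ cube_deg c) (pm_map ((#) c) (bd cs))"
    using Cons by (simp add: pm.scale_sum_right[symmetric] pm_map_sum[symmetric])
  finally show ?case by simp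
qed simp

lemma chain_boundary_eq:
  assumes "p \<in> chains n"
  shows "chain_boundary P p = (chain_bd p :: _ \<Rightarrow>\<^sub>0 'r::field)"
proof -
  obtain v cs w where p: "p = (v, cs, w)" by (cases p)
  have cs: "set cs \<subseteq> {c \<in> Q. dirs c \<noteq> {}}" using assms lchain_set by (auto simp: p chains_def)
  show ?thesis
    unfolding p chain_bd_def prod.case chain_boundary_list[OF cs, symmetric] pm_map_sum chain_boundary_def
    by (rule sum.cong[OF refl])
      (simp add: index_bd1_def pm_map_minus pm_map_scale pm_map_sum pm_map_pm_map pm.scale_sum_right split_chain_def
        Let_def power_add mult.assoc)
qed

lemma boundary_eq:
  assumes "Poly_Mapping.keys f \<subseteq> chains n"
  shows "boundary P f = (lin_ext chain_bd f :: _ \<Rightarrow>\<^sub>0 'r::field)"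
  unfolding boundary_def by (rule lin_ext_cong[OF refl]) (use assms chain_boundary_eq in blast)

end

subsection \<open>Iterated faces in a tensor product\<close>

text \<open>Iterated faces apply the largest index first. This bound shows that a smaller index is still
  within the dimension of the face that has been reached.\<close>

lemma sorted_wrt_less_length:
  fixes l :: "nat list"
  assumes "sorted_wrt (<) (i # l)" "set (i # l) \<subseteq> {..<m}"
  shows "i < m - length l"
proof -
  have "distinct (i # l)" using assms(1) strict_sorted_iff by blast
  then have "length (i # l) = card (set (i # l))" using distinct_card by metis
  also have "\<dots> \<le> card {i..<m}" 
  proof (intro card_mono subsetI)
    fix x assume "x \<in> set (i # l)"
    then have "i \<le> x" "x < m" using assms by (cases "x = i"; auto)+
    then show "x \<in> {i..<m}" by simp
  qed simp
  finally have "Suc (length l) \<le> m - i" by simp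
  then show ?thesis by arith
qed

lemma (in precubical_set) foldr_face:
  assumes "c \<in> cubes X" "sorted_wrt (<) l" "set l \<subseteq> {..<cdim X c}"
  shows "foldr (face X e) l c \<in> cubes X \<and> cdim X (foldr (face X e) l c) = cdim X c - length l"
  using assms(2,3)
proof (induction l)
  case (Cons i l)
  have "i < cdim X c - length l" using sorted_wrt_less_length Cons.prems by blast
  then show ?case using Cons face_in_cubes cdim_face by simp
qed (use assms in simp)

lemma sorted_list_of_set_split:
  fixes I :: "nat set"
  assumes "finite I"
  shows "sorted_list_of_set I = sorted_list_of_set (I \<inter> {..<m}) @ map ((+) m) (sorted_list_of_set {k. m + k \<in> I})"
proof -
  have fin: "finite {k. m + k \<in> I}"
    using finite_vimageI[OF assms, of "(+) m"] by (simp add: vimage_def)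
  have elems: "set (sorted_list_of_set (I \<inter> {..<m}) @ map ((+) m) (sorted_list_of_set {k. m + k \<in> I})) = I"
    using assms fin by (auto simp: image_iff) (metis le_add_diff_inverse not_less)
  have "sorted_wrt (<) (sorted_list_of_set (I \<inter> {..<m}) @ map ((+) m) (sorted_list_of_set {k. m + k \<in> I}))"
    using assms fin by (auto simp: sorted_wrt_append sorted_wrt_map)
  then show ?thesis
    by (rule strict_sorted_equal[OF _ strict_sorted_list_of_set])
      (simp only: elems set_sorted_list_of_set[OF assms])
qed

text \<open>The indices of the second factor are the large ones, so their faces are applied first and do
  not change the dimension of the first factor.\<close>

lemma iter_face_tensor:
  assumes "precubical_set X" "a \<in> cubes X" "finite I"
  shows "iter_face (tensor_precubical X Y) e I (a, b) =
    (iter_face X e (I \<inter> {..<cdim X a}) a, iter_face Y e {k. cdim X a + k \<in> I} b)"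
proof -
  interpret X: precubical_set X by fact
  let ?m = "cdim X a" and ?f = "face (tensor_precubical X Y) e"
  have "foldr ?f (map ((+) ?m) l) (a, b) = (a, foldr (face Y e) l b)" for l
    by (induction l) (simp_all add: tensor_precubical_def)
  moreover have "foldr ?f l (a, b') = (foldr (face X e) l a, b')"
    if "sorted_wrt (<) l" "set l \<subseteq> {..<?m}" for l b'
    using that
  proof (induction l)
    case (Cons i l)
    have "i < ?m - length l" using sorted_wrt_less_length Cons.prems by blast
    moreover have "cdim X (foldr (face X e) l a) = ?m - length l"
      using X.foldr_face[OF assms(2), of l e] Cons.prems by simp
    ultimately show ?case using Cons by (simp add: tensor_precubical_def)
  qed simp
  ultimately show ?thesis unfolding iter_face_def
    by (subst sorted_list_of_set_split[OF assms(3), of ?m]) (simp add: assms(3))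
qed

locale labelled_tensor = tensor_cubes Q1 dirs1 lo1 hi1 Q2 dirs2 lo2 hi2 +
  X: labelled_precubical Q1 dirs1 lo1 hi1 P1 lab1 + Y: labelled_precubical Q2 dirs2 lo2 hi2 P2 lab2
  for Q1 :: "'a set" and dirs1 lo1 hi1 and Q2 :: "'b set" and dirs2 lo2 hi2 and P1 P2 lab1 lab2
begin

definition tlab :: "'a \<times> 'b \<Rightarrow> nat \<Rightarrow> nat" where
  "tlab = (\<lambda>(a, b) i. if i < cdim P1 a then lab1 a i else lab2 b (i - cdim P1 a))"

lemma tlab_image:
  assumes "I \<subseteq> {..<cdim P1 a + n}"
  shows "tlab (a, b) ` I = lab1 a ` (I \<inter> {..<cdim P1 a}) \<union> lab2 b ` {k. cdim P1 a + k \<in> I}"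
proof (intro subset_antisym subsetI)
  fix x assume "x \<in> tlab (a, b) ` I"
  then obtain i where i: "i \<in> I" "x = tlab (a, b) i" by blast
  show "x \<in> lab1 a ` (I \<inter> {..<cdim P1 a}) \<union> lab2 b ` {k. cdim P1 a + k \<in> I}"
  proof (cases "i < cdim P1 a")
    case True
    then show ?thesis using i by (auto simp: tlab_def)
  next
    case False
    then have "cdim P1 a + (i - cdim P1 a) \<in> I" "x = lab2 b (i - cdim P1 a)" using i by (auto simp: tlab_def)
    then show ?thesis by blast
  qed
next
  fix x assume "x \<in> lab1 a ` (I \<inter> {..<cdim P1 a}) \<union> lab2 b ` {k. cdim P1 a + k \<in> I}"
  then consider i where "i \<in> I" "i < cdim P1 a" "x = lab1 a i" | k where "cdim P1 a + k \<in> I" "x = lab2 b k" by auto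
  then show "x \<in> tlab (a, b) ` I"
  proof cases
    case 1
    then have "x = tlab (a, b) i" by (simp add: tlab_def)
    then show ?thesis using 1 by blast
  next
    case 2
    then have "x = tlab (a, b) (cdim P1 a + k)" by (simp add: tlab_def)
    then show ?thesis using 2 by blast
  qed
qed

lemma lab_blocks:
  assumes ab: "a \<in> Q1" "b \<in> Q2" and I: "I \<subseteq> {..<cdim P1 a + cdim P2 b}"
  shows "tlab (a, b) ` I \<inter> dirs1 a = lab1 a ` (I \<inter> {..<cdim P1 a})"
    "tlab (a, b) ` I \<inter> dirs2 b = lab2 b ` {k. cdim P1 a + k \<in> I}"
proof -
  have "lab1 a ` (I \<inter> {..<cdim P1 a}) \<subseteq> dirs1 a" using X.lab_image[OF ab(1)] by auto
  moreover have "{k. cdim P1 a + k \<in> I} \<subseteq> {..<cdim P2 b}" using I by auto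
  then have "lab2 b ` {k. cdim P1 a + k \<in> I} \<subseteq> dirs2 b" using Y.lab_image[OF ab(2)] by auto
  ultimately show "tlab (a, b) ` I \<inter> dirs1 a = lab1 a ` (I \<inter> {..<cdim P1 a})"
    "tlab (a, b) ` I \<inter> dirs2 b = lab2 b ` {k. cdim P1 a + k \<in> I}"
    unfolding tlab_image[OF I] using dirs_disjoint[OF ab] by blast+
qed

sublocale T: labelled_precubical "Q1 \<times> Q2" tdirs tlo thi "tensor_precubical P1 P2" tlab
proof -
  let ?P = "tensor_precubical P1 P2"
  have cd: "cdim ?P (a, b) = cdim P1 a + cdim P2 b" for a b by (simp add: tensor_precubical_def)
  interpret TP: precubical_set ?P
    by (rule precubical_set_tensor) (unfold_locales)
  show "labelled_precubical (Q1 \<times> Q2) tdirs tlo thi ?P tlab"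
  proof (unfold_locales, goal_cases)
    case 1
    then show ?case by (simp add: tensor_precubical_def X.cubes_eq Y.cubes_eq)
  next
    case (2 c)
    obtain a b where c: "c = (a, b)" by (cases c)
    have ab: "a \<in> Q1" "b \<in> Q2" using 2 by (auto simp: c)
    show ?case
    proof (rule strict_mono_onI)
      fix r s assume rs: "r \<in> {..<cdim ?P c}" "s \<in> {..<cdim ?P c}" "r < s"
      consider "s < cdim P1 a" | "r < cdim P1 a" "cdim P1 a \<le> s" | "cdim P1 a \<le> r" by linarith
      then show "tlab c r < tlab c s"
      proof cases
        case 1
        then show ?thesis using rs strict_mono_onD[OF X.lab_mono[OF ab(1)], of r s] by (simp add: tlab_def c)
      next
        case 2
        have "lab1 a r \<in> dirs1 a" using X.lab_image[OF ab(1)] 2 by auto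
        moreover have "lab2 b (s - cdim P1 a) \<in> dirs2 b"
          using Y.lab_image[OF ab(2)] 2 rs by (auto simp: c cd)
        ultimately show ?thesis using dirs_less[OF ab] 2 by (simp add: tlab_def c)
      next
        case 3
        then have "r - cdim P1 a < s - cdim P1 a" "s - cdim P1 a < cdim P2 b" using rs by (auto simp: c cd)
        then show ?thesis using 3 rs strict_mono_onD[OF Y.lab_mono[OF ab(2)], of "r - cdim P1 a" "s - cdim P1 a"]
          by (simp add: tlab_def c)
      qed
    qed
  next
    case (3 c)
    obtain a b where c: "c = (a, b)" by (cases c)
    have ab: "a \<in> Q1" "b \<in> Q2" using 3 by (auto simp: c)
    have "{..<cdim P1 a + cdim P2 b} \<inter> {..<cdim P1 a} = {..<cdim P1 a}" by auto
    moreover have "{k. cdim P1 a + k \<in> {..<cdim P1 a + cdim P2 b}} = {..<cdim P2 b}" by auto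
    ultimately show ?case unfolding c cd tlab_image[OF order_refl] tdirs_pair
      using X.lab_image[OF ab(1)] Y.lab_image[OF ab(2)] by simp
  next
    case (4 c I)
    obtain a b where c: "c = (a, b)" by (cases c)
    have ab: "a \<in> Q1" "b \<in> Q2" using 4 by (auto simp: c)
    have I: "I \<subseteq> {..<cdim P1 a + cdim P2 b}" using 4 by (simp add: c cd)
    let ?J = "{..<cdim P1 a + cdim P2 b} - I"
    have A: "?J \<inter> {..<cdim P1 a} = {..<cdim P1 a} - (I \<inter> {..<cdim P1 a})"
      and B: "{k. cdim P1 a + k \<in> ?J} = {..<cdim P2 b} - {k. cdim P1 a + k \<in> I}" by auto
    have I2: "{k. cdim P1 a + k \<in> I} \<subseteq> {..<cdim P2 b}" "I \<inter> {..<cdim P1 a} \<subseteq> {..<cdim P1 a}" using I by auto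
    have "a \<in> cubes P1" "finite ?J" using ab(1) by (simp_all add: X.cubes_eq)
    from iter_face_tensor[OF X.precubical_set_axioms this, where Y = P2 and e = False and b = b] show ?case
      unfolding c cd tlo_pair lab_blocks[OF ab I] A B X.iter_lo[OF ab(1) I2(2)] Y.iter_lo[OF ab(2) I2(1)] .
  next
    case (5 c I)
    obtain a b where c: "c = (a, b)" by (cases c)
    have ab: "a \<in> Q1" "b \<in> Q2" using 5 by (auto simp: c)
    have I: "I \<subseteq> {..<cdim P1 a + cdim P2 b}" using 5 by (simp add: c cd)
    have I2: "{k. cdim P1 a + k \<in> I} \<subseteq> {..<cdim P2 b}" "I \<inter> {..<cdim P1 a} \<subseteq> {..<cdim P1 a}" using I by auto
    have "a \<in> cubes P1" "finite I" using ab(1) finite_subset[OF I] by (simp_all add: X.cubes_eq)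
    from iter_face_tensor[OF X.precubical_set_axioms this, where Y = P2 and e = True and b = b] show ?case
      unfolding c thi_pair lab_blocks[OF ab I] X.iter_hi[OF ab(1) I2(2)] Y.iter_hi[OF ab(2) I2(1)] .
  qed
qed

end

subsection \<open>Cubical complexes\<close>

text \<open>The shift \<open>s\<close> is \<open>0\<close> for the first factor of a product. For the second it is the dimension \<open>d\<close>
  of the space of the first factor, which makes its labels the larger ones.\<close>

definition cube_dirs :: "nat \<Rightarrow> euclidean_cube \<Rightarrow> nat set" where
  "cube_dirs s c = (+) s ` fst c"

definition cube_lo :: "nat \<Rightarrow> nat set \<Rightarrow> euclidean_cube \<Rightarrow> euclidean_cube" where
  "cube_lo s I = (\<lambda>(D, x). ({k \<in> D. s + k \<in> I}, x))"

definition cube_hi :: "nat \<Rightarrow> nat set \<Rightarrow> euclidean_cube \<Rightarrow> euclidean_cube" where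
  "cube_hi s I = (\<lambda>(D, x). ({k \<in> D. s + k \<notin> I}, \<lambda>k. if k \<in> D \<and> s + k \<in> I then x k + 1 else x k))"

definition cube_lab :: "nat \<Rightarrow> euclidean_cube \<Rightarrow> nat \<Rightarrow> nat" where
  "cube_lab s c i = s + sorted_list_of_set (fst c) ! i"

text \<open>Removing later elements does not change the positions of earlier ones.\<close>

lemma sorted_list_of_set_Diff_nth:
  assumes "finite D" "i < card D" "\<And>j. j \<in> J \<Longrightarrow> i < j \<and> j < card D"
  shows "sorted_list_of_set (D - (!) (sorted_list_of_set D) ` J) ! i = sorted_list_of_set D ! i"
proof -
  let ?l = "sorted_list_of_set D" and ?S = "(!) (sorted_list_of_set D) ` J"
  have len: "length ?l = card D" using assms(1) by simp
  have "sorted_list_of_set (D - ?S) = filter (\<lambda>k. k \<notin> ?S) ?l"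
  proof (rule strict_sorted_equal)
    show "sorted_wrt (<) (filter (\<lambda>k. k \<notin> ?S) ?l)" by (rule sorted_wrt_filter) simp
  qed (use assms(1) in auto)
  also have "\<dots> = filter (\<lambda>k. k \<notin> ?S) (take (Suc i) ?l) @ filter (\<lambda>k. k \<notin> ?S) (drop (Suc i) ?l)"
    by (simp only: filter_append[symmetric] append_take_drop_id)
  also have "filter (\<lambda>k. k \<notin> ?S) (take (Suc i) ?l) = take (Suc i) ?l"
  proof (rule filter_True, rule ballI, rule notI)
    fix x assume "x \<in> set (take (Suc i) ?l)" "x \<in> ?S"
    then obtain m j where m: "m < Suc i" "x = ?l ! m" "j \<in> J" "x = ?l ! j"
      using assms(2) len by (auto simp: in_set_conv_nth)
    then have "m = j" using nth_eq_iff_index_eq[of ?l m j] assms len by force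
    then show False using m assms(3) by fastforce
  qed
  finally show ?thesis using assms(2) len by (simp add: nth_append)
qed

lemma iter_face_cubical:
  assumes "finite D" "I \<subseteq> {..<card D}"
  shows "iter_face (cubical_precubical K) e I (D, x) =
    (D - (!) (sorted_list_of_set D) ` I,
     \<lambda>k. if e \<and> k \<in> (!) (sorted_list_of_set D) ` I then x k + 1 else x k)"
proof -
  let ?n = "(!) (sorted_list_of_set D)"
  have *: "foldr (cube_face e) l (D, x) = (D - ?n ` set l, \<lambda>k. if e \<and> k \<in> ?n ` set l then x k + 1 else x k)"
    if "sorted_wrt (<) l" "set l \<subseteq> {..<card D}" for l
    using that
  proof (induction l)
    case (Cons i l)
    have i: "sorted_list_of_set (D - ?n ` set l) ! i = ?n i"
      by (rule sorted_list_of_set_Diff_nth) (use Cons.prems assms(1) in auto)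
    have new: "?n i \<notin> ?n ` set l"
    proof
      assume "?n i \<in> ?n ` set l"
      then obtain j where j: "j \<in> set l" "?n i = ?n j" by blast
      then have "i = j" using nth_eq_iff_index_eq[of "sorted_list_of_set D" i j] Cons.prems assms(1) by auto
      then show False using j Cons.prems by auto
    qed
    have IH: "foldr (cube_face e) l (D, x) = (D - ?n ` set l, \<lambda>k. if e \<and> k \<in> ?n ` set l then x k + 1 else x k)"
      using Cons by simp
    show ?case unfolding foldr.simps comp_apply IH using new
      by (auto simp: cube_face_def i Let_def fun_eq_iff)
  qed simp
  have "finite I" using finite_subset[OF assms(2)] by simp
  then show ?thesis using *[of "sorted_list_of_set I"] assms(2)
    by (simp add: iter_face_def cubical_precubical_def)
qed

lemma labelled_cubical:
  assumes "cubical_complex d K"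
  shows "labelled_precubical K (cube_dirs s) (cube_lo s) (cube_hi s) (cubical_precubical K) (cube_lab s)"
proof -
  interpret P: precubical_set "cubical_precubical K" by (rule precubical_set_cubical[OF assms])
  have fin: "finite D" if "(D, x) \<in> K" for D x using cubical_complex_finite_directions[OF assms that] by simp
  have cd: "cubes (cubical_precubical K) = K" "cdim (cubical_precubical K) (D, x) = card D" for D x
    by (simp_all add: cubical_precubical_def)
  have nth: "(!) (sorted_list_of_set D) ` {..<card D} = D" "inj_on ((!) (sorted_list_of_set D)) {..<card D}"
    if "finite D" for D :: "nat set"
    using that nth_image[of "card D" "sorted_list_of_set D"] by (auto simp: lessThan_atLeast0 intro: inj_on_nth)
  have iter: "iter_face (cubical_precubical K) e I (D, x) \<in> K" if "(D, x) \<in> K" "I \<subseteq> {..<card D}" for e I D x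
  proof -
    have "finite I" using that(2) finite_subset by blast
    then show ?thesis unfolding iter_face_def
      using P.foldr_face[of "(D, x)" "sorted_list_of_set I" e] that by (simp add: cd)
  qed
  have lo: "iter_face (cubical_precubical K) False ({..<card D} - I) (D, x) = cube_lo s (cube_lab s (D, x) ` I) (D, x)"
    if D: "(D, x) \<in> K" "I \<subseteq> {..<card D}" for I D x
  proof -
    let ?n = "(!) (sorted_list_of_set D)"
    have "D - ?n ` ({..<card D} - I) = ?n ` I"
      using inj_on_image_set_diff[OF nth(2)[OF fin[OF D(1)]], of "{..<card D}" "{..<card D} - I"] D(2)
        nth(1)[OF fin[OF D(1)]] by (simp add: double_diff)
    moreover have "?n ` I \<subseteq> D" using D(2) nth(1)[OF fin[OF D(1)]] by blast
    ultimately show ?thesis using iter_face_cubical[OF fin[OF D(1)], of "{..<card D} - I" K False x]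
      by (auto simp: cube_lo_def cube_lab_def)
  qed
  have hi: "iter_face (cubical_precubical K) True I (D, x) = cube_hi s (cube_lab s (D, x) ` I) (D, x)"
    if D: "(D, x) \<in> K" "I \<subseteq> {..<card D}" for I D x
  proof -
    let ?n = "(!) (sorted_list_of_set D)"
    have "?n ` I \<subseteq> D" using D(2) nth(1)[OF fin[OF D(1)]] by blast
    then show ?thesis using iter_face_cubical[OF fin[OF D(1)] D(2), of K True x]
      by (auto simp: cube_hi_def cube_lab_def fun_eq_iff)
  qed
  have ex: "\<exists>J\<subseteq>{..<card D}. cube_lab s (D, x) ` J = I" if D: "(D, x) \<in> K" "I \<subseteq> cube_dirs s (D, x)" for D x I
  proof -
    have "I \<subseteq> cube_lab s (D, x) ` {..<card D}"
      using D(2) nth(1)[OF fin[OF D(1)]] by (force simp: cube_dirs_def cube_lab_def)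
    then obtain J where "J \<subseteq> {..<card D}" "I = cube_lab s (D, x) ` J" unfolding subset_image_iff by blast
    then show ?thesis by blast
  qed
  have lo_in: "cube_lo s I (D, x) \<in> K" and hi_in: "cube_hi s I (D, x) \<in> K"
    if D: "(D, x) \<in> K" "I \<subseteq> cube_dirs s (D, x)" for D x I
  proof -
    obtain J where J: "J \<subseteq> {..<card D}" "cube_lab s (D, x) ` J = I" using ex[OF D] by blast
    show "cube_lo s I (D, x) \<in> K" using lo[OF D(1) J(1)] iter[OF D(1), of "{..<card D} - J" False] J(2) by auto
    show "cube_hi s I (D, x) \<in> K" using hi[OF D(1) J(1)] iter[OF D(1) J(1), of True] J(2) by auto
  qed
  show ?thesis
  proof (unfold_locales, goal_cases)
    case (1 c)
    then show ?case using cubical_complex_finite_directions[OF assms] by (simp add: cube_dirs_def)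
  next
    case (2 c I)
    then show ?case using lo_in by (cases c) simp
  next
    case (3 c I)
    then show ?case by (cases c) (auto simp: cube_dirs_def cube_lo_def)
  next
    case (4 c I)
    then show ?case using hi_in by (cases c) simp
  next
    case (5 c I)
    then show ?case by (cases c) (auto simp: cube_dirs_def cube_hi_def)
  next
    case (6 c A I)
    then have "k \<in> I" if "k \<in> A" for k using that by blast
    then show ?case by (cases c) (auto simp: cube_lo_def)
  next
    case (7 c A B)
    then have "s + k \<notin> B" if "s + k \<in> A" for k using that by blast
    then show ?case by (cases c) (auto simp: cube_hi_def)
  next
    case (8 c A B)
    then have "s + k \<notin> B" if "s + k \<in> A" for k using that by blast
    then show ?case by (cases c) (auto simp: cube_hi_def cube_lo_def)
  next
    case (9 c)
    then show ?case by (cases c) (auto simp: cube_lo_def cube_dirs_def)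
  next
    case (10 c)
    then show ?case by (cases c) (auto simp: cube_hi_def)
  next
    case 11
    then show ?case by (simp add: cd)
  next
    case (12 c)
    then show ?case using fin
      by (cases c) (auto intro!: strict_mono_onI simp: cd cube_lab_def sorted_wrt_nth_less[OF strict_sorted_list_of_set])
  next
    case (13 c)
    obtain D x where c: "c = (D, x)" by (cases c)
    have "cube_lab s (D, x) ` {..<card D} = (+) s ` ((!) (sorted_list_of_set D) ` {..<card D})"
      by (auto simp: cube_lab_def)
    then show ?case using 13 nth(1)[OF fin] by (simp add: c cd cube_dirs_def)
  next
    case (14 c I)
    then show ?case using lo by (cases c) (simp add: cd)
  next
    case (15 c I)
    then show ?case using hi by (cases c) (simp add: cd)
  qed
qed

lemma labelled_tensor_cubical:
  assumes "cubical_complex d K" "cubical_complex d' L"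
  shows "labelled_tensor K (cube_dirs 0) (cube_lo 0) (cube_hi 0) L (cube_dirs d) (cube_lo d) (cube_hi d)
    (cubical_precubical K) (cubical_precubical L) (cube_lab 0) (cube_lab d)"
proof -
  interpret X: labelled_precubical K "cube_dirs 0" "cube_lo 0" "cube_hi 0" "cubical_precubical K" "cube_lab 0"
    by (rule labelled_cubical[OF assms(1)])
  interpret Y: labelled_precubical L "cube_dirs d" "cube_lo d" "cube_hi d" "cubical_precubical L" "cube_lab d"
    by (rule labelled_cubical[OF assms(2)])
  show ?thesis
  proof (unfold_locales, goal_cases)
    case (1 a b i j)
    have "fst a \<subseteq> {1..d}" using assms(1) 1(1) unfolding cubical_complex_def by (cases a) auto
    moreover have "fst b \<subseteq> {1..d'}" using assms(2) 1(2) unfolding cubical_complex_def by (cases b) auto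
    ultimately show ?case using 1(3,4) unfolding cube_dirs_def by fastforce
  qed
qed

section \<open>The path algebra and its bimodules\<close>

lemma subspace_kernel:
  "pm.subspace V \<Longrightarrow> pm.subspace {f \<in> V. lin_ext g f = 0}"
  unfolding pm.subspace_def by (simp add: lin_ext_add lin_ext_scale)

lemma chain_mult_basis [simp]: "chain_mult (basis_vec p) (basis_vec q) = chain_concat p q"
  by (simp add: chain_mult_def)

lemma chain_mult_basis_left: "chain_mult (basis_vec p) g = lin_ext (chain_concat p) g"
  by (simp add: chain_mult_def)

lemma chain_mult_basis_right: "chain_mult f (basis_vec q) = lin_ext (\<lambda>p. chain_concat p q) f"
  by (simp add: chain_mult_def)

lemma linear_chain_mult: "Vector_Spaces.linear pm_scale pm_scale (chain_mult u)"
  "Vector_Spaces.linear pm_scale pm_scale (\<lambda>z. chain_mult z u)"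
  by (unfold_locales; simp add: chain_mult_def lin_ext_add lin_ext_scale lin_ext_fun_add lin_ext_fun_scale)+

lemma chain_mult_lin_ext_left: "chain_mult (lin_ext F f) g = lin_ext (\<lambda>p. chain_mult (F p) g) f"
  by (rule linear_of_lin_ext[OF linear_chain_mult(2)])

lemma chain_mult_lin_ext_right: "chain_mult f (lin_ext F g) = lin_ext (\<lambda>p. chain_mult f (F p)) g"
  by (rule linear_of_lin_ext[OF linear_chain_mult(1)])

lemma chain_mult_simps:
  "chain_mult (f + f') g = chain_mult f g + chain_mult f' g"
  "chain_mult f (g + g') = chain_mult f g + chain_mult f g'"
  "chain_mult (f - f') g = chain_mult f g - chain_mult f' g"
  "chain_mult f (g - g') = chain_mult f g - chain_mult f g'"
  "chain_mult (pm_scale c f) g = pm_scale c (chain_mult f g)"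
  "chain_mult f (pm_scale c g) = pm_scale c (chain_mult f g)"
  "chain_mult 0 g = 0" "chain_mult f 0 = 0"
  by (simp_all add: chain_mult_def lin_ext_add lin_ext_diff lin_ext_scale lin_ext_fun_add
      lin_ext_fun_diff lin_ext_fun_scale)

lemma chain_mult_assoc: "chain_mult (chain_mult f g) h = chain_mult f (chain_mult g h)"
proof -
  have *: "lin_ext (\<lambda>p. lin_ext (chain_concat p) h) (chain_concat q r) =
      lin_ext (\<lambda>s. lin_ext (chain_concat q) (chain_concat r s)) h" for q r
  proof -
    obtain v cs w where q: "q = (v, cs, w)" by (cases q)
    obtain v' ds w' where r: "r = (v', ds, w')" by (cases r)
    show ?thesis
    proof (cases "w = v'")
      case True
      then show ?thesis
        by (auto simp: q r chain_concat_def intro!: lin_ext_cong)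
    next
      case False
      have "lin_ext (\<lambda>s. lin_ext (chain_concat q) (chain_concat r s)) h = lin_ext (\<lambda>s. 0) h"
        by (rule lin_ext_cong[OF refl]) (use False in \<open>auto simp: q r chain_concat_def\<close>)
      then show ?thesis using False by (simp add: q r chain_concat_def)
    qed
  qed
  show ?thesis unfolding chain_mult_def lin_ext_lin_ext * ..
qed

context labelled_precubical
begin

definition span_chains :: "nat \<Rightarrow> ('a cube_chain \<Rightarrow>\<^sub>0 'r::field) set" where
  "span_chains n = {f. Poly_Mapping.keys f \<subseteq> chains n}"

abbreviation bnd :: "('a cube_chain \<Rightarrow>\<^sub>0 'r::field) \<Rightarrow> ('a cube_chain \<Rightarrow>\<^sub>0 'r)" where
  "bnd \<equiv> lin_ext chain_bd"

lemma subspace_span_chains: "pm.subspace (span_chains n)"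
  unfolding span_chains_def by (rule subspace_keys)

lemma basis_span_chains [simp]: "basis_vec c \<in> span_chains n \<longleftrightarrow> c \<in> chains n"
  by (simp add: span_chains_def)

lemma span_chainsD: "f \<in> span_chains n \<Longrightarrow> c \<in> Poly_Mapping.keys f \<Longrightarrow> c \<in> chains n"
  by (auto simp: span_chains_def)

lemma lin_ext_span_chains:
  "f \<in> span_chains m \<Longrightarrow> (\<And>c. c \<in> chains m \<Longrightarrow> F c \<in> span_chains n) \<Longrightarrow> lin_ext F f \<in> span_chains n"
  by (rule lin_ext_in_subspace[OF subspace_span_chains]) (auto dest: span_chainsD)

lemma chain_bd_span_chains: "c \<in> chains (Suc n) \<Longrightarrow> (chain_bd c :: _ \<Rightarrow>\<^sub>0 'r::field) \<in> span_chains n"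
  using keys_chain_bd[of c "Suc n", where 'r = 'r] by (auto simp: span_chains_def)

lemma chain_bd_chains_0: "c \<in> chains 0 \<Longrightarrow> (chain_bd c :: _ \<Rightarrow>\<^sub>0 'r::field) = 0"
proof -
  assume "c \<in> chains 0"
  then have "Poly_Mapping.keys (chain_bd c :: _ \<Rightarrow>\<^sub>0 'r) = {}" using keys_chain_bd[of c 0, where 'r = 'r] by auto
  then show ?thesis by simp
qed

lemma bnd_span_chains: "f \<in> span_chains (Suc n) \<Longrightarrow> bnd f \<in> span_chains n"
  by (rule lin_ext_span_chains) (auto intro: chain_bd_span_chains)

lemma bnd_chains_0: "f \<in> span_chains 0 \<Longrightarrow> bnd f = 0"
proof -
  assume f: "f \<in> span_chains 0"
  have "bnd f = lin_ext (\<lambda>_. 0) f"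
    by (rule lin_ext_cong[OF refl]) (erule chain_bd_chains_0[OF span_chainsD[OF f]])
  then show ?thesis by simp
qed

lemma bnd_bnd:
  assumes "f \<in> span_chains n"
  shows "bnd (bnd f) = 0"
proof -
  have "bnd (bnd f) = lin_ext (\<lambda>_. 0) f"
    unfolding lin_ext_lin_ext by (rule lin_ext_cong[OF refl]) (erule chain_bd_chain_bd[OF span_chainsD[OF assms]])
  then show ?thesis by simp
qed

lemma boundary_eq_bnd: "f \<in> span_chains n \<Longrightarrow> boundary P f = bnd f"
  by (rule boundary_eq[of f n]) (simp add: span_chains_def)

lemma chain_space_eq: "chain_space P (Suc n) = span_chains n"
  by (simp add: chain_space_def span_chains_def cube_chains_eq)

lemma cycles_eq: "cycles P (Suc n) = {f \<in> span_chains n. bnd f = 0}"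
  unfolding cycles_def chain_space_eq by (auto simp: boundary_eq_bnd[of _ n])

lemma boundaries_eq: "boundaries P (Suc n) = bnd ` span_chains (Suc n)"
  unfolding boundaries_def Suc_eq_plus1[symmetric] chain_space_eq by (simp add: boundary_eq_bnd[of _ "Suc n"])

lemma pm_quotient_homology: "pm_quotient (cycles P (Suc n)) (boundaries P (Suc n))"
proof
  show "pm.subspace (cycles P (Suc n))" unfolding cycles_eq
    by (rule subspace_kernel[OF subspace_span_chains])
  show "pm.subspace (boundaries P (Suc n))" unfolding boundaries_eq
    by (rule subspace_linear_image[OF subspace_span_chains])
  show "boundaries P (Suc n) \<subseteq> cycles P (Suc n)"
    unfolding boundaries_eq cycles_eq by (auto simp: bnd_span_chains bnd_bnd[of _ "Suc n"])
qed

subsection \<open>Concatenation\<close>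

lemma chain_concat_span:
  assumes "p \<in> chains m" "q \<in> chains n"
  shows "(chain_concat p q :: _ \<Rightarrow>\<^sub>0 'r::field) \<in> span_chains (m + n)"
proof -
  obtain v cs w where p: "p = (v, cs, w)" by (cases p)
  obtain v' ds w' where q: "q = (v', ds, w')" by (cases q)
  show ?thesis using assms by (auto simp: p q chain_concat_def chains_def lchain_append span_chains_def)
qed

lemma chain_mult_span:
  assumes "f \<in> span_chains m" "g \<in> span_chains n"
  shows "chain_mult f g \<in> span_chains (m + n)"
  unfolding chain_mult_def
  by (rule lin_ext_span_chains[OF assms(1)], rule lin_ext_span_chains[OF assms(2)]) (rule chain_concat_span)

lemma chain_bd_concat_left:
  assumes "p \<in> chains 0" "q \<in> chains n"
  shows "bnd (chain_concat p q) = lin_ext (chain_concat p) (chain_bd q :: _ \<Rightarrow>\<^sub>0 'r::field)"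
proof -
  obtain v cs w where p: "p = (v, cs, w)" by (cases p)
  obtain v' ds w' where q: "q = (v', ds, w')" by (cases q)
  have cs: "deg cs = 0" "lchain v cs w" using assms(1) by (auto simp: p chains_def)
  have "(bd cs :: _ \<Rightarrow>\<^sub>0 'r) = 0" using bd_vertices_free[OF cs(1) lchain_set[OF cs(2)]] .
  then show ?thesis
    by (cases "w = v'") (simp_all add: p q chain_concat_def chain_bd_def bd_append cs(1) pm_map_pm_map lin_ext_pm_map pm_map_def lin_ext_lin_ext)
qed

lemma chain_bd_concat_right:
  assumes "p \<in> chains 0" "q \<in> chains n"
  shows "bnd (chain_concat q p) = lin_ext (\<lambda>q. chain_concat q p) (chain_bd q :: _ \<Rightarrow>\<^sub>0 'r::field)"
proof -
  obtain v cs w where p: "p = (v, cs, w)" by (cases p)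
  obtain v' ds w' where q: "q = (v', ds, w')" by (cases q)
  have cs: "deg cs = 0" "lchain v cs w" using assms(1) by (auto simp: p chains_def)
  have "(bd cs :: _ \<Rightarrow>\<^sub>0 'r) = 0" using bd_vertices_free[OF cs(1) lchain_set[OF cs(2)]] .
  then show ?thesis
    by (cases "v = w'") (auto simp: p q chain_concat_def chain_bd_def bd_append cs(1) pm_map_pm_map lin_ext_pm_map pm_map_def lin_ext_lin_ext)
qed

lemma bnd_chain_mult_left:
  assumes "u \<in> span_chains 0" "z \<in> span_chains n"
  shows "bnd (chain_mult u z) = chain_mult u (bnd z)"
proof -
  have "bnd (chain_mult u z) = lin_ext (\<lambda>p. lin_ext (\<lambda>q. bnd (chain_concat p q)) z) u"
    by (simp add: chain_mult_def lin_ext_lin_ext)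
  also have "\<dots> = lin_ext (\<lambda>p. lin_ext (\<lambda>q. lin_ext (chain_concat p) (chain_bd q)) z) u"
    by (intro lin_ext_cong refl chain_bd_concat_left) (auto intro: span_chainsD[OF assms(1)] span_chainsD[OF assms(2)])
  finally show ?thesis by (simp add: chain_mult_def lin_ext_lin_ext)
qed

lemma bnd_chain_mult_right:
  assumes "u \<in> span_chains 0" "z \<in> span_chains n"
  shows "bnd (chain_mult z u) = chain_mult (bnd z) u"
proof -
  have "bnd (chain_mult z u) = lin_ext (\<lambda>q. lin_ext (\<lambda>p. bnd (chain_concat q p)) u) z"
    by (simp add: chain_mult_def lin_ext_lin_ext)
  also have "\<dots> = lin_ext (\<lambda>q. lin_ext (\<lambda>p. lin_ext (\<lambda>q. chain_concat q p) (chain_bd q)) u) z"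
    by (intro lin_ext_cong refl chain_bd_concat_right) (auto intro: span_chainsD[OF assms(1)] span_chainsD[OF assms(2)])
  also have "\<dots> = lin_ext (\<lambda>q. lin_ext (\<lambda>q. lin_ext (chain_concat q) u) (chain_bd q)) z"
    by (subst lin_ext_swap) (rule refl)
  finally show ?thesis by (simp add: chain_mult_def lin_ext_lin_ext)
qed

lemma chain_mult_cycles:
  assumes "u \<in> span_chains 0" "z \<in> cycles P (Suc n)"
  shows "chain_mult u z \<in> cycles P (Suc n)" "chain_mult z u \<in> cycles P (Suc n)"
  using assms chain_mult_span[of u 0 z n] chain_mult_span[of z n u 0]
    bnd_chain_mult_left[of u z n] bnd_chain_mult_right[of u z n]
  by (auto simp: cycles_eq chain_mult_simps)

lemma chain_mult_boundaries:
  assumes "u \<in> span_chains 0" "z \<in> boundaries P (Suc n)"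
  shows "chain_mult u z \<in> boundaries P (Suc n)" "chain_mult z u \<in> boundaries P (Suc n)"
proof -
  obtain y where y: "y \<in> span_chains (Suc n)" "z = bnd y" using assms(2) by (auto simp: boundaries_eq)
  have "chain_mult u z = bnd (chain_mult u y)" "chain_mult z u = bnd (chain_mult y u)"
    using bnd_chain_mult_left[OF assms(1) y(1)] bnd_chain_mult_right[OF assms(1) y(1)] y(2) by auto
  moreover have "chain_mult u y \<in> span_chains (Suc n)" "chain_mult y u \<in> span_chains (Suc n)"
    using chain_mult_span[OF assms(1) y(1)] chain_mult_span[OF y(1) assms(1)] by auto
  ultimately show "chain_mult u z \<in> boundaries P (Suc n)" "chain_mult z u \<in> boundaries P (Suc n)"
    unfolding boundaries_eq by auto
qed

end

lemma with_actions_simps [simp]: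
  "carrier (with_actions M l r) = carrier M" "add (with_actions M l r) = add M"
  "ring.zero (with_actions M l r) = ring.zero M" "module.smult (with_actions M l r) = module.smult M"
  "lact (with_actions M l r) = l" "ract (with_actions M l r) = r"
  by (simp_all add: with_actions_def module.defs bimodule.defs)

lemma module_with_actions:
  assumes "Module.module R M"
  shows "Module.module R (with_actions M l r)"
proof -
  interpret M: Module.module R M by fact
  show ?thesis
  proof (rule moduleI)
    show "abelian_group (with_actions M l r)"
      by (rule abelian_groupI) (auto simp: M.a_ac intro: M.l_neg M.a_inv_closed)
  qed (auto simp: M.smult_l_distr M.smult_r_distr M.smult_assoc1 M.R.is_cring)
qed

context labelled_precubical
begin

lemma HM_simps:
  fixes x y :: "'a cube_chain \<Rightarrow>\<^sub>0 'r::field"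
  shows "carrier (HM P (Suc n)) = cls (boundaries P (Suc n)) ` (cycles P (Suc n) :: (_ \<Rightarrow>\<^sub>0 'r) set)"
    "\<zero>\<^bsub>HM P (Suc n)\<^esub> = cls (boundaries P (Suc n)) (0 :: _ \<Rightarrow>\<^sub>0 'r)"
    "cls (boundaries P (Suc n)) x \<oplus>\<^bsub>HM P (Suc n)\<^esub> cls (boundaries P (Suc n)) y = cls (boundaries P (Suc n)) (x + y)"
    "c \<odot>\<^bsub>HM P (Suc n)\<^esub> cls (boundaries P (Suc n)) x = cls (boundaries P (Suc n)) (pm_scale c x)"
proof -
  interpret H: pm_quotient "cycles P (Suc n) :: (_ \<Rightarrow>\<^sub>0 'r) set" "boundaries P (Suc n)"
    by (rule pm_quotient_homology)
  show "carrier (HM P (Suc n)) = cls (boundaries P (Suc n)) ` (cycles P (Suc n) :: (_ \<Rightarrow>\<^sub>0 'r) set)"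
    "\<zero>\<^bsub>HM P (Suc n)\<^esub> = cls (boundaries P (Suc n)) (0 :: _ \<Rightarrow>\<^sub>0 'r)"
    "cls (boundaries P (Suc n)) x \<oplus>\<^bsub>HM P (Suc n)\<^esub> cls (boundaries P (Suc n)) y = cls (boundaries P (Suc n)) (x + y)"
    "c \<odot>\<^bsub>HM P (Suc n)\<^esub> cls (boundaries P (Suc n)) x = cls (boundaries P (Suc n)) (pm_scale c x)"
    unfolding HM_def with_actions_simps cycle_module_eq
    by (rule H.carrier_Q H.Q_zero H.Q_add H.Q_smult)+
qed

lemma HM_act:
  fixes x :: "'a cube_chain \<Rightarrow>\<^sub>0 'r::field"
  assumes "u \<in> span_chains 0"
  shows "lact (HM P (Suc n)) u (cls (boundaries P (Suc n)) x) = cls (boundaries P (Suc n)) (chain_mult u x)"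
    "ract (HM P (Suc n)) (cls (boundaries P (Suc n)) x) u = cls (boundaries P (Suc n)) (chain_mult x u)"
proof -
  interpret H: pm_quotient "cycles P (Suc n) :: (_ \<Rightarrow>\<^sub>0 'r) set" "boundaries P (Suc n)"
    by (rule pm_quotient_homology)
  show "lact (HM P (Suc n)) u (cls (boundaries P (Suc n)) x) = cls (boundaries P (Suc n)) (chain_mult u x)"
    unfolding HM_def with_actions_simps cycle_module_eq
    by (rule H.set_add_image_cls[OF linear_chain_mult(1)]) (rule chain_mult_boundaries(1)[OF assms])
  show "ract (HM P (Suc n)) (cls (boundaries P (Suc n)) x) u = cls (boundaries P (Suc n)) (chain_mult x u)"
    unfolding HM_def with_actions_simps cycle_module_eq
    by (rule H.set_add_image_cls[OF linear_chain_mult(2)]) (rule chain_mult_boundaries(2)[OF assms])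
qed

lemma module_HM: "Module.module (ring_of_type_algebra :: 'r::field ring) (HM P (Suc n))"
  unfolding HM_def cycle_module_eq
  by (rule module_with_actions[OF pm_quotient.module_Q[OF pm_quotient_homology]])

subsection \<open>The path algebra\<close>

definition unit_path :: "'a cube_chain \<Rightarrow>\<^sub>0 'r::field" where
  "unit_path = (\<Sum>v\<in>vertices P. basis_vec (v, [], v))"

lemma path_algebra_simps:
  "carrier (path_algebra P) = span_chains 0" "f \<otimes>\<^bsub>path_algebra P\<^esub> g = chain_mult f g"
  "\<one>\<^bsub>path_algebra P\<^esub> = unit_path" "f \<oplus>\<^bsub>path_algebra P\<^esub> g = f + g" "\<zero>\<^bsub>path_algebra P\<^esub> = 0"
  "c \<odot>\<^bsub>path_algebra P\<^esub> f = pm_scale c f"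
  by (simp_all add: path_algebra_def unit_path_def span_chains_def cube_chains_eq)

context
  assumes finite_vertices: "finite (vertices P)"
begin

lemma unit_path_span: "unit_path \<in> span_chains 0"
  unfolding unit_path_def
  by (intro pm.subspace_sum[OF subspace_span_chains]) (auto simp: chains_def vertices_eq)

lemma unit_path_mult:
  assumes "z \<in> span_chains n"
  shows "chain_mult unit_path z = (z :: _ \<Rightarrow>\<^sub>0 'r::field)" "chain_mult z unit_path = z"
proof -
  have l: "lin_ext (\<lambda>p. chain_concat p q) unit_path = (basis_vec q :: _ \<Rightarrow>\<^sub>0 'r)" if q: "q \<in> chains n" for q
  proof -
    obtain v cs w where q': "q = (v, cs, w)" by (cases q)
    have "v \<in> vertices P" using q lchain_vertices[of v cs w] by (auto simp: q' chains_def vertices_eq)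
    have "lin_ext (\<lambda>p. chain_concat p q) unit_path = (\<Sum>x\<in>vertices P. if x = v then basis_vec q else 0 :: _ \<Rightarrow>\<^sub>0 'r)"
      unfolding unit_path_def lin_ext_sum by (rule sum.cong) (auto simp: q' chain_concat_def)
    then show ?thesis using \<open>v \<in> vertices P\<close> finite_vertices by simp
  qed
  have r: "lin_ext (chain_concat q) unit_path = (basis_vec q :: _ \<Rightarrow>\<^sub>0 'r)" if q: "q \<in> chains n" for q
  proof -
    obtain v cs w where q': "q = (v, cs, w)" by (cases q)
    have "w \<in> vertices P" using q lchain_vertices[of v cs w] by (auto simp: q' chains_def vertices_eq)
    have "lin_ext (chain_concat q) unit_path = (\<Sum>x\<in>vertices P. if x = w then basis_vec q else 0 :: _ \<Rightarrow>\<^sub>0 'r)"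
      unfolding unit_path_def lin_ext_sum by (rule sum.cong) (auto simp: q' chain_concat_def)
    then show ?thesis using \<open>w \<in> vertices P\<close> finite_vertices by simp
  qed
  have "chain_mult unit_path z = lin_ext (\<lambda>q. lin_ext (\<lambda>p. chain_concat p q) unit_path) z"
    unfolding chain_mult_def by (rule lin_ext_swap)
  also have "\<dots> = lin_ext basis_vec z" by (rule lin_ext_cong[OF refl]) (use l span_chainsD[OF assms] in blast)
  finally show "chain_mult unit_path z = z" by simp
  have "chain_mult z unit_path = lin_ext basis_vec z" unfolding chain_mult_def
    by (rule lin_ext_cong[OF refl]) (use r span_chainsD[OF assms] in blast)
  then show "chain_mult z unit_path = z" by simp
qed

lemma abelian_group_path_algebra: "abelian_group (path_algebra P :: ('r::field, _) module)"
proof (rule abelian_groupI)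
  fix x :: "'a cube_chain \<Rightarrow>\<^sub>0 'r" assume "x \<in> carrier (path_algebra P)"
  then show "\<exists>y\<in>carrier (path_algebra P). y \<oplus>\<^bsub>path_algebra P\<^esub> x = \<zero>\<^bsub>path_algebra P\<^esub>"
    by (intro bexI[of _ "- x"]) (simp_all add: path_algebra_simps pm.subspace_neg[OF subspace_span_chains])
qed (auto simp: path_algebra_simps pm.subspace_add[OF subspace_span_chains] pm.subspace_0[OF subspace_span_chains] algebra_simps)

lemma ring_path_algebra: "ring (path_algebra P :: ('r::field, _) module)"
proof (rule ringI[OF abelian_group_path_algebra])
  show "Group.monoid (path_algebra P :: ('r, _) module)"
    by (rule monoidI) (auto simp: path_algebra_simps unit_path_span unit_path_mult chain_mult_assoc
        dest: chain_mult_span[of _ 0 _ 0])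
qed (auto simp: path_algebra_simps chain_mult_simps)

lemma module_path_algebra: "Module.module (ring_of_type_algebra :: 'r ring) (path_algebra P :: ('r::field, _) module)"
proof (rule moduleI)
  show "cring (ring_of_type_algebra :: 'r ring)" by (rule cring_from_type_algebra)
qed (auto simp: abelian_group_path_algebra path_algebra_simps ring_of_type_algebra_def
    pm.scale_left_distrib pm.scale_right_distrib pm.subspace_scale[OF subspace_span_chains])

lemma bimodule_HM: "bimodule (path_algebra P :: ('r::field, _) module) (HM P (Suc n))"
proof -
  let ?B = "boundaries P (Suc n) :: ('a cube_chain \<Rightarrow>\<^sub>0 'r) set"
  interpret A: ring "path_algebra P :: ('r, _) module" by (rule ring_path_algebra)
  interpret A: Module.module "ring_of_type_algebra :: 'r ring" "path_algebra P" by (rule module_path_algebra)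
  interpret M: Module.module "ring_of_type_algebra :: 'r ring" "HM P (Suc n)" by (rule module_HM)
  have M: "\<exists>z\<in>cycles P (Suc n). z \<in> span_chains n \<and> x = cls ?B z" if "x \<in> carrier (HM P (Suc n))" for x
    using that unfolding HM_simps(1) by (auto simp: cycles_eq)
  have A: "carrier (path_algebra P :: ('r, _) module) = span_chains 0" by (rule path_algebra_simps(1))
  have add: "a + b \<in> span_chains 0" if "a \<in> span_chains 0" "b \<in> span_chains 0" for a b :: "_ \<Rightarrow>\<^sub>0 'r"
    using that by (rule pm.subspace_add[OF subspace_span_chains])
  have scale: "pm_scale c a \<in> span_chains 0" if "a \<in> span_chains 0" for c and a :: "_ \<Rightarrow>\<^sub>0 'r"
    using that by (rule pm.subspace_scale[OF subspace_span_chains])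
  have mult: "chain_mult a b \<in> span_chains 0" if "a \<in> span_chains 0" "b \<in> span_chains 0" for a b :: "_ \<Rightarrow>\<^sub>0 'r"
    using chain_mult_span[OF that] by simp
  show ?thesis
  proof (unfold_locales, unfold A path_algebra_simps(2-), goal_cases)
    case (1 a x)
    then show ?case using M[of x] by (auto simp: HM_act HM_simps(1) chain_mult_cycles)
  next
    case (2 a x y)
    then show ?case using M[of x] M[of y] by (auto simp: HM_act HM_simps(3) chain_mult_simps)
  next
    case (3 a b x)
    then show ?case using M[of x] by (auto simp: HM_act HM_simps(3) chain_mult_simps add)
  next
    case (4 a b x)
    then show ?case using M[of x] by (auto simp: HM_act chain_mult_assoc mult)
  next
    case (5 x)
    then show ?case using M[of x] by (auto simp: HM_act unit_path_span unit_path_mult)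
  next
    case (6 a x)
    then show ?case using M[of x] by (auto simp: HM_act HM_simps(1) chain_mult_cycles)
  next
    case (7 a x y)
    then show ?case using M[of x] M[of y] by (auto simp: HM_act HM_simps(3) chain_mult_simps)
  next
    case (8 a b x)
    then show ?case using M[of x] by (auto simp: HM_act HM_simps(3) chain_mult_simps add)
  next
    case (9 a b x)
    then show ?case using M[of x] by (auto simp: HM_act chain_mult_assoc mult)
  next
    case (10 x)
    then show ?case using M[of x] by (auto simp: HM_act unit_path_span unit_path_mult)
  next
    case (11 a b x)
    then show ?case using M[of x] by (auto simp: HM_act chain_mult_assoc)
  next
    case (12 a x c)
    then show ?case using M[of x] by (auto simp: HM_act HM_simps(4) chain_mult_simps scale)
  next
    case (13 a x c)
    then show ?case using M[of x] by (auto simp: HM_act HM_simps(4) chain_mult_simps scale)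
  qed
qed

end

subsection \<open>Splitting the chain complex\<close>

text \<open>Over a field the boundary has a linear section \<open>k\<close> on its image. Then \<open>p = 1 - \<partial>k - k\<partial>\<close> takes
  values in the cycles, is zero on the boundaries and is homotopic to the identity.\<close>

lemma exists_splitting:
  "\<exists>k :: ('a cube_chain \<Rightarrow>\<^sub>0 'r::field) \<Rightarrow> ('a cube_chain \<Rightarrow>\<^sub>0 'r). Vector_Spaces.linear pm_scale pm_scale k \<and>
     (\<forall>n. \<forall>f\<in>span_chains n. k f \<in> span_chains (Suc n)) \<and> (\<forall>n. \<forall>f\<in>span_chains n. bnd (k (bnd f)) = bnd f)"
proof -
  interpret V: vector_space_pair "pm_scale :: 'r \<Rightarrow> ('a cube_chain \<Rightarrow>\<^sub>0 'r) \<Rightarrow> _" "pm_scale :: 'r \<Rightarrow> ('a cube_chain \<Rightarrow>\<^sub>0 'r) \<Rightarrow> _" ..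
  have "\<forall>n. \<exists>g :: ('a cube_chain \<Rightarrow>\<^sub>0 'r) \<Rightarrow> ('a cube_chain \<Rightarrow>\<^sub>0 'r). g ` UNIV \<subseteq> span_chains (Suc n) \<and>
      Vector_Spaces.linear pm_scale pm_scale g \<and> (\<forall>v\<in>bnd ` span_chains (Suc n). bnd (g v) = v)"
    by (intro allI V.linear_exists_right_inverse_on[OF linear_lin_ext subspace_span_chains])
  then obtain g :: "nat \<Rightarrow> ('a cube_chain \<Rightarrow>\<^sub>0 'r) \<Rightarrow> ('a cube_chain \<Rightarrow>\<^sub>0 'r)" where
    G: "\<forall>n. g n ` UNIV \<subseteq> span_chains (Suc n) \<and>
      Vector_Spaces.linear pm_scale pm_scale (g n) \<and> (\<forall>v\<in>bnd ` span_chains (Suc n). bnd (g n v) = v)"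
    unfolding choice_iff by (elim exE)
  have g: "g n f \<in> span_chains (Suc n)" "Vector_Spaces.linear pm_scale pm_scale (g n)"
      "f \<in> span_chains (Suc n) \<Longrightarrow> bnd (g n (bnd f)) = bnd f" for n f
  proof -
    show "g n f \<in> span_chains (Suc n)" using conjunct1[OF spec[OF G, of n]] by (rule subsetD) (rule rangeI)
    show "Vector_Spaces.linear pm_scale pm_scale (g n)" using spec[OF G, of n] by (elim conjE)
    show "bnd (g n (bnd f)) = bnd f" if "f \<in> span_chains (Suc n)"
      using conjunct2[OF conjunct2[OF spec[OF G, of n]]] imageI[OF that, of bnd] by (rule bspec)
  qed
  \<comment> \<open>The sections in the single degrees are put together on basis vectors.\<close>
  define k where "k = lin_ext (\<lambda>c. g (deg (fst (snd c))) (basis_vec c))"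
  have k: "k f = g n f" if "f \<in> span_chains n" for f n
  proof -
    have "k f = lin_ext (\<lambda>c. g n (basis_vec c)) f" unfolding k_def
      by (rule lin_ext_cong[OF refl]) (use span_chainsD[OF that] in \<open>auto simp: chains_def\<close>)
    also have "\<dots> = g n f" by (rule linear_eq_lin_ext[OF g(2), symmetric])
    finally show ?thesis .
  qed
  have section_k: "bnd (k (bnd f)) = bnd f" if f: "f \<in> span_chains n" for f n
  proof (cases n)
    case 0
    then have "bnd f = 0" using bnd_chains_0[of f] f by simp
    then show ?thesis by (simp add: k_def)
  next
    case (Suc m)
    then show ?thesis unfolding k[OF bnd_span_chains[OF f[unfolded Suc]]]
      using g(3)[of f m] f by simp
  qed
  moreover have "Vector_Spaces.linear pm_scale pm_scale k" unfolding k_def by (rule linear_lin_ext)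
  moreover have "k f \<in> span_chains (Suc n)" if "f \<in> span_chains n" for f n
    unfolding k[OF that] by (rule g(1))
  ultimately show ?thesis by (intro exI[of _ k] conjI allI ballI)
qed

text \<open>A linear map is needed on all degrees at once; the choice is arbitrary.\<close>

definition splitting :: "('a cube_chain \<Rightarrow>\<^sub>0 'r::field) \<Rightarrow> ('a cube_chain \<Rightarrow>\<^sub>0 'r)" where
  "splitting = (SOME k. Vector_Spaces.linear pm_scale pm_scale k \<and>
     (\<forall>n. \<forall>f\<in>span_chains n. k f \<in> span_chains (Suc n)) \<and> (\<forall>n. \<forall>f\<in>span_chains n. bnd (k (bnd f)) = bnd f))"

lemma splitting:
  "Vector_Spaces.linear pm_scale pm_scale (splitting :: _ \<Rightarrow> 'a cube_chain \<Rightarrow>\<^sub>0 'r::field)"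
  "f \<in> span_chains n \<Longrightarrow> splitting f \<in> (span_chains (Suc n) :: (_ \<Rightarrow>\<^sub>0 'r) set)"
  "f \<in> span_chains n \<Longrightarrow> bnd (splitting (bnd f)) = (bnd f :: _ \<Rightarrow>\<^sub>0 'r)"
proof -
  have *: "Vector_Spaces.linear pm_scale pm_scale (splitting :: _ \<Rightarrow> 'a cube_chain \<Rightarrow>\<^sub>0 'r) \<and>
     (\<forall>n. \<forall>f\<in>span_chains n. splitting f \<in> (span_chains (Suc n) :: (_ \<Rightarrow>\<^sub>0 'r) set)) \<and>
     (\<forall>n. \<forall>f\<in>span_chains n. bnd (splitting (bnd f)) = (bnd f :: _ \<Rightarrow>\<^sub>0 'r))"
    unfolding splitting_def by (rule someI_ex[OF exists_splitting])
  show "Vector_Spaces.linear pm_scale pm_scale (splitting :: _ \<Rightarrow> 'a cube_chain \<Rightarrow>\<^sub>0 'r)"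
    using * by (elim conjE)
  show "splitting f \<in> (span_chains (Suc n) :: (_ \<Rightarrow>\<^sub>0 'r) set)" if "f \<in> span_chains n"
    using conjunct1[OF conjunct2[OF *]] that by simp
  show "bnd (splitting (bnd f)) = (bnd f :: _ \<Rightarrow>\<^sub>0 'r)" if "f \<in> span_chains n"
    using conjunct2[OF conjunct2[OF *]] that by blast
qed

definition proj :: "('a cube_chain \<Rightarrow>\<^sub>0 'r::field) \<Rightarrow> ('a cube_chain \<Rightarrow>\<^sub>0 'r)" where
  "proj f = f - bnd (splitting f) - splitting (bnd f)"

lemma splitting_simps:
  "splitting (f + g) = splitting f + splitting g" "splitting (f - g) = splitting f - splitting g"
  "splitting (pm_scale c f) = pm_scale c (splitting f)" "splitting 0 = 0"
proof -
  interpret k: Vector_Spaces.linear pm_scale pm_scale splitting by (rule splitting(1))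
  show "splitting (f + g) = splitting f + splitting g" "splitting (f - g) = splitting f - splitting g"
    "splitting (pm_scale c f) = pm_scale c (splitting f)" "splitting 0 = 0"
    by (simp_all add: k.add k.diff k.scale k.zero)
qed

lemma linear_proj: "Vector_Spaces.linear pm_scale pm_scale proj"
  by unfold_locales (simp_all add: proj_def lin_ext_add lin_ext_scale splitting_simps pm.scale_right_diff_distrib)

lemma bnd_proj:
  assumes "f \<in> span_chains n"
  shows "bnd (proj f) = 0"
  using bnd_bnd[OF splitting(2)[OF assms]] splitting(3)[OF assms] by (simp add: proj_def lin_ext_diff)

lemma proj_bnd:
  assumes "f \<in> span_chains n"
  shows "proj (bnd f) = 0"
  using bnd_bnd[OF assms] splitting(3)[OF assms] by (simp add: proj_def splitting_simps)

lemma proj_span: "f \<in> span_chains n \<Longrightarrow> proj f \<in> span_chains n"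
proof -
  assume f: "f \<in> span_chains n"
  have "splitting (bnd f) \<in> span_chains n"
  proof (cases n)
    case 0
    then show ?thesis using bnd_chains_0[of f] f by (simp add: splitting_simps pm.subspace_0[OF subspace_span_chains])
  next
    case (Suc m)
    then show ?thesis using splitting(2)[OF bnd_span_chains, of f m] f by simp
  qed
  then show ?thesis unfolding proj_def
    using f bnd_span_chains[OF splitting(2)[OF f]] by (intro pm.subspace_diff[OF subspace_span_chains])
qed

lemma proj_cycle: "f \<in> span_chains n \<Longrightarrow> proj f \<in> cycles P (Suc n)"
  by (simp add: cycles_eq bnd_proj proj_span)

lemma cycle_diff_proj: "z \<in> cycles P (Suc n) \<Longrightarrow> z - proj z \<in> boundaries P (Suc n)"
  using splitting(2)[of z n] by (auto simp: cycles_eq boundaries_eq proj_def splitting_simps)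

end

section \<open>Tensor products and direct sums of quotients\<close>

lemma lin_ext_span_in:
  assumes "x \<in> pm.span S" "pm.subspace W" "\<And>s. s \<in> S \<Longrightarrow> lin_ext g s \<in> W"
  shows "lin_ext g x \<in> W"
  using assms(1)
proof (induction rule: pm.span_induct_alt)
  case base
  then show ?case by (simp add: pm.subspace_0[OF assms(2)])
next
  case (step c x y)
  then show ?case using assms(3)
    by (simp add: lin_ext_add lin_ext_scale pm.subspace_add[OF assms(2)] pm.subspace_scale[OF assms(2)])
qed

locale two_quotients = A: pm_quotient V1 N1 + B: pm_quotient V2 N2
  for V1 N1 :: "('s \<Rightarrow>\<^sub>0 'r::field) set" and V2 N2 :: "('t \<Rightarrow>\<^sub>0 'r) set"
begin

abbreviation rel :: "(('s \<Rightarrow>\<^sub>0 'r) set \<times> ('t \<Rightarrow>\<^sub>0 'r) set \<Rightarrow>\<^sub>0 'r) set" where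
  "rel \<equiv> tensor_relations A.Q B.Q"

abbreviation elt :: "('s \<Rightarrow>\<^sub>0 'r) \<Rightarrow> ('t \<Rightarrow>\<^sub>0 'r) \<Rightarrow> (('s \<Rightarrow>\<^sub>0 'r) set \<times> ('t \<Rightarrow>\<^sub>0 'r) set \<Rightarrow>\<^sub>0 'r)" where
  "elt x y \<equiv> basis_vec (cls N1 x, cls N2 y)"

lemma subspace_rel: "pm.subspace rel"
  by (simp add: tensor_relations_def)

text \<open>The class of a simple tensor is bilinear in representatives of its two factors.\<close>

lemma rel_generators:
  "x \<in> V1 \<Longrightarrow> x' \<in> V1 \<Longrightarrow> y \<in> V2 \<Longrightarrow> elt (x + x') y - elt x y - elt x' y \<in> rel"
  "x \<in> V1 \<Longrightarrow> y \<in> V2 \<Longrightarrow> y' \<in> V2 \<Longrightarrow> elt x (y + y') - elt x y - elt x y' \<in> rel"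
  "x \<in> V1 \<Longrightarrow> y \<in> V2 \<Longrightarrow> elt (pm_scale c x) y - pm_scale c (elt x y) \<in> rel"
  "x \<in> V1 \<Longrightarrow> y \<in> V2 \<Longrightarrow> elt x (pm_scale c y) - pm_scale c (elt x y) \<in> rel"
  unfolding tensor_relations_def
  by (rule pm.span_base, simp only: A.Q_add[symmetric] B.Q_add[symmetric] A.Q_smult[symmetric] B.Q_smult[symmetric]
      A.carrier_Q B.carrier_Q, blast)+

text \<open>To map the relations into a subspace it is enough to treat the four kinds of generators,
  written with representatives.\<close>

lemma lin_ext_rel_in:
  assumes "x \<in> rel" "pm.subspace W"
    and "\<And>x x' y. x \<in> V1 \<Longrightarrow> x' \<in> V1 \<Longrightarrow> y \<in> V2 \<Longrightarrow> lin_ext g (elt (x + x') y) - lin_ext g (elt x y) - lin_ext g (elt x' y) \<in> W"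
    and "\<And>x y y'. x \<in> V1 \<Longrightarrow> y \<in> V2 \<Longrightarrow> y' \<in> V2 \<Longrightarrow> lin_ext g (elt x (y + y')) - lin_ext g (elt x y) - lin_ext g (elt x y') \<in> W"
    and "\<And>c x y. x \<in> V1 \<Longrightarrow> y \<in> V2 \<Longrightarrow> lin_ext g (elt (pm_scale c x) y) - pm_scale c (lin_ext g (elt x y)) \<in> W"
    and "\<And>c x y. x \<in> V1 \<Longrightarrow> y \<in> V2 \<Longrightarrow> lin_ext g (elt x (pm_scale c y)) - pm_scale c (lin_ext g (elt x y)) \<in> W"
  shows "lin_ext g x \<in> W"
  using assms(1,2) unfolding tensor_relations_def
proof (rule lin_ext_span_in, goal_cases)
  case (1 s)
  then show ?case using assms(3-6)
    by (auto simp: A.carrier_Q B.carrier_Q A.Q_add B.Q_add A.Q_smult B.Q_smult lin_ext_diff lin_ext_scale)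
qed

lemma pm_quotient_tensor:
  "pm_quotient {f. Poly_Mapping.keys f \<subseteq> carrier A.Q \<times> carrier B.Q} rel"
proof
  show "rel \<subseteq> {f. Poly_Mapping.keys f \<subseteq> carrier A.Q \<times> carrier B.Q}"
  proof
    fix x assume "x \<in> rel"
    then have "lin_ext basis_vec x \<in> {f. Poly_Mapping.keys f \<subseteq> carrier A.Q \<times> carrier B.Q}"
    proof (rule lin_ext_rel_in[OF _ subspace_keys])
    qed (auto simp: A.carrier_Q B.carrier_Q intro!: imageI pm.subspace_add[OF A.subspace_V] pm.subspace_add[OF B.subspace_V]
        pm.subspace_scale[OF A.subspace_V] pm.subspace_scale[OF B.subspace_V]
        dest!: subsetD[OF Poly_Mapping.keys_diff] subsetD[OF keys_pm_scale])
    then show "x \<in> {f. Poly_Mapping.keys f \<subseteq> carrier A.Q \<times> carrier B.Q}" by simp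
  qed
qed (simp_all add: subspace_keys subspace_rel)

lemma rel_zero: "y \<in> V2 \<Longrightarrow> elt 0 y \<in> rel" "x \<in> V1 \<Longrightarrow> elt x 0 \<in> rel"
  using rel_generators(3)[OF pm.subspace_0[OF A.subspace_V], of y 0]
    rel_generators(4)[OF _ pm.subspace_0[OF B.subspace_V], of x 0] by simp_all

lemma rel_lin_ext_left:
  assumes y: "y \<in> V2" and F: "\<And>a. a \<in> Poly_Mapping.keys f \<Longrightarrow> F a \<in> V1"
  shows "elt (lin_ext F f) y - lin_ext (\<lambda>a. elt (F a) y) f \<in> rel"
proof -
  have "(\<Sum>a\<in>S. pm_scale (c a) (F a)) \<in> V1 \<and>
      elt (\<Sum>a\<in>S. pm_scale (c a) (F a)) y - (\<Sum>a\<in>S. pm_scale (c a) (elt (F a) y)) \<in> rel"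
    if "finite S" "\<forall>a\<in>S. F a \<in> V1" for S and c :: "_ \<Rightarrow> 'r"
    using that
  proof (induction S)
    case empty
    show ?case using rel_zero(1)[OF y] by (simp add: pm.subspace_0[OF A.subspace_V])
  next
    case (insert a S)
    let ?u = "pm_scale (c a) (F a)" and ?s = "\<Sum>a\<in>S. pm_scale (c a) (F a)"
    have u: "?u \<in> V1" "F a \<in> V1" using insert by (auto intro: pm.subspace_scale[OF A.subspace_V])
    have s: "?s \<in> V1" using insert by simp
    have "elt (?u + ?s) y - (pm_scale (c a) (elt (F a) y) + (\<Sum>a\<in>S. pm_scale (c a) (elt (F a) y))) =
        (elt (?u + ?s) y - elt ?u y - elt ?s y) + (elt ?u y - pm_scale (c a) (elt (F a) y)) +
        (elt ?s y - (\<Sum>a\<in>S. pm_scale (c a) (elt (F a) y)))" by (simp add: algebra_simps)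
    also have "\<dots> \<in> rel"
      using rel_generators(1)[OF u(1) s y] rel_generators(3)[OF u(2) y, of "c a"] insert
      by (intro pm.subspace_add[OF subspace_rel]) auto
    finally show ?case using insert u s by (auto intro: pm.subspace_add[OF A.subspace_V])
  qed
  from this[of "Poly_Mapping.keys f" "Poly_Mapping.lookup f"] F show ?thesis by (simp add: lin_ext_def)
qed

lemma rel_lin_ext_right:
  assumes x: "x \<in> V1" and F: "\<And>b. b \<in> Poly_Mapping.keys f \<Longrightarrow> F b \<in> V2"
  shows "elt x (lin_ext F f) - lin_ext (\<lambda>b. elt x (F b)) f \<in> rel"
proof -
  have "(\<Sum>a\<in>S. pm_scale (c a) (F a)) \<in> V2 \<and>
      elt x (\<Sum>a\<in>S. pm_scale (c a) (F a)) - (\<Sum>a\<in>S. pm_scale (c a) (elt x (F a))) \<in> rel"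
    if "finite S" "\<forall>a\<in>S. F a \<in> V2" for S and c :: "_ \<Rightarrow> 'r"
    using that
  proof (induction S)
    case empty
    show ?case using rel_zero(2)[OF x] by (simp add: pm.subspace_0[OF B.subspace_V])
  next
    case (insert a S)
    let ?u = "pm_scale (c a) (F a)" and ?s = "\<Sum>a\<in>S. pm_scale (c a) (F a)"
    have u: "?u \<in> V2" "F a \<in> V2" using insert by (auto intro: pm.subspace_scale[OF B.subspace_V])
    have s: "?s \<in> V2" using insert by simp
    have "elt x (?u + ?s) - (pm_scale (c a) (elt x (F a)) + (\<Sum>a\<in>S. pm_scale (c a) (elt x (F a)))) =
        (elt x (?u + ?s) - elt x ?u - elt x ?s) + (elt x ?u - pm_scale (c a) (elt x (F a))) +
        (elt x ?s - (\<Sum>a\<in>S. pm_scale (c a) (elt x (F a))))" by (simp add: algebra_simps)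
    also have "\<dots> \<in> rel"
      using rel_generators(2)[OF x u(1) s] rel_generators(4)[OF x u(2), of "c a"] insert
      by (intro pm.subspace_add[OF subspace_rel]) auto
    finally show ?case using insert u s by (auto intro: pm.subspace_add[OF B.subspace_V])
  qed
  from this[of "Poly_Mapping.keys f" "Poly_Mapping.lookup f"] F show ?thesis by (simp add: lin_ext_def)
qed

lemma rel_bilinear:
  assumes F: "\<And>a. a \<in> Poly_Mapping.keys f \<Longrightarrow> F a \<in> V1" and G: "\<And>b. b \<in> Poly_Mapping.keys g \<Longrightarrow> G b \<in> V2"
  shows "elt (lin_ext F f) (lin_ext G g) - lin_ext (\<lambda>a. lin_ext (\<lambda>b. elt (F a) (G b)) g) f \<in> rel"
proof -
  have G': "lin_ext G g \<in> V2" by (rule lin_ext_in_subspace[OF B.subspace_V]) (rule G)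
  have "lin_ext (\<lambda>a. elt (F a) (lin_ext G g) - lin_ext (\<lambda>b. elt (F a) (G b)) g) f \<in> rel"
    by (rule lin_ext_in_subspace[OF subspace_rel]) (rule rel_lin_ext_right[OF F G])
  then have "lin_ext (\<lambda>a. elt (F a) (lin_ext G g)) f - lin_ext (\<lambda>a. lin_ext (\<lambda>b. elt (F a) (G b)) g) f \<in> rel"
    by (simp add: lin_ext_fun_diff)
  moreover have "elt (lin_ext F f) (lin_ext G g) - lin_ext (\<lambda>a. elt (F a) (lin_ext G g)) f \<in> rel"
    by (rule rel_lin_ext_left[OF G']) (rule F)
  ultimately show ?thesis using pm.subspace_add[OF subspace_rel] by fastforce
qed

lemma tensor_map_cls:
  assumes f: "\<And>x. x \<in> V1 \<Longrightarrow> f (cls N1 x) = cls N1 (f' x)" "Vector_Spaces.linear pm_scale pm_scale f'" "\<And>x. x \<in> V1 \<Longrightarrow> f' x \<in> V1"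
    and g: "\<And>y. y \<in> V2 \<Longrightarrow> g (cls N2 y) = cls N2 (g' y)" "Vector_Spaces.linear pm_scale pm_scale g'" "\<And>y. y \<in> V2 \<Longrightarrow> g' y \<in> V2"
  defines "T \<equiv> lin_ext (\<lambda>(a, b). basis_vec (f a, g b))"
  shows "t \<in> rel \<Longrightarrow> T t \<in> rel" "tensor_map A.Q B.Q f g (cls rel t) = cls rel (T t)"
    "Poly_Mapping.keys t \<subseteq> carrier A.Q \<times> carrier B.Q \<Longrightarrow> Poly_Mapping.keys (T t) \<subseteq> carrier A.Q \<times> carrier B.Q"
proof -
  interpret F: Vector_Spaces.linear pm_scale pm_scale f' by fact
  interpret G: Vector_Spaces.linear pm_scale pm_scale g' by fact
  interpret TQ: pm_quotient "{f. Poly_Mapping.keys f \<subseteq> carrier A.Q \<times> carrier B.Q}" rel by (rule pm_quotient_tensor)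
  show *: "T t \<in> rel" if "t \<in> rel" for t
    using that unfolding T_def
  proof (rule lin_ext_rel_in[OF _ subspace_rel], goal_cases)
    case (1 x x' y)
    then show ?case using rel_generators(1)[of "f' x" "f' x'" "g' y"] f(3) g(3)
      by (simp add: f(1) g(1) F.add pm.subspace_add[OF A.subspace_V])
  next
    case (2 x y y')
    then show ?case using rel_generators(2)[of "f' x" "g' y" "g' y'"] f(3) g(3)
      by (simp add: f(1) g(1) G.add pm.subspace_add[OF B.subspace_V])
  next
    case (3 c x y)
    then show ?case using rel_generators(3)[of "f' x" "g' y" c] f(3) g(3)
      by (simp add: f(1) g(1) F.scale pm.subspace_scale[OF A.subspace_V])
  next
    case (4 c x y)
    then show ?case using rel_generators(4)[of "f' x" "g' y" c] f(3) g(3)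
      by (simp add: f(1) g(1) G.scale pm.subspace_scale[OF B.subspace_V])
  qed
  show "tensor_map A.Q B.Q f g (cls rel t) = cls rel (T t)"
    unfolding tensor_map_def free_module_eq T_def[symmetric]
    by (rule TQ.set_add_image_cls[OF _ *]) (simp_all add: T_def linear_lin_ext)
  show "Poly_Mapping.keys (T t) \<subseteq> carrier A.Q \<times> carrier B.Q" if "Poly_Mapping.keys t \<subseteq> carrier A.Q \<times> carrier B.Q"
  proof
    fix q assume "q \<in> Poly_Mapping.keys (T t)"
    then obtain r where r: "r \<in> Poly_Mapping.keys t" "q \<in> Poly_Mapping.keys ((case r of (a, b) \<Rightarrow> basis_vec (f a, g b)) :: _ \<Rightarrow>\<^sub>0 'r)"
      unfolding T_def by (rule keys_lin_extE)
    obtain a b where ab: "r = (a, b)" by (cases r)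
    then have "a \<in> cls N1 ` V1" "b \<in> cls N2 ` V2"
      using subsetD[OF that r(1)] by (simp_all add: A.carrier_Q B.carrier_Q)
    then obtain x y where "a = cls N1 x" "x \<in> V1" "b = cls N2 y" "y \<in> V2" by blast
    then show "q \<in> carrier A.Q \<times> carrier B.Q"
      using r(2) f(1,3) g(1,3) by (auto simp: ab A.carrier_Q B.carrier_Q)
  qed
qed

end

locale direct_quotients =
  fixes I :: "'i set" and V N :: "'i \<Rightarrow> ('s \<Rightarrow>\<^sub>0 'r::field) set"
  assumes finite_I: "finite I" and quot: "\<And>i. i \<in> I \<Longrightarrow> pm_quotient (V i) (N i)"
begin

abbreviation D where "D \<equiv> direct_sum I (\<lambda>i. quot_module (sub_module (V i)) (N i))"

definition family_cls :: "('i \<Rightarrow> ('s \<Rightarrow>\<^sub>0 'r)) \<Rightarrow> 'i \<Rightarrow> ('s \<Rightarrow>\<^sub>0 'r) set" where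
  "family_cls f = (\<lambda>i\<in>I. cls (N i) (f i))"

lemma family_cls_eq_iff: "family_cls f = family_cls g \<longleftrightarrow> (\<forall>i\<in>I. f i - g i \<in> N i)"
proof -
  have "family_cls f = family_cls g \<longleftrightarrow> (\<forall>i\<in>I. cls (N i) (f i) = cls (N i) (g i))"
    by (auto simp: family_cls_def restrict_def fun_eq_iff)
  then show ?thesis using pm_quotient.cls_eq_iff[OF quot] by simp
qed

lemma carrier_D: "carrier D = family_cls ` {f. \<forall>i\<in>I. f i \<in> V i}"
proof (intro subset_antisym subsetI)
  fix t assume "t \<in> carrier D"
  then have t: "t \<in> (\<Pi>\<^sub>E i\<in>I. carrier (quot_module (sub_module (V i)) (N i)))" by (simp add: direct_sum_def)
  then have "\<forall>i\<in>I. \<exists>x. x \<in> V i \<and> t i = cls (N i) x"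
    using pm_quotient.carrier_Q[OF quot] by (fastforce simp: PiE_iff)
  then obtain f where f: "\<forall>i\<in>I. f i \<in> V i \<and> t i = cls (N i) (f i)" by metis
  moreover have "t = family_cls f" using t f by (auto simp: family_cls_def PiE_iff extensional_def fun_eq_iff)
  ultimately show "t \<in> family_cls ` {f. \<forall>i\<in>I. f i \<in> V i}" by blast
next
  fix t assume "t \<in> family_cls ` {f. \<forall>i\<in>I. f i \<in> V i}"
  then show "t \<in> carrier D" using pm_quotient.carrier_Q[OF quot] finite_I by (auto simp: direct_sum_def family_cls_def)
qed

lemma D_zero: "\<zero>\<^bsub>D\<^esub> = family_cls (\<lambda>i. 0)"
  using pm_quotient.Q_zero[OF quot] by (auto simp: direct_sum_def family_cls_def restrict_def fun_eq_iff)

lemma D_add: "family_cls f \<oplus>\<^bsub>D\<^esub> family_cls g = family_cls (\<lambda>i. f i + g i)"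
  using pm_quotient.Q_add[OF quot] by (auto simp: direct_sum_def family_cls_def restrict_def fun_eq_iff)

lemma D_smult: "c \<odot>\<^bsub>D\<^esub> family_cls f = family_cls (\<lambda>i. pm_scale c (f i))"
  using pm_quotient.Q_smult[OF quot] by (auto simp: direct_sum_def family_cls_def restrict_def fun_eq_iff)

lemma subspace_quot: "i \<in> I \<Longrightarrow> pm.subspace (V i)"
  using quot by (simp add: pm_quotient_def)

lemma abelian_group_D: "abelian_group D"
proof (rule abelian_groupI)
  fix x assume "x \<in> carrier D"
  then obtain f where f: "x = family_cls f" "\<forall>i\<in>I. f i \<in> V i" by (auto simp: carrier_D)
  then have "family_cls (\<lambda>i. - f i) \<in> carrier D" using pm.subspace_neg[OF subspace_quot] by (auto simp: carrier_D)
  then show "\<exists>y\<in>carrier D. y \<oplus>\<^bsub>D\<^esub> x = \<zero>\<^bsub>D\<^esub>"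
    using f(1) by (intro bexI[of _ "family_cls (\<lambda>i. - f i)"]) (simp_all add: D_add D_zero)
qed (auto simp: carrier_D D_add D_zero algebra_simps intro!: imageI pm.subspace_add[OF subspace_quot] pm.subspace_0[OF subspace_quot])

lemma module_D: "Module.module (ring_of_type_algebra :: 'r ring) D"
proof (rule moduleI)
  show "cring (ring_of_type_algebra :: 'r ring)" by (rule cring_from_type_algebra)
qed (auto simp: abelian_group_D carrier_D D_add D_smult ring_of_type_algebra_def
    pm.scale_left_distrib pm.scale_right_distrib intro!: imageI pm.subspace_scale[OF subspace_quot])

text \<open>The action of a general element of the path algebra on the shifted tensor product is defined
  by such a sum over its paths.\<close>

lemma finsum_family_cls:
  assumes "finite S" "\<And>r i. r \<in> S \<Longrightarrow> i \<in> I \<Longrightarrow> F r i \<in> V i" "\<And>r. r \<in> S \<Longrightarrow> t r = family_cls (F r)"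
  shows "(\<Oplus>\<^bsub>D\<^esub>r\<in>S. c r \<odot>\<^bsub>D\<^esub> t r) = family_cls (\<lambda>i. \<Sum>r\<in>S. pm_scale (c r) (F r i))"
  using assms
proof (induction S)
  interpret G: abelian_group D by (rule abelian_group_D)
  case empty
  then show ?case by (simp add: D_zero)
next
  interpret G: abelian_group D by (rule abelian_group_D)
  case (insert r S)
  have "c s \<odot>\<^bsub>D\<^esub> t s \<in> carrier D" if "s \<in> insert r S" for s
    using insert.prems(1)[OF that] insert.prems(2)[OF that] pm.subspace_scale[OF subspace_quot] by (auto simp: D_smult carrier_D)
  then show ?case using insert by (simp add: G.finsum_insert Pi_iff D_add D_smult)
qed

end

section \<open>The Kuenneth homotopy\<close>

context labelled_tensor
begin

abbreviation "TP \<equiv> tensor_precubical P1 P2"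

definition pairs :: "nat \<Rightarrow> ('a cube_chain \<times> 'b cube_chain) set" where
  "pairs n = {(c, d). \<exists>i j. c \<in> X.chains i \<and> d \<in> Y.chains j \<and> i + j = n}"

lemma tensor_chain_bd_eq:
  assumes "c \<in> X.chains i"
  shows "tensor_chain_bd (c, d) = pm_tensor (X.chain_bd c) (basis_vec d) +
    pm_scale ((- 1) ^ i) (pm_tensor (basis_vec c) (Y.chain_bd d) :: _ \<Rightarrow>\<^sub>0 'r::field)"
proof -
  have "len_deg c = i" using assms by (auto simp: len_deg_def X.chains_def)
  then show ?thesis by (simp add: tensor_chain_bd_def pm_tensor_basis_right pm_tensor_basis_left)
qed

lemma tensor_chain_bd_tensor:
  assumes x: "x \<in> X.span_chains i"
  shows "lin_ext tensor_chain_bd (pm_tensor x y) = pm_tensor (X.bnd x) y +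
    pm_scale ((- 1) ^ i) (pm_tensor x (Y.bnd y) :: _ \<Rightarrow>\<^sub>0 'r::field)"
proof -
  have "lin_ext tensor_chain_bd (pm_tensor x y) = lin_ext (\<lambda>a. pm_tensor (X.chain_bd a) y +
      pm_scale ((- 1) ^ i) (pm_tensor (basis_vec a) (Y.bnd y) :: _ \<Rightarrow>\<^sub>0 'r)) x"
    unfolding lin_ext_pm_tensor
    by (rule lin_ext_cong[OF refl])
      (simp add: tensor_chain_bd_eq[OF X.span_chainsD[OF x]] lin_ext_fun_add lin_ext_fun_scale lin_ext_pm_tensor_right)
  then show ?thesis by (simp add: lin_ext_fun_add lin_ext_fun_scale lin_ext_pm_tensor_left)
qed

text \<open>The usual homotopy of a tensor product of maps, built from the homotopy \<open>splitting\<close> between the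
  identity and \<open>proj\<close> on each factor.\<close>

definition tensor_homotopy :: "'a cube_chain \<times> 'b cube_chain \<Rightarrow> ('a cube_chain \<times> 'b cube_chain \<Rightarrow>\<^sub>0 'r::field)" where
  "tensor_homotopy = (\<lambda>(c, d). pm_tensor (X.splitting (basis_vec c)) (basis_vec d) +
     pm_scale ((- 1) ^ len_deg c) (pm_tensor (X.proj (basis_vec c)) (Y.splitting (basis_vec d))))"

lemma tensor_homotopy_tensor:
  assumes x: "x \<in> X.span_chains i"
  shows "lin_ext tensor_homotopy (pm_tensor x y) = pm_tensor (X.splitting x) y +
    pm_scale ((- 1) ^ i) (pm_tensor (X.proj x) (Y.splitting y) :: _ \<Rightarrow>\<^sub>0 'r::field)"
proof -
  have "lin_ext tensor_homotopy (pm_tensor x y) = lin_ext (\<lambda>a. pm_tensor (X.splitting (basis_vec a)) y +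
      pm_scale ((- 1) ^ i) (pm_tensor (X.proj (basis_vec a)) (Y.splitting y) :: _ \<Rightarrow>\<^sub>0 'r)) x"
    unfolding lin_ext_pm_tensor
  proof (rule lin_ext_cong[OF refl])
    fix a assume "a \<in> Poly_Mapping.keys x"
    then have "len_deg a = i" using X.span_chainsD[OF x, of a] by (auto simp: len_deg_def X.chains_def)
    then show "lin_ext (\<lambda>b. tensor_homotopy (a, b)) y = pm_tensor (X.splitting (basis_vec a)) y +
      pm_scale ((- 1) ^ i) (pm_tensor (X.proj (basis_vec a)) (Y.splitting y) :: _ \<Rightarrow>\<^sub>0 'r)"
      by (simp add: tensor_homotopy_def lin_ext_fun_add lin_ext_fun_scale lin_ext_pm_tensor_right linear_eq_lin_ext[OF Y.splitting(1), symmetric])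
  qed
  then show ?thesis
    by (simp add: lin_ext_fun_add lin_ext_fun_scale lin_ext_pm_tensor_left
        linear_eq_lin_ext[OF X.splitting(1), symmetric] linear_eq_lin_ext[OF X.linear_proj, symmetric])
qed

definition tensor_proj :: "'a cube_chain \<times> 'b cube_chain \<Rightarrow> ('a cube_chain \<times> 'b cube_chain \<Rightarrow>\<^sub>0 'r::field)" where
  "tensor_proj = (\<lambda>(c, d). pm_tensor (X.proj (basis_vec c)) (Y.proj (basis_vec d)))"

lemma homotopy:
  assumes c: "c \<in> X.chains i" and d: "d \<in> Y.chains j"
  shows "lin_ext tensor_chain_bd (tensor_homotopy (c, d)) + lin_ext tensor_homotopy (tensor_chain_bd (c, d)) = basis_vec (c, d) - (tensor_proj (c, d) :: _ \<Rightarrow>\<^sub>0 'r::field)"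
proof -
  let ?c = "basis_vec c :: _ \<Rightarrow>\<^sub>0 'r" and ?d = "basis_vec d :: _ \<Rightarrow>\<^sub>0 'r" and ?s = "(- 1) ^ i :: 'r"
  have sc: "?c \<in> X.span_chains i" and sd: "?d \<in> Y.span_chains j" using c d by simp_all
  have len: "len_deg c = i" using c by (auto simp: len_deg_def X.chains_def)
  have ss: "?s * ?s = 1" by (simp add: minus_one_power_iff)
  have 1: "lin_ext tensor_chain_bd (tensor_homotopy (c, d)) = pm_tensor (X.bnd (X.splitting ?c)) ?d -
      pm_scale ?s (pm_tensor (X.splitting ?c) (Y.chain_bd d)) +
      pm_tensor (X.proj ?c) (Y.bnd (Y.splitting ?d))"
    using tensor_chain_bd_tensor[OF X.splitting(2)[OF sc], of ?d] tensor_chain_bd_tensor[OF X.proj_span[OF sc], of "Y.splitting ?d"]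
      X.bnd_proj[OF sc]
    by (simp add: tensor_homotopy_def len lin_ext_add lin_ext_scale pm.scale_right_distrib ss)
  have 2: "lin_ext tensor_homotopy (pm_tensor (X.chain_bd c) ?d) = pm_tensor (X.splitting (X.chain_bd c)) ?d"
  proof (cases i)
    case 0
    then have "X.chain_bd c = (0 :: _ \<Rightarrow>\<^sub>0 'r)" using X.chain_bd_chains_0 c by blast
    then show ?thesis by (simp add: X.splitting_simps)
  next
    case (Suc m)
    then have "X.chain_bd c \<in> (X.span_chains m :: (_ \<Rightarrow>\<^sub>0 'r) set)" using X.chain_bd_span_chains c by blast
    then show ?thesis using tensor_homotopy_tensor[of "X.chain_bd c" m ?d] X.proj_bnd[OF sc] by simp
  qed
  have 3: "lin_ext tensor_homotopy (pm_scale ?s (pm_tensor ?c (Y.chain_bd d))) =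
      pm_scale ?s (pm_tensor (X.splitting ?c) (Y.chain_bd d)) + pm_tensor (X.proj ?c) (Y.splitting (Y.chain_bd d))"
    unfolding lin_ext_scale tensor_homotopy_tensor[OF sc]
    by (simp add: pm.scale_right_distrib ss)
  have "?c = X.proj ?c + X.bnd (X.splitting ?c) + X.splitting (X.chain_bd c)"
    "?d = Y.proj ?d + Y.bnd (Y.splitting ?d) + Y.splitting (Y.chain_bd d)"
    by (simp_all add: X.proj_def Y.proj_def)
  then have "basis_vec (c, d) = pm_tensor (X.proj ?c + X.bnd (X.splitting ?c) + X.splitting (X.chain_bd c)) ?d"
    "pm_tensor (X.proj ?c) ?d = pm_tensor (X.proj ?c) (Y.proj ?d + Y.bnd (Y.splitting ?d) + Y.splitting (Y.chain_bd d))"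
    by simp_all
  then show ?thesis
    unfolding tensor_chain_bd_eq[OF c] lin_ext_add 1 2 3 tensor_proj_def prod.case by (simp add: pm_tensor_simps)
qed

definition cross :: "('a cube_chain \<times> 'b cube_chain \<Rightarrow>\<^sub>0 'r::field) \<Rightarrow> (('a \<times> 'b) cube_chain \<Rightarrow>\<^sub>0 'r)" where
  "cross = pm_map cross_chain"

lemma pairs_tensor:
  "x \<in> X.span_chains i \<Longrightarrow> y \<in> Y.span_chains j \<Longrightarrow> Poly_Mapping.keys (pm_tensor x y) \<subseteq> pairs (i + j)"
  using keys_pm_tensor[of x y] by (fastforce simp: X.span_chains_def Y.span_chains_def pairs_def)

lemma keys_lin_ext_unshuffle_chain:
  assumes "z \<in> T.span_chains n"
  shows "Poly_Mapping.keys (lin_ext unshuffle_chain z) \<subseteq> pairs n"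
proof
  fix q assume q: "q \<in> Poly_Mapping.keys (lin_ext unshuffle_chain z)"
  obtain a b where ab: "q = (a, b)" by (cases q)
  obtain c where c: "c \<in> Poly_Mapping.keys z" "(a, b) \<in> Poly_Mapping.keys (unshuffle_chain c :: _ \<Rightarrow>\<^sub>0 'c)"
    using q unfolding ab by (rule keys_lin_extE)
  show "q \<in> pairs n" using keys_unshuffle_chain[OF T.span_chainsD[OF assms c(1)] c(2)] by (simp add: ab pairs_def)
qed

lemma cross_span: "Poly_Mapping.keys w \<subseteq> pairs n \<Longrightarrow> cross w \<in> T.span_chains n"
  unfolding cross_def T.span_chains_def
  using cross_chain_in by (fastforce simp: pairs_def dest!: subsetD[OF keys_pm_map])

lemma bnd_cross:
  assumes "Poly_Mapping.keys w \<subseteq> pairs n"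
  shows "T.bnd (cross w) = cross (lin_ext tensor_chain_bd w :: _ \<Rightarrow>\<^sub>0 'r::field)"
proof -
  have "T.bnd (cross w) = lin_ext (\<lambda>q. T.chain_bd (cross_chain q)) w" by (simp add: cross_def lin_ext_pm_map)
  also have "\<dots> = lin_ext (\<lambda>q. cross (tensor_chain_bd q)) w"
  proof (rule lin_ext_cong[OF refl])
    fix q assume "q \<in> Poly_Mapping.keys w"
    then obtain c d i j where q: "q = (c, d)" "c \<in> X.chains i" "d \<in> Y.chains j" using assms by (auto simp: pairs_def)
    show "T.chain_bd (cross_chain q) = (cross (tensor_chain_bd q) :: _ \<Rightarrow>\<^sub>0 'r)"
      unfolding q(1) cross_def by (rule chain_bd_cross_chain[OF q(2,3)])
  qed
  finally show ?thesis by (simp add: cross_def pm_map_lin_ext)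
qed

lemma unshuffle_chain_cross:
  assumes "Poly_Mapping.keys w \<subseteq> pairs n"
  shows "lin_ext unshuffle_chain (cross w) = (w :: _ \<Rightarrow>\<^sub>0 'r::field)"
proof -
  have "lin_ext unshuffle_chain (cross w) = lin_ext (\<lambda>q. unshuffle_chain (cross_chain q)) w" by (simp add: cross_def lin_ext_pm_map)
  also have "\<dots> = lin_ext basis_vec w"
  proof (rule lin_ext_cong[OF refl])
    fix q assume "q \<in> Poly_Mapping.keys w"
    then obtain c d i j where q: "q = (c, d)" "c \<in> X.chains i" "d \<in> Y.chains j" using assms by (auto simp: pairs_def)
    show "unshuffle_chain (cross_chain q) = (basis_vec q :: _ \<Rightarrow>\<^sub>0 'r)" unfolding q(1) by (rule unshuffle_chain_cross_chain[OF q(2,3)])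
  qed
  finally show ?thesis by simp
qed

lemma unshuffle_chain_bnd:
  assumes "z \<in> T.span_chains n"
  shows "lin_ext unshuffle_chain (T.bnd z) = lin_ext tensor_chain_bd (lin_ext unshuffle_chain z :: _ \<Rightarrow>\<^sub>0 'r::field)"
  unfolding lin_ext_lin_ext by (rule lin_ext_cong[OF refl]) (erule unshuffle_chain_chain_bd[OF T.span_chainsD[OF assms]])

lemma cycle_diff_cross_unshuffle_chain:
  assumes "z \<in> cycles TP (Suc n)"
  shows "z - cross (lin_ext unshuffle_chain z) \<in> (boundaries TP (Suc n) :: (_ \<Rightarrow>\<^sub>0 'r::field) set)"
  using cycle_homologous_cross_unshuffle_chain[of z n] assms
  by (auto simp: T.cycles_eq T.boundaries_eq T.span_chains_def cross_def)

text \<open>Both cycles are homologous to the cross product of the same element. Sorting does not commute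
  with concatenation, but unshuffling does; this lemma transfers equivariance from unshuffling to the
  classes of cross products.\<close>

lemma homologous_if_unshuffle_chain_eq:
  assumes "z \<in> cycles TP (Suc n)" "z' \<in> cycles TP (Suc n)" "lin_ext unshuffle_chain z = lin_ext unshuffle_chain z'"
  shows "z - z' \<in> (boundaries TP (Suc n) :: (_ \<Rightarrow>\<^sub>0 'r::field) set)"
proof -
  interpret H: pm_quotient "cycles TP (Suc n) :: (_ \<Rightarrow>\<^sub>0 'r) set" "boundaries TP (Suc n)" by (rule T.pm_quotient_homology)
  show ?thesis using pm.subspace_diff[OF H.subspace_N cycle_diff_cross_unshuffle_chain[OF assms(1)] cycle_diff_cross_unshuffle_chain[OF assms(2)]]
    by (simp add: assms(3))
qed

text \<open>The cycle is homologous to the sorted form of its unshuffled image, and the homotopy moves this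
  image to a combination of tensors of cycles.\<close>

lemma cycle_diff_cross_tensor_proj:
  assumes z: "z \<in> cycles TP (Suc n)"
  shows "z - cross (lin_ext tensor_proj (lin_ext unshuffle_chain z)) \<in> (boundaries TP (Suc n) :: (_ \<Rightarrow>\<^sub>0 'r::field) set)"
proof -
  interpret H: pm_quotient "cycles TP (Suc n) :: (_ \<Rightarrow>\<^sub>0 'r) set" "boundaries TP (Suc n)" by (rule T.pm_quotient_homology)
  let ?w = "lin_ext unshuffle_chain z :: _ \<Rightarrow>\<^sub>0 'r"
  have zs: "z \<in> T.span_chains n" "T.bnd z = 0" using z by (auto simp: T.cycles_eq)
  have w: "Poly_Mapping.keys ?w \<subseteq> pairs n" by (rule keys_lin_ext_unshuffle_chain[OF zs(1)])
  have cyc: "lin_ext tensor_chain_bd ?w = 0" using unshuffle_chain_bnd[OF zs(1)] zs(2) by simp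
  have "?w - lin_ext tensor_proj ?w = lin_ext (\<lambda>q. basis_vec q - tensor_proj q) ?w" by (simp add: lin_ext_fun_diff)
  also have "\<dots> = lin_ext (\<lambda>q. lin_ext tensor_chain_bd (tensor_homotopy q) + lin_ext tensor_homotopy (tensor_chain_bd q)) ?w"
  proof (rule lin_ext_cong[OF refl])
    fix q assume "q \<in> Poly_Mapping.keys ?w"
    then obtain c d i j where "q = (c, d)" "c \<in> X.chains i" "d \<in> Y.chains j" using w by (auto simp: pairs_def)
    then show "basis_vec q - tensor_proj q = lin_ext tensor_chain_bd (tensor_homotopy q) + (lin_ext tensor_homotopy (tensor_chain_bd q) :: _ \<Rightarrow>\<^sub>0 'r)"
      using homotopy by metis
  qed
  also have "\<dots> = lin_ext tensor_chain_bd (lin_ext tensor_homotopy ?w)"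
    using cyc by (simp add: lin_ext_fun_add lin_ext_lin_ext[symmetric])
  finally have eq: "?w - lin_ext tensor_proj ?w = lin_ext tensor_chain_bd (lin_ext tensor_homotopy ?w)" .
  have tensor_homotopy: "Poly_Mapping.keys (lin_ext tensor_homotopy ?w) \<subseteq> pairs (Suc n)"
  proof -
    have "lin_ext tensor_homotopy ?w \<in> {f. Poly_Mapping.keys f \<subseteq> pairs (Suc n)}"
    proof (rule lin_ext_in_subspace[OF subspace_keys])
      fix q assume "q \<in> Poly_Mapping.keys ?w"
      then obtain c d i j where q: "q = (c, d)" "c \<in> X.chains i" "d \<in> Y.chains j" "i + j = n"
        using w by (auto simp: pairs_def)
      have sc: "basis_vec c \<in> (X.span_chains i :: (_ \<Rightarrow>\<^sub>0 'r) set)" and sd: "basis_vec d \<in> (Y.span_chains j :: (_ \<Rightarrow>\<^sub>0 'r) set)"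
        using q by simp_all
      have "Poly_Mapping.keys (pm_tensor (X.splitting (basis_vec c)) (basis_vec d) :: _ \<Rightarrow>\<^sub>0 'r) \<subseteq> pairs (Suc n)"
        using pairs_tensor[OF X.splitting(2)[OF sc] sd] q(4) by simp
      moreover have "Poly_Mapping.keys (pm_tensor (X.proj (basis_vec c)) (Y.splitting (basis_vec d)) :: _ \<Rightarrow>\<^sub>0 'r) \<subseteq> pairs (Suc n)"
        using pairs_tensor[OF X.proj_span[OF sc] Y.splitting(2)[OF sd]] q(4) by simp
      ultimately show "tensor_homotopy q \<in> {f :: _ \<Rightarrow>\<^sub>0 'r. Poly_Mapping.keys f \<subseteq> pairs (Suc n)}"
        unfolding tensor_homotopy_def q(1) prod.case
        by (intro pm.subspace_add[OF subspace_keys] pm.subspace_scale[OF subspace_keys]) simp_all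
    qed
    then show ?thesis by simp
  qed
  have "cross ?w - cross (lin_ext tensor_proj ?w) = T.bnd (cross (lin_ext tensor_homotopy ?w))"
    unfolding bnd_cross[OF tensor_homotopy] eq[symmetric] by (simp add: cross_def pm_map_diff)
  then have "cross ?w - cross (lin_ext tensor_proj ?w) \<in> boundaries TP (Suc n)"
    unfolding T.boundaries_eq using cross_span[OF tensor_homotopy] by auto
  from pm.subspace_add[OF H.subspace_N cycle_diff_cross_unshuffle_chain[OF z] this] show ?thesis by simp
qed

abbreviation cross_prod :: "('a cube_chain \<Rightarrow>\<^sub>0 'r::field) \<Rightarrow> ('b cube_chain \<Rightarrow>\<^sub>0 'r) \<Rightarrow> (('a \<times> 'b) cube_chain \<Rightarrow>\<^sub>0 'r)" where
  "cross_prod x y \<equiv> cross (pm_tensor x y)"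

lemma cross_prod_simps:
  "cross_prod (x + x') y = cross_prod x y + cross_prod x' y" "cross_prod x (y + y') = cross_prod x y + cross_prod x y'"
  "cross_prod (x - x') y = cross_prod x y - cross_prod x' y" "cross_prod x (y - y') = cross_prod x y - cross_prod x y'"
  "cross_prod (pm_scale c x) y = pm_scale c (cross_prod x y)" "cross_prod x (pm_scale c y) = pm_scale c (cross_prod x y)"
  by (simp_all add: cross_def pm_tensor_simps pm_map_add pm_map_diff pm_map_scale)

lemma bnd_cross_prod:
  assumes "x \<in> X.span_chains i" "y \<in> Y.span_chains j"
  shows "T.bnd (cross_prod x y) = cross_prod (X.bnd x) y + pm_scale ((- 1) ^ i) (cross_prod x (Y.bnd y))"
  unfolding bnd_cross[OF pairs_tensor[OF assms]] tensor_chain_bd_tensor[OF assms(1)]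
  by (simp add: cross_def pm_map_add pm_map_scale)

lemma cross_prod_cycles:
  assumes "x \<in> cycles P1 (Suc i)" "y \<in> cycles P2 (Suc j)"
  shows "cross_prod x y \<in> cycles TP (Suc (i + j))"
proof -
  have *: "x \<in> X.span_chains i" "X.bnd x = 0" "y \<in> Y.span_chains j" "Y.bnd y = 0"
    using assms by (auto simp: X.cycles_eq Y.cycles_eq)
  show ?thesis using bnd_cross_prod[OF *(1,3)] *(2,4) cross_span[OF pairs_tensor[OF *(1,3)]]
    by (simp add: T.cycles_eq cross_def)
qed

lemma cross_prod_boundaries:
  "x \<in> boundaries P1 (Suc i) \<Longrightarrow> y \<in> cycles P2 (Suc j) \<Longrightarrow> cross_prod x y \<in> boundaries TP (Suc (i + j))"
  "x' \<in> cycles P1 (Suc i) \<Longrightarrow> y' \<in> boundaries P2 (Suc j) \<Longrightarrow> cross_prod x' y' \<in> boundaries TP (Suc (i + j))"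
proof -
  assume x: "x \<in> boundaries P1 (Suc i)" and y: "y \<in> cycles P2 (Suc j)"
  obtain u where u: "u \<in> X.span_chains (Suc i)" "x = X.bnd u" using x by (auto simp: X.boundaries_eq)
  have y': "y \<in> Y.span_chains j" "Y.bnd y = 0" using y by (auto simp: Y.cycles_eq)
  have "cross_prod x y = T.bnd (cross_prod u y)" using bnd_cross_prod[OF u(1) y'(1)] y'(2) u(2) by (simp add: cross_def)
  moreover have "cross_prod u y \<in> T.span_chains (Suc (i + j))" using cross_span[OF pairs_tensor[OF u(1) y'(1)]] by simp
  ultimately show "cross_prod x y \<in> boundaries TP (Suc (i + j))" by (auto simp: T.boundaries_eq)
next
  assume x: "x' \<in> cycles P1 (Suc i)" and y: "y' \<in> boundaries P2 (Suc j)"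
  obtain u where u: "u \<in> Y.span_chains (Suc j)" "y' = Y.bnd u" using y by (auto simp: Y.boundaries_eq)
  have x': "x' \<in> X.span_chains i" "X.bnd x' = 0" using x by (auto simp: X.cycles_eq)
  have "cross_prod x' y' = T.bnd (pm_scale ((- 1) ^ i) (cross_prod x' u))"
    unfolding lin_ext_scale using bnd_cross_prod[OF x'(1) u(1)] x'(2) u(2) by (simp add: cross_def minus_one_power_iff)
  moreover have "pm_scale ((- 1) ^ i) (cross_prod x' u) \<in> T.span_chains (Suc (i + j))"
    using cross_span[OF pairs_tensor[OF x'(1) u(1)]] by (intro pm.subspace_scale[OF T.subspace_span_chains]) simp
  ultimately show "cross_prod x' y' \<in> boundaries TP (Suc (i + j))" unfolding T.boundaries_eq by (rule image_eqI)
qed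

subsection \<open>Shuffles\<close>

definition prX :: "('a \<times> 'b) list \<Rightarrow> 'a list" where
  "prX cs = map fst (filter (\<lambda>c. dirs1 (fst c) \<noteq> {}) cs)"

definition prY :: "('a \<times> 'b) list \<Rightarrow> 'b list" where
  "prY cs = map snd (filter (\<lambda>c. dirs2 (snd c) \<noteq> {}) cs)"

lemma edge_cases:
  assumes "c \<in> T_good" "T.cube_deg c = 0"
  shows "(dirs1 (fst c) \<noteq> {} \<and> dirs2 (snd c) = {} \<and> X.cube_deg (fst c) = 0 \<and> cdim P1 (fst c) = 1 \<and> cdim P2 (snd c) = 0) \<or>
    (dirs1 (fst c) = {} \<and> dirs2 (snd c) \<noteq> {} \<and> Y.cube_deg (snd c) = 0 \<and> cdim P1 (fst c) = 0 \<and> cdim P2 (snd c) = 1)"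
proof -
  obtain a b where c: "c = (a, b)" by (cases c)
  have ab: "a \<in> Q1" "b \<in> Q2" using assms(1) by (auto simp: c)
  have fin: "finite (dirs1 a)" "finite (dirs2 b)" using X.finite_dirs Y.finite_dirs ab by auto
  have "card (dirs1 a \<union> dirs2 b) = card (dirs1 a) + card (dirs2 b)"
    using fin dirs_disjoint[OF ab] by (rule card_Un_disjoint)
  moreover have "card (dirs1 a \<union> dirs2 b) > 0" using assms(1) fin by (auto simp: c tdirs_pair card_gt_0_iff)
  ultimately have "card (dirs1 a) + card (dirs2 b) = 1"
    using assms(2) by (simp add: T.cube_deg_def tdirs_pair c) linarith
  then consider "card (dirs1 a) = 1" "card (dirs2 b) = 0" | "card (dirs1 a) = 0" "card (dirs2 b) = 1" by linarith
  then show ?thesis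
  proof cases
    case 1
    then have "dirs2 b = {}" "dirs1 a \<noteq> {}" using fin by auto
    then show ?thesis using 1 ab by (simp add: c X.cube_deg_def X.cdim_eq Y.cdim_eq)
  next
    case 2
    then have "dirs1 a = {}" "dirs2 b \<noteq> {}" using fin by auto
    then show ?thesis using 2 ab by (simp add: c Y.cube_deg_def X.cdim_eq Y.cdim_eq)
  qed
qed

text \<open>The cubes of a path have degree 0, so moving them past other cubes creates no sign.\<close>

lemma unshuffle_path_append:
  assumes "set r \<subseteq> T_good" "T.deg r = 0"
  shows "unshuffle (r @ cs) = (pm_map (\<lambda>(A, B). (prX r @ A, prY r @ B)) (unshuffle cs) :: _ \<Rightarrow>\<^sub>0 'r::field)"
  using assms
proof (induction r)
  case Nil
  then show ?case by (simp add: prX_def prY_def case_prod_unfold)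
next
  case (Cons c r)
  have "c \<in> T_good" "T.cube_deg c = 0" using Cons.prems by auto
  from edge_cases[OF this] show ?case
  proof
    assume "dirs1 (fst c) \<noteq> {} \<and> dirs2 (snd c) = {} \<and> X.cube_deg (fst c) = 0 \<and> cdim P1 (fst c) = 1 \<and> cdim P2 (snd c) = 0"
    then show ?thesis using Cons by (simp add: prX_def prY_def pm_map_pm_map case_prod_unfold)
  next
    assume *: "dirs1 (fst c) = {} \<and> dirs2 (snd c) \<noteq> {} \<and> Y.cube_deg (snd c) = 0 \<and> cdim P1 (fst c) = 0 \<and> cdim P2 (snd c) = 1"
    have "addY (snd c) = (\<lambda>(A, B). basis_vec (A, snd c # B) :: _ \<Rightarrow>\<^sub>0 'r)" using * by (auto simp: addY_def fun_eq_iff)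
    then show ?thesis using * Cons by (simp add: prX_def prY_def lin_ext_pm_map pm_map_def lin_ext_lin_ext case_prod_unfold)
  qed
qed

lemma unshuffle_path: "set r \<subseteq> T_good \<Longrightarrow> T.deg r = 0 \<Longrightarrow> unshuffle r = (basis_vec (prX r, prY r) :: _ \<Rightarrow>\<^sub>0 'r::field)"
  using unshuffle_path_append[of r "[]", where 'r = 'r] by simp

text \<open>The statement is about lists only; the rational numbers serve as some field of coefficients.\<close>

lemma deg_prX: "set r \<subseteq> T_good \<Longrightarrow> T.deg r = 0 \<Longrightarrow> X.deg (prX r) = 0 \<and> Y.deg (prY r) = 0"
  using keys_unshuffle[of r "prX r" "prY r", where 'r = rat] unshuffle_path[of r, where 'r = rat] by simp

lemma unshuffle_append_path:
  assumes "set r \<subseteq> T_good" "T.deg r = 0"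
  shows "unshuffle (cs @ r) = (pm_map (\<lambda>(A, B). (A @ prX r, B @ prY r)) (unshuffle cs) :: _ \<Rightarrow>\<^sub>0 'r::field)"
proof (induction cs)
  case Nil
  then show ?case using unshuffle_path[OF assms] by simp
next
  case (Cons c cs)
  have "lin_ext (addY b) (pm_map (\<lambda>(A, B). (A @ prX r, B @ prY r)) w) =
      pm_map (\<lambda>(A, B). (A @ prX r, B @ prY r)) (lin_ext (addY b) w :: _ \<Rightarrow>\<^sub>0 'r)" for b w
    unfolding lin_ext_pm_map pm_map_lin_ext
    by (rule lin_ext_cong[OF refl]) (simp add: addY_def case_prod_unfold pm_map_scale deg_prX[OF assms])
  then show ?case using Cons by (simp add: pm_map_pm_map case_prod_unfold)
qed

lemma left_path_eq:
  assumes "set r \<subseteq> T_good" "T.deg r = 0"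
  shows "left_path P1 (v, r, w) = (fst v, prX r, fst w)" "right_path P2 (v, r, w) = (snd v, prY r, snd w)"
proof -
  have "[a. (a, b) \<leftarrow> r, cdim P1 a = 1] = prX r \<and> [b. (a, b) \<leftarrow> r, cdim P2 b = 1] = prY r"
    using assms
  proof (induction r)
    case (Cons c r)
    obtain a b where c: "c = (a, b)" by (cases c)
    have "c \<in> T_good" "T.cube_deg c = 0" using Cons.prems by auto
    from edge_cases[OF this] show ?case using Cons by (auto simp: c prX_def prY_def)
  qed (simp add: prX_def prY_def)
  then show "left_path P1 (v, r, w) = (fst v, prX r, fst w)" "right_path P2 (v, r, w) = (snd v, prY r, snd w)"
    by (simp_all add: left_path_def right_path_def)
qed

lemma paths_in:
  assumes "r \<in> T.chains 0"
  shows "left_path P1 r \<in> X.chains 0" "right_path P2 r \<in> Y.chains 0"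
proof -
  obtain v l w where r: "r = (v, l, w)" by (cases r)
  have l: "T.lchain v l w" "T.deg l = 0" "set l \<subseteq> T_good"
    using assms T.lchain_set[of v l w] by (simp_all add: r T.chains_def)
  have "(prX l, prY l) \<in> Poly_Mapping.keys (unshuffle l :: _ \<Rightarrow>\<^sub>0 rat)" unfolding unshuffle_path[OF l(3,2)] by simp
  from keys_unshuffle_lchain[OF l(1) this]
  have "X.lchain (fst v) (prX l) (fst w) \<and> Y.lchain (snd v) (prY l) (snd w)" .
  then show "left_path P1 r \<in> X.chains 0" "right_path P2 r \<in> Y.chains 0"
    using deg_prX[OF l(3,2)] by (simp_all add: r left_path_eq[OF l(3,2)] X.chains_def Y.chains_def)
qed

lemma unshuffle_chain_concat:
  assumes r: "r \<in> T.chains 0" and c: "c \<in> T.chains n"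
  shows "lin_ext unshuffle_chain (chain_concat r c) =
      (lin_ext (\<lambda>(a, b). pm_tensor (chain_concat (left_path P1 r) a) (chain_concat (right_path P2 r) b)) (unshuffle_chain c) :: _ \<Rightarrow>\<^sub>0 'r::field)"
    "lin_ext unshuffle_chain (chain_concat c r) =
      (lin_ext (\<lambda>(a, b). pm_tensor (chain_concat a (left_path P1 r)) (chain_concat b (right_path P2 r))) (unshuffle_chain c) :: _ \<Rightarrow>\<^sub>0 'r::field)"
proof -
  obtain v l w where r': "r = (v, l, w)" by (cases r)
  obtain v' m w' where c': "c = (v', m, w')" by (cases c)
  have l: "set l \<subseteq> T_good" "T.deg l = 0" using r T.lchain_set[of v l w] by (simp_all add: r' T.chains_def)
  show "lin_ext unshuffle_chain (chain_concat r c) =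
      (lin_ext (\<lambda>(a, b). pm_tensor (chain_concat (left_path P1 r) a) (chain_concat (right_path P2 r) b)) (unshuffle_chain c) :: _ \<Rightarrow>\<^sub>0 'r)"
  proof (cases "w = v'")
    case True
    then show ?thesis
      by (simp add: r' c' chain_concat_def unshuffle_chain_def left_path_eq[OF l] unshuffle_path_append[OF l] pm_map_pm_map lin_ext_pm_map
          case_prod_unfold) (simp add: pm_map_def case_prod_unfold)
  next
    case False
    then have "fst w \<noteq> fst v' \<or> snd w \<noteq> snd v'" by (simp add: prod_eq_iff)
    then show ?thesis using False
      by (auto simp: r' c' chain_concat_def unshuffle_chain_def left_path_eq[OF l] lin_ext_pm_map case_prod_unfold)
  qed
  show "lin_ext unshuffle_chain (chain_concat c r) =
      (lin_ext (\<lambda>(a, b). pm_tensor (chain_concat a (left_path P1 r)) (chain_concat b (right_path P2 r))) (unshuffle_chain c) :: _ \<Rightarrow>\<^sub>0 'r)"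
  proof (cases "w' = v")
    case True
    then show ?thesis
      by (simp add: r' c' chain_concat_def unshuffle_chain_def left_path_eq[OF l] unshuffle_append_path[OF l] pm_map_pm_map lin_ext_pm_map
          case_prod_unfold) (simp add: pm_map_def case_prod_unfold)
  next
    case False
    then have "fst w' \<noteq> fst v \<or> snd w' \<noteq> snd v" by (simp add: prod_eq_iff)
    then show ?thesis using False
      by (auto simp: r' c' chain_concat_def unshuffle_chain_def left_path_eq[OF l] lin_ext_pm_map case_prod_unfold)
  qed
qed

lemma unshuffle_chain_mult_cross_prod:
  assumes r: "r \<in> T.chains 0" and x: "x \<in> X.span_chains i" and y: "y \<in> Y.span_chains j"
  shows "lin_ext unshuffle_chain (chain_mult (basis_vec r) (cross_prod x y)) =
      pm_tensor (chain_mult (basis_vec (left_path P1 r)) x) (chain_mult (basis_vec (right_path P2 r)) y)"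
    "lin_ext unshuffle_chain (chain_mult (cross_prod x y) (basis_vec r)) =
      (pm_tensor (chain_mult x (basis_vec (left_path P1 r))) (chain_mult y (basis_vec (right_path P2 r))) :: _ \<Rightarrow>\<^sub>0 'r::field)"
proof -
  have w: "cross_prod x y \<in> T.span_chains (i + j)" by (rule cross_span[OF pairs_tensor[OF x y]])
  let ?f = "\<lambda>(a, b). pm_tensor (chain_concat (left_path P1 r) a) (chain_concat (right_path P2 r) b) :: _ \<Rightarrow>\<^sub>0 'r"
  let ?g = "\<lambda>(a, b). pm_tensor (chain_concat a (left_path P1 r)) (chain_concat b (right_path P2 r)) :: _ \<Rightarrow>\<^sub>0 'r"
  have "lin_ext unshuffle_chain (chain_mult (basis_vec r) (cross_prod x y)) = lin_ext (\<lambda>c. lin_ext ?f (unshuffle_chain c)) (cross_prod x y)"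
    unfolding chain_mult_basis_left lin_ext_lin_ext
    by (rule lin_ext_cong[OF refl]) (erule unshuffle_chain_concat(1)[OF r T.span_chainsD[OF w]])
  also have "\<dots> = lin_ext ?f (pm_tensor x y)"
    using unshuffle_chain_cross[OF pairs_tensor[OF x y]] by (simp add: lin_ext_lin_ext[symmetric])
  finally show "lin_ext unshuffle_chain (chain_mult (basis_vec r) (cross_prod x y)) =
      pm_tensor (chain_mult (basis_vec (left_path P1 r)) x) (chain_mult (basis_vec (right_path P2 r)) y)"
    by (simp add: lin_ext_pm_tensor lin_ext_pm_tensor_right lin_ext_pm_tensor_left chain_mult_basis_left)
  have "lin_ext unshuffle_chain (chain_mult (cross_prod x y) (basis_vec r)) = lin_ext (\<lambda>c. lin_ext ?g (unshuffle_chain c)) (cross_prod x y)"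
    unfolding chain_mult_basis_right lin_ext_lin_ext
    by (rule lin_ext_cong[OF refl]) (erule unshuffle_chain_concat(2)[OF r T.span_chainsD[OF w]])
  also have "\<dots> = lin_ext ?g (pm_tensor x y)"
    using unshuffle_chain_cross[OF pairs_tensor[OF x y]] by (simp add: lin_ext_lin_ext[symmetric])
  finally show "lin_ext unshuffle_chain (chain_mult (cross_prod x y) (basis_vec r)) =
      pm_tensor (chain_mult x (basis_vec (left_path P1 r))) (chain_mult y (basis_vec (right_path P2 r)))"
    by (simp add: lin_ext_pm_tensor lin_ext_pm_tensor_right lin_ext_pm_tensor_left chain_mult_basis_right)
qed

lemma mult_cross_prod_homologous:
  fixes x :: "'a cube_chain \<Rightarrow>\<^sub>0 'r::field"
  assumes r: "r \<in> T.chains 0" and x: "x \<in> cycles P1 (Suc i)" and y: "y \<in> cycles P2 (Suc j)"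
  shows "cross_prod (chain_mult (basis_vec (left_path P1 r)) x) (chain_mult (basis_vec (right_path P2 r)) y) -
      chain_mult (basis_vec r) (cross_prod x y) \<in> boundaries TP (Suc (i + j))"
    "cross_prod (chain_mult x (basis_vec (left_path P1 r))) (chain_mult y (basis_vec (right_path P2 r))) -
      chain_mult (cross_prod x y) (basis_vec r) \<in> boundaries TP (Suc (i + j))"
proof -
  let ?l = "basis_vec (left_path P1 r) :: _ \<Rightarrow>\<^sub>0 'r" and ?q = "basis_vec (right_path P2 r) :: _ \<Rightarrow>\<^sub>0 'r" and ?r = "basis_vec r :: _ \<Rightarrow>\<^sub>0 'r"
  have l: "?l \<in> X.span_chains 0" "?q \<in> Y.span_chains 0" "?r \<in> T.span_chains 0" using paths_in[OF r] r by simp_all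
  have xs: "x \<in> X.span_chains i" "y \<in> Y.span_chains j" using x y by (auto simp: X.cycles_eq Y.cycles_eq)
  note cx = X.chain_mult_cycles[OF l(1) x] and cy = Y.chain_mult_cycles[OF l(2) y]
  have s: "chain_mult ?l x \<in> X.span_chains i" "chain_mult x ?l \<in> X.span_chains i"
    "chain_mult ?q y \<in> Y.span_chains j" "chain_mult y ?q \<in> Y.span_chains j"
    using cx cy by (auto simp: X.cycles_eq Y.cycles_eq)
  show "cross_prod (chain_mult ?l x) (chain_mult ?q y) - chain_mult ?r (cross_prod x y) \<in> boundaries TP (Suc (i + j))"
    by (rule homologous_if_unshuffle_chain_eq[OF cross_prod_cycles[OF cx(1) cy(1)] T.chain_mult_cycles(1)[OF l(3) cross_prod_cycles[OF x y]]])
      (simp add: unshuffle_chain_cross[OF pairs_tensor[OF s(1,3)]] unshuffle_chain_mult_cross_prod(1)[OF r xs])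
  show "cross_prod (chain_mult x ?l) (chain_mult y ?q) - chain_mult (cross_prod x y) ?r \<in> boundaries TP (Suc (i + j))"
    by (rule homologous_if_unshuffle_chain_eq[OF cross_prod_cycles[OF cx(2) cy(2)] T.chain_mult_cycles(2)[OF l(3) cross_prod_cycles[OF x y]]])
      (simp add: unshuffle_chain_cross[OF pairs_tensor[OF s(2,4)]] unshuffle_chain_mult_cross_prod(2)[OF r xs])
qed

end

section \<open>Isomorphisms of quotients and bimodules\<close>

lemma (in pm_quotient) some_cls_diff: "(SOME y. y \<in> cls N x) - x \<in> N"
  using someI[of "\<lambda>y. y \<in> cls N x", OF cls_self] by (simp add: in_cls_iff)

text \<open>An isomorphism from one quotient to a direct sum of quotients, given by linear maps of the
  numerators that are inverse to each other modulo the denominators.\<close>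

locale quotient_iso = direct_quotients I V N + M: pm_quotient V0 N0
  for I :: "'i set" and V N :: "'i \<Rightarrow> ('s \<Rightarrow>\<^sub>0 'r::field) set" and V0 N0 :: "('t \<Rightarrow>\<^sub>0 'r) set" +
  fixes H :: "'i \<Rightarrow> ('t \<Rightarrow>\<^sub>0 'r) \<Rightarrow> ('s \<Rightarrow>\<^sub>0 'r)" and G :: "'i \<Rightarrow> ('s \<Rightarrow>\<^sub>0 'r) \<Rightarrow> ('t \<Rightarrow>\<^sub>0 'r)"
  assumes linear_H: "Vector_Spaces.linear pm_scale pm_scale (H i)"
    and H_V: "i \<in> I \<Longrightarrow> z \<in> V0 \<Longrightarrow> H i z \<in> V i"
    and H_N: "i \<in> I \<Longrightarrow> z \<in> N0 \<Longrightarrow> H i z \<in> N i"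
    and G_V: "i \<in> I \<Longrightarrow> f \<in> V i \<Longrightarrow> G i f \<in> V0"
    and G_N: "i \<in> I \<Longrightarrow> f \<in> N i \<Longrightarrow> G i f \<in> N0"
    and H_G: "i \<in> I \<Longrightarrow> j \<in> I \<Longrightarrow> f \<in> V i \<Longrightarrow> H j (G i f) - (if i = j then f else 0) \<in> N j"
    and G_H: "z \<in> V0 \<Longrightarrow> (\<Sum>i\<in>I. G i (H i z)) - z \<in> N0"
begin

lemma H_add: "H i (x + y) = H i x + H i y"
  and H_diff: "H i (x - y) = H i x - H i y"
  and H_scale: "H i (pm_scale c x) = pm_scale c (H i x)"
  and H_sum: "H i (\<Sum>s\<in>S. f s) = (\<Sum>s\<in>S. H i (f s))"
proof -
  interpret L: Vector_Spaces.linear pm_scale pm_scale "H i" by (rule linear_H)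
  show "H i (x + y) = H i x + H i y" "H i (x - y) = H i x - H i y" "H i (pm_scale c x) = pm_scale c (H i x)"
    "H i (\<Sum>s\<in>S. f s) = (\<Sum>s\<in>S. H i (f s))"
    by (rule L.add L.diff L.scale L.sum)+
qed

lemma subspace_N: "i \<in> I \<Longrightarrow> pm.subspace (N i)"
  using quot by (simp add: pm_quotient_def)

definition iso :: "('t \<Rightarrow>\<^sub>0 'r) set \<Rightarrow> 'i \<Rightarrow> ('s \<Rightarrow>\<^sub>0 'r) set" where
  "iso Z = family_cls (\<lambda>i. H i (SOME z. z \<in> Z))"

lemma iso_cls: "iso (cls N0 z) = family_cls (\<lambda>i. H i z)"
  using H_N[OF _ M.some_cls_diff[of z]] by (simp add: iso_def family_cls_eq_iff H_diff)

lemma H_sum_G: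
  assumes f: "\<And>i. i \<in> I \<Longrightarrow> f i \<in> V i" and j: "j \<in> I"
  shows "H j (\<Sum>i\<in>I. G i (f i)) - f j \<in> N j"
proof -
  have "(\<Sum>i\<in>I. H j (G i (f i)) - (if i = j then f i else 0)) \<in> N j"
    using H_G f j by (intro pm.subspace_sum[OF subspace_N[OF j]]) blast
  then show ?thesis using j finite_I by (simp add: sum_subtractf H_sum)
qed

lemma bij_iso: "bij_betw iso (carrier M.Q) (carrier D)"
proof (rule bij_betwI')
  fix A B assume "A \<in> carrier M.Q" "B \<in> carrier M.Q"
  then obtain x y where xy: "A = cls N0 x" "x \<in> V0" "B = cls N0 y" "y \<in> V0" by (auto simp: M.carrier_Q)
  have V: "x - y \<in> V0" using xy pm.subspace_diff[OF M.subspace_V] by simp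
  show "iso A = iso B \<longleftrightarrow> A = B"
  proof
    assume "iso A = iso B"
    then have "H i (x - y) \<in> N i" if "i \<in> I" for i using that by (simp add: xy iso_cls family_cls_eq_iff H_diff)
    then have "(\<Sum>i\<in>I. G i (H i (x - y))) \<in> N0" by (intro pm.subspace_sum[OF M.subspace_N] G_N)
    from pm.subspace_diff[OF M.subspace_N this G_H[OF V]] have "x - y \<in> N0" by simp
    then show "A = B" by (simp add: xy M.cls_eq_iff)
  qed simp
next
  fix A assume "A \<in> carrier M.Q"
  then show "iso A \<in> carrier D" using H_V by (auto simp: M.carrier_Q carrier_D iso_cls)
next
  fix t assume "t \<in> carrier D"
  then obtain f where f: "t = family_cls f" "\<And>i. i \<in> I \<Longrightarrow> f i \<in> V i" by (auto simp: carrier_D)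
  let ?z = "\<Sum>i\<in>I. G i (f i)"
  have "?z \<in> V0" by (intro pm.subspace_sum[OF M.subspace_V] G_V f(2))
  moreover have "iso (cls N0 ?z) = t" using H_sum_G[OF f(2)] by (simp add: iso_cls f(1) family_cls_eq_iff)
  ultimately show "\<exists>A\<in>carrier M.Q. t = iso A" by (auto simp: M.carrier_Q)
qed

text \<open>The maps \<open>T i\<close> need to correspond to \<open>R\<close> under \<open>G\<close> only. This is the direction that can be
  checked on representatives: \<open>H\<close> depends on choices which no action respects.\<close>

lemma iso_equivariant:
  assumes R: "Vector_Spaces.linear pm_scale pm_scale R" "\<And>z. z \<in> N0 \<Longrightarrow> R z \<in> N0"
    and T: "\<And>i f. i \<in> I \<Longrightarrow> f \<in> V i \<Longrightarrow> T i f \<in> V i"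
    and GT: "\<And>i f. i \<in> I \<Longrightarrow> f \<in> V i \<Longrightarrow> G i (T i f) - R (G i f) \<in> N0"
    and z: "z \<in> V0"
  shows "iso (cls N0 (R z)) = family_cls (\<lambda>i. T i (H i z))"
proof -
  interpret R: Vector_Spaces.linear pm_scale pm_scale R by fact
  let ?y = "\<Sum>i\<in>I. G i (H i z)" and ?y' = "\<Sum>i\<in>I. G i (T i (H i z))"
  have "(\<Sum>i\<in>I. G i (T i (H i z)) - R (G i (H i z))) \<in> N0"
    using GT H_V z by (intro pm.subspace_sum[OF M.subspace_N]) blast
  then have 1: "?y' - R ?y \<in> N0" by (simp add: sum_subtractf R.sum)
  have "R (?y - z) \<in> N0" using R(2) G_H[OF z] by blast
  from pm.subspace_add[OF M.subspace_N 1 this] have "?y' - R z \<in> N0" by (simp add: R.diff)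
  then have "H j ?y' - H j (R z) \<in> N j" if "j \<in> I" for j using H_N[OF that] by (simp add: H_diff[symmetric])
  moreover have "H j ?y' - T j (H j z) \<in> N j" if "j \<in> I" for j
    using that H_V z T by (intro H_sum_G) blast+
  ultimately have "H j (R z) - T j (H j z) \<in> N j" if "j \<in> I" for j
    using pm.subspace_diff[OF subspace_N[OF that], of "H j ?y' - T j (H j z)" "H j ?y' - H j (R z)"] that by simp
  then show ?thesis by (simp add: iso_cls family_cls_eq_iff)
qed

end

text \<open>The axioms on the actions are transported from the source: for the target only the module
  structure and the compatibility of the actions with \<open>h\<close> have to be known.\<close>

lemma bimodule_iso_transfer:
  fixes M :: "('r::field, 'a, 'm, 'y) bimodule_scheme" and N :: "('r, 'a, 'n, 'x) bimodule_scheme"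
  assumes M: "bimodule A M" and N: "Module.module (ring_of_type_algebra :: 'r ring) N"
    and bij: "bij_betw h (carrier M) (carrier N)"
    and add: "\<And>x y. x \<in> carrier M \<Longrightarrow> y \<in> carrier M \<Longrightarrow> h (x \<oplus>\<^bsub>M\<^esub> y) = h x \<oplus>\<^bsub>N\<^esub> h y"
    and smult: "\<And>c x. x \<in> carrier M \<Longrightarrow> h (c \<odot>\<^bsub>M\<^esub> x) = c \<odot>\<^bsub>N\<^esub> h x"
    and lact: "\<And>a x. a \<in> carrier A \<Longrightarrow> x \<in> carrier M \<Longrightarrow> h (lact M a x) = lact N a (h x)"
    and ract: "\<And>a x. a \<in> carrier A \<Longrightarrow> x \<in> carrier M \<Longrightarrow> h (ract M x a) = ract N (h x) a"
  shows "bimodule_iso A M N h"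
proof -
  interpret M: bimodule A M by fact
  interpret N: Module.module "ring_of_type_algebra :: 'r ring" N by fact
  have h: "\<exists>x'\<in>carrier M. x = h x'" if "x \<in> carrier N" for x using that bij by (auto simp: bij_betw_def)
  have hN: "h x \<in> carrier N" if "x \<in> carrier M" for x using that bij by (auto simp: bij_betw_def)
  have c: "c \<in> carrier (ring_of_type_algebra :: 'r ring)" for c by (simp add: ring_of_type_algebra_def)
  note rev = add[symmetric] smult[symmetric] lact[symmetric] ract[symmetric]
  note cl = M.lact_closed M.ract_closed M.M.smult_closed[OF c]
  show ?thesis
  proof (unfold_locales, goal_cases)
    case (1 a x)
    then show ?case using h[of x] by (auto simp: rev cl hN)
  next
    case (2 a x y)
    then show ?case using h[of x] h[of y] by (auto simp: rev cl M.lact_add)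
  next
    case (3 a b x)
    then show ?case using h[of x] by (auto simp: rev cl M.add_lact)
  next
    case (4 a b x)
    then show ?case using h[of x] by (auto simp: rev cl M.lact_assoc)
  next
    case (5 x)
    then show ?case using h[of x] by (auto simp: rev cl M.lact_one)
  next
    case (6 a x)
    then show ?case using h[of x] by (auto simp: rev cl hN)
  next
    case (7 a x y)
    then show ?case using h[of x] h[of y] by (auto simp: rev cl M.ract_add)
  next
    case (8 a b x)
    then show ?case using h[of x] by (auto simp: rev cl M.add_ract)
  next
    case (9 a b x)
    then show ?case using h[of x] by (auto simp: rev cl M.ract_assoc)
  next
    case (10 x)
    then show ?case using h[of x] by (auto simp: rev cl M.ract_one)
  next
    case (11 a b x)
    then show ?case using h[of x] by (auto simp: rev cl M.lact_ract)
  next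
    case (12 a x c)
    then show ?case using h[of x] by (auto simp: rev cl M.smult_lact M.A.smult_closed[OF c])
  next
    case (13 a x c)
    then show ?case using h[of x] by (auto simp: rev cl M.smult_ract M.A.smult_closed[OF c])
  qed (use bij add smult lact ract in auto)
qed

section \<open>The isomorphism of homology modules\<close>

context labelled_tensor
begin

text \<open>For an index \<open>q\<close> of the shifted tensor product, its summand is the quotient of \<open>tensor_num q\<close>
  by \<open>tensor_den q\<close>.\<close>

definition tensor_num :: "nat \<times> nat \<Rightarrow> (('a cube_chain \<Rightarrow>\<^sub>0 'r::field) set \<times> ('b cube_chain \<Rightarrow>\<^sub>0 'r) set \<Rightarrow>\<^sub>0 'r) set" where
  "tensor_num q = {f. Poly_Mapping.keys f \<subseteq> carrier (HM P1 (fst q)) \<times> carrier (HM P2 (snd q))}"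

definition tensor_den :: "nat \<times> nat \<Rightarrow> (('a cube_chain \<Rightarrow>\<^sub>0 'r::field) set \<times> ('b cube_chain \<Rightarrow>\<^sub>0 'r) set \<Rightarrow>\<^sub>0 'r) set" where
  "tensor_den q = tensor_relations (HM P1 (fst q)) (HM P2 (snd q))"

text \<open>The homology cross product, on arbitrary representatives of the two classes.\<close>

definition cross_class :: "('a cube_chain \<Rightarrow>\<^sub>0 'r::field) set \<times> ('b cube_chain \<Rightarrow>\<^sub>0 'r) set \<Rightarrow> (('a \<times> 'b) cube_chain \<Rightarrow>\<^sub>0 'r)" where
  "cross_class = (\<lambda>(A, B). cross_prod (SOME x. x \<in> A) (SOME y. y \<in> B))"

text \<open>By means of \<open>proj\<close> every chain, not only a cycle, determines a homology class; this gives a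
  linear map on all chains which is inverse to the cross product in homology.\<close>

definition proj_class :: "nat \<times> nat \<Rightarrow> 'a cube_chain \<times> 'b cube_chain \<Rightarrow>
    (('a cube_chain \<Rightarrow>\<^sub>0 'r::field) set \<times> ('b cube_chain \<Rightarrow>\<^sub>0 'r) set \<Rightarrow>\<^sub>0 'r)" where
  "proj_class q = (\<lambda>(c, d). if c \<in> X.chains (fst q - 1) \<and> d \<in> Y.chains (snd q - 1)
     then basis_vec (cls (boundaries P1 (fst q)) (X.proj (basis_vec c)), cls (boundaries P2 (snd q)) (Y.proj (basis_vec d)))
     else 0)"

definition split_class :: "nat \<times> nat \<Rightarrow> (('a \<times> 'b) cube_chain \<Rightarrow>\<^sub>0 'r::field) \<Rightarrow>
    (('a cube_chain \<Rightarrow>\<^sub>0 'r) set \<times> ('b cube_chain \<Rightarrow>\<^sub>0 'r) set \<Rightarrow>\<^sub>0 'r)" where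
  "split_class q z = lin_ext (proj_class q) (lin_ext unshuffle_chain z)"

lemma two_quotients_homology:
  "two_quotients (cycles P1 (Suc i) :: (_ \<Rightarrow>\<^sub>0 'r::field) set) (boundaries P1 (Suc i)) (cycles P2 (Suc j)) (boundaries P2 (Suc j))"
  by (intro two_quotients.intro X.pm_quotient_homology Y.pm_quotient_homology)

abbreviation "homology1 i \<equiv> quot_module (sub_module (cycles P1 (Suc i))) (boundaries P1 (Suc i))"
abbreviation "homology2 j \<equiv> quot_module (sub_module (cycles P2 (Suc j))) (boundaries P2 (Suc j))"

lemma tensor_num_tensor_den_eq:
  "tensor_den (Suc i, Suc j) = (tensor_relations (homology1 i) (homology2 j) :: (_ \<Rightarrow>\<^sub>0 'r::field) set)"
  "tensor_num (Suc i, Suc j) = {f :: _ \<Rightarrow>\<^sub>0 'r. Poly_Mapping.keys f \<subseteq> carrier (homology1 i) \<times> carrier (homology2 j)}"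
  "tensor_map (HM P1 (Suc i)) (HM P2 (Suc j)) f g = tensor_map (homology1 i) (homology2 j) f g"
  unfolding tensor_den_def tensor_num_def tensor_map_def tensor_relations_def HM_def with_actions_simps cycle_module_eq fst_conv snd_conv
  by (rule refl)+

lemma pm_quotient_tensor_num: "pm_quotient (tensor_num (Suc i, Suc j)) (tensor_den (Suc i, Suc j) :: (_ \<Rightarrow>\<^sub>0 'r::field) set)"
proof -
  interpret W: two_quotients "cycles P1 (Suc i) :: (_ \<Rightarrow>\<^sub>0 'r) set" "boundaries P1 (Suc i)" "cycles P2 (Suc j)" "boundaries P2 (Suc j)"
    by (rule two_quotients_homology)
  show ?thesis unfolding tensor_num_tensor_den_eq by (rule W.pm_quotient_tensor)
qed

lemma tensor_num_keys:
  assumes "f \<in> (tensor_num (Suc i, Suc j) :: (_ \<Rightarrow>\<^sub>0 'r::field) set)" "q \<in> Poly_Mapping.keys f"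
  obtains x y where "q = (cls (boundaries P1 (Suc i)) x, cls (boundaries P2 (Suc j)) y)"
    "x \<in> cycles P1 (Suc i)" "y \<in> cycles P2 (Suc j)"
  using assms by (cases q) (auto simp: tensor_num_def X.HM_simps(1) Y.HM_simps(1))

lemma some_cls:
  fixes x :: "'a cube_chain \<Rightarrow>\<^sub>0 'r::field" and y :: "'b cube_chain \<Rightarrow>\<^sub>0 'r"
  shows "x \<in> cycles P1 (Suc i) \<Longrightarrow> (SOME u. u \<in> cls (boundaries P1 (Suc i)) x) - x \<in> boundaries P1 (Suc i)"
    "x \<in> cycles P1 (Suc i) \<Longrightarrow> (SOME u. u \<in> cls (boundaries P1 (Suc i)) x) \<in> cycles P1 (Suc i)"
    "y \<in> cycles P2 (Suc j) \<Longrightarrow> (SOME u. u \<in> cls (boundaries P2 (Suc j)) y) - y \<in> boundaries P2 (Suc j)"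
    "y \<in> cycles P2 (Suc j) \<Longrightarrow> (SOME u. u \<in> cls (boundaries P2 (Suc j)) y) \<in> cycles P2 (Suc j)"
proof -
  interpret A: pm_quotient "cycles P1 (Suc i) :: (_ \<Rightarrow>\<^sub>0 'r) set" "boundaries P1 (Suc i)" by (rule X.pm_quotient_homology)
  interpret B: pm_quotient "cycles P2 (Suc j) :: (_ \<Rightarrow>\<^sub>0 'r) set" "boundaries P2 (Suc j)" by (rule Y.pm_quotient_homology)
  show "(SOME u. u \<in> cls (boundaries P1 (Suc i)) x) - x \<in> boundaries P1 (Suc i)" by (rule A.some_cls_diff)
  show "(SOME u. u \<in> cls (boundaries P2 (Suc j)) y) - y \<in> boundaries P2 (Suc j)" by (rule B.some_cls_diff)
  show "(SOME u. u \<in> cls (boundaries P1 (Suc i)) x) \<in> cycles P1 (Suc i)" if x: "x \<in> cycles P1 (Suc i)"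
    using pm.subspace_add[OF A.subspace_V subsetD[OF A.sub A.some_cls_diff[of x]] x] by simp
  show "(SOME u. u \<in> cls (boundaries P2 (Suc j)) y) \<in> cycles P2 (Suc j)" if y: "y \<in> cycles P2 (Suc j)"
    using pm.subspace_add[OF B.subspace_V subsetD[OF B.sub B.some_cls_diff[of y]] y] by simp
qed

lemma cross_class_cls:
  fixes x :: "'a cube_chain \<Rightarrow>\<^sub>0 'r::field"
  assumes x: "x \<in> cycles P1 (Suc i)" and y: "y \<in> cycles P2 (Suc j)"
  shows "cross_class (cls (boundaries P1 (Suc i)) x, cls (boundaries P2 (Suc j)) y) - cross_prod x y \<in> boundaries TP (Suc (i + j))"
proof -
  interpret M: pm_quotient "cycles TP (Suc (i + j)) :: (_ \<Rightarrow>\<^sub>0 'r) set" "boundaries TP (Suc (i + j))" by (rule T.pm_quotient_homology)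
  let ?x = "SOME u. u \<in> cls (boundaries P1 (Suc i)) x" and ?y = "SOME u. u \<in> cls (boundaries P2 (Suc j)) y"
  have "cross_prod (?x - x) ?y + cross_prod x (?y - y) \<in> boundaries TP (Suc (i + j))"
    by (intro pm.subspace_add[OF M.subspace_N] cross_prod_boundaries some_cls x y)
  then show ?thesis by (simp add: cross_class_def cross_prod_simps)
qed

lemma cross_class_in:
  assumes "q \<in> Poly_Mapping.keys f" "f \<in> (tensor_num (Suc i, Suc j) :: (_ \<Rightarrow>\<^sub>0 'r::field) set)"
  shows "cross_class q \<in> cycles TP (Suc (i + j))"
proof -
  obtain x y where "q = (cls (boundaries P1 (Suc i)) x, cls (boundaries P2 (Suc j)) y)"
    "x \<in> cycles P1 (Suc i)" "y \<in> cycles P2 (Suc j)" using assms(2,1) by (rule tensor_num_keys)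
  then show ?thesis by (simp add: cross_class_def cross_prod_cycles some_cls)
qed

lemma cross_class_tensor_num:
  assumes "f \<in> (tensor_num (Suc i, Suc j) :: (_ \<Rightarrow>\<^sub>0 'r::field) set)"
  shows "lin_ext cross_class f \<in> cycles TP (Suc (i + j))"
proof -
  interpret M: pm_quotient "cycles TP (Suc (i + j)) :: (_ \<Rightarrow>\<^sub>0 'r) set" "boundaries TP (Suc (i + j))" by (rule T.pm_quotient_homology)
  show ?thesis by (rule lin_ext_in_subspace[OF M.subspace_V]) (erule cross_class_in[OF _ assms])
qed

lemma cross_class_tensor_den:
  assumes "f \<in> (tensor_den (Suc i, Suc j) :: (_ \<Rightarrow>\<^sub>0 'r::field) set)"
  shows "lin_ext cross_class f \<in> boundaries TP (Suc (i + j))"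
proof -
  interpret M: pm_quotient "cycles TP (Suc (i + j)) :: (_ \<Rightarrow>\<^sub>0 'r) set" "boundaries TP (Suc (i + j))" by (rule T.pm_quotient_homology)
  interpret W: two_quotients "cycles P1 (Suc i) :: (_ \<Rightarrow>\<^sub>0 'r) set" "boundaries P1 (Suc i)" "cycles P2 (Suc j)" "boundaries P2 (Suc j)"
    by (rule two_quotients_homology)
  let ?B = "boundaries TP (Suc (i + j)) :: (_ \<Rightarrow>\<^sub>0 'r) set"
  \<comment> \<open>Modulo boundaries, \<open>cross_class\<close> is the cross product of any representatives, which is bilinear.\<close>
  let ?e = "\<lambda>x y. cross_class (cls (boundaries P1 (Suc i)) x, cls (boundaries P2 (Suc j)) y) - cross_prod x y"
  have e: "?e x y \<in> ?B" if "x \<in> cycles P1 (Suc i)" "y \<in> cycles P2 (Suc j)" for x y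
    using that by (rule cross_class_cls)
  note sub = pm.subspace_diff[OF M.subspace_N]
  note V = pm.subspace_add[OF W.A.subspace_V] pm.subspace_add[OF W.B.subspace_V]
    pm.subspace_scale[OF W.A.subspace_V] pm.subspace_scale[OF W.B.subspace_V]
  from assms show ?thesis unfolding tensor_num_tensor_den_eq(1)
  proof (rule W.lin_ext_rel_in[OF _ M.subspace_N], unfold lin_ext_basis, goal_cases)
    case (1 x x' y)
    from sub[OF sub[OF e[OF V(1)[OF 1(1,2)] 1(3)] e[OF 1(1,3)]] e[OF 1(2,3)]]
    show ?case by (simp add: cross_prod_simps algebra_simps)
  next
    case (2 x y y')
    from sub[OF sub[OF e[OF 2(1) V(2)[OF 2(2,3)]] e[OF 2(1,2)]] e[OF 2(1,3)]]
    show ?case by (simp add: cross_prod_simps algebra_simps)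
  next
    case (3 c x y)
    from sub[OF e[OF V(3)[OF 3(1)] 3(2)] pm.subspace_scale[OF M.subspace_N e[OF 3(1,2)]], of c c]
    show ?case by (simp add: cross_prod_simps pm.scale_right_diff_distrib)
  next
    case (4 c x y)
    from sub[OF e[OF 4(1) V(4)[OF 4(2)]] pm.subspace_scale[OF M.subspace_N e[OF 4(1,2)]], of c c]
    show ?case by (simp add: cross_prod_simps pm.scale_right_diff_distrib)
  qed
qed

lemma proj_class_tensor_num: "proj_class (Suc i, Suc j) p \<in> (tensor_num (Suc i, Suc j) :: (_ \<Rightarrow>\<^sub>0 'r::field) set)"
  using X.proj_cycle[of "basis_vec (fst p) :: _ \<Rightarrow>\<^sub>0 'r" i] Y.proj_cycle[of "basis_vec (snd p) :: _ \<Rightarrow>\<^sub>0 'r" j]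
  by (auto simp: proj_class_def tensor_num_def X.HM_simps(1) Y.HM_simps(1) case_prod_beta)

lemma split_class_tensor_num: "split_class (Suc i, Suc j) z \<in> (tensor_num (Suc i, Suc j) :: (_ \<Rightarrow>\<^sub>0 'r::field) set)"
proof -
  interpret W: pm_quotient "tensor_num (Suc i, Suc j) :: (_ \<Rightarrow>\<^sub>0 'r) set" "tensor_den (Suc i, Suc j)" by (rule pm_quotient_tensor_num)
  show ?thesis unfolding split_class_def by (rule lin_ext_in_subspace[OF W.subspace_V proj_class_tensor_num])
qed

text \<open>The map \<open>proj_class\<close> is defined on basis vectors; the relations of the tensor product extend its
  formula to tensors of arbitrary chains.\<close>

lemma proj_class_tensor:
  fixes x :: "'a cube_chain \<Rightarrow>\<^sub>0 'r::field"
  assumes x: "x \<in> X.span_chains i" and y: "y \<in> Y.span_chains j"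
  shows "lin_ext (proj_class (Suc i, Suc j)) (pm_tensor x y) -
    basis_vec (cls (boundaries P1 (Suc i)) (X.proj x), cls (boundaries P2 (Suc j)) (Y.proj y)) \<in> tensor_den (Suc i, Suc j)"
proof -
  interpret W: two_quotients "cycles P1 (Suc i) :: (_ \<Rightarrow>\<^sub>0 'r) set" "boundaries P1 (Suc i)" "cycles P2 (Suc j)" "boundaries P2 (Suc j)"
    by (rule two_quotients_homology)
  have p: "lin_ext (\<lambda>a. X.proj (basis_vec a)) x = X.proj x" "lin_ext (\<lambda>b. Y.proj (basis_vec b)) y = Y.proj y"
    by (rule linear_eq_lin_ext[OF X.linear_proj, symmetric], rule linear_eq_lin_ext[OF Y.linear_proj, symmetric])
  have "W.elt (lin_ext (\<lambda>a. X.proj (basis_vec a)) x) (lin_ext (\<lambda>b. Y.proj (basis_vec b)) y) -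
      lin_ext (\<lambda>a. lin_ext (\<lambda>b. W.elt (X.proj (basis_vec a)) (Y.proj (basis_vec b))) y) x \<in> W.rel"
    by (rule W.rel_bilinear)
      (use X.span_chainsD[OF x] Y.span_chainsD[OF y] in \<open>auto intro!: X.proj_cycle Y.proj_cycle\<close>)
  moreover have "lin_ext (proj_class (Suc i, Suc j)) (pm_tensor x y) =
      lin_ext (\<lambda>a. lin_ext (\<lambda>b. W.elt (X.proj (basis_vec a)) (Y.proj (basis_vec b))) y) x"
    unfolding lin_ext_pm_tensor
    by (intro lin_ext_cong refl) (simp add: proj_class_def X.span_chainsD[OF x] Y.span_chainsD[OF y])
  ultimately show ?thesis unfolding tensor_num_tensor_den_eq(1) p
    using pm.subspace_neg[OF W.subspace_rel] by fastforce
qed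

lemma proj_class_other:
  fixes x :: "'a cube_chain \<Rightarrow>\<^sub>0 'r::field"
  assumes x: "x \<in> X.span_chains i'" and y: "y \<in> Y.span_chains j'" and "(i, j) \<noteq> (i', j')"
  shows "lin_ext (proj_class (Suc i, Suc j)) (pm_tensor x y) = 0"
proof -
  have disj: "c \<notin> X.chains i \<or> d \<notin> Y.chains j" if "c \<in> X.chains i'" "d \<in> Y.chains j'" for c d
    using that assms(3) by (auto simp: X.chains_def Y.chains_def)
  have "lin_ext (proj_class (Suc i, Suc j)) (pm_tensor x y) = lin_ext (\<lambda>a. lin_ext (\<lambda>b. 0) y) x"
    unfolding lin_ext_pm_tensor
  proof (intro lin_ext_cong refl)
    fix a b assume "a \<in> Poly_Mapping.keys x" "b \<in> Poly_Mapping.keys y"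
    from disj[OF X.span_chainsD[OF x this(1)] Y.span_chainsD[OF y this(2)]]
    show "proj_class (Suc i, Suc j) (a, b) = 0" by (auto simp: proj_class_def)
  qed
  then show ?thesis by simp
qed

lemma proj_class_boundary:
  fixes x :: "'a cube_chain \<Rightarrow>\<^sub>0 'r::field"
  assumes x: "x \<in> X.span_chains i'" and y: "y \<in> Y.span_chains j'" and 0: "X.proj x = 0 \<or> Y.proj y = 0"
  shows "lin_ext (proj_class (Suc i, Suc j)) (pm_tensor x y) \<in> tensor_den (Suc i, Suc j)"
proof -
  interpret W: two_quotients "cycles P1 (Suc i) :: (_ \<Rightarrow>\<^sub>0 'r) set" "boundaries P1 (Suc i)" "cycles P2 (Suc j)" "boundaries P2 (Suc j)"
    by (rule two_quotients_homology)
  show ?thesis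
  proof (cases "(i, j) = (i', j')")
    case True
    have xy: "x \<in> X.span_chains i" "y \<in> Y.span_chains j" using x y True by simp_all
    have "W.elt (X.proj x) (Y.proj y) \<in> W.rel"
      using 0 W.rel_zero X.proj_cycle[OF xy(1)] Y.proj_cycle[OF xy(2)] by auto
    from pm.subspace_add[OF W.subspace_rel proj_class_tensor[OF xy, unfolded tensor_num_tensor_den_eq(1)] this]
    show ?thesis unfolding tensor_num_tensor_den_eq(1) by simp
  next
    case False
    then show ?thesis using proj_class_other[OF x y False] pm.subspace_0[OF W.subspace_rel] by (simp add: tensor_num_tensor_den_eq(1))
  qed
qed

lemma split_class_tensor_den:
  assumes z: "z \<in> boundaries TP (Suc n)"
  shows "split_class (Suc i, Suc j) z \<in> (tensor_den (Suc i, Suc j) :: (_ \<Rightarrow>\<^sub>0 'r::field) set)"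
proof -
  interpret W: pm_quotient "tensor_num (Suc i, Suc j) :: (_ \<Rightarrow>\<^sub>0 'r) set" "tensor_den (Suc i, Suc j)" by (rule pm_quotient_tensor_num)
  obtain u where u: "u \<in> T.span_chains (Suc n)" "z = T.bnd u" using z by (auto simp: T.boundaries_eq)
  have "split_class (Suc i, Suc j) z = lin_ext (\<lambda>p. lin_ext (proj_class (Suc i, Suc j)) (tensor_chain_bd p)) (lin_ext unshuffle_chain u)"
    unfolding split_class_def u(2) unshuffle_chain_bnd[OF u(1)] by (rule lin_ext_lin_ext)
  also have "\<dots> \<in> tensor_den (Suc i, Suc j)"
  proof (rule lin_ext_in_subspace[OF W.subspace_N])
    fix p assume "p \<in> Poly_Mapping.keys (lin_ext unshuffle_chain u :: _ \<Rightarrow>\<^sub>0 'r)"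
    then obtain c d a b where p: "p = (c, d)" "c \<in> X.chains a" "d \<in> Y.chains b"
      using keys_lin_ext_unshuffle_chain[OF u(1)] by (auto simp: pairs_def)
    have s: "basis_vec c \<in> (X.span_chains a :: (_ \<Rightarrow>\<^sub>0 'r) set)" "basis_vec d \<in> (Y.span_chains b :: (_ \<Rightarrow>\<^sub>0 'r) set)" using p by simp_all
    have 1: "lin_ext (proj_class (Suc i, Suc j)) (pm_tensor (X.chain_bd c) (basis_vec d)) \<in> (tensor_den (Suc i, Suc j) :: (_ \<Rightarrow>\<^sub>0 'r) set)"
    proof (cases a)
      case 0
      then have "X.chain_bd c = (0 :: _ \<Rightarrow>\<^sub>0 'r)" using X.chain_bd_chains_0 p by blast
      then show ?thesis using pm.subspace_0[OF W.subspace_N] by simp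
    next
      case (Suc m)
      then have "X.chain_bd c \<in> (X.span_chains m :: (_ \<Rightarrow>\<^sub>0 'r) set)" using X.chain_bd_span_chains p(2) by blast
      then show ?thesis using proj_class_boundary[OF _ s(2)] X.proj_bnd[OF s(1)] by simp
    qed
    have 2: "lin_ext (proj_class (Suc i, Suc j)) (pm_tensor (basis_vec c) (Y.chain_bd d)) \<in> (tensor_den (Suc i, Suc j) :: (_ \<Rightarrow>\<^sub>0 'r) set)"
    proof (cases b)
      case 0
      then have "Y.chain_bd d = (0 :: _ \<Rightarrow>\<^sub>0 'r)" using Y.chain_bd_chains_0 p by blast
      then show ?thesis using pm.subspace_0[OF W.subspace_N] by simp
    next
      case (Suc m)
      then have "Y.chain_bd d \<in> (Y.span_chains m :: (_ \<Rightarrow>\<^sub>0 'r) set)" using Y.chain_bd_span_chains p(3) by blast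
      then show ?thesis using proj_class_boundary[OF s(1)] Y.proj_bnd[OF s(2)] by simp
    qed
    show "lin_ext (proj_class (Suc i, Suc j)) (tensor_chain_bd p) \<in> (tensor_den (Suc i, Suc j) :: (_ \<Rightarrow>\<^sub>0 'r) set)"
      unfolding p(1) tensor_chain_bd_eq[OF p(2)] lin_ext_add lin_ext_scale
      using 1 2 by (intro pm.subspace_add[OF W.subspace_N] pm.subspace_scale[OF W.subspace_N])
  qed
  finally show ?thesis .
qed

lemma split_class_cross_prod:
  fixes x :: "'a cube_chain \<Rightarrow>\<^sub>0 'r::field"
  assumes x: "x \<in> cycles P1 (Suc i)" and y: "y \<in> cycles P2 (Suc j)"
  shows "split_class (Suc i', Suc j') (cross_prod x y) - (if (Suc i, Suc j) = (Suc i', Suc j')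
    then basis_vec (cls (boundaries P1 (Suc i)) x, cls (boundaries P2 (Suc j)) y) else 0) \<in> tensor_den (Suc i', Suc j')"
proof -
  interpret W: pm_quotient "tensor_num (Suc i', Suc j') :: (_ \<Rightarrow>\<^sub>0 'r) set" "tensor_den (Suc i', Suc j')" by (rule pm_quotient_tensor_num)
  interpret A: pm_quotient "cycles P1 (Suc i) :: (_ \<Rightarrow>\<^sub>0 'r) set" "boundaries P1 (Suc i)" by (rule X.pm_quotient_homology)
  interpret B: pm_quotient "cycles P2 (Suc j) :: (_ \<Rightarrow>\<^sub>0 'r) set" "boundaries P2 (Suc j)" by (rule Y.pm_quotient_homology)
  have s: "x \<in> X.span_chains i" "y \<in> Y.span_chains j" using x y by (auto simp: X.cycles_eq Y.cycles_eq)
  have eq: "split_class (Suc i', Suc j') (cross_prod x y) = lin_ext (proj_class (Suc i', Suc j')) (pm_tensor x y)"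
    by (simp add: split_class_def unshuffle_chain_cross[OF pairs_tensor[OF s]])
  show ?thesis
  proof (cases "(i', j') = (i, j)")
    case True
    have "cls (boundaries P1 (Suc i)) (X.proj x) = cls (boundaries P1 (Suc i)) x"
      "cls (boundaries P2 (Suc j)) (Y.proj y) = cls (boundaries P2 (Suc j)) y"
      using X.cycle_diff_proj[OF x] Y.cycle_diff_proj[OF y] by (metis A.cls_eq_iff, metis B.cls_eq_iff)
    then show ?thesis using proj_class_tensor[OF s] True unfolding eq by simp
  next
    case False
    then show ?thesis using proj_class_other[OF s False] pm.subspace_0[OF W.subspace_N] unfolding eq by auto
  qed
qed

lemma split_class_add: "split_class q (x + y) = split_class q x + split_class q y"
  and split_class_scale: "split_class q (pm_scale c x) = pm_scale c (split_class q x)"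
  and split_class_lin_ext: "split_class q (lin_ext F f) = lin_ext (\<lambda>p. split_class q (F p)) f"
  by (simp_all add: split_class_def lin_ext_add lin_ext_scale lin_ext_lin_ext)

lemma split_cross_class:
  assumes f: "f \<in> (tensor_num (Suc i, Suc j) :: (_ \<Rightarrow>\<^sub>0 'r::field) set)"
  shows "split_class (Suc i', Suc j') (lin_ext cross_class f) - (if (Suc i, Suc j) = (Suc i', Suc j') then f else 0) \<in> tensor_den (Suc i', Suc j')"
proof -
  interpret W: pm_quotient "tensor_num (Suc i', Suc j') :: (_ \<Rightarrow>\<^sub>0 'r) set" "tensor_den (Suc i', Suc j')" by (rule pm_quotient_tensor_num)
  interpret A: pm_quotient "cycles P1 (Suc i) :: (_ \<Rightarrow>\<^sub>0 'r) set" "boundaries P1 (Suc i)" by (rule X.pm_quotient_homology)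
  interpret B: pm_quotient "cycles P2 (Suc j) :: (_ \<Rightarrow>\<^sub>0 'r) set" "boundaries P2 (Suc j)" by (rule Y.pm_quotient_homology)
  let ?c = "(Suc i, Suc j) = (Suc i', Suc j')"
  have "lin_ext (\<lambda>p. split_class (Suc i', Suc j') (cross_class p) - (if ?c then basis_vec p else 0)) f \<in> tensor_den (Suc i', Suc j')"
  proof (rule lin_ext_in_subspace[OF W.subspace_N])
    fix p assume "p \<in> Poly_Mapping.keys f"
    with f obtain x y where p: "p = (cls (boundaries P1 (Suc i)) x, cls (boundaries P2 (Suc j)) y)"
      "x \<in> cycles P1 (Suc i)" "y \<in> cycles P2 (Suc j)" by (rule tensor_num_keys)
    let ?x = "SOME u. u \<in> cls (boundaries P1 (Suc i)) x" and ?y = "SOME u. u \<in> cls (boundaries P2 (Suc j)) y"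
    have eqs: "cls (boundaries P1 (Suc i)) ?x = cls (boundaries P1 (Suc i)) x" "cls (boundaries P2 (Suc j)) ?y = cls (boundaries P2 (Suc j)) y"
      using A.cls_eq_iff B.cls_eq_iff some_cls(1)[OF p(2)] some_cls(3)[OF p(3)] by blast+
    then show "split_class (Suc i', Suc j') (cross_class p) - (if ?c then basis_vec p else 0) \<in> tensor_den (Suc i', Suc j')"
      using split_class_cross_prod[OF some_cls(2)[OF p(2)] some_cls(4)[OF p(3)], of i' j', unfolded eqs]
      by (simp only: p(1) cross_class_def prod.case)
  qed
  moreover have "lin_ext (\<lambda>p. split_class (Suc i', Suc j') (cross_class p) - (if ?c then basis_vec p else 0)) f =
      split_class (Suc i', Suc j') (lin_ext cross_class f) - (if ?c then f else 0)"
  proof -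
    have "lin_ext (\<lambda>p. if b then basis_vec p else 0) f = (if b then f else 0)" for b by (cases b) simp_all
    then show ?thesis by (simp only: lin_ext_fun_diff split_class_lin_ext)
  qed
  ultimately show ?thesis by simp
qed

lemma finite_box_index: "finite (box_index n)"
  by (rule finite_subset[of _ "{..n} \<times> {..n}"]) (auto simp: box_index_def)

lemma box_indexE:
  assumes "q \<in> box_index (Suc n)"
  obtains i j where "q = (Suc i, Suc j)" "i + j = n"
proof -
  obtain a b where q: "q = (a, b)" by (cases q)
  then have "a \<ge> 1" "b \<ge> 1" "a + b = Suc n + 1" using assms by (auto simp: box_index_def)
  then have "q = (Suc (a - 1), Suc (b - 1))" "(a - 1) + (b - 1) = n" by (auto simp: q)
  then show thesis by (rule that)
qed

text \<open>A basis element of degrees \<open>i\<close> and \<open>j\<close> contributes to the summand \<open>(i + 1, j + 1)\<close> only, where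
  the composition sends it to the cross product of its projections.\<close>

lemma cross_split_class:
  assumes z: "z \<in> cycles TP (Suc n)"
  shows "(\<Sum>q\<in>box_index (Suc n). lin_ext cross_class (split_class q z)) - z \<in> (boundaries TP (Suc n) :: (_ \<Rightarrow>\<^sub>0 'r::field) set)"
proof -
  interpret M: pm_quotient "cycles TP (Suc n) :: (_ \<Rightarrow>\<^sub>0 'r) set" "boundaries TP (Suc n)" by (rule T.pm_quotient_homology)
  have zs: "z \<in> T.span_chains n" using z by (auto simp: T.cycles_eq)
  let ?w = "lin_ext unshuffle_chain z :: _ \<Rightarrow>\<^sub>0 'r"
  let ?F = "\<lambda>p. \<Sum>q\<in>box_index (Suc n). lin_ext cross_class (proj_class q p) :: _ \<Rightarrow>\<^sub>0 'r"
  have "lin_ext (\<lambda>p. ?F p - cross (tensor_proj p)) ?w \<in> boundaries TP (Suc n)"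
  proof (rule lin_ext_in_subspace[OF M.subspace_N])
    fix p assume "p \<in> Poly_Mapping.keys ?w"
    then obtain c d i j where p: "p = (c, d)" "c \<in> X.chains i" "d \<in> Y.chains j" "i + j = n"
      using keys_lin_ext_unshuffle_chain[OF zs] by (auto simp: pairs_def)
    have s: "basis_vec c \<in> (X.span_chains i :: (_ \<Rightarrow>\<^sub>0 'r) set)" "basis_vec d \<in> (Y.span_chains j :: (_ \<Rightarrow>\<^sub>0 'r) set)" using p by simp_all
    have mem: "(Suc i, Suc j) \<in> box_index (Suc n)" using p(4) by (simp add: box_index_def)
    have "lin_ext cross_class (proj_class q p) = (0 :: _ \<Rightarrow>\<^sub>0 'r)" if q: "q \<in> box_index (Suc n)" "q \<noteq> (Suc i, Suc j)" for q
    proof -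
      obtain a b where ab: "q = (Suc a, Suc b)" using q(1) by (rule box_indexE)
      then have "(a, b) \<noteq> (i, j)" using q(2) by simp
      from proj_class_other[OF s this] show ?thesis by (simp add: ab p(1))
    qed
    then have "?F p = lin_ext cross_class (proj_class (Suc i, Suc j) p)"
      by (subst sum.remove[OF finite_box_index mem]) (auto intro!: sum.neutral)
    also have "\<dots> = cross_class (cls (boundaries P1 (Suc i)) (X.proj (basis_vec c)), cls (boundaries P2 (Suc j)) (Y.proj (basis_vec d)))"
      using p(2,3) by (simp add: p(1) proj_class_def)
    finally have F: "?F p = cross_class (cls (boundaries P1 (Suc i)) (X.proj (basis_vec c)), cls (boundaries P2 (Suc j)) (Y.proj (basis_vec d)))" .
    show "?F p - cross (tensor_proj p) \<in> boundaries TP (Suc n)"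
      unfolding F using cross_class_cls[OF X.proj_cycle[OF s(1)] Y.proj_cycle[OF s(2)]] p(4) by (simp add: p(1) tensor_proj_def)
  qed
  moreover have "lin_ext (\<lambda>p. ?F p - cross (tensor_proj p)) ?w =
      (\<Sum>q\<in>box_index (Suc n). lin_ext cross_class (split_class q z)) - cross (lin_ext tensor_proj ?w)"
    by (simp add: lin_ext_fun_diff lin_ext_fun_sum split_class_def lin_ext_lin_ext cross_def pm_map_lin_ext)
  ultimately have 1: "(\<Sum>q\<in>box_index (Suc n). lin_ext cross_class (split_class q z)) - cross (lin_ext tensor_proj ?w) \<in> boundaries TP (Suc n)" by simp
  from pm.subspace_diff[OF M.subspace_N 1 cycle_diff_cross_tensor_proj[OF z]] show ?thesis by simp
qed

lemma quotient_iso_homology: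
  "quotient_iso (box_index (Suc n)) tensor_num (tensor_den :: _ \<Rightarrow> (_ \<Rightarrow>\<^sub>0 'r::field) set) (cycles TP (Suc n)) (boundaries TP (Suc n)) split_class (\<lambda>_. lin_ext cross_class)"
proof -
  interpret M: pm_quotient "cycles TP (Suc n) :: (_ \<Rightarrow>\<^sub>0 'r) set" "boundaries TP (Suc n)" by (rule T.pm_quotient_homology)
  show ?thesis
  proof (intro quotient_iso.intro direct_quotients.intro quotient_iso_axioms.intro M.pm_quotient_axioms, goal_cases)
    case 1
    show ?case by (rule finite_box_index)
  next
    case (2 q)
    then show ?case by (elim box_indexE) (simp only: pm_quotient_tensor_num)
  next
    case (3 q)
    show ?case by unfold_locales (simp_all add: split_class_add split_class_scale)
  next
    case (4 q z)
    then show ?case by (elim box_indexE) (simp only: split_class_tensor_num)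
  next
    case (5 q z)
    then show ?case by (elim box_indexE) (simp only: split_class_tensor_den)
  next
    case (6 q f)
    from 6(1) obtain i j where q: "q = (Suc i, Suc j)" "i + j = n" by (rule box_indexE)
    show ?case using cross_class_tensor_num[of f i j] 6(2) q by simp
  next
    case (7 q f)
    from 7(1) obtain i j where q: "q = (Suc i, Suc j)" "i + j = n" by (rule box_indexE)
    show ?case using cross_class_tensor_den[of f i j] 7(2) q by simp
  next
    case (8 q q' f)
    from 8(1) obtain i j where q: "q = (Suc i, Suc j)" by (rule box_indexE)
    from 8(2) obtain i' j' where q': "q' = (Suc i', Suc j')" by (rule box_indexE)
    show ?case using 8(3) unfolding q q' by (rule split_cross_class)
  next
    case (9 z)
    then show ?case by (rule cross_split_class)
  qed
qed

subsection \<open>Compatibility with the actions\<close>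

definition lact_shuffle :: "('a \<times> 'b) cube_chain \<Rightarrow> nat \<times> nat \<Rightarrow>
    (('a cube_chain \<Rightarrow>\<^sub>0 'r::field) set \<times> ('b cube_chain \<Rightarrow>\<^sub>0 'r) set \<Rightarrow>\<^sub>0 'r) \<Rightarrow> (('a cube_chain \<Rightarrow>\<^sub>0 'r) set \<times> ('b cube_chain \<Rightarrow>\<^sub>0 'r) set \<Rightarrow>\<^sub>0 'r)" where
  "lact_shuffle r q = lin_ext (\<lambda>(A, B). basis_vec (lact (HM P1 (fst q)) (basis_vec (left_path P1 r)) A, lact (HM P2 (snd q)) (basis_vec (right_path P2 r)) B))"

definition ract_shuffle :: "('a \<times> 'b) cube_chain \<Rightarrow> nat \<times> nat \<Rightarrow>
    (('a cube_chain \<Rightarrow>\<^sub>0 'r::field) set \<times> ('b cube_chain \<Rightarrow>\<^sub>0 'r) set \<Rightarrow>\<^sub>0 'r) \<Rightarrow> (('a cube_chain \<Rightarrow>\<^sub>0 'r) set \<times> ('b cube_chain \<Rightarrow>\<^sub>0 'r) set \<Rightarrow>\<^sub>0 'r)" where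
  "ract_shuffle r q = lin_ext (\<lambda>(A, B). basis_vec (ract (HM P1 (fst q)) A (basis_vec (left_path P1 r)), ract (HM P2 (snd q)) B (basis_vec (right_path P2 r))))"

lemma shuffle_tensor_map:
  fixes f :: "_ \<Rightarrow>\<^sub>0 'r::field"
  assumes r: "r \<in> T.chains 0"
  shows "tensor_map (HM P1 (Suc i)) (HM P2 (Suc j)) (lact (HM P1 (Suc i)) (basis_vec (left_path P1 r)))
      (lact (HM P2 (Suc j)) (basis_vec (right_path P2 r))) (cls (tensor_den (Suc i, Suc j)) f) = cls (tensor_den (Suc i, Suc j)) (lact_shuffle r (Suc i, Suc j) f)"
    "f \<in> tensor_num (Suc i, Suc j) \<Longrightarrow> lact_shuffle r (Suc i, Suc j) f \<in> tensor_num (Suc i, Suc j)"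
    "tensor_map (HM P1 (Suc i)) (HM P2 (Suc j)) (\<lambda>A. ract (HM P1 (Suc i)) A (basis_vec (left_path P1 r)))
      (\<lambda>B. ract (HM P2 (Suc j)) B (basis_vec (right_path P2 r))) (cls (tensor_den (Suc i, Suc j)) f) = cls (tensor_den (Suc i, Suc j)) (ract_shuffle r (Suc i, Suc j) f)"
    "f \<in> tensor_num (Suc i, Suc j) \<Longrightarrow> ract_shuffle r (Suc i, Suc j) f \<in> tensor_num (Suc i, Suc j)"
proof -
  interpret W: two_quotients "cycles P1 (Suc i) :: (_ \<Rightarrow>\<^sub>0 'r) set" "boundaries P1 (Suc i)" "cycles P2 (Suc j)" "boundaries P2 (Suc j)"
    by (rule two_quotients_homology)
  have p: "basis_vec (left_path P1 r) \<in> (X.span_chains 0 :: (_ \<Rightarrow>\<^sub>0 'r) set)" "basis_vec (right_path P2 r) \<in> (Y.span_chains 0 :: (_ \<Rightarrow>\<^sub>0 'r) set)"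
    using paths_in[OF r] by simp_all
  note L = W.tensor_map_cls[OF X.HM_act(1)[OF p(1)] linear_chain_mult(1) X.chain_mult_cycles(1)[OF p(1)]
      Y.HM_act(1)[OF p(2)] linear_chain_mult(1) Y.chain_mult_cycles(1)[OF p(2)]]
  note R = W.tensor_map_cls[OF X.HM_act(2)[OF p(1)] linear_chain_mult(2) X.chain_mult_cycles(2)[OF p(1)]
      Y.HM_act(2)[OF p(2)] linear_chain_mult(2) Y.chain_mult_cycles(2)[OF p(2)]]
  show "tensor_map (HM P1 (Suc i)) (HM P2 (Suc j)) (lact (HM P1 (Suc i)) (basis_vec (left_path P1 r)))
      (lact (HM P2 (Suc j)) (basis_vec (right_path P2 r))) (cls (tensor_den (Suc i, Suc j)) f) = cls (tensor_den (Suc i, Suc j)) (lact_shuffle r (Suc i, Suc j) f)"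
    unfolding tensor_num_tensor_den_eq(1,3) lact_shuffle_def fst_conv snd_conv by (rule L(2))
  show "lact_shuffle r (Suc i, Suc j) f \<in> tensor_num (Suc i, Suc j)" if "f \<in> tensor_num (Suc i, Suc j)"
  proof -
    have k: "Poly_Mapping.keys f \<subseteq> carrier W.A.Q \<times> carrier W.B.Q" using that unfolding tensor_num_tensor_den_eq(2) by simp
    show ?thesis unfolding tensor_num_tensor_den_eq(2) lact_shuffle_def fst_conv snd_conv mem_Collect_eq
      by (rule L(3), (assumption | rule k)+)
  qed
  show "tensor_map (HM P1 (Suc i)) (HM P2 (Suc j)) (\<lambda>A. ract (HM P1 (Suc i)) A (basis_vec (left_path P1 r)))
      (\<lambda>B. ract (HM P2 (Suc j)) B (basis_vec (right_path P2 r))) (cls (tensor_den (Suc i, Suc j)) f) = cls (tensor_den (Suc i, Suc j)) (ract_shuffle r (Suc i, Suc j) f)"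
    unfolding tensor_num_tensor_den_eq(1,3) ract_shuffle_def fst_conv snd_conv by (rule R(2))
  show "ract_shuffle r (Suc i, Suc j) f \<in> tensor_num (Suc i, Suc j)" if "f \<in> tensor_num (Suc i, Suc j)"
  proof -
    have k: "Poly_Mapping.keys f \<subseteq> carrier W.A.Q \<times> carrier W.B.Q" using that unfolding tensor_num_tensor_den_eq(2) by simp
    show ?thesis unfolding tensor_num_tensor_den_eq(2) ract_shuffle_def fst_conv snd_conv mem_Collect_eq
      by (rule R(3), (assumption | rule k)+)
  qed
qed

text \<open>For a simple tensor this is the equivariance of the cross product up to boundaries; the action
  on a class is computed on the representative that \<open>cross_class\<close> has chosen.\<close>

lemma cross_class_shuffle:
  fixes f :: "_ \<Rightarrow>\<^sub>0 'r::field"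
  assumes r: "r \<in> T.chains 0" and f: "f \<in> tensor_num (Suc i, Suc j)"
  shows "lin_ext cross_class (lact_shuffle r (Suc i, Suc j) f) - chain_mult (basis_vec r) (lin_ext cross_class f) \<in> boundaries TP (Suc (i + j))"
    "lin_ext cross_class (ract_shuffle r (Suc i, Suc j) f) - chain_mult (lin_ext cross_class f) (basis_vec r) \<in> boundaries TP (Suc (i + j))"
proof -
  interpret M: pm_quotient "cycles TP (Suc (i + j)) :: (_ \<Rightarrow>\<^sub>0 'r) set" "boundaries TP (Suc (i + j))" by (rule T.pm_quotient_homology)
  interpret A: pm_quotient "cycles P1 (Suc i) :: (_ \<Rightarrow>\<^sub>0 'r) set" "boundaries P1 (Suc i)" by (rule X.pm_quotient_homology)
  interpret B: pm_quotient "cycles P2 (Suc j) :: (_ \<Rightarrow>\<^sub>0 'r) set" "boundaries P2 (Suc j)" by (rule Y.pm_quotient_homology)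
  let ?l = "basis_vec (left_path P1 r) :: _ \<Rightarrow>\<^sub>0 'r" and ?q = "basis_vec (right_path P2 r) :: _ \<Rightarrow>\<^sub>0 'r"
  have p: "?l \<in> X.span_chains 0" "?q \<in> Y.span_chains 0" using paths_in[OF r] by simp_all
  let ?L = "\<lambda>(A, B). basis_vec (lact (HM P1 (Suc i)) ?l A, lact (HM P2 (Suc j)) ?q B) :: _ \<Rightarrow>\<^sub>0 'r"
  let ?R = "\<lambda>(A, B). basis_vec (ract (HM P1 (Suc i)) A ?l, ract (HM P2 (Suc j)) B ?q) :: _ \<Rightarrow>\<^sub>0 'r"
  have rep: "\<exists>x\<in>cycles P1 (Suc i). \<exists>y\<in>cycles P2 (Suc j). s = (cls (boundaries P1 (Suc i)) x, cls (boundaries P2 (Suc j)) y) \<and> cross_class s = cross_prod x y"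
    if s: "s \<in> Poly_Mapping.keys f" for s
  proof -
    obtain x y where xy: "s = (cls (boundaries P1 (Suc i)) x, cls (boundaries P2 (Suc j)) y)"
      "x \<in> cycles P1 (Suc i)" "y \<in> cycles P2 (Suc j)" using f s by (rule tensor_num_keys)
    let ?x = "SOME u. u \<in> cls (boundaries P1 (Suc i)) x" and ?y = "SOME u. u \<in> cls (boundaries P2 (Suc j)) y"
    have "cls (boundaries P1 (Suc i)) ?x = cls (boundaries P1 (Suc i)) x" "cls (boundaries P2 (Suc j)) ?y = cls (boundaries P2 (Suc j)) y"
      using A.cls_eq_iff B.cls_eq_iff some_cls(1)[OF xy(2)] some_cls(3)[OF xy(3)] by blast+
    then have "s = (cls (boundaries P1 (Suc i)) ?x, cls (boundaries P2 (Suc j)) ?y)" "cross_class s = cross_prod ?x ?y"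
      by (simp_all add: xy(1) cross_class_def)
    then show ?thesis using some_cls(2)[OF xy(2)] some_cls(4)[OF xy(3)] by blast
  qed
  have "lin_ext (\<lambda>s. lin_ext cross_class (?L s) - chain_mult (basis_vec r) (cross_class s)) f \<in> boundaries TP (Suc (i + j))"
  proof (rule lin_ext_in_subspace[OF M.subspace_N])
    fix s assume "s \<in> Poly_Mapping.keys f"
    then obtain x y where xy: "x \<in> cycles P1 (Suc i)" "y \<in> cycles P2 (Suc j)"
      "s = (cls (boundaries P1 (Suc i)) x, cls (boundaries P2 (Suc j)) y)" "cross_class s = cross_prod x y" using rep by blast
    from pm.subspace_add[OF M.subspace_N cross_class_cls[OF X.chain_mult_cycles(1)[OF p(1) xy(1)] Y.chain_mult_cycles(1)[OF p(2) xy(2)]]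
        mult_cross_prod_homologous(1)[OF r xy(1,2)]]
    show "lin_ext cross_class (?L s) - chain_mult (basis_vec r) (cross_class s) \<in> boundaries TP (Suc (i + j))"
      by (simp add: xy(3) X.HM_act(1)[OF p(1)] Y.HM_act(1)[OF p(2)] xy(4)[unfolded xy(3)])
  qed
  then show "lin_ext cross_class (lact_shuffle r (Suc i, Suc j) f) - chain_mult (basis_vec r) (lin_ext cross_class f) \<in> boundaries TP (Suc (i + j))"
    by (simp add: lact_shuffle_def lin_ext_fun_diff lin_ext_lin_ext chain_mult_lin_ext_right)
  have "lin_ext (\<lambda>s. lin_ext cross_class (?R s) - chain_mult (cross_class s) (basis_vec r)) f \<in> boundaries TP (Suc (i + j))"
  proof (rule lin_ext_in_subspace[OF M.subspace_N])
    fix s assume "s \<in> Poly_Mapping.keys f"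
    then obtain x y where xy: "x \<in> cycles P1 (Suc i)" "y \<in> cycles P2 (Suc j)"
      "s = (cls (boundaries P1 (Suc i)) x, cls (boundaries P2 (Suc j)) y)" "cross_class s = cross_prod x y" using rep by blast
    from pm.subspace_add[OF M.subspace_N cross_class_cls[OF X.chain_mult_cycles(2)[OF p(1) xy(1)] Y.chain_mult_cycles(2)[OF p(2) xy(2)]]
        mult_cross_prod_homologous(2)[OF r xy(1,2)]]
    show "lin_ext cross_class (?R s) - chain_mult (cross_class s) (basis_vec r) \<in> boundaries TP (Suc (i + j))"
      by (simp add: xy(3) X.HM_act(2)[OF p(1)] Y.HM_act(2)[OF p(2)] xy(4)[unfolded xy(3)])
  qed
  then show "lin_ext cross_class (ract_shuffle r (Suc i, Suc j) f) - chain_mult (lin_ext cross_class f) (basis_vec r) \<in> boundaries TP (Suc (i + j))"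
    by (simp add: ract_shuffle_def lin_ext_fun_diff lin_ext_lin_ext chain_mult_lin_ext_left)
qed

text \<open>Finitely many vertices are what gives the path algebras a unit.\<close>

theorem kuenneth:
  assumes "finite (vertices P1)" "finite (vertices P2)"
  shows "\<exists>h. bimodule_iso (path_algebra TP :: ('r::field, _) module) (HM TP (Suc n)) (HM_box P1 P2 (Suc n)) h"
proof -
  interpret K: quotient_iso "box_index (Suc n)" tensor_num "tensor_den :: _ \<Rightarrow> (_ \<Rightarrow>\<^sub>0 'r) set" "cycles TP (Suc n)" "boundaries TP (Suc n)"
    split_class "\<lambda>_. lin_ext cross_class" by (rule quotient_iso_homology)
  have "vertices TP = vertices P1 \<times> vertices P2" by (auto simp: vertices_def tensor_precubical_def)
  then have fin: "finite (vertices TP)" using assms by simp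
  let ?A = "path_algebra TP :: ('r, _) module" and ?M = "HM TP (Suc n) :: ('r, _, _) bimodule"
  let ?N = "HM_box P1 P2 (Suc n) :: ('r, _, _) bimodule"
  have box: "box_module P1 P2 (Suc n) = K.D"
    unfolding box_module_def tensor_module_def free_module_eq tensor_num_def tensor_den_def by (simp add: case_prod_unfold)
  have N: "carrier ?N = carrier K.D" "add ?N = add K.D" "module.smult ?N = module.smult K.D"
    by (simp_all add: HM_box_def box)
  have M: "carrier ?M = carrier K.M.Q" unfolding T.HM_simps(1) K.M.carrier_Q ..
  have rep: "\<exists>z\<in>cycles TP (Suc n). C = cls (boundaries TP (Suc n)) z" if "C \<in> carrier ?M" for C
    using that unfolding T.HM_simps(1) by blast
  have SV: "split_class q z \<in> tensor_num q" if "q \<in> box_index (Suc n)" for q and z :: "_ \<Rightarrow>\<^sub>0 'r"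
    using that by (elim box_indexE) (simp only: split_class_tensor_num)
  have path_l: "box_path_lact P1 P2 (Suc n) r (K.family_cls f) = K.family_cls (\<lambda>q. lact_shuffle r q (f q))"
    and path_r: "box_path_ract P1 P2 (Suc n) (K.family_cls f) r = K.family_cls (\<lambda>q. ract_shuffle r q (f q))"
    if r: "r \<in> T.chains 0" for r and f :: "_ \<Rightarrow> _ \<Rightarrow>\<^sub>0 'r"
  proof -
    have "box_path_lact P1 P2 (Suc n) r (K.family_cls f) q = K.family_cls (\<lambda>q. lact_shuffle r q (f q)) q \<and>
        box_path_ract P1 P2 (Suc n) (K.family_cls f) r q = K.family_cls (\<lambda>q. ract_shuffle r q (f q)) q" for q
    proof (cases "q \<in> box_index (Suc n)")
      case True
      then obtain i j where q: "q = (Suc i, Suc j)" by (rule box_indexE)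
      show ?thesis using True unfolding q
        by (simp add: box_path_lact_def box_path_ract_def K.family_cls_def shuffle_tensor_map(1,3)[OF r])
    qed (simp add: box_path_lact_def box_path_ract_def K.family_cls_def)
    then show "box_path_lact P1 P2 (Suc n) r (K.family_cls f) = K.family_cls (\<lambda>q. lact_shuffle r q (f q))"
      "box_path_ract P1 P2 (Suc n) (K.family_cls f) r = K.family_cls (\<lambda>q. ract_shuffle r q (f q))" by auto
  qed
  have shuffle_tensor_num: "lact_shuffle r q f \<in> tensor_num q" "ract_shuffle r q f \<in> tensor_num q"
    if "r \<in> T.chains 0" "q \<in> box_index (Suc n)" "f \<in> tensor_num q" for r q and f :: "_ \<Rightarrow>\<^sub>0 'r"
    using that(2,3) shuffle_tensor_map(2,4)[OF that(1)] by (auto elim!: box_indexE)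
  have shuffle_cross: "lin_ext cross_class (lact_shuffle r q f) - chain_mult (basis_vec r) (lin_ext cross_class f) \<in> boundaries TP (Suc n)"
    "lin_ext cross_class (ract_shuffle r q f) - chain_mult (lin_ext cross_class f) (basis_vec r) \<in> boundaries TP (Suc n)"
    if "r \<in> T.chains 0" "q \<in> box_index (Suc n)" "f \<in> tensor_num q" for r q and f :: "_ \<Rightarrow>\<^sub>0 'r"
    using that(2,3) cross_class_shuffle[OF that(1)] by (auto elim!: box_indexE)
  let ?L = "\<lambda>u q f. \<Sum>r\<in>Poly_Mapping.keys u. pm_scale (Poly_Mapping.lookup u r) (lact_shuffle r q f) :: _ \<Rightarrow>\<^sub>0 'r"
  let ?R = "\<lambda>u q f. \<Sum>r\<in>Poly_Mapping.keys u. pm_scale (Poly_Mapping.lookup u r) (ract_shuffle r q f) :: _ \<Rightarrow>\<^sub>0 'r"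
  have mult_sum: "chain_mult u z = (\<Sum>r\<in>Poly_Mapping.keys u. pm_scale (Poly_Mapping.lookup u r) (chain_mult (basis_vec r) z))"
    "chain_mult z u = (\<Sum>r\<in>Poly_Mapping.keys u. pm_scale (Poly_Mapping.lookup u r) (chain_mult z (basis_vec r)))"
    for u z :: "('a \<times> 'b) cube_chain \<Rightarrow>\<^sub>0 'r"
    using chain_mult_lin_ext_left[of basis_vec u z] chain_mult_lin_ext_right[of z basis_vec u] by (simp_all add: lin_ext_def)
  have act: "K.iso (lact ?M u C) = lact ?N u (K.iso C)" "K.iso (ract ?M C u) = ract ?N (K.iso C) u"
    if u: "u \<in> carrier ?A" and C: "C \<in> carrier ?M" for u C
  proof -
    have us: "u \<in> T.span_chains 0" using u by (simp add: T.path_algebra_simps)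
    have ur: "r \<in> T.chains 0" if "r \<in> Poly_Mapping.keys u" for r by (rule T.span_chainsD[OF us that])
    obtain z where z: "z \<in> cycles TP (Suc n)" "C = cls (boundaries TP (Suc n)) z" using rep[OF C] by blast
    have "K.iso (cls (boundaries TP (Suc n)) (chain_mult u z)) = K.family_cls (\<lambda>q. ?L u q (split_class q z))"
    proof (rule K.iso_equivariant[OF linear_chain_mult(1) T.chain_mult_boundaries(1)[OF us] _ _ z(1)])
      fix q and f :: "_ \<Rightarrow>\<^sub>0 'r" assume q: "q \<in> box_index (Suc n)" "f \<in> tensor_num q"
      show "?L u q f \<in> tensor_num q"
        by (intro pm.subspace_sum[OF K.subspace_quot[OF q(1)]] pm.subspace_scale[OF K.subspace_quot[OF q(1)]] shuffle_tensor_num(1)[OF _ q] ur)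
      have "(\<Sum>r\<in>Poly_Mapping.keys u. pm_scale (Poly_Mapping.lookup u r)
          (lin_ext cross_class (lact_shuffle r q f) - chain_mult (basis_vec r) (lin_ext cross_class f))) \<in> boundaries TP (Suc n)"
        by (intro pm.subspace_sum[OF K.M.subspace_N] pm.subspace_scale[OF K.M.subspace_N] shuffle_cross(1)[OF _ q] ur)
      then show "lin_ext cross_class (?L u q f) - chain_mult u (lin_ext cross_class f) \<in> boundaries TP (Suc n)"
        unfolding mult_sum(1)[of u] by (simp add: lin_ext_sum lin_ext_scale pm.scale_right_diff_distrib sum_subtractf)
    qed
    moreover have "lact ?N u (K.iso C) = K.family_cls (\<lambda>q. ?L u q (split_class q z))"
      unfolding HM_box_def with_actions_simps box z(2) K.iso_cls
      by (rule K.finsum_family_cls) (auto intro!: shuffle_tensor_num(1) ur SV path_l)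
    ultimately show "K.iso (lact ?M u C) = lact ?N u (K.iso C)" by (simp add: z(2) T.HM_act(1)[OF us])
    have "K.iso (cls (boundaries TP (Suc n)) (chain_mult z u)) = K.family_cls (\<lambda>q. ?R u q (split_class q z))"
    proof (rule K.iso_equivariant[OF linear_chain_mult(2) T.chain_mult_boundaries(2)[OF us] _ _ z(1)])
      fix q and f :: "_ \<Rightarrow>\<^sub>0 'r" assume q: "q \<in> box_index (Suc n)" "f \<in> tensor_num q"
      show "?R u q f \<in> tensor_num q"
        by (intro pm.subspace_sum[OF K.subspace_quot[OF q(1)]] pm.subspace_scale[OF K.subspace_quot[OF q(1)]] shuffle_tensor_num(2)[OF _ q] ur)
      have "(\<Sum>r\<in>Poly_Mapping.keys u. pm_scale (Poly_Mapping.lookup u r)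
          (lin_ext cross_class (ract_shuffle r q f) - chain_mult (lin_ext cross_class f) (basis_vec r))) \<in> boundaries TP (Suc n)"
        by (intro pm.subspace_sum[OF K.M.subspace_N] pm.subspace_scale[OF K.M.subspace_N] shuffle_cross(2)[OF _ q] ur)
      then show "lin_ext cross_class (?R u q f) - chain_mult (lin_ext cross_class f) u \<in> boundaries TP (Suc n)"
        unfolding mult_sum(2)[of _ u] by (simp add: lin_ext_sum lin_ext_scale pm.scale_right_diff_distrib sum_subtractf)
    qed
    moreover have "ract ?N (K.iso C) u = K.family_cls (\<lambda>q. ?R u q (split_class q z))"
      unfolding HM_box_def with_actions_simps box z(2) K.iso_cls
      by (rule K.finsum_family_cls) (auto intro!: shuffle_tensor_num(2) ur SV path_r)
    ultimately show "K.iso (ract ?M C u) = ract ?N (K.iso C) u" by (simp add: z(2) T.HM_act(2)[OF us])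
  qed
  have "bimodule_iso ?A ?M ?N K.iso"
  proof (rule bimodule_iso_transfer)
    show "bimodule ?A ?M" by (rule T.bimodule_HM[OF fin])
    show "Module.module (ring_of_type_algebra :: 'r ring) ?N"
      unfolding HM_box_def box by (rule module_with_actions[OF K.module_D])
    show "bij_betw K.iso (carrier ?M) (carrier ?N)" unfolding M N(1) by (rule K.bij_iso)
  next
    fix C E assume "C \<in> carrier ?M" "E \<in> carrier ?M"
    then obtain x y where xy: "C = cls (boundaries TP (Suc n)) x" "E = cls (boundaries TP (Suc n)) y" using rep by blast
    show "K.iso (C \<oplus>\<^bsub>?M\<^esub> E) = K.iso C \<oplus>\<^bsub>?N\<^esub> K.iso E"
      unfolding xy T.HM_simps(3) K.iso_cls N(2) K.D_add by (simp add: K.H_add)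
  next
    fix c C assume "C \<in> carrier ?M"
    then obtain x where x: "C = cls (boundaries TP (Suc n)) x" using rep by blast
    show "K.iso (c \<odot>\<^bsub>?M\<^esub> C) = c \<odot>\<^bsub>?N\<^esub> K.iso C"
      unfolding x T.HM_simps(4) K.iso_cls N(3) K.D_smult by (simp add: K.H_scale)
  qed (rule act, assumption+)+
  then show ?thesis by blast
qed

end

theorem theorem8p14:
  fixes K L :: "euclidean_cube set" and d d' n :: nat
  assumes "cubical_complex d K" and "cubical_complex d' L" and "n \<ge> 1"
  shows "\<exists>h. bimodule_iso
           (path_algebra (tensor_precubical (cubical_precubical K) (cubical_precubical L))
              :: ('r::field, (euclidean_cube \<times> euclidean_cube) cube_chain \<Rightarrow>\<^sub>0 'r) module)
           (HM (tensor_precubical (cubical_precubical K) (cubical_precubical L)) n)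
           (HM_box (cubical_precubical K) (cubical_precubical L) n) h"
proof -
  interpret labelled_tensor K "cube_dirs 0" "cube_lo 0" "cube_hi 0" L "cube_dirs d" "cube_lo d" "cube_hi d"
    "cubical_precubical K" "cubical_precubical L" "cube_lab 0" "cube_lab d"
    by (rule labelled_tensor_cubical[OF assms(1,2)])
  have "finite K" "finite L" using assms by (simp_all add: cubical_complex_def)
  then have "finite (vertices (cubical_precubical K))" "finite (vertices (cubical_precubical L))"
    by (simp_all add: vertices_def cubical_precubical_def)
  moreover obtain m where "n = Suc m" using assms(3) by (cases n) auto
  ultimately show ?thesis using kuenneth by blast
qed

end
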